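(* Let $\alpha\in\mathbb{T}\setminus\mathbb{Q}$ and let $(\alpha,A(\cdot))$, with $A\in C^\infty(\mathbb{T},SO(3))$, be a $C^\infty$-smooth cocycle in $\mathbb{T}\times SO(3)$ which has degree $0$ and such that $A:\mathbb{T}\to SO(3)$ is not homotopic to the constant map $\mathrm{Id}$. Suppose, moreover, that $\alpha\in\widetilde{RDC}$. Then $(\alpha,A(\cdot))$ is $C^\infty$ almost reducible by $2$-periodic conjugations: there exist sequences $B_m\in C^\infty(\mathbb{R}/2\mathbb{Z},SO(3))$, $A_m\in SO(3)$ and $U_m\in C^\infty(\mathbb{R}/2\mathbb{Z},so(3))$ with $U_m\to 0$ in the $C^\infty$ topology as $m\to\infty$, such that for all $m$ and all $x\in\mathbb{R}$ $$B_m(x+\alpha)\,A(x)\,B_m(x)^{-1}=A_m\exp(U_m(x)).$$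
   Context: $\mathbb{T}=\mathbb{R}/\mathbb{Z}$, and irrational elements of $\mathbb{T}$ are identified with irrational numbers in $(0,1)$; functions on $\mathbb{T}$ are identified with $1$-periodic functions on $\mathbb{R}$, and functions on $\mathbb{R}/2\mathbb{Z}$ with $2$-periodic functions on $\mathbb{R}$. A $C^\infty$ cocycle $(\alpha,A(\cdot))$ in $\mathbb{T}\times SO(3)$, with $\alpha\in\mathbb{T}$ and $A\in C^\infty(\mathbb{T},SO(3))$, is the map $(x,S)\mapsto(x+\alpha,A(x)S)$ of $\mathbb{T}\times SO(3)$. Its iterates are $(\alpha,A)^n=(n\alpha,A_n)$, where $A_n(x)=A(x+(n-1)\alpha)\cdots A(x)$ for $n\ge1$. Degree $0$: for irrational $\alpha$, the cocycle has degree $0$ if and only if the derivatives of its iterates have no linear growth, i.e. $\frac1n(\partial_xA_n)A_n^{-1}\to0$ in $L^2(\mathbb{T},so(3))$ as $n\to\infty$. Arithmetic condition: $|\cdot|_{\mathbb{Z}}$ denotes the distance to the nearest integer. For $\gamma,\tau>0$, $\widetilde{DC}(\gamma,\tau)$ is the set of $\alpha\in\mathbb{T}$ such that $|k\alpha-\tfrac12|_{\mathbb{Z}}\ge\gamma^{-1}|k|^{-\tau}$ for all $k\in\mathbb{Z}\setminus\{0\}$. Let $\mathrm{G}(\alpha)=\{\alpha^{-1}\}$ (fractional part) be the Gauss map on $(0,1)\setminus\mathbb{Q}$. $\widetilde{RDC}(\gamma,\tau)$ is the set of $\alpha\in\mathbb{T}\setminus\mathbb{Q}$ such that $\mathrm{G}^n(\alpha)\in\widetilde{DC}(\gamma,\tau)$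 for infinitely many $n$, and $\widetilde{RDC}=\bigcup_{\gamma,\tau>0}\widetilde{RDC}(\gamma,\tau)$. *)

theory Defs
  imports "HOL-Analysis.Analysis"
begin

text \<open>Functions on \<open>\<real>/p\<int>\<close> are \<open>p\<close>-periodic functions on \<open>\<real>\<close>; an irrational element of the
  circle \<open>\<real>/\<int>\<close> is its representative in \<open>(0,1)\<close>.\<close>

definition SO3 :: "(real^3^3) set" where
  "SO3 = {Q. orthogonal_matrix Q \<and> det Q = 1}"

definition so3 :: "(real^3^3) set" where
  "so3 = {X. transpose X = - X}"

text \<open>The type of matrices is not an instance of \<^class>\<open>real_normed_algebra_1\<close>, so the library's
  exponential does not apply to it.\<close>

definition mat_exp :: "real^'n^'n \<Rightarrow> real^'n^'n" where
  "mat_exp X = (\<Sum>k. (1 / fact k) *\<^sub>R ((\<lambda>Y. X ** Y) ^^ k) (mat 1))"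

definition nth_deriv :: "nat \<Rightarrow> (real \<Rightarrow> 'a::real_normed_vector) \<Rightarrow> real \<Rightarrow> 'a" where
  "nth_deriv r f = ((\<lambda>g x. vector_derivative g (at x)) ^^ r) f"

definition smooth :: "(real \<Rightarrow> 'a::real_normed_vector) \<Rightarrow> bool" where
  "smooth f \<longleftrightarrow> (\<forall>r x. nth_deriv r f differentiable at x)"

text \<open>\<open>C_infty p S\<close> is \<open>C\<^sup>\<infinity>(\<real>/p\<int>, S)\<close>; for the submanifolds \<open>S\<close> used here, smoothness into \<open>S\<close>
  is smoothness into the ambient space of matrices.\<close>

definition C_infty :: "real \<Rightarrow> 'a::real_normed_vector set \<Rightarrow> (real \<Rightarrow> 'a) set" where
  "C_infty p S = {f. smooth f \<and> (\<forall>x. f (x + p) = f x) \<and> range f \<subseteq> S}"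

text \<open>By periodicity, uniform convergence on \<open>\<real>\<close> is uniform convergence on the circle.\<close>

definition tendsto_zero_C_infty :: "(nat \<Rightarrow> real \<Rightarrow> 'a::real_normed_vector) \<Rightarrow> bool" where
  "tendsto_zero_C_infty U \<longleftrightarrow>
     (\<forall>r. uniform_limit UNIV (\<lambda>m. nth_deriv r (U m)) (\<lambda>x. 0) sequentially)"

text \<open>\<open>cocycle_iter \<alpha> A n x = A (x + (n - 1) \<alpha>) ** \<dots> ** A x\<close>\<close>

primrec cocycle_iter :: "real \<Rightarrow> (real \<Rightarrow> real^'n^'n) \<Rightarrow> nat \<Rightarrow> real \<Rightarrow> real^'n^'n" where
  "cocycle_iter \<alpha> A 0 x = mat 1"
| "cocycle_iter \<alpha> A (Suc n) x = A (x + real n * \<alpha>) ** cocycle_iter \<alpha> A n x"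

definition L2_norm_circle :: "(real \<Rightarrow> 'a::real_normed_vector) \<Rightarrow> real" where
  "L2_norm_circle f = sqrt (LBINT x:{0..1}. (norm (f x))\<^sup>2)"

definition degree_zero :: "real \<Rightarrow> (real \<Rightarrow> real^'n^'n) \<Rightarrow> bool" where
  "degree_zero \<alpha> A \<longleftrightarrow>
     (\<lambda>n. L2_norm_circle (\<lambda>x. (1 / real n) *\<^sub>R
        (vector_derivative (cocycle_iter \<alpha> A n) (at x) ** matrix_inv (cocycle_iter \<alpha> A n x))))
     \<longlonglongrightarrow> 0"

definition gauss_map :: "real \<Rightarrow> real" where
  "gauss_map \<alpha> = frac (inverse \<alpha>)"

text \<open>\<open>infdist y \<int>\<close> is the distance from \<open>y\<close> to the nearest integer. The condition
  defining \<open>DC_tilde\<close> depends only on the class of \<open>\<alpha>\<close> modulo \<open>\<int>\<close>.\<close>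

definition DC_tilde :: "real \<Rightarrow> real \<Rightarrow> real set" where
  "DC_tilde \<gamma> \<tau> = {\<alpha>. \<forall>k::int. k \<noteq> 0 \<longrightarrow>
     infdist (real_of_int k * \<alpha> - 1/2) \<int> \<ge> inverse \<gamma> * \<bar>real_of_int k\<bar> powr (- \<tau>)}"

definition RDC_tilde_of :: "real \<Rightarrow> real \<Rightarrow> real set" where
  "RDC_tilde_of \<gamma> \<tau> = {\<alpha> \<in> {0<..<1} - \<rat>. \<exists>\<^sub>\<infinity>n. (gauss_map ^^ n) \<alpha> \<in> DC_tilde \<gamma> \<tau>}"

definition RDC_tilde :: "real set" where
  "RDC_tilde = (\<Union>\<gamma>\<in>{0<..}. \<Union>\<tau>\<in>{0<..}. RDC_tilde_of \<gamma> \<tau>)"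

definition almost_reducible_2periodic :: "real \<Rightarrow> (real \<Rightarrow> real^3^3) \<Rightarrow> bool" where
  "almost_reducible_2periodic \<alpha> A \<longleftrightarrow>
     (\<exists>(B :: nat \<Rightarrow> real \<Rightarrow> real^3^3) (A' :: nat \<Rightarrow> real^3^3) (U :: nat \<Rightarrow> real \<Rightarrow> real^3^3).
        (\<forall>m. B m \<in> C_infty 2 SO3 \<and> A' m \<in> SO3 \<and> U m \<in> C_infty 2 so3) \<and>
        tendsto_zero_C_infty U \<and>
        (\<forall>m x. B m (x + \<alpha>) ** A x ** matrix_inv (B m x) = A' m ** mat_exp (U m x)))"

end

theory Submission
  imports Defs
begin

text \<open>Lift \<open>A\<close> to a curve \<open>a\<close> of unit quaternions; as \<open>A\<close> is not null-homotopic, \<open>a (x + 1) = - a x\<close>. Degree zero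
  and interpolation show that the derivatives of the iterates satisfy \<open>\<bar>\<partial>\<^sup>m a\<^sub>n\<bar> = o(k\<^sup>m)\<close> for \<open>n \<le> k\<close>. Take a rational
  approximation \<open>h/k\<close> of \<open>\<alpha>\<close> and a second lattice vector \<open>(p', q')\<close> with \<open>k p' - h q' = \<plusminus>1\<close> and
  \<open>\<tau> = q' \<alpha> - p'\<close> of size \<open>1/k\<close>. After rescaling by \<open>\<tau>\<close>, the iterates \<open>a\<^sub>q\<^sub>'\<close> and \<open>a\<^sub>k\<close> are close to constants \<open>X, Y\<close>,
  and the antiperiodicity of \<open>a\<close> forces \<open>Y X = - X Y\<close>.

  A pair near such an anticommuting pair has no resonances: for a close return \<open>q \<alpha> - p\<close>, conjugation by the constant
  \<open>X\<^sup>p Y\<^sup>q\<close> acts by signs on the three imaginary directions. Where the sign is \<open>-1\<close>, the average of a perturbation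
  over the close return is a difference quotient, hence small; so the cohomological equation is solved up to a
  small error by averaging, without small divisors and for every irrational \<open>\<alpha>\<close>. Two close returns with
  anticommuting constants treat all directions, and iterating makes the pair arbitrarily close to \<open>(X, Y)\<close> in
  \<open>C\<^sup>s\<close>. Undoing the rescaling, the same conjugation takes the original generators close to elements
  of the quaternion group generated by \<open>X, Y\<close>, whose squares are \<open>\<plusminus>1\<close>; this is where period \<open>2\<close> comes from.\<close>

subsection \<open>Quaternions\<close>

text \<open>The order of the choices shapes the argument. The renormalized rotation number is the
  quotient of \<open>k \<alpha> - h\<close> by \<open>q' \<alpha> - p'\<close>, known only after the
  required closeness of the rescaled pair has fixed \<open>k\<close>; so the reducibility statement
  for pairs near a constant must come with a threshold fixed before that number.

  The iteration gains because a size is always recorded together with a frequency. A part of size X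
  at frequency Q, averaged r times over a return of length at most 1/Q', has size at most X (Q/Q')^r
  at frequency Q'. A size of order Q^(1-r) therefore reproduces itself while Q grows without bound,
  and the derivatives of order at most r - 2 tend to zero.

  Only one generator of the pair is ever perturbed. The other is first made exactly constant by
  solving a functional equation over the unit shift, and every later conjugation is equivariant
  under that shift, hence preserves the constant. Unit quaternions are used because the images of X
  and Y in SO(3) commute: the sign in \<open>Y X = - X Y\<close> is visible only in the double
  cover.\<close>

datatype quat = Quat (qre: real) (qi: real) (qj: real) (qk: real)

lemma quat_eq_iff: "x = y \<longleftrightarrow> qre x = qre y \<and> qi x = qi y \<and> qj x = qj y \<and> qk x = qk y"
  by (metis quat.expand)

instantiation quat :: ab_group_add
begin
definition "0 = Quat 0 0 0 0"
definition "x + y = Quat (qre x + qre y) (qi x + qi y) (qj x + qj y) (qk x + qk y)"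
definition "- x = Quat (- qre x) (- qi x) (- qj x) (- qk x)"
definition "x - y = Quat (qre x - qre y) (qi x - qi y) (qj x - qj y) (qk x - qk y)" for x y :: quat
instance
  by standard (simp_all add: quat_eq_iff zero_quat_def plus_quat_def uminus_quat_def minus_quat_def)
end

lemma quat_zero_simps [simp]: "qre 0 = 0" "qi 0 = 0" "qj 0 = 0" "qk 0 = 0"
  by (simp_all add: zero_quat_def)
lemma quat_add_simps [simp]: "qre (x + y) = qre x + qre y" "qi (x + y) = qi x + qi y"
   "qj (x + y) = qj x + qj y" "qk (x + y) = qk x + qk y"
  by (simp_all add: plus_quat_def)
lemma quat_minus_simps [simp]: "qre (- x) = - qre x" "qi (- x) = - qi x" "qj (- x) = - qj x" "qk (- x) = - qk x"
  by (simp_all add: uminus_quat_def)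
lemma quat_diff_simps [simp]: "qre (x - y) = qre x - qre y" "qi (x - y) = qi x - qi y"
   "qj (x - y) = qj x - qj y" "qk (x - y) = qk x - qk y"
  by (simp_all add: minus_quat_def)

instantiation quat :: ring_1
begin
definition "1 = Quat 1 0 0 0"
definition "x * y = Quat
   (qre x * qre y - qi x * qi y - qj x * qj y - qk x * qk y)
   (qre x * qi y + qi x * qre y + qj x * qk y - qk x * qj y)
   (qre x * qj y - qi x * qk y + qj x * qre y + qk x * qi y)
   (qre x * qk y + qi x * qj y - qj x * qi y + qk x * qre y)"
instance
  by standard (simp_all add: quat_eq_iff one_quat_def times_quat_def algebra_simps)
end

lemma quat_one_simps [simp]: "qre 1 = 1" "qi 1 = 0" "qj 1 = 0" "qk 1 = 0"
  by (simp_all add: one_quat_def)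
lemma quat_mult_simps [simp]:
  "qre (x * y) = qre x * qre y - qi x * qi y - qj x * qj y - qk x * qk y"
  "qi (x * y) = qre x * qi y + qi x * qre y + qj x * qk y - qk x * qj y"
  "qj (x * y) = qre x * qj y - qi x * qk y + qj x * qre y + qk x * qi y"
  "qk (x * y) = qre x * qk y + qi x * qj y - qj x * qi y + qk x * qre y"
  by (simp_all add: times_quat_def)

instantiation quat :: real_algebra_1
begin
definition "r *\<^sub>R x = Quat (r * qre x) (r * qi x) (r * qj x) (r * qk x)"
instance
  by standard (simp_all add: quat_eq_iff scaleR_quat_def algebra_simps)
end

lemma quat_scaleR_simps [simp]: "qre (r *\<^sub>R x) = r * qre x" "qi (r *\<^sub>R x) = r * qi x"
   "qj (r *\<^sub>R x) = r * qj x" "qk (r *\<^sub>R x) = r * qk x"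
  by (simp_all add: scaleR_quat_def)

instantiation quat :: real_inner
begin
definition "inner x y = qre x * qre y + qi x * qi y + qj x * qj y + qk x * qk y"
definition "norm x = sqrt (inner x x)" for x :: quat
definition "dist x y = norm (x - y)" for x y :: quat
definition "sgn x = inverse (norm x) *\<^sub>R x" for x :: quat
definition
  "(uniformity :: (quat \<times> quat) filter) = (INF e\<in>{0<..}. principal {(x, y). dist x y < e})"
definition
  "open (U :: quat set) = (\<forall>x\<in>U. eventually (\<lambda>(x', y). x' = x \<longrightarrow> y \<in> U) uniformity)"
instance
proof
  fix x y z :: quat and r :: real and U :: "quat set"
  show "dist x y = norm (x - y)" by (rule dist_quat_def)
  show "sgn x = x /\<^sub>R norm x" by (rule sgn_quat_def)
  show "(uniformity :: (quat \<times> quat) filter) = (INF e\<in>{0<..}. principal {(x, y). dist x y < e})"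
    by (rule uniformity_quat_def)
  show "open U = (\<forall>x\<in>U. eventually (\<lambda>(x', y). x' = x \<longrightarrow> y \<in> U) uniformity)"
    by (rule open_quat_def)
  show "inner x y = inner y x" "inner (x + y) z = inner x z + inner y z"
    "inner (r *\<^sub>R x) y = r * inner x y" "norm x = sqrt (inner x x)"
    by (simp_all add: inner_quat_def norm_quat_def algebra_simps)
  show "0 \<le> inner x x" by (simp add: inner_quat_def)
  show "inner x x = 0 \<longleftrightarrow> x = 0"
    by (auto simp: inner_quat_def quat_eq_iff add_nonneg_eq_0_iff)
qed
end

lemma norm_quat_eq: "norm x = sqrt ((qre x)\<^sup>2 + (qi x)\<^sup>2 + (qj x)\<^sup>2 + (qk x)\<^sup>2)" for x :: quat
  by (simp add: norm_quat_def inner_quat_def power2_eq_square)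

text \<open>Euler's four-square identity, followed by a square root.\<close>

lemma norm_quat_mult: "norm (x * y) = norm x * norm y" for x y :: quat
proof -
  have "(qre (x * y))\<^sup>2 + (qi (x * y))\<^sup>2 + (qj (x * y))\<^sup>2 + (qk (x * y))\<^sup>2
    = ((qre x)\<^sup>2 + (qi x)\<^sup>2 + (qj x)\<^sup>2 + (qk x)\<^sup>2) * ((qre y)\<^sup>2 + (qi y)\<^sup>2 + (qj y)\<^sup>2 + (qk y)\<^sup>2)"
    unfolding quat_mult_simps by algebra
  then show ?thesis unfolding norm_quat_eq by (simp only: real_sqrt_mult)
qed

instance quat :: real_normed_algebra_1
  by standard (simp_all add: norm_quat_mult, simp add: norm_quat_eq)

instantiation quat :: euclidean_space
begin
definition "Basis = {Quat 1 0 0 0, Quat 0 1 0 0, Quat 0 0 1 0, Quat 0 0 0 1}"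
instance
proof
  show "(Basis :: quat set) \<noteq> {}" "finite (Basis :: quat set)" by (simp_all add: Basis_quat_def)
  show "inner u v = (if u = v then 1 else 0)" if "u \<in> Basis" "v \<in> Basis" for u v :: quat
    using that unfolding Basis_quat_def inner_quat_def by (elim insertE emptyE) simp_all
  show "(\<forall>u\<in>Basis. inner x u = 0) = (x = 0)" for x :: quat
    unfolding Basis_quat_def inner_quat_def quat_eq_iff by simp
qed
end

lemma DIM_quat: "DIM(quat) = 4"
  by (simp add: Basis_quat_def)

definition qcnj :: "quat \<Rightarrow> quat" where
  "qcnj x = Quat (qre x) (- qi x) (- qj x) (- qk x)"

lemma qcnj_simps [simp]: "qre (qcnj x) = qre x" "qi (qcnj x) = - qi x"
   "qj (qcnj x) = - qj x" "qk (qcnj x) = - qk x"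
  by (simp_all add: qcnj_def)

lemma qcnj_mult: "qcnj (x * y) = qcnj y * qcnj x"
  by (simp add: quat_eq_iff algebra_simps)

lemma qcnj_qcnj [simp]: "qcnj (qcnj x) = x" and qcnj_one [simp]: "qcnj 1 = 1"
  and qcnj_minus: "qcnj (- x) = - qcnj x" and qcnj_add: "qcnj (x + y) = qcnj x + qcnj y"
  and qcnj_diff: "qcnj (x - y) = qcnj x - qcnj y" and qcnj_scaleR: "qcnj (r *\<^sub>R x) = r *\<^sub>R qcnj x"
  and qcnj_zero [simp]: "qcnj 0 = 0"
  by (simp_all add: quat_eq_iff)

lemma norm_qcnj [simp]: "norm (qcnj x) = norm x"
  by (simp add: norm_quat_eq)

lemma quat_mult_cnj: "x * qcnj x = of_real ((norm x)\<^sup>2)" "qcnj x * x = of_real ((norm x)\<^sup>2)"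
proof -
  have "(norm x)\<^sup>2 = qre x * qre x + qi x * qi x + qj x * qj x + qk x * qk x"
    unfolding norm_quat_eq by (simp add: power2_eq_square)
  then show "x * qcnj x = of_real ((norm x)\<^sup>2)" "qcnj x * x = of_real ((norm x)\<^sup>2)"
    by (simp_all add: quat_eq_iff of_real_def)
qed

lemma unit_mult_cnj [simp]: "norm x = 1 \<Longrightarrow> x * qcnj x = 1" "norm x = 1 \<Longrightarrow> qcnj x * x = 1"
  by (simp_all add: quat_mult_cnj)

lemma unit_mult_cnj_assoc [simp]:
  "norm x = 1 \<Longrightarrow> x * (qcnj x * y) = y" "norm x = 1 \<Longrightarrow> qcnj x * (x * y) = y"
  by (simp_all add: mult.assoc[symmetric])

lemma bounded_linear_qcnj: "bounded_linear qcnj"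
  by (rule bounded_linear_intro[where K=1]) (simp_all add: qcnj_add qcnj_scaleR)

lemma abs_qre_le: "\<bar>qre x\<bar> \<le> norm x"
  unfolding norm_quat_eq by (rule real_le_rsqrt) simp

lemma bounded_linear_qre: "bounded_linear qre"
  by (rule bounded_linear_intro[where K=1]) (simp_all add: abs_qre_le)

definition qimag :: "quat \<Rightarrow> bool" where "qimag x \<longleftrightarrow> qre x = 0"

lemma qimag_iff: "qimag x \<longleftrightarrow> qcnj x = - x"
  by (auto simp: qimag_def quat_eq_iff)

lemma qre_mult_commute: "qre (x * y) = qre (y * x)"
  by (simp add: algebra_simps)

lemma inner_eq_qre: "inner x y = qre (x * qcnj y)"
  by (simp add: inner_quat_def)

subsection \<open>Smooth curves and \<open>C\<^sup>r\<close> bounds\<close>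

text \<open>\<open>r\<close> counts the derivatives that exist. Smoothness of composites and of the
  flat functions is proved by induction on this order, since their derivatives involve functions of
  the same kind.\<close>

definition diff_upto :: "nat \<Rightarrow> real set \<Rightarrow> (real \<Rightarrow> 'a::real_normed_vector) \<Rightarrow> bool" where
  "diff_upto r S f \<longleftrightarrow> (\<forall>m<r. \<forall>x\<in>S. nth_deriv m f differentiable at x)"

definition smooth_on :: "real set \<Rightarrow> (real \<Rightarrow> 'a::real_normed_vector) \<Rightarrow> bool" where
  "smooth_on S f \<longleftrightarrow> (\<forall>r. \<forall>x\<in>S. nth_deriv r f differentiable at x)"

lemma smooth_iff: "smooth f \<longleftrightarrow> smooth_on UNIV f"
  by (simp add: smooth_def smooth_on_def)

lemma smooth_on_iff: "smooth_on S f \<longleftrightarrow> (\<forall>r. diff_upto r S f)"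
  by (auto simp: smooth_on_def diff_upto_def)

lemma smooth_on_subset: "smooth_on T f \<Longrightarrow> S \<subseteq> T \<Longrightarrow> smooth_on S f"
  by (auto simp: smooth_on_def)

lemma nth_deriv_0 [simp]: "nth_deriv 0 f = f"
  by (simp add: nth_deriv_def)

lemma nth_deriv_Suc: "nth_deriv (Suc n) f = (\<lambda>x. vector_derivative (nth_deriv n f) (at x))"
  by (simp add: nth_deriv_def)

lemma nth_deriv_add: "nth_deriv m (nth_deriv n f) = nth_deriv (m + n) f"
  by (simp add: nth_deriv_def funpow_add)

lemma nth_deriv_Suc': "nth_deriv (Suc n) f = nth_deriv n (nth_deriv 1 f)"
  by (simp add: nth_deriv_add)

lemma diff_upto_deriv:
  assumes "diff_upto r S f" "n < r" "x \<in> S"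
  shows "(nth_deriv n f has_vector_derivative nth_deriv (Suc n) f x) (at x)"
  using assms by (auto simp: diff_upto_def nth_deriv_Suc vector_derivative_works[symmetric])

lemma smooth_on_deriv:
  assumes "smooth_on S f" "x \<in> S"
  shows "(nth_deriv n f has_vector_derivative nth_deriv (Suc n) f x) (at x)"
  using assms by (auto simp: smooth_on_def nth_deriv_Suc vector_derivative_works[symmetric])

lemma smooth_on_deriv1:
  assumes "smooth_on S f" "x \<in> S"
  shows "(f has_vector_derivative nth_deriv 1 f x) (at x)"
  using smooth_on_deriv[OF assms, of 0] by simp

lemma smooth_on_nth_deriv: "smooth_on S f \<Longrightarrow> smooth_on S (nth_deriv n f)"
  by (auto simp: smooth_on_def nth_deriv_add)

lemma smooth_on_continuous: "smooth_on S f \<Longrightarrow> continuous_on S (nth_deriv n f)"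
  by (meson continuous_at_imp_continuous_on differentiable_imp_continuous_within smooth_on_def)

lemma vector_derivative_local_cong:
  assumes "open S" "x \<in> S" "\<And>y. y \<in> S \<Longrightarrow> f y = g y"
  shows "vector_derivative f (at x) = vector_derivative g (at x)"
    and "f differentiable at x \<longleftrightarrow> g differentiable at x"
proof -
  have *: "(f has_vector_derivative d) (at x) \<longleftrightarrow> (g has_vector_derivative d) (at x)" for d
    using has_vector_derivative_transform_within_open[of f d x S g]
      has_vector_derivative_transform_within_open[of g d x S f] assms by auto
  show "vector_derivative f (at x) = vector_derivative g (at x)"
    by (simp add: vector_derivative_def *)
  show "f differentiable at x \<longleftrightarrow> g differentiable at x"
    using * by (metis differentiableI_vector vector_derivative_works)
qed

lemma nth_deriv_cong:
  assumes "open S" "\<And>y. y \<in> S \<Longrightarrow> f y = g y" "x \<in> S"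
  shows "nth_deriv n f x = nth_deriv n g x"
  using assms(3)
proof (induction n arbitrary: x)
  case 0 then show ?case using assms by simp
next
  case (Suc n)
  then show ?case unfolding nth_deriv_Suc
    using vector_derivative_local_cong(1)[OF assms(1) Suc.prems Suc.IH] by simp
qed

lemma smooth_on_cong:
  assumes "open S" "\<And>y. y \<in> S \<Longrightarrow> f y = g y" "smooth_on S f"
  shows "smooth_on S g"
  unfolding smooth_on_def
proof (intro allI ballI)
  fix r x assume x: "x \<in> S"
  have "nth_deriv r f differentiable at x \<longleftrightarrow> nth_deriv r g differentiable at x"
    by (rule vector_derivative_local_cong(2)[OF assms(1) x]) (rule nth_deriv_cong[OF assms(1,2)])
  then show "nth_deriv r g differentiable at x"
    using assms(3) x by (simp add: smooth_on_def)
qed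

text \<open>Higher derivatives are identified from a proposed sequence \<open>ds\<close>, checked
  one order at a time. Openness of \<open>S\<close> allows an identity on \<open>S\<close> to be
  differentiated.\<close>

lemma diff_uptoI_derivs:
  assumes S: "open S" and ds0: "\<And>x. x \<in> S \<Longrightarrow> ds 0 x = f x"
    and ds: "\<And>n x. n < r \<Longrightarrow> x \<in> S \<Longrightarrow> (ds n has_vector_derivative ds (Suc n) x) (at x)"
  shows "diff_upto r S f" and "n \<le> r \<Longrightarrow> x \<in> S \<Longrightarrow> nth_deriv n f x = ds n x"
proof -
  have *: "nth_deriv n f x = ds n x" if "n \<le> r" "x \<in> S" for n x
    using that
  proof (induction n arbitrary: x)
    case 0 then show ?case using ds0 by simp
  next
    case (Suc n)
    have "vector_derivative (nth_deriv n f) (at x) = vector_derivative (ds n) (at x)"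
      by (rule vector_derivative_local_cong[OF S]) (use Suc in auto)
    then show ?case
      using ds[of n x] Suc.prems by (simp add: nth_deriv_Suc vector_derivative_at)
  qed
  then show "n \<le> r \<Longrightarrow> x \<in> S \<Longrightarrow> nth_deriv n f x = ds n x" .
  show "diff_upto r S f" unfolding diff_upto_def
  proof (intro allI impI ballI)
    fix m x assume "m < r" "x \<in> S"
    have "nth_deriv m f differentiable at x \<longleftrightarrow> ds m differentiable at x"
      by (rule vector_derivative_local_cong[OF S]) (use * \<open>m < r\<close> \<open>x \<in> S\<close> in auto)
    then show "nth_deriv m f differentiable at x"
      using ds[OF \<open>m < r\<close> \<open>x \<in> S\<close>] by (metis differentiableI_vector)
  qed
qed

lemma smooth_onI_derivs:
  assumes "open S" "\<And>x. x \<in> S \<Longrightarrow> ds 0 x = f x"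
    "\<And>n x. x \<in> S \<Longrightarrow> (ds n has_vector_derivative ds (Suc n) x) (at x)"
  shows "smooth_on S f" and "x \<in> S \<Longrightarrow> nth_deriv n f x = ds n x"
  using diff_uptoI_derivs[of S ds f] assms by (auto simp: smooth_on_iff)

lemma diff_upto_SucI:
  assumes "open S" "\<And>x. x \<in> S \<Longrightarrow> (f has_vector_derivative f' x) (at x)" "diff_upto r S f'"
  shows "diff_upto (Suc r) S f"
  by (rule diff_uptoI_derivs(1)[where ds="\<lambda>n. case n of 0 \<Rightarrow> f | Suc k \<Rightarrow> nth_deriv k f'"])
     (use assms in \<open>auto split: nat.splits dest: diff_upto_deriv\<close>)

lemma nth_deriv_Suc_eq:
  assumes "open S" "\<And>x. x \<in> S \<Longrightarrow> (f has_vector_derivative f' x) (at x)" "x \<in> S"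
  shows "nth_deriv (Suc n) f x = nth_deriv n f' x"
  unfolding nth_deriv_Suc'[of n f]
  by (rule nth_deriv_cong[OF assms(1) _ assms(3)]) (use assms(2) in \<open>simp add: nth_deriv_Suc vector_derivative_at\<close>)

lemma smooth_on_SucI:
  assumes "open S" "\<And>x. x \<in> S \<Longrightarrow> (f has_vector_derivative f' x) (at x)" "smooth_on S f'"
  shows "smooth_on S f"
proof -
  have "diff_upto r S f" for r
    using diff_upto_SucI[OF assms(1,2), of r] assms(3) by (auto simp: smooth_on_iff diff_upto_def)
  then show ?thesis by (simp add: smooth_on_iff)
qed

text \<open>Pascal's rule in the form required by the Leibniz formula: \<open>F k l\<close> stands
  for the product of the k-th derivative of one factor and the l-th derivative of the other.\<close>

lemma binomial_shift_sum:
  fixes F :: "nat \<Rightarrow> nat \<Rightarrow> 'a::real_vector"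
  shows "(\<Sum>k\<le>n. real (n choose k) *\<^sub>R (F k (Suc (n - k)) + F (Suc k) (n - k)))
    = (\<Sum>k\<le>Suc n. real (Suc n choose k) *\<^sub>R F k (Suc n - k))"
proof -
  have "(\<Sum>k\<le>Suc n. real (Suc n choose k) *\<^sub>R F k (Suc n - k))
    = F 0 (Suc n) + (\<Sum>k\<le>n. real (Suc n choose Suc k) *\<^sub>R F (Suc k) (n - k))"
    by (subst sum.atMost_Suc_shift) simp
  also have "\<dots> = (F 0 (Suc n) + (\<Sum>k\<le>n. real (n choose Suc k) *\<^sub>R F (Suc k) (n - k)))
      + (\<Sum>k\<le>n. real (n choose k) *\<^sub>R F (Suc k) (n - k))"
    by (simp add: scaleR_add_left sum.distrib)
  also have "F 0 (Suc n) + (\<Sum>k\<le>n. real (n choose Suc k) *\<^sub>R F (Suc k) (n - k))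
     = (\<Sum>k\<le>Suc n. real (n choose k) *\<^sub>R F k (Suc n - k))"
    by (subst sum.atMost_Suc_shift) simp
  also have "\<dots> = (\<Sum>k\<le>n. real (n choose k) *\<^sub>R F k (Suc (n - k)))"
    by (simp add: Suc_diff_le)
  finally show ?thesis by (simp add: scaleR_add_right sum.distrib)
qed

section \<open>The Leibniz rule and closure properties of smooth curves\<close>

context bounded_bilinear
begin

lemma leibniz_aux:
  assumes f: "diff_upto r S f" and g: "diff_upto r S g" and n: "n < r" and x: "x \<in> S"
  shows "((\<lambda>x. \<Sum>k\<le>n. real (n choose k) *\<^sub>R prod (nth_deriv k f x) (nth_deriv (n - k) g x))
    has_vector_derivative (\<Sum>k\<le>Suc n. real (Suc n choose k) *\<^sub>R prod (nth_deriv k f x) (nth_deriv (Suc n - k) g x))) (at x)"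
proof -
  have "((\<lambda>x. \<Sum>k\<le>n. real (n choose k) *\<^sub>R prod (nth_deriv k f x) (nth_deriv (n - k) g x))
    has_vector_derivative (\<Sum>k\<le>n. real (n choose k) *\<^sub>R (prod (nth_deriv k f x) (nth_deriv (Suc (n - k)) g x)
       + prod (nth_deriv (Suc k) f x) (nth_deriv (n - k) g x)))) (at x)"
    by (intro has_vector_derivative_sum bounded_linear.has_vector_derivative[OF bounded_linear_scaleR_right] has_vector_derivative
        diff_upto_deriv[OF f _ x] diff_upto_deriv[OF g _ x]) (use n in auto)
  then show ?thesis
    by (simp only: binomial_shift_sum[where F="\<lambda>k l. prod (nth_deriv k f x) (nth_deriv l g x)"])
qed

lemma diff_upto_prod:
  assumes "open S" "diff_upto r S f" "diff_upto r S g"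
  shows "diff_upto r S (\<lambda>x. prod (f x) (g x))"
  by (rule diff_uptoI_derivs(1)[OF assms(1), where ds="\<lambda>n x. \<Sum>k\<le>n. real (n choose k) *\<^sub>R prod (nth_deriv k f x) (nth_deriv (n - k) g x)"])
     (use leibniz_aux[OF assms(2,3)] in auto)

lemma smooth_on_prod:
  assumes "open S" "smooth_on S f" "smooth_on S g"
  shows "smooth_on S (\<lambda>x. prod (f x) (g x))"
  using assms diff_upto_prod by (auto simp: smooth_on_iff)

lemma nth_deriv_prod:
  assumes "open S" "smooth_on S f" "smooth_on S g" "x \<in> S"
  shows "nth_deriv n (\<lambda>x. prod (f x) (g x)) x = (\<Sum>k\<le>n. real (n choose k) *\<^sub>R prod (nth_deriv k f x) (nth_deriv (n - k) g x))"
proof (rule smooth_onI_derivs(2)[OF assms(1) _ _ assms(4), where ds="\<lambda>n x. \<Sum>k\<le>n. real (n choose k) *\<^sub>R prod (nth_deriv k f x) (nth_deriv (n - k) g x)"])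
  fix n x assume "x \<in> S"
  then show "((\<lambda>x. \<Sum>k\<le>n. real (n choose k) *\<^sub>R prod (nth_deriv k f x) (nth_deriv (n - k) g x))
    has_vector_derivative (\<Sum>k\<le>Suc n. real (Suc n choose k) *\<^sub>R prod (nth_deriv k f x) (nth_deriv (Suc n - k) g x))) (at x)"
    using leibniz_aux[of "Suc n" S f g n x] assms by (simp add: smooth_on_iff)
qed simp

end

lemma
  assumes L: "bounded_linear L" and S: "open S"
  shows smooth_on_linear: "smooth_on S f \<Longrightarrow> smooth_on S (\<lambda>x. L (f x))"
    and nth_deriv_linear: "smooth_on S f \<Longrightarrow> x \<in> S \<Longrightarrow> nth_deriv n (\<lambda>x. L (f x)) x = L (nth_deriv n f x)"
  using smooth_onI_derivs[OF S, where ds="\<lambda>n x. L (nth_deriv n f x)" and f="\<lambda>x. L (f x)"]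
    bounded_linear.has_vector_derivative[OF L smooth_on_deriv] by auto

lemma
  assumes S: "open S" and f: "smooth_on S f" and g: "smooth_on S g"
  shows smooth_on_add: "smooth_on S (\<lambda>x. f x + g x)"
    and nth_deriv_plus: "x \<in> S \<Longrightarrow> nth_deriv n (\<lambda>x. f x + g x) x = nth_deriv n f x + nth_deriv n g x"
  using smooth_onI_derivs[OF S, where ds="\<lambda>n x. nth_deriv n f x + nth_deriv n g x" and f="\<lambda>x. f x + g x"]
    has_vector_derivative_add[OF smooth_on_deriv[OF f] smooth_on_deriv[OF g]] by auto

lemma
  assumes S: "open S"
  shows smooth_on_const: "smooth_on S (\<lambda>x. c)"
    and nth_deriv_const: "x \<in> S \<Longrightarrow> nth_deriv n (\<lambda>x. c) x = (if n = 0 then c else 0)"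
  using smooth_onI_derivs[OF S, where ds="\<lambda>n x. if n = 0 then c else 0" and f="\<lambda>x. c"]
  by (auto intro: derivative_eq_intros)

lemma smooth_on_minus: "open S \<Longrightarrow> smooth_on S f \<Longrightarrow> smooth_on S (\<lambda>x. - f x)"
  by (rule smooth_on_linear[OF bounded_linear_minus[OF bounded_linear_ident]])
lemma nth_deriv_minus: "open S \<Longrightarrow> smooth_on S f \<Longrightarrow> x \<in> S \<Longrightarrow> nth_deriv n (\<lambda>x. - f x) x = - nth_deriv n f x"
  by (rule nth_deriv_linear[OF bounded_linear_minus[OF bounded_linear_ident]])
lemma smooth_on_diff: "open S \<Longrightarrow> smooth_on S f \<Longrightarrow> smooth_on S g \<Longrightarrow> smooth_on S (\<lambda>x. f x - g x)"
  using smooth_on_add[of S f "\<lambda>x. - g x"] smooth_on_minus[of S g] by simp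
lemma nth_deriv_diff: "open S \<Longrightarrow> smooth_on S f \<Longrightarrow> smooth_on S g \<Longrightarrow> x \<in> S \<Longrightarrow>
    nth_deriv n (\<lambda>x. f x - g x) x = nth_deriv n f x - nth_deriv n g x"
  using nth_deriv_plus[of S f "\<lambda>x. - g x"] smooth_on_minus[of S g] nth_deriv_minus[of S g] by simp

lemmas smooth_on_mult = bounded_bilinear.smooth_on_prod[OF bounded_bilinear_mult]
lemmas smooth_on_scaleR = bounded_bilinear.smooth_on_prod[OF bounded_bilinear_scaleR]
lemmas nth_deriv_mult = bounded_bilinear.nth_deriv_prod[OF bounded_bilinear_mult]

lemma
  fixes a b :: real
  assumes S: "open S" and T: "open T" and sub: "\<And>x. x \<in> T \<Longrightarrow> a * x + b \<in> S" and f: "smooth_on S f"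
  shows smooth_on_affine: "smooth_on T (\<lambda>x. f (a * x + b))"
    and nth_deriv_affine: "x \<in> T \<Longrightarrow> nth_deriv n (\<lambda>x. f (a * x + b)) x = a ^ n *\<^sub>R nth_deriv n f (a * x + b)"
proof -
  have "((\<lambda>x. a ^ n *\<^sub>R nth_deriv n f (a * x + b)) has_vector_derivative a ^ Suc n *\<^sub>R nth_deriv (Suc n) f (a * x + b)) (at x)"
    if "x \<in> T" for n x
  proof -
    have 1: "((\<lambda>x. a * x + b) has_vector_derivative a) (at x)"
      by (auto intro!: derivative_eq_intros)
    have "((\<lambda>x. nth_deriv n f (a * x + b)) has_vector_derivative a *\<^sub>R nth_deriv (Suc n) f (a * x + b)) (at x)"
      using vector_diff_chain_at[OF 1 smooth_on_deriv[OF f sub[OF that], of n]] by (simp add: o_def)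
    from bounded_linear.has_vector_derivative[OF bounded_linear_scaleR_right this, of "a ^ n"]
    show ?thesis by (simp add: mult.commute)
  qed
  then show "smooth_on T (\<lambda>x. f (a * x + b))"
    "x \<in> T \<Longrightarrow> nth_deriv n (\<lambda>x. f (a * x + b)) x = a ^ n *\<^sub>R nth_deriv n f (a * x + b)"
    using smooth_onI_derivs[OF T, where ds="\<lambda>n x. a ^ n *\<^sub>R nth_deriv n f (a * x + b)" and f="\<lambda>x. f (a * x + b)"]
    by auto
qed

lemma smooth_on_shift: "smooth_on UNIV f \<Longrightarrow> smooth_on UNIV (\<lambda>x. f (x + t))"
  and nth_deriv_shift: "smooth_on UNIV f \<Longrightarrow> nth_deriv n (\<lambda>x. f (x + t)) x = nth_deriv n f (x + t)"
  using smooth_on_affine[of UNIV UNIV 1 t f] nth_deriv_affine[of UNIV UNIV 1 t f x] by simp_all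

lemma smooth_on_of_real: "open S \<Longrightarrow> smooth_on S f \<Longrightarrow> smooth_on S (\<lambda>x. of_real (f x) :: quat)"
  unfolding of_real_def by (intro smooth_on_scaleR smooth_on_const)

lemma smooth_on_qcnj: "open S \<Longrightarrow> smooth_on S f \<Longrightarrow> smooth_on S (\<lambda>x. qcnj (f x))"
  by (rule smooth_on_linear[OF bounded_linear_qcnj])
lemma smooth_on_qre: "open S \<Longrightarrow> smooth_on S f \<Longrightarrow> smooth_on S (\<lambda>x. qre (f x))"
  by (rule smooth_on_linear[OF bounded_linear_qre])

text \<open>\<open>hs\<close> lists the outer function and all its derivatives. The index
  \<open>n\<close> stays free because the chain rule replaces \<open>hs n\<close> by
  \<open>hs (Suc n)\<close>; this avoids an explicit formula for higher derivatives of a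
  composite.\<close>

lemma diff_upto_comp:
  fixes hs :: "nat \<Rightarrow> real \<Rightarrow> real" and f :: "real \<Rightarrow> real"
  assumes S: "open S" and hs: "\<And>n t. t \<in> J \<Longrightarrow> (hs n has_real_derivative hs (Suc n) t) (at t)"
    and f: "smooth_on S f" and fJ: "\<And>x. x \<in> S \<Longrightarrow> f x \<in> J"
  shows "diff_upto r S (\<lambda>x. hs n (f x))"
proof (induction r arbitrary: n)
  case 0 show ?case by (simp add: diff_upto_def)
next
  case (Suc r)
  show ?case
  proof (rule diff_upto_SucI[OF S])
    show "((\<lambda>x. hs n (f x)) has_vector_derivative (nth_deriv 1 f x * hs (Suc n) (f x))) (at x)" if "x \<in> S" for x
      using vector_diff_chain_at[OF smooth_on_deriv1[OF f that], of "hs n" "hs (Suc n) (f x)"] hs[OF fJ[OF that]]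
      by (simp add: o_def has_real_derivative_iff_has_vector_derivative)
    show "diff_upto r S (\<lambda>x. nth_deriv 1 f x * hs (Suc n) (f x))"
      by (intro bounded_bilinear.diff_upto_prod[OF bounded_bilinear_mult] S Suc)
         (use smooth_on_nth_deriv[OF f] in \<open>simp add: smooth_on_iff\<close>)
  qed
qed

lemma smooth_on_comp:
  fixes hs :: "nat \<Rightarrow> real \<Rightarrow> real" and f :: "real \<Rightarrow> real"
  assumes "open S" "\<And>n t. t \<in> J \<Longrightarrow> (hs n has_real_derivative hs (Suc n) t) (at t)"
    and "smooth_on S f" "\<And>x. x \<in> S \<Longrightarrow> f x \<in> J"
  shows "smooth_on S (\<lambda>x. hs n (f x))"
  unfolding smooth_on_iff by (intro allI diff_upto_comp[where J=J and hs=hs and f=f] assms)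

subsection \<open>Scaled derivative bounds\<close>

text \<open>Size \<open>b\<close> at frequency \<open>Q\<close>: every derivative up to order \<open>r\<close> costs a factor \<open>Q\<close>.\<close>

definition Cb :: "real set \<Rightarrow> nat \<Rightarrow> real \<Rightarrow> real \<Rightarrow> (real \<Rightarrow> 'a::real_normed_vector) \<Rightarrow> bool" where
  "Cb S r Q b f \<longleftrightarrow> smooth_on S f \<and> (\<forall>m\<le>r. \<forall>x\<in>S. norm (nth_deriv m f x) \<le> b * Q ^ m)"

lemma CbD: "Cb S r Q b f \<Longrightarrow> m \<le> r \<Longrightarrow> x \<in> S \<Longrightarrow> norm (nth_deriv m f x) \<le> b * Q ^ m"
  and Cb_smooth: "Cb S r Q b f \<Longrightarrow> smooth_on S f"
  by (auto simp: Cb_def)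

lemma CbD0: "Cb S r Q b f \<Longrightarrow> x \<in> S \<Longrightarrow> norm (f x) \<le> b"
  using CbD[of S r Q b f 0 x] by simp

lemma Cb_mono:
  assumes "Cb S r Q b f" "T \<subseteq> S" "r' \<le> r" "0 \<le> Q" "Q \<le> Q'" "b \<le> b'" "0 \<le> b'"
  shows "Cb T r' Q' b' f"
  unfolding Cb_def
proof (intro conjI allI impI ballI)
  show "smooth_on T f" using assms by (auto simp: Cb_def intro: smooth_on_subset)
  fix m x assume "m \<le> r'" "x \<in> T"
  then have "norm (nth_deriv m f x) \<le> b * Q ^ m" using assms CbD by fastforce
  also have "\<dots> \<le> b' * Q' ^ m" by (intro mult_mono power_mono) (use assms in auto)
  finally show "norm (nth_deriv m f x) \<le> b' * Q' ^ m" .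
qed

lemma Cb_le: "Cb S r Q b f \<Longrightarrow> b \<le> b' \<Longrightarrow> 0 \<le> Q \<Longrightarrow> Cb S r Q b' f"
  unfolding Cb_def by (meson mult_right_mono order_trans zero_le_power)

lemma Cb_cong:
  assumes "open S" "Cb S r Q b f" "\<And>x. x \<in> S \<Longrightarrow> f x = g x"
  shows "Cb S r Q b g"
  using assms smooth_on_cong[OF assms(1,3)] nth_deriv_cong[OF assms(1,3)] by (auto simp: Cb_def)

lemma Cb_const: "open S \<Longrightarrow> norm c \<le> b \<Longrightarrow> 0 \<le> Q \<Longrightarrow> Cb S r Q b (\<lambda>x. c)"
  unfolding Cb_def
  by (auto simp: smooth_on_const nth_deriv_const intro: order_trans[OF norm_ge_zero] mult_nonneg_nonneg)

lemma Cb_add: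
  assumes "open S" "Cb S r Q b f" "Cb S r Q c g"
  shows "Cb S r Q (b + c) (\<lambda>x. f x + g x)"
  unfolding Cb_def
proof (intro conjI allI impI ballI)
  show "smooth_on S (\<lambda>x. f x + g x)" using assms by (auto simp: Cb_def intro: smooth_on_add)
  fix m x assume "m \<le> r" "x \<in> S"
  then show "norm (nth_deriv m (\<lambda>x. f x + g x) x) \<le> (b + c) * Q ^ m"
    using nth_deriv_plus[OF assms(1) Cb_smooth[OF assms(2)] Cb_smooth[OF assms(3)], of x m]
      CbD[OF assms(2), of m x] CbD[OF assms(3), of m x]
    by (auto simp: algebra_simps intro: norm_triangle_le)
qed

lemma Cb_linear:
  assumes "bounded_linear L" "\<And>y. norm (L y) \<le> c * norm y" "0 \<le> c" "open S" "Cb S r Q b f"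
  shows "Cb S r Q (c * b) (\<lambda>x. L (f x))"
  unfolding Cb_def
proof (intro conjI allI impI ballI)
  show "smooth_on S (\<lambda>x. L (f x))" using assms by (auto simp: Cb_def intro: smooth_on_linear)
  fix m x assume "m \<le> r" "x \<in> S"
  then have "norm (nth_deriv m (\<lambda>x. L (f x)) x) \<le> c * norm (nth_deriv m f x)"
    using nth_deriv_linear[OF assms(1,4) Cb_smooth[OF assms(5)]] assms(2) by metis
  also have "\<dots> \<le> c * (b * Q ^ m)"
    by (intro mult_left_mono CbD[OF assms(5)] \<open>m \<le> r\<close> \<open>x \<in> S\<close> assms(3))
  finally show "norm (nth_deriv m (\<lambda>x. L (f x)) x) \<le> c * b * Q ^ m" by simp
qed

lemma Cb_minus: "open S \<Longrightarrow> Cb S r Q b f \<Longrightarrow> Cb S r Q b (\<lambda>x. - f x)"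
  using Cb_linear[OF bounded_linear_minus[OF bounded_linear_ident], of 1 S r Q b f] by simp

lemma Cb_diff: "open S \<Longrightarrow> Cb S r Q b f \<Longrightarrow> Cb S r Q c g \<Longrightarrow> Cb S r Q (b + c) (\<lambda>x. f x - g x)"
  using Cb_add[of S r Q b f c "\<lambda>x. - g x"] Cb_minus[of S r Q c g] by simp

lemma Cb_cmult: "open S \<Longrightarrow> Cb S r Q b f \<Longrightarrow> Cb S r Q (\<bar>c\<bar> * b) (\<lambda>x. c *\<^sub>R f x)"
  by (rule Cb_linear[OF bounded_linear_scaleR_right]) auto

lemma Cb_qcnj: "open S \<Longrightarrow> Cb S r Q b f \<Longrightarrow> Cb S r Q b (\<lambda>x. qcnj (f x))"
  using Cb_linear[OF bounded_linear_qcnj, of 1 S r Q b f] by simp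

lemma Cb_qre: "open S \<Longrightarrow> Cb S r Q b f \<Longrightarrow> Cb S r Q b (\<lambda>x. qre (f x))"
  using Cb_linear[OF bounded_linear_qre, of 1 S r Q b f] by (simp add: abs_qre_le)

lemma Cb_sum:
  assumes "open S" "0 \<le> Q" "\<And>i. i \<in> I \<Longrightarrow> Cb S r Q (b i) (f i)"
  shows "Cb S r Q (\<Sum>i\<in>I. b i) (\<lambda>x. \<Sum>i\<in>I. f i x)"
proof (cases "finite I")
  case True
  then show ?thesis using assms(3)
    by (induction I) (auto intro!: Cb_add Cb_const assms(1,2))
next
  case False then show ?thesis using assms(1,2) by (simp add: Cb_const)
qed

text \<open>All terms of the Leibniz sum carry the same power of \<open>Q\<close>, so only the
  binomial coefficients are added, and they sum to at most \<open>2 ^ r\<close>.\<close>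

lemma (in bounded_bilinear) Cb_prod:
  assumes le: "\<And>a b. norm (prod a b) \<le> norm a * norm b" and S: "open S"
    and f: "Cb S r Q b f" and g: "Cb S r Q c g"
  shows "Cb S r Q (2 ^ r * b * c) (\<lambda>x. prod (f x) (g x))"
  unfolding Cb_def
proof (intro conjI allI impI ballI)
  note sm = Cb_smooth[OF f] Cb_smooth[OF g]
  show "smooth_on S (\<lambda>x. prod (f x) (g x))" using smooth_on_prod[OF S sm] .
  fix m x assume m: "m \<le> r" and x: "x \<in> S"
  have b0: "0 \<le> b" and c0: "0 \<le> c"
    using order_trans[OF norm_ge_zero CbD0[OF f x]] order_trans[OF norm_ge_zero CbD0[OF g x]] by auto
  have "norm (nth_deriv m (\<lambda>x. prod (f x) (g x)) x)
    \<le> (\<Sum>k\<le>m. norm (real (m choose k) *\<^sub>R prod (nth_deriv k f x) (nth_deriv (m - k) g x)))"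
    unfolding nth_deriv_prod[OF S sm x] by (rule norm_sum)
  also have "\<dots> \<le> (\<Sum>k\<le>m. real (m choose k) * (b * c * Q ^ m))"
  proof (rule sum_mono)
    fix k assume "k \<in> {..m}"
    then have k: "k \<le> m" by simp
    have "norm (prod (nth_deriv k f x) (nth_deriv (m - k) g x)) \<le> (b * Q ^ k) * (c * Q ^ (m - k))"
      by (rule order_trans[OF le], rule mult_mono)
         (use CbD[OF f _ x, of k] CbD[OF g _ x, of "m - k"] k m in \<open>auto intro: order_trans[OF norm_ge_zero]\<close>)
    also have "\<dots> = b * c * (Q ^ k * Q ^ (m - k))" by simp
    also have "Q ^ k * Q ^ (m - k) = Q ^ m" using k by (simp add: power_add[symmetric])
    finally show "norm (real (m choose k) *\<^sub>R prod (nth_deriv k f x) (nth_deriv (m - k) g x)) \<le> real (m choose k) * (b * c * Q ^ m)"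
      by (simp add: mult_left_mono)
  qed
  also have "\<dots> = real (2 ^ m) * (b * c * Q ^ m)"
    by (simp add: sum_distrib_right[symmetric] of_nat_sum[symmetric] choose_row_sum del: of_nat_sum)
  also have "\<dots> \<le> 2 ^ r * (b * c * Q ^ m)"
  proof (rule mult_right_mono)
    show "real (2 ^ m) \<le> 2 ^ r" using m by (simp add: power_increasing)
    have "0 \<le> b * Q ^ m" using CbD[OF f m x] by (meson norm_ge_zero order_trans)
    then show "0 \<le> b * c * Q ^ m" using c0 by (metis mult.assoc mult.commute mult_nonneg_nonneg)
  qed
  finally show "norm (nth_deriv m (\<lambda>x. prod (f x) (g x)) x) \<le> 2 ^ r * b * c * Q ^ m" by simp
qed

lemmas Cb_mult = bounded_bilinear.Cb_prod[OF bounded_bilinear_mult norm_mult_ineq]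

lemma Cb_scaleR: "open S \<Longrightarrow> Cb S r Q b f \<Longrightarrow> Cb S r Q c g \<Longrightarrow> Cb S r Q (2 ^ r * b * c) (\<lambda>x. f x *\<^sub>R g x)"
  by (rule bounded_bilinear.Cb_prod[OF bounded_bilinear_scaleR]) auto

lemma Cb_shift: "Cb UNIV r Q b f \<Longrightarrow> Cb UNIV r Q b (\<lambda>x. f (x + t))"
  by (auto simp: Cb_def smooth_on_shift nth_deriv_shift)

lemma Cb_SucI:
  assumes "open S" "\<And>x. x \<in> S \<Longrightarrow> (f has_vector_derivative f' x) (at x)" "Cb S r Q (b * Q) f'"
    "\<And>x. x \<in> S \<Longrightarrow> norm (f x) \<le> b"
  shows "Cb S (Suc r) Q b f"
  unfolding Cb_def
proof (intro conjI allI impI ballI)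
  show "smooth_on S f" by (rule smooth_on_SucI[OF assms(1,2) Cb_smooth[OF assms(3)]])
  fix m x assume "m \<le> Suc r" "x \<in> S"
  then show "norm (nth_deriv m f x) \<le> b * Q ^ m"
    using nth_deriv_Suc_eq[OF assms(1,2) \<open>x \<in> S\<close>] CbD[OF assms(3), of "m - 1" x] assms(4)
    by (cases m) (auto simp: mult.assoc)
qed

lemma Cb_deriv:
  assumes "Cb S (Suc r) Q b f"
  shows "Cb S r Q (b * Q) (nth_deriv 1 f)"
  unfolding Cb_def
proof (intro conjI allI impI ballI)
  show "smooth_on S (nth_deriv 1 f)" using smooth_on_nth_deriv[OF Cb_smooth[OF assms]] .
  fix m x assume "m \<le> r" "x \<in> S"
  then show "norm (nth_deriv m (nth_deriv 1 f) x) \<le> b * Q * Q ^ m"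
    using CbD[OF assms, of "Suc m" x] by (simp add: nth_deriv_add mult.assoc)
qed

text \<open>The chain rule gives a product to which the bound of one order less applies. The factor
  \<open>f'\<close> carries \<open>b\<close>, and \<open>b \<le> 1\<close> bounds the other factor,
  so the estimate stays linear in \<open>b\<close>. Only derivatives of positive order are
  estimated, so with \<open>J = UNIV\<close> the function \<open>f\<close> may be a phase much
  larger than 1.\<close>

lemma comp_bound:
  fixes hs :: "nat \<Rightarrow> real \<Rightarrow> real"
  assumes hs: "\<And>n t. t \<in> J \<Longrightarrow> (hs n has_real_derivative hs (Suc n) t) (at t)"
    and bd: "\<And>n. \<exists>H. \<forall>t\<in>J. \<bar>hs n t\<bar> \<le> H"
  shows "\<exists>K\<ge>0. \<forall>S f Q b. open S \<longrightarrow> 0 \<le> Q \<longrightarrow> 0 \<le> b \<longrightarrow> b \<le> 1 \<longrightarrow> smooth_on S f \<longrightarrow> (\<forall>x\<in>S. f x \<in> J) \<longrightarrow>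
    (\<forall>m x. 1 \<le> m \<longrightarrow> m \<le> r \<longrightarrow> x \<in> S \<longrightarrow> \<bar>nth_deriv m f x\<bar> \<le> b * Q ^ m) \<longrightarrow>
    (\<forall>m x. 1 \<le> m \<longrightarrow> m \<le> r \<longrightarrow> x \<in> S \<longrightarrow> \<bar>nth_deriv m (\<lambda>x. hs n (f x)) x\<bar> \<le> K * b * Q ^ m)"
proof (induction r arbitrary: n)
  case 0 show ?case by (rule exI[of _ 0]) auto
next
  case (Suc r)
  obtain H where H: "\<And>t. t \<in> J \<Longrightarrow> \<bar>hs (Suc n) t\<bar> \<le> H" using bd by blast
  obtain K where K: "K \<ge> 0" and KK: "\<forall>S f Q b. open S \<longrightarrow> 0 \<le> Q \<longrightarrow> 0 \<le> b \<longrightarrow> b \<le> 1 \<longrightarrow> smooth_on S f \<longrightarrow> (\<forall>x\<in>S. f x \<in> J) \<longrightarrow>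
    (\<forall>m x. 1 \<le> m \<longrightarrow> m \<le> r \<longrightarrow> x \<in> S \<longrightarrow> \<bar>nth_deriv m f x\<bar> \<le> b * Q ^ m) \<longrightarrow>
    (\<forall>m x. 1 \<le> m \<longrightarrow> m \<le> r \<longrightarrow> x \<in> S \<longrightarrow> \<bar>nth_deriv m (\<lambda>x. hs (Suc n) (f x)) x\<bar> \<le> K * b * Q ^ m)"
    using Suc[of "Suc n"] by blast
  define L where "L = 2 ^ r * (\<bar>H\<bar> + K)"
  show ?case
  proof (intro exI[of _ L] conjI allI impI)
    show "0 \<le> L" using K by (simp add: L_def)
    fix S f Q b m x
    assume S: "open S" and Q: "0 \<le> Q" and b: "0 \<le> b" "b \<le> 1" and f: "smooth_on S f" and fJ: "\<forall>x\<in>S. f x \<in> J"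
      and fb: "\<forall>m x. 1 \<le> m \<longrightarrow> m \<le> Suc r \<longrightarrow> x \<in> S \<longrightarrow> \<bar>nth_deriv m f x\<bar> \<le> b * Q ^ m"
      and m: "1 \<le> m" "m \<le> Suc r" and x: "x \<in> S"
    have 1: "Cb S r Q (\<bar>H\<bar> + K) (\<lambda>x. hs (Suc n) (f x))"
      unfolding Cb_def
    proof (intro conjI allI impI ballI)
      show "smooth_on S (\<lambda>x. hs (Suc n) (f x))"
        by (rule smooth_on_comp[where J=J]) (use S hs f fJ in auto)
      fix m x assume m: "m \<le> r" and x: "x \<in> S"
      show "norm (nth_deriv m (\<lambda>x. hs (Suc n) (f x)) x) \<le> (\<bar>H\<bar> + K) * Q ^ m"
      proof (cases "m = 0")
        case True then show ?thesis using H[of "f x"] fJ x K by auto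
      next
        case False
        have "\<bar>nth_deriv m (\<lambda>x. hs (Suc n) (f x)) x\<bar> \<le> K * b * Q ^ m"
        proof (rule KK[rule_format, OF S Q b f _ _ _ m x])
          show "f x \<in> J" if "x \<in> S" for x using fJ that by blast
          show "\<bar>nth_deriv m f x\<bar> \<le> b * Q ^ m" if "1 \<le> m" "m \<le> r" "x \<in> S" for m x
            using fb that by simp
        qed (use False in simp)
        also have "\<dots> \<le> (\<bar>H\<bar> + K) * Q ^ m"
          using b K Q mult_left_le[of b K] by (intro mult_right_mono) auto
        finally show ?thesis by simp
      qed
    qed
    have 2: "Cb S r Q (b * Q) (nth_deriv 1 f)"
      unfolding Cb_def
    proof (intro conjI allI impI ballI)
      show "smooth_on S (nth_deriv 1 f)" by (rule smooth_on_nth_deriv[OF f])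
      fix m x assume "m \<le> r" "x \<in> S"
      then show "norm (nth_deriv m (nth_deriv 1 f) x) \<le> b * Q * Q ^ m"
        using fb[rule_format, of "Suc m" x] by (simp add: nth_deriv_add mult.assoc)
    qed
    have d: "((\<lambda>x. hs n (f x)) has_vector_derivative (hs (Suc n) (f x) * nth_deriv 1 f x)) (at x)" if "x \<in> S" for x
      using vector_diff_chain_at[OF smooth_on_deriv1[OF f that], of "hs n" "hs (Suc n) (f x)"] hs[of "f x"] fJ that
      by (simp add: o_def has_real_derivative_iff_has_vector_derivative mult.commute)
    obtain k where k: "m = Suc k" using m by (cases m) auto
    have "\<bar>nth_deriv m (\<lambda>x. hs n (f x)) x\<bar> = \<bar>nth_deriv k (\<lambda>x. hs (Suc n) (f x) * nth_deriv 1 f x) x\<bar>"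
      unfolding k using nth_deriv_Suc_eq[OF S d x] by simp
    also have "\<dots> \<le> 2 ^ r * (\<bar>H\<bar> + K) * (b * Q) * Q ^ k"
      using CbD[OF Cb_mult[OF S 1 2], of k x] k m x by simp
    finally show "\<bar>nth_deriv m (\<lambda>x. hs n (f x)) x\<bar> \<le> L * b * Q ^ m"
      by (simp add: L_def k mult.assoc)
  qed
qed

text \<open>The mean value theorem supplies order zero, which \<open>comp_bound\<close> leaves out;
  subtracting \<open>hs 0 0\<close> makes the result proportional to the size of
  \<open>f\<close>.\<close>

lemma Cb_comp:
  fixes hs :: "nat \<Rightarrow> real \<Rightarrow> real"
  assumes hs: "\<And>n t. \<bar>t\<bar> \<le> \<rho> \<Longrightarrow> (hs n has_real_derivative hs (Suc n) t) (at t)" and \<rho>: "0 \<le> \<rho>" "\<rho> \<le> 1"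
  shows "\<exists>K\<ge>1. \<forall>S f Q b. open S \<longrightarrow> 0 \<le> Q \<longrightarrow> b \<le> \<rho> \<longrightarrow> Cb S r Q b f \<longrightarrow>
    Cb S r Q (K * b) (\<lambda>x. hs 0 (f x) - hs 0 0)"
proof -
  let ?J = "{t. \<bar>t\<bar> \<le> \<rho>}"
  have J: "?J = {-\<rho>..\<rho>}" by auto
  have bd: "\<exists>H. \<forall>t\<in>?J. \<bar>hs n t\<bar> \<le> H" for n
  proof -
    have "continuous_on {-\<rho>..\<rho>} (hs n)"
      using hs by (intro DERIV_continuous_on[where D="hs (Suc n)"]) (auto intro: has_field_derivative_at_within)
    then have "bounded (hs n ` {-\<rho>..\<rho>})" by (intro compact_imp_bounded compact_continuous_image) auto
    then show ?thesis unfolding J by (auto simp: bounded_iff)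
  qed
  obtain K0 where K0: "K0 \<ge> 0" and KK: "\<forall>S f Q b. open S \<longrightarrow> 0 \<le> Q \<longrightarrow> 0 \<le> b \<longrightarrow> b \<le> 1 \<longrightarrow> smooth_on S f \<longrightarrow> (\<forall>x\<in>S. f x \<in> ?J) \<longrightarrow>
    (\<forall>m x. 1 \<le> m \<longrightarrow> m \<le> r \<longrightarrow> x \<in> S \<longrightarrow> \<bar>nth_deriv m f x\<bar> \<le> b * Q ^ m) \<longrightarrow>
    (\<forall>m x. 1 \<le> m \<longrightarrow> m \<le> r \<longrightarrow> x \<in> S \<longrightarrow> \<bar>nth_deriv m (\<lambda>x. hs 0 (f x)) x\<bar> \<le> K0 * b * Q ^ m)"
    using comp_bound[of ?J hs r 0] hs bd by blast
  obtain H where H: "\<And>t. t \<in> ?J \<Longrightarrow> \<bar>hs 1 t\<bar> \<le> H" using bd by blast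
  have mvt: "\<bar>hs 0 t - hs 0 0\<bar> \<le> H * \<bar>t\<bar>" if "\<bar>t\<bar> \<le> \<rho>" for t
  proof -
    have "norm (hs 0 t - hs 0 0) \<le> H * norm (t - 0)"
    proof (rule field_differentiable_bound[of "{-\<rho>..\<rho>}" "hs 0" "hs 1"])
      show "(hs 0 has_real_derivative hs 1 z) (at z within {-\<rho>..\<rho>})" if "z \<in> {-\<rho>..\<rho>}" for z
        using hs[of z 0] that by (auto intro: has_field_derivative_at_within)
    qed (use H that \<rho> in auto)
    then show ?thesis by simp
  qed
  define K where "K = K0 + \<bar>H\<bar> + 1"
  show ?thesis
  proof (intro exI[of _ K] conjI allI impI)
    show "1 \<le> K" using K0 by (simp add: K_def)
    fix S :: "real set" and f :: "real \<Rightarrow> real" and Q b :: real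
    assume S: "open S" and Q: "0 \<le> Q" and b: "b \<le> \<rho>" and f: "Cb S r Q b f"
    show "Cb S r Q (K * b) (\<lambda>x. hs 0 (f x) - hs 0 0)"
      unfolding Cb_def
    proof (intro conjI allI impI ballI)
      have sm: "smooth_on S (\<lambda>x. hs 0 (f x))"
      proof (rule smooth_on_comp[where J="?J", OF S _ Cb_smooth[OF f]])
        show "f x \<in> ?J" if "x \<in> S" for x using CbD0[OF f that] b by simp
      qed (use hs in simp)
      then show "smooth_on S (\<lambda>x. hs 0 (f x) - hs 0 0)"
        by (intro smooth_on_diff smooth_on_const S)
      fix m x assume m: "m \<le> r" and x: "x \<in> S"
      have b0: "0 \<le> b" using CbD0[OF f x] by (meson norm_ge_zero order_trans)
      have eq: "nth_deriv m (\<lambda>x. hs 0 (f x) - hs 0 0) x = nth_deriv m (\<lambda>x. hs 0 (f x)) x - (if m = 0 then hs 0 0 else 0)"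
        using nth_deriv_diff[OF S sm smooth_on_const[OF S] x] by (simp add: nth_deriv_const[OF S x])
      show "norm (nth_deriv m (\<lambda>x. hs 0 (f x) - hs 0 0) x) \<le> K * b * Q ^ m"
      proof (cases "m = 0")
        case True
        have fx: "\<bar>f x\<bar> \<le> b" using CbD0[OF f x] by simp
        have "\<bar>hs 0 (f x) - hs 0 0\<bar> \<le> H * \<bar>f x\<bar>" using mvt fx b by auto
        also have "\<dots> \<le> \<bar>H\<bar> * b" using fx by (intro mult_mono) auto
        also have "\<dots> \<le> K * b" unfolding K_def using b0 K0 by (intro mult_right_mono) auto
        finally show ?thesis using True by simp
      next
        case False
        have "\<bar>nth_deriv m (\<lambda>x. hs 0 (f x)) x\<bar> \<le> K0 * b * Q ^ m"
        proof (rule KK[rule_format, OF S Q b0 _ Cb_smooth[OF f] _ _ _ m x])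
            show "b \<le> 1" using b \<rho> by simp
            show "f x \<in> ?J" if "x \<in> S" for x using CbD0[OF f that] b by simp
            show "\<bar>nth_deriv m f x\<bar> \<le> b * Q ^ m" if "m \<le> r" "x \<in> S" for m x
              using CbD[OF f that] by simp
          qed (use False in simp)
        also have "\<dots> \<le> K * b * Q ^ m" unfolding K_def using b0 Q by (intro mult_right_mono) auto
        finally show ?thesis using False eq by simp
      qed
    qed
  qed
qed

section \<open>Reciprocals, square roots, sines and cosines of curves\<close>

lemma deriv_inverse_family:
  assumes "(t::real) \<noteq> 0"
  shows "((\<lambda>t. (-1) ^ n * fact n * inverse t ^ Suc n) has_real_derivative (-1) ^ Suc n * fact (Suc n) * inverse t ^ Suc (Suc n)) (at t)"
proof -
  have "((\<lambda>t. inverse t ^ Suc n) has_real_derivative (1 + real n) * (- (inverse t ^ Suc (Suc 0)) * inverse t ^ n)) (at t)"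
    by (rule DERIV_power_Suc[OF DERIV_inverse[OF assms]])
  from DERIV_cmult[OF this, of "(-1) ^ n * fact n"]
  show ?thesis by (rule DERIV_cong) (simp add: algebra_simps)
qed

lemma smooth_on_inverse:
  fixes f :: "real \<Rightarrow> real"
  assumes "open S" "smooth_on S f" "\<And>x. x \<in> S \<Longrightarrow> f x \<noteq> 0"
  shows "smooth_on S (\<lambda>x. inverse (f x))"
  using smooth_on_comp[where J="- {0}" and hs="\<lambda>n t. (-1) ^ n * fact n * inverse t ^ Suc n" and n=0 and S=S and f=f]
     deriv_inverse_family assms by (simp del: power_Suc)

lemma Cb_inverse:
  "\<exists>K\<ge>1. \<forall>S (f :: real \<Rightarrow> real) Q b. open S \<longrightarrow> 0 \<le> Q \<longrightarrow> b \<le> 1/2 \<longrightarrow> Cb S r Q b f \<longrightarrow>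
    Cb S r Q (K * b) (\<lambda>x. inverse (1 + f x) - 1)"
proof -
  have "((\<lambda>t. (-1) ^ n * fact n * inverse (1 + t) ^ Suc n) has_real_derivative (-1) ^ Suc n * fact (Suc n) * inverse (1 + t) ^ Suc (Suc n)) (at t)"
    if "\<bar>t\<bar> \<le> 1/2" for n and t :: real
    using DERIV_shift[of "\<lambda>t. (-1) ^ n * fact n * inverse t ^ Suc n" _ t 1] deriv_inverse_family[where t="1 + t" and n=n] that
    by (simp add: add.commute)
  from Cb_comp[where hs="\<lambda>n t. (-1) ^ n * fact n * inverse (1 + t) ^ Suc n" and \<rho>="1/2" and r=r, OF this]
  show ?thesis by simp
qed

lemma deriv_powr_family:
  assumes "(t::real) > 0"
  shows "((\<lambda>t. (\<Prod>i<n. a - real i) * t powr (a - real n)) has_real_derivative (\<Prod>i<Suc n. a - real i) * t powr (a - real (Suc n))) (at t)"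
  using assms by (auto intro!: derivative_eq_intros simp: algebra_simps)

lemma smooth_on_sqrt:
  fixes f :: "real \<Rightarrow> real"
  assumes "open S" "smooth_on S f" "\<And>x. x \<in> S \<Longrightarrow> f x > 0"
  shows "smooth_on S (\<lambda>x. sqrt (f x))"
proof -
  have "smooth_on S (\<lambda>x. f x powr (1/2))"
    using smooth_on_comp[where J="{0<..}" and hs="\<lambda>n t. (\<Prod>i<n. 1/2 - real i) * t powr (1/2 - real n)" and n=0 and S=S and f=f]
     deriv_powr_family[where a="1/2"] assms by simp
  then show ?thesis
    by (rule smooth_on_cong[OF assms(1), rotated]) (use assms(3) in \<open>simp add: powr_half_sqrt less_imp_le\<close>)
qed

lemma Cb_sqrt:
  "\<exists>K\<ge>1. \<forall>S (f :: real \<Rightarrow> real) Q b. open S \<longrightarrow> 0 \<le> Q \<longrightarrow> b \<le> 1/2 \<longrightarrow> Cb S r Q b f \<longrightarrow>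
    Cb S r Q (K * b) (\<lambda>x. sqrt (1 + f x) - 1)"
proof -
  have "((\<lambda>t. (\<Prod>i<n. 1/2 - real i) * (1 + t) powr (1/2 - real n)) has_real_derivative
        (\<Prod>i<Suc n. 1/2 - real i) * (1 + t) powr (1/2 - real (Suc n))) (at t)"
    if "\<bar>t\<bar> \<le> 1/2" for n and t :: real
    using DERIV_shift[of "\<lambda>t. (\<Prod>i<n. 1/2 - real i) * t powr (1/2 - real n)" _ t 1] deriv_powr_family[where t="1 + t" and n=n and a="1/2"] that
    by (simp add: add.commute)
  from Cb_comp[where hs="\<lambda>n t. (\<Prod>i<n. 1/2 - real i) * (1 + t) powr (1/2 - real n)" and \<rho>="1/2" and r=r, OF this]
  obtain K where K: "K \<ge> 1" and "\<And>S (f :: real \<Rightarrow> real) Q b. \<lbrakk>open S; 0 \<le> Q; b \<le> 1/2; Cb S r Q b f\<rbrakk> \<Longrightarrow>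
    Cb S r Q (K * b) (\<lambda>x. (1 + f x) powr (1/2) - 1)" by auto
  note KK = this(2)
  have eq: "(1 + f x) powr (1/2) = sqrt (1 + f x)" if "Cb S r Q b f" "b \<le> 1/2" "x \<in> S" for S f Q b x
    using CbD0[OF that(1,3)] that(2) by (intro powr_half_sqrt) auto
  have "Cb S r Q (K * b) (\<lambda>x. sqrt (1 + f x) - 1)" if "open S" "0 \<le> Q" "b \<le> 1/2" "Cb S r Q b f"
    for S f Q b
    by (rule Cb_cong[OF that(1) KK[OF that]]) (simp add: eq[OF that(4,3)])
  then show ?thesis using K by blast
qed

lemma deriv_sin_family:
  "((\<lambda>t. sin (t + a + real n * (pi/2))) has_real_derivative sin (t + a + real (Suc n) * (pi/2))) (at t)"
proof -
  have "cos (t + a + real n * (pi/2)) = sin (t + a + real (Suc n) * (pi/2))"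
    by (simp add: algebra_simps cos_sin_eq[of "t + _"] sin_add cos_add add_divide_distrib)
  then show ?thesis by (auto intro!: derivative_eq_intros)
qed

lemma
  fixes f :: "real \<Rightarrow> real"
  assumes "open S" "smooth_on S f"
  shows smooth_on_sin: "smooth_on S (\<lambda>x. sin (f x))" and smooth_on_cos: "smooth_on S (\<lambda>x. cos (f x))"
proof -
  have *: "smooth_on S (\<lambda>x. sin (f x + a))" for a
    using smooth_on_comp[where J=UNIV and hs="\<lambda>n t. sin (t + a + real n * (pi/2))" and n=0 and S=S and f=f]
      deriv_sin_family assms by simp
  from *[of 0] *[of "pi/2"] show "smooth_on S (\<lambda>x. sin (f x))" "smooth_on S (\<lambda>x. cos (f x))"
    by (simp_all add: sin_add)
qed

lemma Cb_sin_cos_small: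
  "\<exists>K\<ge>1. \<forall>S (f :: real \<Rightarrow> real) Q b. open S \<longrightarrow> 0 \<le> Q \<longrightarrow> b \<le> 1 \<longrightarrow> Cb S r Q b f \<longrightarrow>
    Cb S r Q (K * b) (\<lambda>x. sin (f x)) \<and> Cb S r Q (K * b) (\<lambda>x. cos (f x) - 1)"
proof -
  obtain K1 where K1: "K1 \<ge> 1" "\<And>S (f :: real \<Rightarrow> real) Q b. \<lbrakk>open S; 0 \<le> Q; b \<le> 1; Cb S r Q b f\<rbrakk> \<Longrightarrow>
      Cb S r Q (K1 * b) (\<lambda>x. sin (f x))"
    using Cb_comp[where hs="\<lambda>n t. sin (t + 0 + real n * (pi/2))" and \<rho>=1 and r=r, OF deriv_sin_family[of 0]]
    by auto
  obtain K2 where K2: "K2 \<ge> 1" "\<And>S (f :: real \<Rightarrow> real) Q b. \<lbrakk>open S; 0 \<le> Q; b \<le> 1; Cb S r Q b f\<rbrakk> \<Longrightarrow>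
      Cb S r Q (K2 * b) (\<lambda>x. cos (f x) - 1)"
    using Cb_comp[where hs="\<lambda>n t. sin (t + pi/2 + real n * (pi/2))" and \<rho>=1 and r=r, OF deriv_sin_family[of "pi/2"]]
    by (auto simp: sin_add)
  show ?thesis
  proof (intro exI[of _ "K1 + K2"] conjI allI impI)
    fix S :: "real set" and f :: "real \<Rightarrow> real" and Q b :: real
    assume *: "open S" "0 \<le> Q" "b \<le> 1" "Cb S r Q b f"
    have "0 \<le> b \<or> S = {}" using CbD0[OF *(4)] by (meson equals0I norm_ge_zero order_trans)
    then show "Cb S r Q ((K1 + K2) * b) (\<lambda>x. sin (f x))" "Cb S r Q ((K1 + K2) * b) (\<lambda>x. cos (f x) - 1)"
      using Cb_le[OF K1(2)[OF *], of "(K1 + K2) * b"] Cb_le[OF K2(2)[OF *], of "(K1 + K2) * b"] K1(1) K2(1) *(2)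
      by (auto simp: Cb_def smooth_on_def mult_right_mono)
  qed (use K1 K2 in auto)
qed

text \<open>Sine and cosine do not see the size of a phase, only its derivatives. This serves the
  rotation through a possibly large angle in \<open>reduce_commuting\<close>.\<close>

lemma Cb_sin_cos_large:
  "\<exists>K\<ge>1. \<forall>S (f :: real \<Rightarrow> real) Q. open S \<longrightarrow> 0 \<le> Q \<longrightarrow> smooth_on S f \<longrightarrow>
    (\<forall>m x. 1 \<le> m \<longrightarrow> m \<le> r \<longrightarrow> x \<in> S \<longrightarrow> \<bar>nth_deriv m f x\<bar> \<le> Q ^ m) \<longrightarrow>
    Cb S r Q K (\<lambda>x. sin (f x)) \<and> Cb S r Q K (\<lambda>x. cos (f x))"
proof -
  have *: "\<exists>K\<ge>1. \<forall>S (f :: real \<Rightarrow> real) Q. open S \<longrightarrow> 0 \<le> Q \<longrightarrow> smooth_on S f \<longrightarrow>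
    (\<forall>m x. 1 \<le> m \<longrightarrow> m \<le> r \<longrightarrow> x \<in> S \<longrightarrow> \<bar>nth_deriv m f x\<bar> \<le> Q ^ m) \<longrightarrow>
    Cb S r Q K (\<lambda>x. sin (f x + a))" for a
  proof -
    have bd: "\<exists>H. \<forall>t\<in>UNIV. \<bar>sin (t + a + real n * (pi/2))\<bar> \<le> H" for n
      by (rule exI[of _ 1]) simp
    obtain K0 where K0: "K0 \<ge> 0" and KK: "\<forall>S f Q b. open S \<longrightarrow> 0 \<le> Q \<longrightarrow> 0 \<le> b \<longrightarrow> b \<le> 1 \<longrightarrow> smooth_on S f \<longrightarrow> (\<forall>x\<in>S. f x \<in> UNIV) \<longrightarrow>
    (\<forall>m x. 1 \<le> m \<longrightarrow> m \<le> r \<longrightarrow> x \<in> S \<longrightarrow> \<bar>nth_deriv m f x\<bar> \<le> b * Q ^ m) \<longrightarrow>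
    (\<forall>m x. 1 \<le> m \<longrightarrow> m \<le> r \<longrightarrow> x \<in> S \<longrightarrow> \<bar>nth_deriv m (\<lambda>x. sin (f x + a + real 0 * (pi/2))) x\<bar> \<le> K0 * b * Q ^ m)"
      using comp_bound[where J=UNIV and hs="\<lambda>n t. sin (t + a + real n * (pi/2))" and r=r and n=0, OF deriv_sin_family bd]
      by blast
    show ?thesis
    proof (intro exI[of _ "K0 + 1"] conjI allI impI)
      fix S :: "real set" and f :: "real \<Rightarrow> real" and Q :: real
      assume S: "open S" and Q: "0 \<le> Q" and f: "smooth_on S f"
       and fb: "\<forall>m x. 1 \<le> m \<longrightarrow> m \<le> r \<longrightarrow> x \<in> S \<longrightarrow> \<bar>nth_deriv m f x\<bar> \<le> Q ^ m"
      show "Cb S r Q (K0 + 1) (\<lambda>x. sin (f x + a))"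
        unfolding Cb_def
      proof (intro conjI allI impI ballI)
        show "smooth_on S (\<lambda>x. sin (f x + a))"
          by (intro smooth_on_sin smooth_on_add smooth_on_const S f)
        fix m x assume m: "m \<le> r" "x \<in> S"
        show "norm (nth_deriv m (\<lambda>x. sin (f x + a)) x) \<le> (K0 + 1) * Q ^ m"
        proof (cases "m = 0")
          case True then show ?thesis using K0 abs_sin_le_one[of "f x + a"] by (simp del: abs_sin_le_one)
        next
          case False
          have "norm (nth_deriv m (\<lambda>x. sin (f x + a)) x) \<le> K0 * 1 * Q ^ m"
            using KK[rule_format, OF S Q _ _ f _ _ _ m, of 1] fb False by simp
          also have "\<dots> \<le> (K0 + 1) * Q ^ m" using Q by (intro mult_right_mono) auto
          finally show ?thesis .
        qed
      qed
    qed (use K0 in auto)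
  qed
  obtain K1 where K1: "K1 \<ge> 1" "\<And>S (f :: real \<Rightarrow> real) Q. \<lbrakk>open S; 0 \<le> Q; smooth_on S f;
    \<forall>m x. 1 \<le> m \<longrightarrow> m \<le> r \<longrightarrow> x \<in> S \<longrightarrow> \<bar>nth_deriv m f x\<bar> \<le> Q ^ m\<rbrakk> \<Longrightarrow> Cb S r Q K1 (\<lambda>x. sin (f x))"
    using *[of 0] by (auto simp del: One_nat_def)
  obtain K2 where K2: "K2 \<ge> 1" "\<And>S (f :: real \<Rightarrow> real) Q. \<lbrakk>open S; 0 \<le> Q; smooth_on S f;
    \<forall>m x. 1 \<le> m \<longrightarrow> m \<le> r \<longrightarrow> x \<in> S \<longrightarrow> \<bar>nth_deriv m f x\<bar> \<le> Q ^ m\<rbrakk> \<Longrightarrow> Cb S r Q K2 (\<lambda>x. cos (f x))"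
    using *[of "pi/2"] by (auto simp: sin_add simp del: One_nat_def)
  show ?thesis
    by (rule exI[of _ "max K1 K2"]) (use K1(1) in \<open>auto intro: Cb_le[OF K1(2)] Cb_le[OF K2(2)]\<close>)
qed

subsection \<open>A smooth step\<close>

text \<open>The flat function exp (-1/x), with the powers of 1/x that make the family closed under
  differentiation up to linear combinations.\<close>

definition flat :: "nat \<Rightarrow> real \<Rightarrow> real" where
  "flat k x = (if x > 0 then inverse x ^ k * exp (- inverse x) else 0)"

lemma flat_tendsto: "(flat k \<longlongrightarrow> 0) (at 0)"
proof (rule filterlim_split_at)
  show "(flat k \<longlongrightarrow> 0) (at_left 0)"
    by (rule tendsto_eventually) (auto simp: eventually_at_filter flat_def)
  have "((\<lambda>t::real. t ^ k / exp t) \<longlongrightarrow> 0) at_top" by (rule tendsto_power_div_exp_0)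
  from filterlim_compose[OF this filterlim_inverse_at_top_right]
  have "((\<lambda>x. inverse x ^ k / exp (inverse x)) \<longlongrightarrow> 0) (at_right (0::real))" .
  then show "(flat k \<longlongrightarrow> 0) (at_right (0::real))"
    by (rule Lim_transform_eventually)
       (auto simp: eventually_at_filter flat_def exp_minus divide_inverse)
qed

lemma flat_deriv: "(flat k has_real_derivative (flat (k + 2) x - real k * flat (k + 1) x)) (at x)"
proof -
  consider "x > 0" | "x < 0" | "x = 0" by linarith
  then show ?thesis
  proof cases
    case 1
    have "((\<lambda>x. inverse x ^ k * exp (- inverse x)) has_real_derivative (flat (k + 2) x - real k * flat (k + 1) x)) (at x)"
    proof -
      have "((\<lambda>x. inverse x ^ k) has_real_derivative (- real k * inverse x ^ (k + 1))) (at x)"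
      proof (cases k)
        case (Suc j)
        have "((\<lambda>x. inverse x ^ Suc j) has_real_derivative (1 + real j) * (- (inverse x ^ Suc (Suc 0)) * inverse x ^ j)) (at x)"
          by (rule DERIV_power_Suc[OF DERIV_inverse]) (use 1 in simp)
        then show ?thesis unfolding Suc by (rule DERIV_cong) (simp add: algebra_simps)
      qed simp
      moreover have "((\<lambda>x. exp (- inverse x)) has_real_derivative (exp (- inverse x) * inverse x ^ 2)) (at x)"
        using 1 by (auto intro!: derivative_eq_intros simp: power2_eq_square)
      ultimately show ?thesis
        by (rule DERIV_cong[OF DERIV_mult]) (use 1 in \<open>simp add: flat_def algebra_simps power_add power2_eq_square\<close>)
    qed
    then show ?thesis
      by (rule has_field_derivative_transform_within_open[where S="{0<..}"]) (use 1 in \<open>auto simp: flat_def\<close>)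
  next
    case 2
    have "((\<lambda>x. 0) has_real_derivative (flat (k + 2) x - real k * flat (k + 1) x)) (at x)"
      using 2 by (simp add: flat_def)
    then show ?thesis
      by (rule has_field_derivative_transform_within_open[where S="{..<0}"]) (use 2 in \<open>auto simp: flat_def\<close>)
  next
    case 3
    have "(\<lambda>h. (flat k h - flat k 0) / h) = flat (Suc k)"
      by (auto simp: flat_def fun_eq_iff divide_inverse)
    then have "(flat k has_real_derivative 0) (at 0)"
      using flat_tendsto[of "Suc k"] by (simp add: DERIV_def)
    then show ?thesis using 3 by (simp add: flat_def)
  qed
qed

lemma smooth_on_flat: "smooth_on UNIV (flat k)"
proof -
  have "diff_upto r UNIV (flat k)" for r
  proof (induction r arbitrary: k)
    case 0 show ?case by (simp add: diff_upto_def)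
  next
    case (Suc r)
    have 1: "diff_upto r UNIV (\<lambda>x. real k * flat (k + 1) x)"
      by (rule bounded_bilinear.diff_upto_prod[OF bounded_bilinear_mult])
         (use Suc smooth_on_const[of UNIV "real k"] in \<open>auto simp: smooth_on_iff\<close>)
    have 2: "diff_upto r UNIV (\<lambda>x. flat (k + 2) x - real k * flat (k + 1) x)"
      by (rule diff_uptoI_derivs(1)[where ds="\<lambda>n x. nth_deriv n (flat (k + 2)) x - nth_deriv n (\<lambda>x. real k * flat (k + 1) x) x"])
         (use has_vector_derivative_diff[OF diff_upto_deriv[OF Suc] diff_upto_deriv[OF 1]] in \<open>auto simp del: Suc_eq_plus1 One_nat_def\<close>)
    show ?case
      by (rule diff_upto_SucI[OF _ _ 2]) (use flat_deriv in \<open>auto simp: has_real_derivative_iff_has_vector_derivative\<close>)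
  qed
  then show ?thesis by (simp add: smooth_on_iff)
qed

text \<open>A quotient u / (u + v), where u vanishes exactly left of 1/3 and v exactly right of 2/3,
  so that the denominator is positive.\<close>

lemma smooth_step:
  obtains \<sigma> :: "real \<Rightarrow> real" where "smooth_on UNIV \<sigma>" "\<And>y. 0 \<le> \<sigma> y" "\<And>y. \<sigma> y \<le> 1"
    "\<And>y. y \<le> 1/3 \<Longrightarrow> \<sigma> y = 0" "\<And>y. 2/3 \<le> y \<Longrightarrow> \<sigma> y = 1"
proof
  let ?u = "\<lambda>y::real. flat 0 (1 * y + (- 1/3))" and ?v = "\<lambda>y::real. flat 0 (- 1 * y + 2/3)"
  let ?c = "\<lambda>y. ?u y * inverse (?u y + ?v y)"
  have pos: "?u y + ?v y > 0" "?u y \<ge> 0" "?v y \<ge> 0" for y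
    by (auto simp: flat_def add_pos_nonneg)
  have "smooth_on UNIV ?u" "smooth_on UNIV ?v"
    by (rule smooth_on_affine[where S=UNIV]; simp add: smooth_on_flat)+
  then show "smooth_on UNIV ?c"
    using pos(1) by (intro smooth_on_mult smooth_on_inverse smooth_on_add) (auto simp: less_imp_neq[symmetric])
  show "0 \<le> ?c y" "?c y \<le> 1" for y
    using pos[of y] by (auto simp: field_simps)
  show "?c y = 0" if "y \<le> 1/3" for y using that by (simp add: flat_def)
  show "?c y = 1" if "2/3 \<le> y" for y using that pos[of y] by (simp add: flat_def)
qed

subsection \<open>Averaging over lattice translates\<close>

lemma imag_unit:
  assumes "e * e = (-1::quat)"
  shows "norm e = 1" "qcnj e = - e" "qre e = 0"
proof -
  have "norm e * norm e = 1"
    using assms by (metis norm_minus_cancel norm_one norm_quat_mult)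
  then show 1: "norm e = 1" by (metis abs_norm_cancel abs_square_eq_1 power2_eq_square)
  have "qcnj e * (e * e) = e" using 1 by simp
  then have "e = - qcnj e" unfolding assms by simp
  then show 2: "qcnj e = - e" by (metis add.inverse_inverse)
  then show "qre e = 0" by (metis qimag_def qimag_iff)
qed

text \<open>A \<open>y\<close>-dependent quaternion \<open>G\<close> with \<open>tw G\<close> is the cocycle \<open>J G\<close> over \<open>y \<mapsto> y + \<alpha>\<close> that commutes, up to sign,
  with the cocycle \<open>I\<close> over \<open>y \<mapsto> y + 1\<close>; \<open>T\<close> is the transfer operator of the constant cocycle \<open>J\<close>.\<close>

locale qframe =
  fixes I J :: quat and \<alpha> :: real
  assumes II: "I * I = -1" and JJ: "J * J = -1" and IJ: "J * I = - (I * J)"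
begin

lemmas I_unit = imag_unit[OF II] and J_unit = imag_unit[OF JJ]

definition tw :: "(real \<Rightarrow> quat) \<Rightarrow> bool" where
  "tw f \<longleftrightarrow> (\<forall>y. f (y + 1) = I * f y * qcnj I)"

definition T :: "(real \<Rightarrow> quat) \<Rightarrow> real \<Rightarrow> quat" where
  "T f y = qcnj J * f (y + \<alpha>) * J"

lemma II': "I * (I * x) = - x" and JJ': "J * (J * x) = - x" and IJ': "J * (I * x) = - (I * (J * x))"
  by (metis II mult.assoc mult_minus1, metis JJ mult.assoc mult_minus1, metis IJ mult.assoc mult_minus_left)

lemmas IJ_simps = I_unit(2) J_unit(2) II JJ IJ II' JJ' IJ' mult.assoc

lemma T_mult: "T (\<lambda>y. f y * g y) y = T f y * T g y"
  by (simp add: T_def IJ_simps)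

lemma T_one: "T (\<lambda>y. 1) y = 1" and T_add: "T (\<lambda>y. f y + g y) y = T f y + T g y"
  and T_diff: "T (\<lambda>y. f y - g y) y = T f y - T g y"
  and T_scaleR: "T (\<lambda>y. c *\<^sub>R f y) y = c *\<^sub>R T f y"
  by (simp_all add: T_def IJ_simps algebra_simps)

lemma T_zero: "T (\<lambda>y. 0) y = 0"
  by (simp add: T_def)

lemma T_sum: "T (\<lambda>y. \<Sum>i\<in>A. f i y) y = (\<Sum>i\<in>A. T (f i) y)"
  by (induction A rule: infinite_finite_induct) (simp_all add: T_zero T_add)

lemma norm_T: "norm (T f y) = norm (f (y + \<alpha>))"
  by (simp add: T_def norm_quat_mult J_unit)

lemma tw_T: "tw f \<Longrightarrow> tw (T f)"
  unfolding tw_def T_def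
proof
  fix y assume *: "\<forall>y. f (y + 1) = I * f y * qcnj I"
  have "f (y + 1 + \<alpha>) = I * f (y + \<alpha>) * qcnj I" using *[rule_format, of "y + \<alpha>"] by (simp add: algebra_simps)
  then show "qcnj J * f (y + 1 + \<alpha>) * J = I * (qcnj J * f (y + \<alpha>) * J) * qcnj I"
    by (simp add: IJ_simps)
qed

lemma tw_one: "tw (\<lambda>y. 1)" and tw_zero: "tw (\<lambda>y. 0)"
  and tw_add: "tw f \<Longrightarrow> tw g \<Longrightarrow> tw (\<lambda>y. f y + g y)"
  and tw_diff: "tw f \<Longrightarrow> tw g \<Longrightarrow> tw (\<lambda>y. f y - g y)"
  and tw_scaleR: "tw f \<Longrightarrow> tw (\<lambda>y. c *\<^sub>R f y)"
  by (simp_all add: tw_def IJ_simps algebra_simps)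

lemma tw_mult: "tw f \<Longrightarrow> tw g \<Longrightarrow> tw (\<lambda>y. f y * g y)"
  by (simp add: tw_def IJ_simps)

lemma tw_qcnj: "tw f \<Longrightarrow> tw (\<lambda>y. qcnj (f y))"
  by (simp add: tw_def IJ_simps qcnj_mult qcnj_minus)

lemma tw_sum: "(\<And>i. i \<in> A \<Longrightarrow> tw (f i)) \<Longrightarrow> tw (\<lambda>y. \<Sum>i\<in>A. f i y)"
  by (induction A rule: infinite_finite_induct) (simp_all add: tw_zero tw_add)

lemma tw_Tpow: "tw f \<Longrightarrow> tw ((T ^^ n) f)"
  by (induction n) (simp_all add: tw_T)

lemma smooth_T: "smooth_on UNIV f \<Longrightarrow> smooth_on UNIV (T f)"
  unfolding T_def by (intro smooth_on_mult smooth_on_const smooth_on_shift) auto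

lemma Cb_conj:
  assumes "norm e = 1" "Cb UNIV r Q b f"
  shows "Cb UNIV r Q b (\<lambda>y. qcnj e * f y * e)" "Cb UNIV r Q b (\<lambda>y. e * f y * e)"
proof -
  have "bounded_linear (\<lambda>x. a * x * e)" for a :: quat
    by (intro bounded_linear_mult_right[THEN bounded_linear_compose[OF bounded_linear_mult_left]])
  then show "Cb UNIV r Q b (\<lambda>y. qcnj e * f y * e)" "Cb UNIV r Q b (\<lambda>y. e * f y * e)"
    using Cb_linear[of "\<lambda>x. qcnj e * x * e" 1 UNIV r Q b f] Cb_linear[of "\<lambda>x. e * x * e" 1 UNIV r Q b f] assms
    by (simp_all add: norm_quat_mult)
qed

lemma Cb_T: "Cb UNIV r Q b f \<Longrightarrow> Cb UNIV r Q b (T f)"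
  unfolding T_def by (intro Cb_conj Cb_shift J_unit)

lemma Cb_Tpow: "Cb UNIV r Q b f \<Longrightarrow> Cb UNIV r Q b ((T ^^ n) f)"
  by (induction n) (simp_all add: Cb_T)

text \<open>The shift by \<open>q \<alpha> - p\<close> acts on twisted functions through the constant \<open>\<plusminus> I\<^sup>p J\<^sup>q\<close>, up to the translation
  itself; only the parities of \<open>p\<close> and \<open>q\<close> matter.\<close>

definition cls :: "int \<Rightarrow> nat \<Rightarrow> quat" where
  "cls p q = (if odd p then I else 1) * (if odd q then J else 1)"

lemma tw_two: "tw f \<Longrightarrow> f (y + 2) = f y"
proof -
  assume "tw f"
  then have "f (y + 1 + 1) = I * (I * f y * qcnj I) * qcnj I" by (simp only: tw_def)
  then have "f (y + 1 + 1) = f y" by (simp add: IJ_simps)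
  then show ?thesis by (simp add: add.assoc)
qed

lemma tw_even: assumes "tw f" shows "f (y + 2 * real_of_int m) = f y"
proof -
  have *: "f (y + 2 * real n) = f y" for n y
  proof (induction n)
    case (Suc n)
    have "y + 2 * real (Suc n) = y + 2 * real n + 2" by simp
    then show ?case using Suc tw_two[OF assms, of "y + 2 * real n"] by metis
  qed simp
  show ?thesis
  proof (cases "m \<ge> 0")
    case True then show ?thesis using *[of y "nat m"] by simp
  next
    case False then show ?thesis using *[of "y + 2 * real_of_int m" "nat (- m)"] by simp
  qed
qed

lemma Tpow_eq:
  assumes "tw f"
  shows "(T ^^ q) f y = qcnj (cls p q) * f (y + (real q * \<alpha> - real_of_int p)) * cls p q"
proof -
  let ?Jq = "if odd q then J else 1"
  have 1: "(T ^^ q) f y = qcnj (if odd q then J else 1) * f (y + real q * \<alpha>) * (if odd q then J else 1)" for q y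
  proof (induction q arbitrary: y)
    case (Suc q)
    have "(T ^^ Suc q) f y = qcnj J * (T ^^ q) f (y + \<alpha>) * J" by (simp add: T_def)
    moreover have "y + \<alpha> + real q * \<alpha> = y + real (Suc q) * \<alpha>" by (simp add: algebra_simps)
    ultimately show ?case using Suc[of "y + \<alpha>"] by (cases "odd q") (simp_all add: IJ_simps)
  qed simp
  have 2: "f (z + real_of_int p) = (if odd p then I else 1) * f z * qcnj (if odd p then I else 1)" for z
  proof (cases "even p")
    case True
    then obtain m where "p = 2 * m" by blast
    then show ?thesis using tw_even[OF assms, of z m] by simp
  next
    case False
    then obtain m where m: "p = 2 * m + 1" by (elim oddE)
    have "f (z + real_of_int p) = f (z + 1 + 2 * real_of_int m)" by (simp add: m algebra_simps)
    also have "\<dots> = f (z + 1)" by (rule tw_even[OF assms])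
    finally show ?thesis using assms m by (simp add: tw_def)
  qed
  have "f (y + real q * \<alpha>) = f (y + (real q * \<alpha> - real_of_int p) + real_of_int p)" by simp
  then show ?thesis unfolding 1 2 cls_def by (simp add: qcnj_mult IJ_simps)
qed

text \<open>These are exactly \<plusminus>I, \<plusminus>J and \<plusminus>I J, the nontrivial
  classes of lattice vectors modulo 2 up to sign.\<close>

definition adm :: "quat \<Rightarrow> bool" where
  "adm e \<longleftrightarrow> e * e = -1 \<and> (e * I = I * e \<or> e * I = - (I * e)) \<and> (e * J = J * e \<or> e * J = - (J * e))"

text \<open>An odd determinant makes the two parity vectors distinct and nonzero modulo 2. They are
  then two different nontrivial elements of the Klein four-group, and lifts of such elements to the
  quaternion group anticommute.\<close>

lemma cls_anticommute:
  assumes "odd (p * int q' - p' * int q)"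
  shows "adm (cls p q)" "adm (cls p' q')" "cls p q * cls p' q' = - (cls p' q' * cls p q)"
  using assms unfolding cls_def adm_def
  by (cases "odd p"; cases "odd q"; cases "odd p'"; cases "odd q'"; simp add: IJ_simps)+

text \<open>Moving \<open>e\<close> past the conjugating unit produces the same sign on both sides,
  and the two signs cancel.\<close>

lemma adm_commute:
  assumes "adm e"
  shows "e * (I * x * qcnj I) * e = I * (e * x * e) * qcnj I" "e * (qcnj J * x * J) * e = qcnj J * (e * x * e) * J"
proof -
  have 1: "e * I = I * e \<or> e * I = - (I * e)" "e * J = J * e \<or> e * J = - (J * e)" using assms by (auto simp: adm_def)
  show "e * (I * x * qcnj I) * e = I * (e * x * e) * qcnj I"
  proof -
    have "e * (I * x * qcnj I) * e = - ((e * I) * x * (I * e))" by (simp add: I_unit mult.assoc)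
    also have "\<dots> = - ((I * e) * x * (e * I))" using 1(1) by auto
    finally show ?thesis by (simp add: I_unit mult.assoc)
  qed
  show "e * (qcnj J * x * J) * e = qcnj J * (e * x * e) * J"
  proof -
    have "e * (qcnj J * x * J) * e = - ((e * J) * x * (J * e))" by (simp add: J_unit mult.assoc)
    also have "\<dots> = - ((J * e) * x * (e * J))" using 1(2) by auto
    finally show ?thesis by (simp add: J_unit mult.assoc)
  qed
qed

subsection \<open>Averaging along the orbit\<close>

definition Av :: "nat \<Rightarrow> (real \<Rightarrow> quat) \<Rightarrow> real \<Rightarrow> quat" where
  "Av q f y = (1/2) *\<^sub>R (f y + (T ^^ q) f y)"

text \<open>\<open>prim\<close> solves the cohomological equation with right-hand side \<open>Av\<^sup>r f - f\<close>, by telescoping and without small divisors.\<close>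

definition prim :: "nat \<Rightarrow> nat \<Rightarrow> (real \<Rightarrow> quat) \<Rightarrow> real \<Rightarrow> quat" where
  "prim q r f y = (1/2) *\<^sub>R (\<Sum>n<q. (T ^^ n) (\<lambda>y. \<Sum>l<r. (Av q ^^ l) f y) y)"

lemma Tpow_add: "(T ^^ n) (\<lambda>y. f y + g y) y = (T ^^ n) f y + (T ^^ n) g y"
proof (induction n arbitrary: y)
  case (Suc n)
  then have "(T ^^ n) (\<lambda>y. f y + g y) = (\<lambda>y. (T ^^ n) f y + (T ^^ n) g y)" by blast
  then show ?case by (simp add: T_add)
qed simp

lemma Tpow_zero: "(T ^^ n) (\<lambda>y. 0) = (\<lambda>y. 0)"
proof (induction n)
  case (Suc n)
  have "T (\<lambda>y. 0) = (\<lambda>y. 0)" by (rule ext) (rule T_zero)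
  then show ?case using Suc by simp
qed simp

lemma Tpow_sum: "(T ^^ n) (\<lambda>y. \<Sum>i\<in>A. f i y) y = (\<Sum>i\<in>A. (T ^^ n) (f i) y)"
  by (induction A rule: infinite_finite_induct) (simp_all add: Tpow_zero Tpow_add)

lemma Av_sum: "Av q (\<lambda>y. \<Sum>i\<in>A. f i y) y = (\<Sum>i\<in>A. Av q (f i) y)"
  unfolding Av_def Tpow_sum by (simp only: scaleR_sum_right[symmetric] sum.distrib)

text \<open>Two geometric sums are multiplied: half of T - 1 times the sum of T^n over n < q is (T^q
  - 1)/2 = Av - 1, and Av - 1 times the sum of Av^l over l < r is Av^r - 1.\<close>

lemma prim_eq: "T (prim q r f) y - prim q r f y = (Av q ^^ r) f y - f y"
proof -
  define g where "g = (\<lambda>y. \<Sum>l<r. (Av q ^^ l) f y)"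
  have "T (prim q r f) y = (1/2) *\<^sub>R (\<Sum>n<q. (T ^^ Suc n) g y)"
    unfolding prim_def[abs_def] g_def[symmetric] T_scaleR T_sum by simp
  then have "T (prim q r f) y - prim q r f y = (1/2) *\<^sub>R (\<Sum>n<q. (T ^^ Suc n) g y - (T ^^ n) g y)"
    unfolding prim_def g_def[symmetric] by (simp only: scaleR_diff_right[symmetric] sum_subtractf)
  also have "(\<Sum>n<q. (T ^^ Suc n) g y - (T ^^ n) g y) = (T ^^ q) g y - g y"
    by (subst sum_lessThan_telescope) simp
  also have "(1/2) *\<^sub>R ((T ^^ q) g y - g y) = Av q g y - g y"
    by (simp add: Av_def quat_eq_iff)
  also have "Av q g y = (\<Sum>l<r. (Av q ^^ Suc l) f y)"
    unfolding g_def Av_sum by simp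
  also have "\<dots> - g y = (\<Sum>l<r. (Av q ^^ Suc l) f y - (Av q ^^ l) f y)"
    by (simp add: g_def sum_subtractf)
  also have "\<dots> = (Av q ^^ r) f y - f y"
    by (subst sum_lessThan_telescope) simp
  finally show ?thesis .
qed

lemma tw_Av: "tw f \<Longrightarrow> tw (Av q f)"
  unfolding Av_def[abs_def] by (intro tw_scaleR tw_add tw_Tpow)

lemma tw_Avpow: "tw f \<Longrightarrow> tw ((Av q ^^ l) f)"
  by (induction l) (simp_all add: tw_Av)

lemma tw_prim: "tw f \<Longrightarrow> tw (prim q r f)"
  unfolding prim_def[abs_def] by (intro tw_scaleR tw_sum tw_Tpow tw_Avpow)

lemma Cb_Av:
  assumes "Cb UNIV r Q b f" shows "Cb UNIV r Q b (Av q f)"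
proof -
  have "Cb UNIV r Q (\<bar>1/2\<bar> * (b + b)) (Av q f)"
    unfolding Av_def[abs_def] by (intro Cb_cmult Cb_add Cb_Tpow assms) auto
  then show ?thesis by simp
qed

lemma Cb_Avpow: "Cb UNIV r Q b f \<Longrightarrow> Cb UNIV r Q b ((Av q ^^ l) f)"
  by (induction l) (simp_all add: Cb_Av)

lemma Cb_prim:
  assumes "Cb UNIV r Q b f" "0 \<le> Q"
  shows "Cb UNIV r Q (real q * real k * b / 2) (prim q k f)"
proof -
  have "Cb UNIV r Q (\<bar>1/2\<bar> * (\<Sum>n<q. \<Sum>l<k. b)) (prim q k f)"
    unfolding prim_def[abs_def] by (intro Cb_cmult Cb_sum Cb_Tpow Cb_Avpow assms) auto
  then show ?thesis by (simp add: mult.assoc)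
qed

lemma adm_Tpow:
  assumes "adm g" "\<And>y. g * f y * g = s *\<^sub>R f y"
  shows "g * (T ^^ n) f y * g = s *\<^sub>R (T ^^ n) f y"
proof (induction n arbitrary: y)
  case (Suc n)
  show ?case unfolding funpow.simps o_apply T_def[of "(T ^^ n) f"] adm_commute(2)[OF assms(1)] Suc by simp
qed (simp add: assms)

lemma adm_Av:
  assumes "adm g" "\<And>y. g * f y * g = s *\<^sub>R f y"
  shows "g * Av q f y * g = s *\<^sub>R Av q f y"
proof -
  have "g * Av q f y * g = (1/2) *\<^sub>R (g * f y * g + g * (T ^^ q) f y * g)"
    by (simp add: Av_def algebra_simps)
  then show ?thesis unfolding assms(2) adm_Tpow[OF assms] by (simp add: Av_def algebra_simps)
qed

lemma adm_Avpow:
  assumes "adm g" "\<And>y. g * f y * g = s *\<^sub>R f y"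
  shows "g * (Av q ^^ l) f y * g = s *\<^sub>R (Av q ^^ l) f y"
  by (induction l arbitrary: y) (simp_all add: assms adm_Av)

lemma adm_sum:
  assumes "\<And>i. i \<in> A \<Longrightarrow> g * f i * g = s *\<^sub>R f i"
  shows "g * (\<Sum>i\<in>A. f i) * (g::quat) = s *\<^sub>R (\<Sum>i\<in>A. f i)"
  using assms by (simp add: sum_distrib_left sum_distrib_right scaleR_sum_right)

lemma adm_prim:
  assumes "adm g" "\<And>y. g * f y * g = s *\<^sub>R f y"
  shows "g * prim q r f y * g = s *\<^sub>R prim q r f y"
proof -
  have "g * (\<Sum>n<q. (T ^^ n) (\<lambda>y. \<Sum>l<r. (Av q ^^ l) f y) y) * g = s *\<^sub>R (\<Sum>n<q. (T ^^ n) (\<lambda>y. \<Sum>l<r. (Av q ^^ l) f y) y)"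
    by (intro adm_sum adm_Tpow adm_Avpow assms)
  then show ?thesis by (simp add: prim_def algebra_simps)
qed

definition hdiff :: "real \<Rightarrow> (real \<Rightarrow> quat) \<Rightarrow> real \<Rightarrow> quat" where
  "hdiff \<sigma> f y = (1/2) *\<^sub>R (f y - f (y + \<sigma>))"

lemma smooth_hdiff: "smooth_on UNIV f \<Longrightarrow> smooth_on UNIV (hdiff \<sigma> f)"
  unfolding hdiff_def[abs_def] by (intro smooth_on_scaleR smooth_on_const smooth_on_diff smooth_on_shift) auto

lemma smooth_hdiffpow: "smooth_on UNIV f \<Longrightarrow> smooth_on UNIV ((hdiff \<sigma> ^^ l) f)"
  by (induction l) (simp_all add: smooth_hdiff)

lemma nth_deriv_hdiff:
  assumes "smooth_on UNIV f" shows "nth_deriv m (hdiff \<sigma> f) = hdiff \<sigma> (nth_deriv m f)"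
proof
  fix x
  have "nth_deriv m (hdiff \<sigma> f) x = (1/2) *\<^sub>R nth_deriv m (\<lambda>y. f y - f (y + \<sigma>)) x"
    unfolding hdiff_def[abs_def]
    by (rule nth_deriv_linear[OF bounded_linear_scaleR_right, where S=UNIV])
       (use assms in \<open>auto intro!: smooth_on_diff smooth_on_shift\<close>)
  then show "nth_deriv m (hdiff \<sigma> f) x = hdiff \<sigma> (nth_deriv m f) x"
    using nth_deriv_diff[OF _ assms smooth_on_shift[OF assms], of x m \<sigma>] nth_deriv_shift[OF assms]
    by (simp add: hdiff_def)
qed

lemma nth_deriv_hdiffpow:
  assumes "smooth_on UNIV f" shows "nth_deriv m ((hdiff \<sigma> ^^ l) f) = (hdiff \<sigma> ^^ l) (nth_deriv m f)"
proof (induction l)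
  case (Suc l)
  then show ?case using nth_deriv_hdiff[OF smooth_hdiffpow[OF assms]] by simp
qed simp

lemma norm_hdiff: "norm (hdiff \<sigma> f y) = norm (f y - f (y + \<sigma>)) / 2"
  by (simp add: hdiff_def)

lemma norm_hdiff_le: "(\<And>y. norm (f y) \<le> M) \<Longrightarrow> norm (hdiff \<sigma> f y) \<le> M"
  unfolding norm_hdiff using norm_triangle_ineq4[of "f y" "f (y + \<sigma>)"]
  by (smt (verit, best) field_sum_of_halves)

lemma norm_hdiffpow_le: "(\<And>y. norm (f y) \<le> M) \<Longrightarrow> norm ((hdiff \<sigma> ^^ l) f y) \<le> M"
proof (induction l arbitrary: y)
  case (Suc l) then show ?case using norm_hdiff_le[of "(hdiff \<sigma> ^^ l) f"] by simp
qed simp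

lemma norm_hdiff_deriv:
  assumes f: "smooth_on UNIV f" and M: "\<And>y. norm (nth_deriv 1 f y) \<le> M"
  shows "norm (hdiff \<sigma> f y) \<le> \<bar>\<sigma>\<bar> * M"
proof -
  have "norm (f (y + \<sigma>) - f y) \<le> M * norm (y + \<sigma> - y)"
  proof (rule differentiable_bound[of UNIV f "\<lambda>x t. t *\<^sub>R nth_deriv 1 f x"])
    show "(f has_derivative (\<lambda>t. t *\<^sub>R nth_deriv 1 f x)) (at x within UNIV)" for x
      using smooth_on_deriv1[OF f, of x] by (simp add: has_vector_derivative_def)
    show "onorm (\<lambda>t. t *\<^sub>R nth_deriv 1 f x) \<le> M" for x
      by (rule onorm_le) (use M[of x] in \<open>simp add: mult.commute[of M] mult_left_mono\<close>)
  qed auto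
  then have "norm (f y - f (y + \<sigma>)) \<le> \<bar>\<sigma>\<bar> * M" by (simp add: norm_minus_commute mult.commute)
  then show ?thesis unfolding norm_hdiff using norm_ge_zero[of "f y - f (y + \<sigma>)"] by linarith
qed

lemma norm_hdiffpow_deriv:
  assumes f: "smooth_on UNIV f" and M: "\<And>y. norm (nth_deriv l f y) \<le> M"
  shows "norm ((hdiff \<sigma> ^^ l) f y) \<le> \<bar>\<sigma>\<bar> ^ l * M"
  using assms
proof (induction l arbitrary: f M y)
  case (Suc l)
  have "norm (nth_deriv 1 ((hdiff \<sigma> ^^ l) f) y) \<le> \<bar>\<sigma>\<bar> ^ l * M" for y
    unfolding nth_deriv_hdiffpow[OF Suc.prems(1)]
    by (rule Suc.IH[OF smooth_on_nth_deriv[OF Suc.prems(1)]]) (use Suc.prems(2) in \<open>simp add: nth_deriv_add\<close>)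
  from norm_hdiff_deriv[OF smooth_hdiffpow[OF Suc.prems(1)] this]
  show ?case by (simp add: mult.assoc)
qed simp

text \<open>For the derivative of order m, r - m of the differences are converted into derivatives
  at a price \<bar>\<sigma>\<bar> \<le> 1/Q' each, and the other m serve only as contractions. The
  bound follows from Q^r / Q'^(r-m) = (Q/Q')^r Q'^m.\<close>

lemma Cb_hdiffpow:
  assumes f: "Cb UNIV r Q b f" and Q: "0 < Q" "0 < Q'" and \<sigma>: "\<bar>\<sigma>\<bar> \<le> 1 / Q'"
  shows "Cb UNIV r Q' (b * (Q / Q') ^ r) ((hdiff \<sigma> ^^ r) f)"
  unfolding Cb_def
proof (intro conjI allI impI ballI)
  have sm: "smooth_on UNIV f" by (rule Cb_smooth[OF f])
  show "smooth_on UNIV ((hdiff \<sigma> ^^ r) f)" by (rule smooth_hdiffpow[OF sm])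
  fix m x assume m: "m \<le> r"
  have b0: "0 \<le> b" using CbD0[OF f, of 0] norm_ge_zero order_trans by blast
  have "(hdiff \<sigma> ^^ r) f = (hdiff \<sigma> ^^ m) ((hdiff \<sigma> ^^ (r - m)) f)"
    using m funpow_add[of m "r - m" "hdiff \<sigma>"] by simp
  then have "nth_deriv m ((hdiff \<sigma> ^^ r) f) x = (hdiff \<sigma> ^^ m) ((hdiff \<sigma> ^^ (r - m)) (nth_deriv m f)) x"
    by (simp add: nth_deriv_hdiffpow smooth_hdiffpow sm)
  also have "norm \<dots> \<le> \<bar>\<sigma>\<bar> ^ (r - m) * (b * Q ^ r)"
  proof (rule norm_hdiffpow_le, rule norm_hdiffpow_deriv[OF smooth_on_nth_deriv[OF sm]])
    show "norm (nth_deriv (r - m) (nth_deriv m f) y) \<le> b * Q ^ r" for y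
      using CbD[OF f, of r y] m by (simp add: nth_deriv_add)
  qed
  also have "\<dots> \<le> (1 / Q') ^ (r - m) * (b * Q ^ r)"
    using \<sigma> b0 Q by (intro mult_right_mono power_mono) auto
  also have "\<dots> = b * (Q / Q') ^ r * Q' ^ m"
  proof -
    have "Q' ^ r = Q' ^ (r - m) * Q' ^ m" using m by (simp add: power_add[symmetric])
    then show ?thesis using Q by (simp add: power_divide field_simps)
  qed
  finally show "norm (nth_deriv m ((hdiff \<sigma> ^^ r) f) x) \<le> b * (Q / Q') ^ r * Q' ^ m" .
qed

text \<open>On functions fixed by \<open>f \<mapsto> e f e\<close>, with \<open>e\<close> the class of \<open>(p, q)\<close>, the operator \<open>T\<^sup>q\<close> is minus a
  translation by the small number \<open>q \<alpha> - p\<close>, so that averaging is a difference operator.\<close>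

lemma averaging:
  assumes adm: "adm (cls p q)" and f: "tw f" "\<And>y. cls p q * f y * cls p q = f y"
    and Cf: "Cb UNIV r Q b f" and Q: "0 < Q" "Q \<le> Q'" and \<sigma>: "\<bar>real q * \<alpha> - real_of_int p\<bar> \<le> 1 / Q'"
  obtains w f' where "tw w" "tw f'" "\<forall>y. T w y - w y = f' y - f y"
    "Cb UNIV r Q (real q * real r * b / 2) w" "Cb UNIV r Q b f'" "Cb UNIV r Q' (b * (Q / Q') ^ r) f'"
    "\<forall>g s. adm g \<longrightarrow> (\<forall>y. g * f y * g = s *\<^sub>R f y) \<longrightarrow> (\<forall>y. g * w y * g = s *\<^sub>R w y \<and> g * f' y * g = s *\<^sub>R f' y)"
proof (rule that[of "prim q r f" "(Av q ^^ r) f"])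
  let ?e = "cls p q" and ?\<sigma> = "real q * \<alpha> - real_of_int p"
  have e: "?e * ?e = -1" using adm by (simp add: adm_def)
  have "(Av q ^^ l) f = (hdiff ?\<sigma> ^^ l) f" for l
  proof (induction l)
    case (Suc l)
    have 1: "tw ((Av q ^^ l) f)" and 2: "?e * (Av q ^^ l) f y * ?e = (Av q ^^ l) f y" for y
      using tw_Avpow[OF f(1)] adm_Avpow[OF adm, of f 1] f(2) by simp_all
    \<comment> \<open>Since \<open>qcnj e = - e\<close>, the conjugation in \<open>Tpow_eq\<close>
      is minus the map \<open>f \<mapsto> e f e\<close>, which fixes the function at hand.\<close>
    have "Av q ((Av q ^^ l) f) y = hdiff ?\<sigma> ((Av q ^^ l) f) y" for y
      by (subst Av_def, subst Tpow_eq[OF 1, where p=p])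
         (use 2[of "y + ?\<sigma>"] in \<open>simp add: hdiff_def imag_unit(2)[OF e]\<close>)
    then have "Av q ((Av q ^^ l) f) = hdiff ?\<sigma> ((Av q ^^ l) f)" by (rule ext)
    then show ?case using Suc by simp
  qed simp
  then show "Cb UNIV r Q' (b * (Q / Q') ^ r) ((Av q ^^ r) f)"
    using Cb_hdiffpow[OF Cf Q(1) _ \<sigma>] Q by simp
qed (use f Cf Q in \<open>auto simp: prim_eq intro!: tw_prim tw_Avpow Cb_Avpow Cb_prim adm_prim adm_Avpow\<close>)

end

subsection \<open>Removing the part anticommuting with a lattice element\<close>

text \<open>Dirichlet's theorem gives the first vector; a Bezout complement, reduced modulo the
  first, gives the second. The first height is bounded by \<open>2 * N\<close> however short its
  return is; the second is bounded only by the inverse of that return.\<close>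

lemma lattice_pair:
  fixes \<alpha> N :: real
  assumes irr: "\<alpha> \<notin> \<rat>" and N: "N \<ge> 1"
  obtains p p' :: int and q q' :: nat where "1 \<le> q" "real q \<le> 2 * N" "0 < \<bar>real q * \<alpha> - real_of_int p\<bar>"
    "\<bar>real q * \<alpha> - real_of_int p\<bar> < 1 / N" "1 \<le> q'" "\<bar>real q' * \<alpha> - real_of_int p'\<bar> \<le> \<bar>real q * \<alpha> - real_of_int p\<bar>"
    "real q' \<le> 2 / \<bar>real q * \<alpha> - real_of_int p\<bar>" "odd (p * int q' - p' * int q)"
proof -
  define M where "M = nat \<lceil>N\<rceil>"
  have M: "M > 0" "N \<le> real M" "real M \<le> 2 * N" using N by (auto simp: M_def) linarith+
  obtain h k where hk: "coprime h k" "0 < k" "k \<le> int M" "\<bar>of_int k * \<alpha> - of_int h\<bar> < 1 / M"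
    using Dirichlet_approx_coprime[OF M(1)] by blast
  define \<sigma> where "\<sigma> = of_int k * \<alpha> - of_int h"
  have \<sigma>0: "\<sigma> \<noteq> 0"
  proof
    assume "\<sigma> = 0"
    then have "\<alpha> = of_int h / of_int k" using hk(2) by (simp add: \<sigma>_def field_simps)
    then show False using irr by auto
  qed
  have "real_of_int k * \<bar>\<sigma>\<bar> < real M * (1 / real M)"
    using hk \<sigma>0 by (intro mult_le_less_imp_less) (auto simp: \<sigma>_def)
  then have k\<sigma>: "real_of_int k * \<bar>\<sigma>\<bar> < 1" using M by simp
  obtain a b where ab: "a * h + b * k = 1"
    using hk(1) bezout_int[of h k] by (auto simp: coprime_iff_gcd_eq_1)
  define s0 where "s0 = of_int (- a) * \<alpha> - of_int b"
  \<comment> \<open>Reduction by the nearest multiple: the second return becomes at most half of the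
    first.\<close>
  define m where "m = round (s0 / \<sigma>)"
  define v where "v = - a - m * k"
  define u where "u = b - m * h"
  define s where "s = of_int v * \<alpha> - of_int u"
  have s: "s = s0 - of_int m * \<sigma>" by (simp add: s_def s0_def v_def u_def \<sigma>_def algebra_simps)
  have "\<bar>s0 / \<sigma> - of_int m\<bar> \<le> 1 / 2" unfolding m_def using of_int_round_abs_le[of "s0 / \<sigma>"] by (simp add: abs_minus_commute)
  then have "\<bar>s0 / \<sigma> - of_int m\<bar> * \<bar>\<sigma>\<bar> \<le> (1 / 2) * \<bar>\<sigma>\<bar>" by (intro mult_right_mono) auto
  then have s\<sigma>: "\<bar>s\<bar> \<le> \<bar>\<sigma>\<bar>"
  proof -
    assume *: "\<bar>s0 / \<sigma> - of_int m\<bar> * \<bar>\<sigma>\<bar> \<le> (1 / 2) * \<bar>\<sigma>\<bar>"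
    have "(s0 / \<sigma> - of_int m) * \<sigma> = s" using \<sigma>0 by (simp add: s algebra_simps)
    then have "\<bar>s\<bar> \<le> (1 / 2) * \<bar>\<sigma>\<bar>" using * by (metis abs_mult)
    then show ?thesis using abs_ge_zero[of \<sigma>] by linarith
  qed
  have det: "k * u + (- h) * v = 1" using ab by (simp add: u_def v_def algebra_simps)
  \<comment> \<open>The determinant 1 ties the two returns together. Once \<open>k * s\<close> is
    known to be below 1 in absolute value, \<open>v * \<sigma>\<close> lies strictly between 0 and
    2.\<close>
  have rel: "of_int v * \<sigma> - of_int k * s = of_int (k * u + (- h) * v)"
    by (simp add: \<sigma>_def s_def algebra_simps)
  then have rel: "of_int v * \<sigma> = 1 + of_int k * s" unfolding det by simp
  have ks: "\<bar>of_int k * s\<bar> < 1"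
  proof -
    have "real_of_int k * \<bar>s\<bar> \<le> real_of_int k * \<bar>\<sigma>\<bar>" using s\<sigma> hk(2) by (intro mult_left_mono) auto
    also have "\<dots> < 1" by (rule k\<sigma>)
    finally show ?thesis using hk(2) by (simp add: abs_mult)
  qed
  have v0: "v \<noteq> 0" using rel ks by auto
  have vb: "\<bar>of_int v\<bar> \<le> 2 / \<bar>\<sigma>\<bar>"
  proof -
    have "\<bar>of_int v\<bar> * \<bar>\<sigma>\<bar> \<le> 2" using rel ks by (simp add: abs_mult[symmetric])
    then show ?thesis using \<sigma>0 by (simp add: field_simps)
  qed
  define q' where "q' = nat \<bar>v\<bar>"
  define p' where "p' = sgn v * u"
  have q': "real q' = \<bar>of_int v\<bar>" "int q' = sgn v * v" by (auto simp: q'_def sgn_if)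
  show thesis
  proof (rule that[of "nat k" h q' p'])
    show "1 \<le> nat k" using hk by simp
    show "real (nat k) \<le> 2 * N" using hk M by linarith
    have \<sigma>': "real (nat k) * \<alpha> - real_of_int h = \<sigma>" using hk by (simp add: \<sigma>_def)
    show "0 < \<bar>real (nat k) * \<alpha> - real_of_int h\<bar>" using \<sigma>' \<sigma>0 by simp
    have "1 / real M \<le> 1 / N" using M N by (simp add: frac_le)
    then show "\<bar>real (nat k) * \<alpha> - real_of_int h\<bar> < 1 / N" using hk(4) unfolding \<sigma>' by (simp add: \<sigma>_def)
    show "1 \<le> q'" using v0 by (simp add: q'_def)
    have "real q' * \<alpha> - real_of_int p' = of_int (sgn v) * s"
      using q'(1) by (auto simp: s_def p'_def sgn_if)
    then show "\<bar>real q' * \<alpha> - real_of_int p'\<bar> \<le> \<bar>real (nat k) * \<alpha> - real_of_int h\<bar>"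
      using s\<sigma> v0 unfolding \<sigma>' by (simp add: abs_mult sgn_if)
    show "real q' \<le> 2 / \<bar>real (nat k) * \<alpha> - real_of_int h\<bar>" using vb q' unfolding \<sigma>' by simp
    have "h * int q' - p' * int (nat k) = - sgn v * (k * u + (- h) * v)"
      using hk by (simp add: q' p'_def algebra_simps)
    then show "odd (h * int q' - p' * int (nat k))" unfolding det using v0 by (simp add: sgn_if)
  qed
qed

text \<open>One constant for all scalar functions that occur, so that the constants of the iteration
  become explicit expressions in \<open>2 ^ r\<close>, \<open>K\<close> and
  \<open>r\<close>.\<close>

definition calc_const :: "nat \<Rightarrow> real \<Rightarrow> bool" where
  "calc_const r K \<longleftrightarrow> K \<ge> 1 \<and>
    (\<forall>(f :: real \<Rightarrow> real) Q b. 0 \<le> Q \<longrightarrow> b \<le> 1/2 \<longrightarrow> Cb UNIV r Q b f \<longrightarrow> Cb UNIV r Q (K * b) (\<lambda>x. inverse (1 + f x) - 1)) \<and>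
    (\<forall>(f :: real \<Rightarrow> real) Q b. 0 \<le> Q \<longrightarrow> b \<le> 1/2 \<longrightarrow> Cb UNIV r Q b f \<longrightarrow> Cb UNIV r Q (K * b) (\<lambda>x. sqrt (1 + f x) - 1)) \<and>
    (\<forall>(f :: real \<Rightarrow> real) Q b. 0 \<le> Q \<longrightarrow> b \<le> 1 \<longrightarrow> Cb UNIV r Q b f \<longrightarrow>
        Cb UNIV r Q (K * b) (\<lambda>x. sin (f x)) \<and> Cb UNIV r Q (K * b) (\<lambda>x. cos (f x) - 1)) \<and>
    (\<forall>(f :: real \<Rightarrow> real) Q. 0 \<le> Q \<longrightarrow> smooth_on UNIV f \<longrightarrow>
        (\<forall>m x. 1 \<le> m \<longrightarrow> m \<le> r \<longrightarrow> \<bar>nth_deriv m f x\<bar> \<le> Q ^ m) \<longrightarrow>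
        Cb UNIV r Q K (\<lambda>x. sin (f x)) \<and> Cb UNIV r Q K (\<lambda>x. cos (f x)))"

lemma
  assumes "calc_const r K"
  shows calc_const_ge1: "K \<ge> 1"
    and calc_inverse: "0 \<le> Q \<Longrightarrow> b \<le> 1/2 \<Longrightarrow> Cb UNIV r Q b f \<Longrightarrow> Cb UNIV r Q (K * b) (\<lambda>x. inverse (1 + f x) - 1)"
    and calc_sqrt: "0 \<le> Q \<Longrightarrow> b \<le> 1/2 \<Longrightarrow> Cb UNIV r Q b f \<Longrightarrow> Cb UNIV r Q (K * b) (\<lambda>x. sqrt (1 + f x) - 1)"
    and calc_sin: "0 \<le> Q \<Longrightarrow> b \<le> 1 \<Longrightarrow> Cb UNIV r Q b f \<Longrightarrow> Cb UNIV r Q (K * b) (\<lambda>x. sin (f x))"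
    and calc_cos: "0 \<le> Q \<Longrightarrow> b \<le> 1 \<Longrightarrow> Cb UNIV r Q b f \<Longrightarrow> Cb UNIV r Q (K * b) (\<lambda>x. cos (f x) - 1)"
    and calc_sin_large: "0 \<le> Q \<Longrightarrow> smooth_on UNIV f \<Longrightarrow> (\<And>m x. 1 \<le> m \<Longrightarrow> m \<le> r \<Longrightarrow> \<bar>nth_deriv m f x\<bar> \<le> Q ^ m) \<Longrightarrow>
        Cb UNIV r Q K (\<lambda>x. sin (f x))"
    and calc_cos_large: "0 \<le> Q \<Longrightarrow> smooth_on UNIV f \<Longrightarrow> (\<And>m x. 1 \<le> m \<Longrightarrow> m \<le> r \<Longrightarrow> \<bar>nth_deriv m f x\<bar> \<le> Q ^ m) \<Longrightarrow>
        Cb UNIV r Q K (\<lambda>x. cos (f x))"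
  using assms unfolding calc_const_def by blast+

lemma Cb_nonneg: "Cb UNIV r Q b f \<Longrightarrow> 0 \<le> b"
  using CbD0[of UNIV r Q b f 0] norm_ge_zero order_trans by blast

lemma calc_const_exists: "\<exists>K. calc_const r K"
proof -
  obtain K1 where K1: "K1 \<ge> 1" "\<forall>S (f :: real \<Rightarrow> real) Q b. open S \<longrightarrow> 0 \<le> Q \<longrightarrow> b \<le> 1/2 \<longrightarrow> Cb S r Q b f \<longrightarrow>
    Cb S r Q (K1 * b) (\<lambda>x. inverse (1 + f x) - 1)" using Cb_inverse[of r] by blast
  obtain K2 where K2: "K2 \<ge> 1" "\<forall>S (f :: real \<Rightarrow> real) Q b. open S \<longrightarrow> 0 \<le> Q \<longrightarrow> b \<le> 1/2 \<longrightarrow> Cb S r Q b f \<longrightarrow>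
    Cb S r Q (K2 * b) (\<lambda>x. sqrt (1 + f x) - 1)" using Cb_sqrt[of r] by blast
  obtain K3 where K3: "K3 \<ge> 1" "\<forall>S (f :: real \<Rightarrow> real) Q b. open S \<longrightarrow> 0 \<le> Q \<longrightarrow> b \<le> 1 \<longrightarrow> Cb S r Q b f \<longrightarrow>
    Cb S r Q (K3 * b) (\<lambda>x. sin (f x)) \<and> Cb S r Q (K3 * b) (\<lambda>x. cos (f x) - 1)" using Cb_sin_cos_small[of r] by blast
  obtain K4 where K4: "K4 \<ge> 1" "\<forall>S (f :: real \<Rightarrow> real) Q. open S \<longrightarrow> 0 \<le> Q \<longrightarrow> smooth_on S f \<longrightarrow>
    (\<forall>m x. 1 \<le> m \<longrightarrow> m \<le> r \<longrightarrow> x \<in> S \<longrightarrow> \<bar>nth_deriv m f x\<bar> \<le> Q ^ m) \<longrightarrow>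
    Cb S r Q K4 (\<lambda>x. sin (f x)) \<and> Cb S r Q K4 (\<lambda>x. cos (f x))" using Cb_sin_cos_large[of r] by blast
  define K where "K = K1 + K2 + K3 + K4"
  have le: "K1 \<le> K" "K2 \<le> K" "K3 \<le> K" "K4 \<le> K" "1 \<le> K" using K1(1) K2(1) K3(1) K4(1) by (auto simp: K_def)
  have up: "Cb UNIV r Q (K * b) g" if "Cb UNIV r Q (k * b) g" "k \<le> K" "0 \<le> Q" "Cb UNIV r Q b f"
    for k Q b and f g :: "real \<Rightarrow> real"
    using that Cb_nonneg[OF that(4)] by (intro Cb_le[OF that(1)] mult_right_mono)
  show ?thesis
    unfolding calc_const_def
  proof (intro exI[of _ K] conjI allI impI)
    show "1 \<le> K" by fact
    fix f :: "real \<Rightarrow> real" and Q b :: real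
    assume Q: "0 \<le> Q"
    show "Cb UNIV r Q (K * b) (\<lambda>x. inverse (1 + f x) - 1)" "Cb UNIV r Q (K * b) (\<lambda>x. sqrt (1 + f x) - 1)"
      if "b \<le> 1/2" "Cb UNIV r Q b f"
      using up[OF K1(2)[rule_format, OF open_UNIV Q that] le(1) Q that(2)]
        up[OF K2(2)[rule_format, OF open_UNIV Q that] le(2) Q that(2)] by auto
    show "Cb UNIV r Q (K * b) (\<lambda>x. sin (f x))" "Cb UNIV r Q (K * b) (\<lambda>x. cos (f x) - 1)"
      if "b \<le> 1" "Cb UNIV r Q b f"
      using up[OF conjunct1[OF K3(2)[rule_format, OF open_UNIV Q that]] le(3) Q that(2)]
        up[OF conjunct2[OF K3(2)[rule_format, OF open_UNIV Q that]] le(3) Q that(2)] by auto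
    assume "smooth_on UNIV f" "\<forall>m x. 1 \<le> m \<longrightarrow> m \<le> r \<longrightarrow> \<bar>nth_deriv m f x\<bar> \<le> Q ^ m"
    then have "Cb UNIV r Q K4 (\<lambda>x. sin (f x)) \<and> Cb UNIV r Q K4 (\<lambda>x. cos (f x))"
      using K4(2) Q by simp
    then show "Cb UNIV r Q K (\<lambda>x. sin (f x))" "Cb UNIV r Q K (\<lambda>x. cos (f x))"
      using Cb_le le(4) Q by blast+
  qed
qed

lemma cayley_mult_diff:
  assumes "qre u = 0" "V = inverse (1 + (norm u)\<^sup>2) *\<^sub>R (1 + u)"
  shows "(1 - u) * V = 1" "V * (1 - u) = 1" "qcnj V = inverse (1 + (norm u)\<^sup>2) *\<^sub>R (1 - u)"
    "norm (V * (1 + u)) = 1" "V * (1 + u) = 2 *\<^sub>R V - 1"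
proof -
  have cu: "qcnj u = - u" using assms(1) qimag_def qimag_iff by blast
  have n0: "1 + (norm u)\<^sup>2 \<noteq> 0" "1 + (norm u)\<^sup>2 > 0" by (metis add_pos_nonneg less_irrefl zero_less_one zero_le_power2)+
  have uu: "u * u = - of_real ((norm u)\<^sup>2)"
    using quat_mult_cnj(1)[of u] unfolding cu by (metis minus_minus mult_minus_right)
  have "(1 - u) * (1 + u) = of_real (1 + (norm u)\<^sup>2)"
    by (simp add: distrib_left left_diff_distrib uu)
  moreover have "(1 + u) * (1 - u) = of_real (1 + (norm u)\<^sup>2)"
    by (simp add: distrib_right right_diff_distrib uu)
  ultimately show 1: "(1 - u) * V = 1" "V * (1 - u) = 1"
    using n0 by (simp_all add: assms(2) of_real_def)
  show "qcnj V = inverse (1 + (norm u)\<^sup>2) *\<^sub>R (1 - u)"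
    by (simp add: assms(2) qcnj_scaleR qcnj_add cu)
  have "1 + u = 2 *\<^sub>R 1 - (1 - u)" by (simp add: quat_eq_iff)
  then have "V * (1 + u) = V * (2 *\<^sub>R 1 - (1 - u))" by (rule arg_cong)
  also have "\<dots> = 2 *\<^sub>R V - 1" by (subst right_diff_distrib, subst 1(2)) simp
  finally show "V * (1 + u) = 2 *\<^sub>R V - 1" .
  have "(norm (1 + u))\<^sup>2 = 1 + (norm u)\<^sup>2"
    using assms(1) by (simp add: norm_quat_eq real_sqrt_pow2)
  moreover have "norm V = inverse (1 + (norm u)\<^sup>2) * norm (1 + u)" using n0 by (simp add: assms(2))
  ultimately have "norm V * norm (1 + u) = inverse (1 + (norm u)\<^sup>2) * (1 + (norm u)\<^sup>2)"
    by (metis mult.assoc power2_eq_square)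
  then have "norm V * norm (1 + u) = 1" using n0 by simp
  then show "norm (V * (1 + u)) = 1" by (simp only: norm_quat_mult)
qed

lemma norm_sq_imag: "qre u = 0 \<Longrightarrow> (norm u)\<^sup>2 = - qre (u * u)"
proof -
  assume "qre u = 0"
  moreover have "(norm u)\<^sup>2 = qre (u * qcnj u)" by (simp only: quat_mult_cnj) (simp add: of_real_def)
  ultimately show ?thesis by simp
qed

section \<open>Gauge transformations of the perturbed generator\<close>

context qframe
begin

text \<open>Because T W (y) = J^-1 W (y + \<alpha>) J, one has W (y + \<alpha>) (J G (y)) W (y)^-1 =
  J (gc W G) (y) for unit \<open>W\<close>: this is the change of coordinates \<open>W\<close>
  applied to the cocycle J G. The twist of \<open>W\<close> means that the generator over the unit
  shift remains the constant \<open>I\<close>.\<close>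

definition gc :: "(real \<Rightarrow> quat) \<Rightarrow> (real \<Rightarrow> quat) \<Rightarrow> real \<Rightarrow> quat" where
  "gc W G y = T W y * G y * qcnj (W y)"

lemma gc_gc: "gc W' (gc W G) = gc (\<lambda>y. W' y * W y) G"
  by (simp add: gc_def fun_eq_iff T_mult qcnj_mult mult.assoc)

lemma gc_one: "gc (\<lambda>y. 1) G = G"
  by (simp add: gc_def fun_eq_iff T_one)

lemma tw_gc: "tw W \<Longrightarrow> tw G \<Longrightarrow> tw (gc W G)"
  unfolding gc_def[abs_def] by (intro tw_mult tw_qcnj tw_T)

lemma norm_gc: "(\<And>y. norm (W y) = 1) \<Longrightarrow> norm (gc W G y) = norm (G y)"
  by (simp add: gc_def norm_quat_mult norm_T)

definition gauge :: "(real \<Rightarrow> quat) \<Rightarrow> bool" where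
  "gauge W \<longleftrightarrow> tw W \<and> smooth_on UNIV W \<and> (\<forall>y. norm (W y) = 1)"

lemma gauge_mult: "gauge W \<Longrightarrow> gauge W' \<Longrightarrow> gauge (\<lambda>y. W y * W' y)"
  by (simp add: gauge_def tw_mult smooth_on_mult norm_quat_mult)

lemma gauge_one: "gauge (\<lambda>y. 1)"
  by (simp add: gauge_def tw_one smooth_on_const)

lemma gauge_gc: "gauge W \<Longrightarrow> gauge G \<Longrightarrow> gauge (gc W G)"
  unfolding gauge_def by (auto simp: norm_gc intro!: tw_gc)
    (auto simp: gc_def[abs_def] intro!: smooth_on_mult smooth_on_qcnj smooth_T)

text \<open>The gauge transformation is the Cayley transform \<open>(1 + w/2) (1 - w/2)\<^sup>-\<^sup>1\<close>.\<close>

lemma cayley_step: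
  fixes r :: nat and K \<omega> v \<delta> Q :: real
  defines "P \<equiv> 2 ^ r"
  assumes K: "calc_const r K" and w: "tw w" "\<And>y. qre (w y) = 0" and Cw: "Cb UNIV r Q \<omega> w" and \<omega>: "\<omega> * P \<le> 1"
    and Q: "0 \<le> Q" and CG: "Cb UNIV r Q v (\<lambda>y. G y - 1)" and Cd: "Cb UNIV r Q \<delta> (\<lambda>y. T w y - w y)"
  obtains W where "gauge W" "Cb UNIV r Q (12 * P ^ 4 * K\<^sup>2 * \<omega> * (v + \<delta>)) (\<lambda>y. gc W G y - G y - (T w y - w y))"
proof -
  have P: "P \<ge> 1" by (simp add: P_def)
  have K1: "K \<ge> 1" by (rule calc_const_ge1[OF K])
  have \<omega>0: "0 \<le> \<omega>" and v0: "0 \<le> v" and \<delta>0: "0 \<le> \<delta>" using Cb_nonneg Cw CG Cd by blast+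
  have \<omega>1: "\<omega> \<le> 1" using \<omega> P \<omega>0 by (metis mult_left_mono mult.right_neutral order_trans)
  define u where "u = (\<lambda>y. (1/2) *\<^sub>R w y)"
  define n where "n = (\<lambda>y. (norm (u y))\<^sup>2)"
  define V where "V = (\<lambda>y. inverse (1 + n y) *\<^sub>R (1 + u y))"
  define W where "W = (\<lambda>y. V y * (1 + u y))"
  define d where "d = (\<lambda>y. T w y - w y)"
  define X where "X = (\<lambda>y. G y - 1)"
  have u0: "qre (u y) = 0" for y by (simp add: u_def w)
  have tu0: "qre (T u y) = 0" for y
    using u0[of "y + \<alpha>"] unfolding T_def by (metis J_unit(1) mult.assoc mult.right_neutral qre_mult_commute unit_mult_cnj(1))
  have n_eq: "n = (\<lambda>y. - qre (u y * u y))" by (simp add: n_def norm_sq_imag u0 fun_eq_iff)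
  have Tn: "(norm (T u y))\<^sup>2 = n (y + \<alpha>)" for y by (simp add: n_def norm_T)
  have TV: "T V y = inverse (1 + (norm (T u y))\<^sup>2) *\<^sub>R (1 + T u y)" for y
  proof -
    have "T V y = inverse (1 + n (y + \<alpha>)) *\<^sub>R (qcnj J * (1 + u (y + \<alpha>)) * J)" by (simp add: T_def V_def)
    also have "qcnj J * (1 + u (y + \<alpha>)) * J = 1 + T u y" using J_unit(1) by (simp add: T_def distrib_left distrib_right)
    finally show ?thesis unfolding Tn .
  qed
  note cV = cayley_mult_diff[OF u0 V_def[unfolded n_def, THEN fun_cong]]
  note cTV = cayley_mult_diff[OF tu0 TV]
  have TW: "T W y = 2 *\<^sub>R T V y - 1" for y
    unfolding W_def T_mult T_add T_one using cTV(5) by simp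
  have Weq: "W y = 2 *\<^sub>R V y - 1" for y unfolding W_def using cV(5) .
  have qcW: "qcnj (W y) = (1 - u y) * qcnj (V y)" for y
    using u0[of y] by (simp add: W_def qcnj_mult qcnj_add qimag_def[symmetric] qimag_iff)
  have dT: "d y = 2 *\<^sub>R (T u y - u y)" for y unfolding d_def u_def T_scaleR by (simp add: scaleR_diff_right)
  \<comment> \<open>The resolvent identity for V = (1 - u)^-1 and T V = (1 - T u)^-1.\<close>
  have "T V y - V y = T V y * (T u y - u y) * V y" for y
  proof -
    have "T V y * ((1 - u y) - (1 - T u y)) * V y = T V y * ((1 - u y) * V y) - (T V y * (1 - T u y)) * V y"
      by (simp add: algebra_simps)
    then show ?thesis unfolding cV(1) cTV(2) by simp
  qed
  note TVV = this
  have TWW: "T W y - W y = T V y * d y * V y" for y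
  proof -
    have "T W y - W y = 2 *\<^sub>R (T V y - V y)" unfolding TW Weq by (simp add: scaleR_diff_right)
    then show ?thesis unfolding TVV dT by (simp only: mult_scaleR_left mult_scaleR_right)
  qed
  have VW: "V y * qcnj (W y) = qcnj (V y)" for y
    unfolding qcW using cV(2)[of y] by (simp add: mult.assoc[symmetric])
  have W1: "norm (W y) = 1" for y unfolding W_def using cV(4) .
  have TWW1: "T W y * qcnj (W y) = 1 + T V y * d y * qcnj (V y)" for y
  proof -
    have "T W y * qcnj (W y) = W y * qcnj (W y) + (T W y - W y) * qcnj (W y)" by (simp add: algebra_simps)
    then show ?thesis unfolding TWW using W1[of y] VW[of y] by (simp add: mult.assoc)
  qed
  \<comment> \<open>The linear term \<open>T w - w\<close> is split off. Every remaining summand has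
    a factor of size \<omega>, the distance of \<open>V\<close>, \<open>W\<close> or one of their
    images from 1, multiplied by \<open>d\<close> or by \<open>G - 1\<close>; this yields the error
    of order \<omega> (v + \<delta>).\<close>
  have main: "gc W G y - G y - (T w y - w y)
     = ((T V y - 1) * d y * qcnj (V y) + d y * (qcnj (V y) - 1)) + ((T W y - 1) * X y * qcnj (W y) + X y * (qcnj (W y) - 1))" for y
  proof -
    have "gc W G y = T W y * qcnj (W y) + T W y * X y * qcnj (W y)"
      by (simp add: gc_def X_def algebra_simps)
    then show ?thesis unfolding TWW1 X_def d_def by (simp add: algebra_simps)
  qed
  have Cu: "Cb UNIV r Q (\<omega> / 2) u" unfolding u_def using Cb_cmult[OF _ Cw, of "1/2"] by simp
  have "Cb UNIV r Q (P * (\<omega>/2) * (\<omega>/2)) n" unfolding n_eq P_def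
    by (intro Cb_minus Cb_qre Cb_mult Cu) auto
  moreover have "P * (\<omega>/2) * (\<omega>/2) \<le> \<omega> / 4" using \<omega> \<omega>0 mult_right_mono[OF \<omega>, of \<omega>] by (simp add: algebra_simps)
  ultimately have Cn: "Cb UNIV r Q (\<omega> / 4) n" using Cb_le Q by blast
  have Ci: "Cb UNIV r Q (K * (\<omega> / 4)) (\<lambda>y. inverse (1 + n y) - 1)"
    by (rule calc_inverse[OF K Q _ Cn]) (use \<omega>1 in simp)
  have C1u: "Cb UNIV r Q (1 + \<omega>/2) (\<lambda>y. 1 + u y)" by (intro Cb_add Cu Cb_const) (use Q in auto)
  define c where "c = 2 * P * K"
  have c1: "1 \<le> P * K" "P \<le> P * K" "K \<le> P * K" using P K1 mult_mono[OF P K1] by auto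
  have "Cb UNIV r Q (P * (K * (\<omega> / 4)) * (1 + \<omega>/2) + \<omega>/2) (\<lambda>y. (inverse (1 + n y) - 1) *\<^sub>R (1 + u y) + u y)"
    unfolding P_def by (intro Cb_add Cb_scaleR Ci C1u Cu) auto
  moreover have "(\<lambda>y. (inverse (1 + n y) - 1) *\<^sub>R (1 + u y) + u y) = (\<lambda>y. V y - 1)"
    by (simp add: V_def fun_eq_iff algebra_simps)
  moreover have "P * (K * (\<omega> / 4)) * (1 + \<omega>/2) + \<omega>/2 \<le> P * K * \<omega>"
  proof -
    have "P * (K * (\<omega> / 4)) * (1 + \<omega>/2) \<le> P * (K * (\<omega> / 4)) * 2"
      using \<omega>0 \<omega>1 P K1 by (intro mult_left_mono) auto
    moreover have "P * (K * (\<omega> / 4)) * 2 = P * K * \<omega> / 2" by simp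
    moreover have "\<omega> \<le> P * K * \<omega>" using mult_right_mono[OF c1(1) \<omega>0] by simp
    ultimately show ?thesis by linarith
  qed
  ultimately have CV1: "Cb UNIV r Q (P * K * \<omega>) (\<lambda>y. V y - 1)" using Cb_le Q by metis
  have PKw: "P * K * \<omega> \<le> K" using mult_left_mono[OF \<omega>, of K] K1 by (simp add: algebra_simps)
  have CV: "Cb UNIV r Q c V"
  proof -
    have "Cb UNIV r Q (1 + P * K * \<omega>) (\<lambda>y. 1 + (V y - 1))" by (intro Cb_add CV1 Cb_const) (use Q in auto)
    then have "Cb UNIV r Q (1 + P * K * \<omega>) V" by simp
    moreover have "1 + P * K * \<omega> \<le> c" using PKw c1 K1 unfolding c_def by linarith
    ultimately show ?thesis using Cb_le Q by blast
  qed
  have CW1: "Cb UNIV r Q (c * \<omega>) (\<lambda>y. W y - 1)"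
  proof -
    have "Cb UNIV r Q (\<bar>2\<bar> * (P * K * \<omega>)) (\<lambda>y. 2 *\<^sub>R (V y - 1))" by (rule Cb_cmult[OF _ CV1]) simp
    moreover have "(\<lambda>y. 2 *\<^sub>R (V y - 1)) = (\<lambda>y. W y - 1)" by (simp add: Weq fun_eq_iff algebra_simps scaleR_2)
    ultimately show ?thesis by (simp add: c_def mult.assoc)
  qed
  have CW: "Cb UNIV r Q (2 * c) W"
  proof -
    have "Cb UNIV r Q (1 + c * \<omega>) (\<lambda>y. 1 + (W y - 1))" by (intro Cb_add CW1 Cb_const) (use Q in auto)
    then have "Cb UNIV r Q (1 + c * \<omega>) W" by simp
    moreover have "1 + c * \<omega> \<le> 2 * c"
    proof -
      have "c * \<omega> = 2 * (P * K * \<omega>)" "c = 2 * (P * K)" by (simp_all add: c_def)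
      then show ?thesis using PKw c1 K1 by linarith
    qed
    ultimately show ?thesis using Cb_le Q by blast
  qed
  have CV1c: "Cb UNIV r Q (c * \<omega>) (\<lambda>y. V y - 1)"
    by (rule Cb_le[OF CV1]) (use \<omega>0 P K1 Q in \<open>auto simp: c_def\<close>)
  have CTV1: "Cb UNIV r Q (c * \<omega>) (\<lambda>y. T V y - 1)"
    using Cb_T[OF CV1c] unfolding T_diff[abs_def] T_one .
  have CTW1: "Cb UNIV r Q (c * \<omega>) (\<lambda>y. T W y - 1)"
    using Cb_T[OF CW1] unfolding T_diff[abs_def] T_one .
  have Cq1: "Cb UNIV r Q (c * \<omega>) (\<lambda>y. qcnj (V y) - 1)" "Cb UNIV r Q (c * \<omega>) (\<lambda>y. qcnj (W y) - 1)"
    using Cb_qcnj[OF _ CV1c] Cb_qcnj[OF _ CW1] by (simp_all add: qcnj_diff)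
  have "Cb UNIV r Q ((P * (P * (c * \<omega>) * \<delta>) * c + P * \<delta> * (c * \<omega>)) + (P * (P * (c * \<omega>) * v) * (2 * c) + P * v * (c * \<omega>)))
     (\<lambda>y. gc W G y - G y - (T w y - w y))"
    unfolding main P_def
    by (intro Cb_add Cb_mult Cb_qcnj CTV1 CTW1 Cq1 CV CW) (use Cd CG in \<open>auto simp: d_def X_def\<close>)
  then have "Cb UNIV r Q (12 * P ^ 4 * K\<^sup>2 * \<omega> * (v + \<delta>)) (\<lambda>y. gc W G y - G y - (T w y - w y))"
  proof (rule Cb_le)
    have c2: "1 \<le> c" using c1 by (simp add: c_def)
    have Pc: "P * c \<le> (P * c) * (P * c)"
    proof -
      have "1 \<le> P * c" using mult_mono[OF P c2] P by simp
      from mult_left_mono[OF this, of "P * c"] this show ?thesis by simp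
    qed
    have e: "P * \<delta> * (c * \<omega>) \<le> (P * c)\<^sup>2 * \<omega> * \<delta>" "P * v * (c * \<omega>) \<le> (P * c)\<^sup>2 * \<omega> * v"
      using mult_right_mono[OF Pc, of "\<omega> * \<delta>"] mult_right_mono[OF Pc, of "\<omega> * v"] \<omega>0 \<delta>0 v0
      by (simp_all add: power2_eq_square algebra_simps)
    have f: "P * (P * (c * \<omega>) * \<delta>) * c = (P * c)\<^sup>2 * \<omega> * \<delta>" "P * (P * (c * \<omega>) * v) * (2 * c) = 2 * ((P * c)\<^sup>2 * \<omega> * v)"
      by (simp_all add: power2_eq_square algebra_simps)
    have g: "12 * P ^ 4 * K\<^sup>2 * \<omega> * (v + \<delta>) = 3 * ((P * c)\<^sup>2 * \<omega> * v) + 3 * ((P * c)\<^sup>2 * \<omega> * \<delta>)"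
      by (simp add: c_def power2_eq_square power4_eq_xxxx algebra_simps)
    have h: "0 \<le> (P * c)\<^sup>2 * \<omega> * \<delta>" using \<omega>0 \<delta>0 by simp
    show "P * (P * (c * \<omega>) * \<delta>) * c + P * \<delta> * (c * \<omega>) + (P * (P * (c * \<omega>) * v) * (2 * c) + P * v * (c * \<omega>))
      \<le> 12 * P ^ 4 * K\<^sup>2 * \<omega> * (v + \<delta>)"
      unfolding f g using e h by linarith
  qed (rule Q)
  moreover have "gauge W"
    unfolding gauge_def
  proof (intro conjI allI)
    show "smooth_on UNIV W" by (rule Cb_smooth[OF CW])
    show "norm (W y) = 1" for y by (rule W1)
    have u: "u (y + 1) = I * u y * qcnj I" for y using w(1) by (simp add: tw_def u_def)
    have n: "n (y + 1) = n y" for y by (simp add: n_def u norm_quat_mult I_unit)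
    have u1: "1 + u (y + 1) = I * (1 + u y) * qcnj I" for y
      using I_unit(1) by (simp add: u distrib_left distrib_right)
    have "tw V" unfolding tw_def V_def u1 n by simp
    moreover have "tw (\<lambda>y. 1 + u y)" unfolding tw_def u1 by simp
    ultimately show "tw W" unfolding W_def by (rule tw_mult)
  qed
  ultimately show thesis using that by blast
qed

text \<open>For \<open>e * e = -1\<close> this is the projection onto the quaternions anticommuting
  with \<open>e\<close>, which are those with e x e = x. Its kernel is spanned by 1 and
  \<open>e\<close>.\<close>

definition anti :: "quat \<Rightarrow> quat \<Rightarrow> quat" where
  "anti e x = (1/2) *\<^sub>R (x + e * x * e)"

lemma anti_add: "anti e (x + y) = anti e x + anti e y" and anti_diff: "anti e (x - y) = anti e x - anti e y"
  by (simp_all add: anti_def algebra_simps)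

lemma anti_one: "e * e = -1 \<Longrightarrow> anti e 1 = 0"
  by (simp add: anti_def)

lemma anti_fixed: "e * x * e = x \<Longrightarrow> anti e x = x"
  by (simp add: anti_def)

lemma anti_idem:
  assumes "e * e = -1"
  shows "e * anti e x * e = anti e x"
proof -
  have "e * (e * x * e) * e = (e * e) * x * (e * e)" by (simp only: mult.assoc)
  also have "\<dots> = x" by (simp add: assms)
  finally have 1: "e * (e * x * e) * e = x" .
  have "e * anti e x * e = (1/2) *\<^sub>R (e * x * e + e * (e * x * e) * e)"
    by (simp only: anti_def mult_scaleR_left mult_scaleR_right distrib_left distrib_right)
  then show ?thesis unfolding 1 by (simp only: anti_def add.commute)
qed

lemma tw_anti: "adm e \<Longrightarrow> tw f \<Longrightarrow> tw (\<lambda>y. anti e (f y))"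
  using adm_commute(1)[of e] by (simp add: anti_def tw_def algebra_simps)

lemma Cb_anti:
  assumes "e * e = -1" "Cb UNIV r Q b f"
  shows "Cb UNIV r Q b (\<lambda>y. anti e (f y))"
proof -
  have "Cb UNIV r Q (\<bar>1/2\<bar> * (b + b)) (\<lambda>y. anti e (f y))"
    unfolding anti_def by (intro Cb_cmult Cb_add Cb_conj imag_unit(1)[OF assms(1)] assms) auto
  then show ?thesis by simp
qed

end

context qframe
begin

text \<open>The averaged part accumulates in \<open>a\<close>; the remaining error \<open>b\<close> halves at every step.\<close>

lemma reduce_anticommuting_step:
  fixes r :: nat and K Q Q' X L :: real and p :: int and q n :: nat
  defines "P \<equiv> 2 ^ r"
  assumes K: "calc_const r K" and r: "1 \<le> r" and adm: "adm (cls p q)" and Q: "0 < Q" "Q \<le> Q'"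
    and \<sigma>: "\<bar>real q * \<alpha> - real_of_int p\<bar> \<le> 1 / Q'" and q: "real q \<le> L * Q"
    and small: "96 * P ^ 4 * K\<^sup>2 * L * real r * (Q * X) \<le> 1"
    and G: "gauge G" and CG: "Cb UNIV r Q X (\<lambda>y. G y - 1)"
  shows "\<exists>W a b. gauge W \<and> Cb UNIV r Q ((6 - 5 / 2 ^ n) * X) (\<lambda>y. gc W G y - 1) \<and>
     (\<forall>y. anti (cls p q) (gc W G y) = a y + b y) \<and> tw b \<and> (\<forall>y. cls p q * b y * cls p q = b y) \<and>
     Cb UNIV r Q (X / 2 ^ n) b \<and> Cb UNIV r Q' ((2 - 2 / 2 ^ n) * (X * (Q / Q') ^ r)) a"
proof (induction n)
  have e: "cls p q * cls p q = -1" using adm by (simp add: adm_def)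
  have X0: "0 \<le> X" using Cb_nonneg[OF CG] .
  {
    case 0
    have "anti (cls p q) (G y) = anti (cls p q) (G y - 1)" for y by (simp add: anti_diff anti_one[OF e])
    then have "Cb UNIV r Q X (\<lambda>y. anti (cls p q) (G y))" using Cb_anti[OF e CG] by simp
    then show ?case
      using CG G gauge_one Q tw_anti[OF adm, of G]
      by (intro exI[of _ "\<lambda>y. 1"] exI[of _ "\<lambda>y. 0"] exI[of _ "\<lambda>y. anti (cls p q) (G y)"])
         (auto simp: gc_one gauge_def anti_idem[OF e] intro!: Cb_const)
  next
    case (Suc n)
    then obtain W a b where W: "gauge W" and CW: "Cb UNIV r Q ((6 - 5 / 2 ^ n) * X) (\<lambda>y. gc W G y - 1)"
      and ab: "\<forall>y. anti (cls p q) (gc W G y) = a y + b y" and b: "tw b" and b2: "\<forall>y. cls p q * b y * cls p q = b y"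
      and Cbb: "Cb UNIV r Q (X / 2 ^ n) b" and Ca: "Cb UNIV r Q' ((2 - 2 / 2 ^ n) * (X * (Q / Q') ^ r)) a"
      by (elim exE conjE) (rule that; assumption)
    note b = b b2[rule_format]
    define H where "H = gc W G"
    define \<beta> where "\<beta> = X / 2 ^ n"
    have \<beta>: "0 \<le> \<beta>" "\<beta> \<le> X" using X0 mult_left_mono[of 1 "2 ^ n" X] by (auto simp: \<beta>_def divide_le_eq)
    obtain w b' where w: "tw w" "tw b'" and wb': "\<forall>y. T w y - w y = b' y - b y"
      and Cw: "Cb UNIV r Q (real q * real r * \<beta> / 2) w" and Cb': "Cb UNIV r Q \<beta> b'" "Cb UNIV r Q' (\<beta> * (Q / Q') ^ r) b'"
      and wg: "\<forall>g s. adm g \<longrightarrow> (\<forall>y. g * b y * g = s *\<^sub>R b y) \<longrightarrow> (\<forall>y. g * w y * g = s *\<^sub>R w y \<and> g * b' y * g = s *\<^sub>R b' y)"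
      by (rule averaging[OF adm b Cbb[folded \<beta>_def] Q \<sigma>])
    note wb = wb'[rule_format]
    have wg1: "cls p q * w y * cls p q = w y" "cls p q * b' y * cls p q = b' y" for y
      using wg[rule_format, OF adm, of 1 y] b(2) by simp_all
    \<comment> \<open>By cyclicity of the real part, e w e has the real part of w e e = - w.\<close>
    have w0: "qre (w y) = 0" for y
    proof -
      have "qre (w y) = qre (cls p q * (w y * cls p q))" using wg1(1)[of y] by (simp only: mult.assoc)
      also have "\<dots> = qre (w y * (cls p q * cls p q))" by (subst qre_mult_commute) (simp only: mult.assoc)
      finally show ?thesis unfolding e by simp
    qed
    have Cd: "Cb UNIV r Q (2 * \<beta>) (\<lambda>y. T w y - w y)"
      unfolding wb using Cb_diff[OF _ Cb'(1) Cbb[folded \<beta>_def]] by simp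
    have K1: "1 \<le> K" and P1: "1 \<le> P" using calc_const_ge1[OF K] by (auto simp: P_def)
    define E where "E = 12 * P ^ 4 * K\<^sup>2"
    have E1: "P \<le> E" "0 \<le> E"
    proof -
      have "P * 1 \<le> P * (12 * P ^ 3 * K\<^sup>2)"
        using P1 K1 one_le_power[of P 3] one_le_power[of K 2] mult_mono[of 1 "P ^ 3" 1 "K\<^sup>2"]
        by (intro mult_left_mono) auto
      also have "\<dots> = E" by (simp add: E_def power4_eq_xxxx power3_eq_cube)
      finally show "P \<le> E" by simp
      then show "0 \<le> E" using P1 by simp
    qed
    have L0: "0 \<le> L" using q Q by (metis linorder_not_less mult_neg_pos of_nat_0_le_iff order_le_less_trans)
    have \<omega>_le: "real q * real r * \<beta> / 2 \<le> L * real r * (Q * \<beta>) / 2"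
      using mult_right_mono[OF q, of "real r * \<beta> / 2"] \<beta> by (simp add: algebra_simps)
    \<comment> \<open>The number 96 in the hypothesis is 12 * 8: the constant of the Cayley error
      times the bound 8 X for its last factor.\<close>
    have small': "E * (L * real r * (Q * X)) * 8 \<le> 1" using small by (simp add: E_def mult_ac)
    have LX: "L * real r * (Q * \<beta>) \<le> L * real r * (Q * X)"
      using \<beta> L0 Q by (intro mult_left_mono) auto
    have LX0: "0 \<le> L * real r * (Q * \<beta>)" using \<beta> L0 Q by simp
    have "real q * real r * \<beta> / 2 * P \<le> (L * real r * (Q * X)) / 2 * E"
      using \<omega>_le LX E1 P1 LX0 by (intro mult_mono) auto
    also have "\<dots> = (E * (L * real r * (Q * X)) * 8) / 16" by simp
    also have "\<dots> \<le> 1" using small' by linarith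
    finally have \<omega>P: "real q * real r * \<beta> / 2 * 2 ^ r \<le> 1" unfolding P_def .
    obtain V where V: "gauge V" and CV: "Cb UNIV r Q (12 * (2 ^ r) ^ 4 * K\<^sup>2 * (real q * real r * \<beta> / 2) * ((6 - 5 / 2 ^ n) * X + 2 * \<beta>))
        (\<lambda>y. gc V H y - H y - (T w y - w y))"
      by (rule cayley_step[OF K w(1) w0 Cw \<omega>P less_imp_le[OF Q(1)] CW[folded H_def] Cd])
    define Err where "Err = (\<lambda>y. gc V H y - H y - (T w y - w y))"
    have CErr: "Cb UNIV r Q (\<beta> / 2) Err"
      unfolding Err_def
    proof (rule Cb_le[OF CV])
      have "(6 - 5 / 2 ^ n) * X \<le> 6 * X" using X0 by (intro mult_right_mono) auto
      then have "(6 - 5 / 2 ^ n) * X + 2 * \<beta> \<le> 8 * X" using \<beta> by linarith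
      moreover have "E * (real q * real r * \<beta> / 2) \<le> E * (L * real r * (Q * \<beta>) / 2)"
        using \<omega>_le E1 by (intro mult_left_mono) auto
      moreover have "0 \<le> (6 - 5 / 2 ^ n) * X + 2 * \<beta>"
      proof -
        have "5 / 2 ^ n \<le> (6::real)" by (simp add: divide_le_eq) (use one_le_power[of "2::real" n] in linarith)
        then show ?thesis using X0 \<beta> by simp
      qed
      ultimately have "E * (real q * real r * \<beta> / 2) * ((6 - 5 / 2 ^ n) * X + 2 * \<beta>) \<le> E * (L * real r * (Q * \<beta>) / 2) * (8 * X)"
        by - (rule mult_mono, assumption+, use E1 LX0 in auto)
      also have "\<dots> = (E * (L * real r * (Q * X)) * 8) * (\<beta> / 2)" by simp
      also have "\<dots> \<le> 1 * (\<beta> / 2)" using small' \<beta> by (intro mult_right_mono) auto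
      finally show "12 * (2 ^ r) ^ 4 * K\<^sup>2 * (real q * real r * \<beta> / 2) * ((6 - 5 / 2 ^ n) * X + 2 * \<beta>) \<le> \<beta> / 2"
        by (simp add: E_def P_def)
    qed (use Q in simp)
    have twErr: "tw Err" unfolding Err_def
      using V W G w by (intro tw_diff tw_T tw_gc) (auto simp: gauge_def H_def intro!: tw_gc)
    have gcV: "gc V H y = H y + (b' y - b y) + Err y" for y by (simp add: Err_def wb)
    have half: "\<beta> / 2 = X / 2 ^ Suc n" by (simp add: \<beta>_def)
    show ?case
    proof (intro exI conjI allI)
      show "gauge (\<lambda>y. V y * W y)" by (rule gauge_mult[OF V W])
      have HV: "gc (\<lambda>y. V y * W y) G = gc V H" by (simp add: H_def gc_gc)
      show "Cb UNIV r Q ((6 - 5 / 2 ^ Suc n) * X) (\<lambda>y. gc (\<lambda>y. V y * W y) G y - 1)"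
      proof -
        have "Cb UNIV r Q ((6 - 5 / 2 ^ n) * X + 2 * \<beta> + \<beta> / 2) (\<lambda>y. (H y - 1) + (b' y - b y) + Err y)"
          by (intro Cb_add CErr CW[folded H_def] Cd[unfolded wb]) auto
        \<comment> \<open>One step adds 2 \<beta> + \<beta>/2 = 5 X / 2^(n+1); starting from X, the
          sizes never exceed 6 X.\<close>
        moreover have "(6 - 5 / 2 ^ n) * X + 2 * \<beta> + \<beta> / 2 = (6 - 5 / 2 ^ Suc n) * X"
          by (simp add: \<beta>_def field_simps)
        ultimately show ?thesis unfolding HV gcV by (simp add: algebra_simps)
      qed
      show "anti (cls p q) (gc (\<lambda>y. V y * W y) G y) = (a y + b' y) + anti (cls p q) (Err y)" for y
        unfolding HV gcV anti_add anti_diff using ab[rule_format, of y] anti_fixed[OF b(2)] anti_fixed[OF wg1(2)] by (simp add: H_def)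
      show "tw (\<lambda>y. anti (cls p q) (Err y))" by (rule tw_anti[OF adm twErr])
      show "cls p q * anti (cls p q) (Err y) * cls p q = anti (cls p q) (Err y)" for y by (rule anti_idem[OF e])
      show "Cb UNIV r Q (X / 2 ^ Suc n) (\<lambda>y. anti (cls p q) (Err y))" by (rule Cb_anti[OF e CErr[unfolded half]])
      show "Cb UNIV r Q' ((2 - 2 / 2 ^ Suc n) * (X * (Q / Q') ^ r)) (\<lambda>y. a y + b' y)"
      proof -
        have "(2 - 2 / 2 ^ n) * (X * (Q / Q') ^ r) + \<beta> * (Q / Q') ^ r = (2 - 2 / 2 ^ Suc n) * (X * (Q / Q') ^ r)"
        proof -
          have "(2 - 2 / t) * u + u / t = (2 - 2 / (2 * t)) * u" if "t > 0" for t u :: real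
            using that by (simp add: field_simps)
          from this[of "2 ^ n" "X * (Q / Q') ^ r"] show ?thesis by (simp add: \<beta>_def)
        qed
        then show ?thesis using Cb_add[OF open_UNIV Ca Cb'(2)] by simp
      qed
    qed
  }
qed

text \<open>The preceding step is repeated until the halving error falls below X (Q/Q')^r; a bound
  at frequency Q then also holds at the larger frequency Q'. The number of repetitions depends on
  Q/Q', the resulting constants do not.\<close>

lemma reduce_anticommuting:
  fixes r :: nat and K Q Q' X L :: real and p :: int and q :: nat
  defines "P \<equiv> 2 ^ r"
  assumes K: "calc_const r K" and r: "1 \<le> r" and adm: "adm (cls p q)" and Q: "0 < Q" "Q \<le> Q'"
    and \<sigma>: "\<bar>real q * \<alpha> - real_of_int p\<bar> \<le> 1 / Q'" and q: "real q \<le> L * Q"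
    and small: "96 * P ^ 4 * K\<^sup>2 * L * real r * (Q * X) \<le> 1"
    and G: "gauge G" and CG: "Cb UNIV r Q X (\<lambda>y. G y - 1)"
  obtains W where "gauge W" "Cb UNIV r Q (6 * X) (\<lambda>y. gc W G y - 1)"
    "Cb UNIV r Q' (3 * (X * (Q / Q') ^ r)) (\<lambda>y. anti (cls p q) (gc W G y))"
proof -
  have X0: "0 \<le> X" using Cb_nonneg[OF CG] .
  have "0 < (Q / Q') ^ r" using Q by simp
  then obtain n where n: "(1/2) ^ n < (Q / Q') ^ r" using real_arch_pow_inv[of "(Q / Q') ^ r" "1/2"] by auto
  obtain W a b where W: "gauge W" and CW: "Cb UNIV r Q ((6 - 5 / 2 ^ n) * X) (\<lambda>y. gc W G y - 1)"
      and ab: "\<forall>y. anti (cls p q) (gc W G y) = a y + b y"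
      and Cbb: "Cb UNIV r Q (X / 2 ^ n) b" and Ca: "Cb UNIV r Q' ((2 - 2 / 2 ^ n) * (X * (Q / Q') ^ r)) a"
    using reduce_anticommuting_step[OF K r adm Q \<sigma> q small[unfolded P_def] G CG, of n]
    by (elim exE conjE) (rule that; assumption)
  show thesis
  proof (rule that[OF W])
    show "Cb UNIV r Q (6 * X) (\<lambda>y. gc W G y - 1)"
    proof (rule Cb_le[OF CW])
      show "(6 - 5 / 2 ^ n) * X \<le> 6 * X" using X0 by (intro mult_right_mono) auto
    qed (use Q in simp)
    have 1: "Cb UNIV r Q' (1 * (X * (Q / Q') ^ r)) b"
    proof (rule Cb_mono[OF Cbb])
      show "X / 2 ^ n \<le> 1 * (X * (Q / Q') ^ r)"
      proof -
        have "X / 2 ^ n = X * (1 / 2) ^ n" by (simp add: power_divide)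
        also have "\<dots> \<le> X * (Q / Q') ^ r" by (rule mult_left_mono[OF less_imp_le[OF n] X0])
        finally show ?thesis by simp
      qed
    qed (use Q X0 in auto)
    have 2: "Cb UNIV r Q' (2 * (X * (Q / Q') ^ r)) a"
    proof (rule Cb_le[OF Ca])
      show "(2 - 2 / 2 ^ n) * (X * (Q / Q') ^ r) \<le> 2 * (X * (Q / Q') ^ r)"
        using X0 Q by (intro mult_right_mono) auto
    qed (use Q in simp)
    show "Cb UNIV r Q' (3 * (X * (Q / Q') ^ r)) (\<lambda>y. anti (cls p q) (gc W G y))"
      using Cb_add[OF open_UNIV 2 1] ab by simp
  qed
qed

end

subsection \<open>The iteration scheme\<close>

lemma quat_decomp:
  assumes "e * e = (-1::quat)"
  shows "x = of_real (qre x) + (- qre (x * e)) *\<^sub>R e + (1/2) *\<^sub>R (x + e * x * e)"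
proof -
  obtain a b c where e: "e = Quat 0 a b c" using imag_unit(3)[OF assms] by (metis quat.collapse)
  have n: "a * a + b * b + c * c = 1" using assms by (simp add: e quat_eq_iff)
  show ?thesis
    unfolding quat_eq_iff e
    apply (simp add: of_real_def)
    using n by (intro conjI; algebra)
qed

definition qexp :: "quat \<Rightarrow> real \<Rightarrow> quat" where
  "qexp e t = of_real (cos t) + sin t *\<^sub>R e"

lemma qexp_add:
  assumes "e * e = -1" shows "qexp e s * qexp e t = qexp e (s + t)"
proof -
  have "qexp e s * qexp e t = of_real (cos s * cos t) + (sin s * sin t) *\<^sub>R (e * e) + (sin s * cos t + cos s * sin t) *\<^sub>R e"
    by (simp add: qexp_def of_real_def algebra_simps)
  then show ?thesis by (simp add: assms qexp_def cos_add sin_add of_real_def algebra_simps)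
qed

lemma qexp_cnj: "e * e = -1 \<Longrightarrow> qcnj (qexp e t) = qexp e (- t)"
  by (simp add: qexp_def qcnj_add qcnj_scaleR imag_unit(2) of_real_def)

lemma norm_qexp:
  assumes "e * e = -1" shows "norm (qexp e t) = 1"
proof -
  have "qexp e t * qcnj (qexp e t) = 1"
    unfolding qexp_cnj[OF assms] qexp_add[OF assms] by (simp add: qexp_def)
  then have "of_real ((norm (qexp e t))\<^sup>2) = (of_real 1 :: quat)" by (simp only: quat_mult_cnj(1)) simp
  then have "(norm (qexp e t))\<^sup>2 = 1" by (simp only: of_real_eq_iff)
  then show ?thesis using norm_ge_zero[of "qexp e t"] by (simp add: power2_eq_1_iff)
qed

lemma anti_class:
  assumes "e * e = (-1::quat)" "e * A * e = A"
  shows "qre A = 0" "qre (e * A) = 0" "qcnj A = - A"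
proof -
  have "qre A = qre (e * (A * e))" using assms(2) by (simp only: mult.assoc)
  also have "\<dots> = qre (A * (e * e))" by (subst qre_mult_commute) (simp only: mult.assoc)
  finally show 1: "qre A = 0" unfolding assms(1) by simp
  then show "qcnj A = - A" by (metis qimag_def qimag_iff)
  have "e * A = - (e * A * e * e)" by (simp add: mult.assoc assms(1))
  then have "qre (e * A) = - qre (A * e)" unfolding assms(2) by (metis quat_minus_simps(1))
  then show "qre (e * A) = 0" using qre_mult_commute[of A e] by linarith
qed

lemma norm_orth:
  assumes e: "e * e = (-1::quat)" and A: "e * A * e = A"
  shows "(norm (of_real s + f *\<^sub>R e + A))\<^sup>2 = s\<^sup>2 + f\<^sup>2 + (norm A)\<^sup>2"
proof -
  have 1: "qre A = 0" "qre (e * A) = 0" "qcnj A = - A" using anti_class[OF e A] .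
  have ec: "qcnj e = - e" by (rule imag_unit(2)[OF e])
  let ?x = "of_real s + f *\<^sub>R e + A"
  have "(norm ?x)\<^sup>2 = qre (?x * qcnj ?x)" by (simp only: quat_mult_cnj) (simp add: of_real_def)
  also have "?x * qcnj ?x = of_real (s\<^sup>2) - f\<^sup>2 *\<^sub>R (e * e) + A * qcnj A - f *\<^sub>R (e * A) - f *\<^sub>R (A * e)"
    by (simp add: qcnj_add qcnj_scaleR ec 1(3) of_real_def algebra_simps power2_eq_square)
  also have "qre \<dots> = s\<^sup>2 + f\<^sup>2 + qre (A * qcnj A)"
    using 1(2) qre_mult_commute[of A e] unfolding e by (simp add: of_real_def del: quat_mult_simps)
  also have "qre (A * qcnj A) = (norm A)\<^sup>2" by (simp only: quat_mult_cnj) (simp add: of_real_def)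
  finally show ?thesis .
qed

lemma Cb_qexp:
  assumes e: "e * e = -1" and s: "Cb UNIV r Q a (\<lambda>y. sin (f y))" and c: "Cb UNIV r Q b (\<lambda>y. cos (f y) - c)"
  shows "Cb UNIV r Q (a + b) (\<lambda>y. qexp e (f y) - of_real c)"
proof -
  have 1: "Cb UNIV r Q a (\<lambda>y. sin (f y) *\<^sub>R e)"
    using Cb_linear[of "\<lambda>x. x *\<^sub>R e" 1 UNIV r Q a "\<lambda>y. sin (f y)"] s bounded_linear_scaleR_left[of e]
    by (simp add: imag_unit(1)[OF e])
  have 2: "Cb UNIV r Q b (\<lambda>y. of_real (cos (f y) - c) :: quat)"
    using Cb_linear[of "of_real :: real \<Rightarrow> quat" 1 UNIV r Q b "\<lambda>y. cos (f y) - c"] c bounded_linear_of_real by simp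
  show ?thesis using Cb_add[OF open_UNIV 1 2] by (simp add: qexp_def algebra_simps)
qed

lemma Cb_coord:
  assumes "e * e = (-1::quat)" "Cb UNIV r Q b f"
  shows "Cb UNIV r Q b (\<lambda>y. - qre (f y * e))"
proof -
  have "Cb UNIV r Q b (\<lambda>y. f y * e)"
    using Cb_linear[OF bounded_linear_mult_left[of e], of 1 UNIV r Q b f] assms by (simp add: norm_quat_mult imag_unit)
  then show ?thesis by (intro Cb_minus Cb_qre) auto
qed

text \<open>In positive order one factor \<open>Q\<close> is available to absorb a large size
  \<open>b\<close>. Functions well above 1 thereby qualify as phases for the sine and cosine
  bounds.\<close>

lemma Cb_deriv_scale:
  assumes "Cb UNIV r Q b f" "1 \<le> m" "m \<le> r" "b * Q \<le> Q'" "0 \<le> Q" "Q \<le> Q'"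
  shows "norm (nth_deriv m f x) \<le> Q' ^ m"
proof -
  obtain k where k: "m = Suc k" using assms(2) by (cases m) auto
  have "norm (nth_deriv m f x) \<le> b * Q ^ m" using CbD[OF assms(1,3)] by simp
  also have "\<dots> = (b * Q) * Q ^ k" by (simp add: k)
  also have "\<dots> \<le> Q' * Q' ^ k"
    using assms(4-6) by (intro mult_mono power_mono) auto
  finally show ?thesis by (simp add: k)
qed

context qframe
begin

lemma adm_sign:
  assumes "adm e"
  obtains s t :: real where "s = 1 \<or> s = -1" "t = 1 \<or> t = -1" "I * e * qcnj I = s *\<^sub>R e" "qcnj I * e * I = s *\<^sub>R e"
    "qcnj J * e * J = t *\<^sub>R e"
proof -
  have 1: "\<exists>s. (s = 1 \<or> s = (-1::real)) \<and> I * e * qcnj I = s *\<^sub>R e \<and> qcnj I * e * I = s *\<^sub>R e"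
  proof (cases "e * I = I * e")
    case True
    have "I * e * qcnj I = e" "qcnj I * e * I = e" using I_unit(1) by (simp add: True[symmetric] mult.assoc, simp add: True mult.assoc)
    then show ?thesis by (intro exI[of _ 1]) simp
  next
    case False
    then have F: "e * I = - (I * e)" "I * e = - (e * I)" using assms by (auto simp: adm_def)
    have "I * e * qcnj I = - e" "qcnj I * e * I = - e" using I_unit(1) by (simp add: F(2) mult.assoc, simp add: F(1) mult.assoc)
    then show ?thesis by (intro exI[of _ "-1"]) simp
  qed
  have 2: "\<exists>t. (t = 1 \<or> t = (-1::real)) \<and> qcnj J * e * J = t *\<^sub>R e"
  proof (cases "e * J = J * e")
    case True
    have "qcnj J * e * J = e" using J_unit(1) by (simp add: True mult.assoc)
    then show ?thesis by (intro exI[of _ 1]) simp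
  next
    case False
    then have F: "e * J = - (J * e)" using assms by (auto simp: adm_def)
    have "qcnj J * e * J = - e" using J_unit(1) by (simp add: F mult.assoc)
    then show ?thesis by (intro exI[of _ "-1"]) simp
  qed
  from 1 2 show thesis using that by blast
qed

lemma qexp_sign: "s = 1 \<or> s = -1 \<Longrightarrow> of_real (cos t) + (s * sin t) *\<^sub>R e = qexp e (s * t)"
  by (auto simp: qexp_def)

text \<open>The part of \<open>G\<close> commuting with \<open>e\<close> is a rotation about \<open>e\<close> by the angle \<open>\<psi>\<close>. Its class-\<open>(p', q')\<close> average is small
  because the partner class anticommutes with \<open>e\<close>, so \<open>\<psi>\<close> is removed by a rotation about the same axis.\<close>

lemma reduce_commuting:
  fixes r :: nat and K Q Q' v \<delta> :: real and p p' :: int and q q' :: nat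
  defines "P \<equiv> 2 ^ r"
  assumes K: "calc_const r K" and r: "1 \<le> r" and adm: "adm (cls p q)" "adm (cls p' q')"
    and ac: "cls p q * cls p' q' = - (cls p' q' * cls p q)" and Q: "1 \<le> Q" "Q \<le> Q'"
    and \<sigma>: "\<bar>real q' * \<alpha> - real_of_int p'\<bar> \<le> 1 / Q'" and q: "real q' \<le> 2 * Q'"
    and small: "8 * P\<^sup>2 * K\<^sup>2 * real r * (Q * v) \<le> 1" "P * \<delta> \<le> 1" "\<delta> \<le> 1 / 2"
    and G: "gauge G" and CG: "Cb UNIV r Q v (\<lambda>y. G y - 1)"
    and CA: "Cb UNIV r Q' \<delta> (\<lambda>y. anti (cls p q) (G y))"
  obtains W where "gauge W"
    "Cb UNIV r Q' (8 * P\<^sup>2 * K ^ 3 * v * (Q / Q') ^ r + 15 * P ^ 3 * K ^ 3 * \<delta>) (\<lambda>y. gc W G y - 1)"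
proof -
  define e where "e = cls p q"
  define A where "A = (\<lambda>y. anti e (G y))"
  define s where "s = (\<lambda>y. qre (G y))"
  define f where "f = (\<lambda>y. - qre (G y * e))"
  \<comment> \<open>As \<open>G\<close> has norm 1, \<open>h\<close> is the norm of its commuting
    part s + f e; \<open>\<psi>\<close> is the angle of that part and \<open>g\<close> its
    tangent.\<close>
  define h where "h = (\<lambda>y. sqrt (1 + - (norm (A y))\<^sup>2))"
  define g where "g = (\<lambda>y. f y * inverse (1 + (s y - 1)))"
  define \<psi> where "\<psi> = (\<lambda>y. arctan (g y))"
  have e: "e * e = -1" using adm(1) by (simp add: adm_def e_def)
  have K1: "K \<ge> 1" by (rule calc_const_ge1[OF K])
  have P1: "P \<ge> 1" by (simp add: P_def)
  have v0: "0 \<le> v" "0 \<le> \<delta>" using Cb_nonneg CG CA by blast+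
  have Q0: "0 \<le> Q" "0 \<le> Q'" "0 < Q" "0 < Q'" using Q by auto
  define c where "c = 4 * P\<^sup>2 * K\<^sup>2"
  have PK: "1 \<le> P\<^sup>2" "1 \<le> K\<^sup>2" "P \<le> P\<^sup>2" "K \<le> K\<^sup>2" using P1 K1 mult_mono[OF P1 P1] mult_mono[OF K1 K1] by (auto simp: power2_eq_square)
  have c4: "4 \<le> c" "4 * P * K \<le> c" "4 * P\<^sup>2 * K \<le> c"
    using mult_mono[OF PK(1,2)] mult_mono[OF PK(3,4)] mult_left_mono[OF PK(4), of "P\<^sup>2"] P1 K1 by (auto simp: c_def)
  have sm: "2 * real r * c * (Q * v) \<le> 1" using small(1) by (simp add: c_def mult_ac)
  have Qv: "v \<le> Q * v" using mult_right_mono[OF Q(1) v0(1)] by simp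
  have cv1: "2 * (c * v) \<le> 1"
  proof -
    have "c * v \<le> c * (Q * v)" using Qv c4 by (intro mult_left_mono) auto
    moreover have "1 * (c * (Q * v)) \<le> real r * (c * (Q * v))" using r c4 v0 Q0 by (intro mult_right_mono) auto
    moreover have "2 * real r * c * (Q * v) = 2 * (real r * (c * (Q * v)))" by simp
    ultimately show ?thesis using sm by linarith
  qed
  have v1: "v \<le> 1/2" "2 * P * K * v \<le> 1 / (2 * P)" "4 * P * K * v \<le> c * v"
  proof -
    have "4 * v \<le> c * v" using c4 v0 by (intro mult_right_mono) auto
    then show "v \<le> 1/2" using cv1 v0 by linarith
    have "4 * P\<^sup>2 * K * v \<le> c * v" using c4 v0 by (intro mult_right_mono) auto
    then have "(2 * P * K * v) * (2 * P) \<le> 1" using cv1 v0 c4 by (simp add: power2_eq_square mult_ac)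
    then show "2 * P * K * v \<le> 1 / (2 * P)" using P1 by (simp add: pos_le_divide_eq)
    show "4 * P * K * v \<le> c * v" using c4 v0 by (intro mult_right_mono) auto
  qed
  have Gd: "G y = of_real (s y) + f y *\<^sub>R e + A y" for y
    unfolding s_def f_def A_def anti_def by (rule quat_decomp[OF e])
  have Ac: "e * A y * e = A y" for y unfolding A_def by (rule anti_idem[OF e])
  have nG: "(s y)\<^sup>2 + (f y)\<^sup>2 + (norm (A y))\<^sup>2 = 1" for y
    using norm_orth[OF e Ac[of y], of "s y" "f y"] G by (simp add: Gd[symmetric] gauge_def)
  have Cs: "Cb UNIV r Q v (\<lambda>y. s y - 1)" using Cb_qre[OF _ CG] by (simp add: s_def)
  have Cf: "Cb UNIV r Q v f" using Cb_coord[OF e CG] imag_unit(3)[OF e] by (simp add: f_def left_diff_distrib)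
  have sp: "s y > 0" for y using CbD0[OF Cs, of y] v1 by auto
  have Cis: "Cb UNIV r Q (2 * K) (\<lambda>y. inverse (1 + (s y - 1)))"
  proof -
    have "Cb UNIV r Q (K * v + 1) (\<lambda>y. (inverse (1 + (s y - 1)) - 1) + 1)"
      by (intro Cb_add calc_inverse[OF K Q0(1) v1(1) Cs] Cb_const) (use Q0 in auto)
    moreover have "K * v + 1 \<le> 2 * K"
    proof -
      have "K * v \<le> K * 1" using v1(1) K1 by (intro mult_left_mono) auto
      then show ?thesis using K1 by linarith
    qed
    ultimately show ?thesis using Cb_le Q0(1) by fastforce
  qed
  have Cg: "Cb UNIV r Q (2 * P * K * v) g"
    using Cb_mult[OF _ Cf Cis] unfolding g_def P_def by (simp add: mult_ac)
  have Cgg: "Cb UNIV r Q (1/2) (\<lambda>y. g y * g y)"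
  proof (rule Cb_le[OF Cb_mult[OF _ Cg Cg]])
    have "2 ^ r * (2 * P * K * v) * (2 * P * K * v) \<le> 2 ^ r * (1 / (2 * P)) * 1"
      using v1 v0 P1 K1 cv1 by (intro mult_mono) auto
    then show "2 ^ r * (2 * P * K * v) * (2 * P * K * v) \<le> 1/2" using P1 by (simp add: P_def)
  qed (use Q0 in auto)
  have Cig: "Cb UNIV r Q (2 * K) (\<lambda>y. inverse (1 + g y * g y))"
  proof -
    have "Cb UNIV r Q (K * (1/2) + 1) (\<lambda>y. (inverse (1 + g y * g y) - 1) + 1)"
      by (intro Cb_add calc_inverse[OF K Q0(1) _ Cgg] Cb_const) (use Q0 in auto)
    moreover have "K * (1/2) + 1 \<le> 2 * K" using K1 by simp
    ultimately show ?thesis using Cb_le Q0(1) by fastforce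
  qed
  \<comment> \<open>The derivative g' / (1 + g^2) is estimated up to order r - 1, and \<bar>arctan
    g\<bar> \<le> \<bar>g\<bar> supplies order zero.\<close>
  have C\<psi>: "Cb UNIV r Q (c * v) \<psi>"
  proof -
    obtain r' where r': "r = Suc r'" using r by (cases r) auto
    have d: "(\<psi> has_vector_derivative inverse (1 + g y * g y) * nth_deriv 1 g y) (at y)" for y
    proof -
      have "(g has_real_derivative nth_deriv 1 g y) (at y)"
        using smooth_on_deriv1[OF Cb_smooth[OF Cg], of y] by (simp add: has_real_derivative_iff_has_vector_derivative)
      from DERIV_arctan[THEN DERIV_chain2, OF this]
      show ?thesis unfolding \<psi>_def has_real_derivative_iff_has_vector_derivative by (simp add: power2_eq_square)
    qed
    have "Cb UNIV r' Q (2 ^ r' * (2 * K) * (2 * P * K * v * Q)) (\<lambda>y. inverse (1 + g y * g y) * nth_deriv 1 g y)"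
      by (intro Cb_mult Cb_deriv Cb_mono[OF Cig]) (use Cg Q0 K1 r' in auto)
    moreover have "2 ^ r' * (2 * K) * (2 * P * K * v * Q) \<le> c * v * Q"
    proof -
      have "2 ^ r' * (4 * P * K * K * v * Q) \<le> P * (4 * P * K * K * v * Q)"
        using P1 K1 v0 Q0 r' by (intro mult_right_mono) (auto simp: P_def)
      then show ?thesis by (simp add: c_def power2_eq_square mult_ac)
    qed
    ultimately have D: "Cb UNIV r' Q (c * v * Q) (\<lambda>y. inverse (1 + g y * g y) * nth_deriv 1 g y)" using Cb_le Q0(1) by blast
    show ?thesis unfolding r'
    proof (rule Cb_SucI[OF open_UNIV d D])
      show "norm (\<psi> y) \<le> c * v" for y
      proof -
        have "\<bar>arctan (g y)\<bar> \<le> \<bar>g y\<bar>" by (rule abs_arctan_le)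
        moreover have "\<bar>g y\<bar> \<le> 2 * P * K * v" using CbD0[OF Cg] by simp
        moreover have "0 \<le> P * K * v" using P1 K1 v0 by simp
        ultimately show ?thesis using v1(3) by (simp add: \<psi>_def)
      qed
    qed
  qed
  have cs: "qexp e (\<psi> y) * of_real (h y) = of_real (s y) + f y *\<^sub>R e" for y
  proof -
    have h2: "h y = sqrt ((s y)\<^sup>2 + (f y)\<^sup>2)" using nG[of y] by (simp add: h_def algebra_simps)
    have gy: "g y = f y / s y" by (simp add: g_def divide_inverse)
    have "1 + (g y)\<^sup>2 = ((s y)\<^sup>2 + (f y)\<^sup>2) / (s y)\<^sup>2" using sp[of y] by (simp add: gy power_divide field_simps)
    then have sq: "sqrt (1 + (g y)\<^sup>2) = h y / s y" using sp[of y] by (simp add: h2 real_sqrt_divide)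
    have h0: "h y > 0" unfolding h2 using sp[of y] by (simp add: add_pos_nonneg)
    have "cos (\<psi> y) * h y = s y" "sin (\<psi> y) * h y = f y"
      unfolding \<psi>_def cos_arctan sin_arctan sq using h0 sp[of y] by (simp_all add: gy)
    then show ?thesis by (simp add: qexp_def of_real_def algebra_simps)
  qed
  obtain \<tau> \<kappa> :: real where \<tau>: "\<tau> = 1 \<or> \<tau> = -1" "I * e * qcnj I = \<tau> *\<^sub>R e" "qcnj I * e * I = \<tau> *\<^sub>R e"
    and \<kappa>: "\<kappa> = 1 \<or> \<kappa> = -1" "qcnj J * e * J = \<kappa> *\<^sub>R e"
    using adm_sign[OF adm(1)] unfolding e_def by metis
  have twG: "G (y + 1) = I * G y * qcnj I" for y using G by (simp add: gauge_def tw_def)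
  have s1: "s (y + 1) = s y" for y
    unfolding s_def twG using qre_mult_commute[of "I * G y" "qcnj I"] I_unit(1) by (simp add: mult.assoc[symmetric] del: quat_mult_simps)
  have f1: "f (y + 1) = \<tau> * f y" for y
  proof -
    have "qre (G (y + 1) * e) = qre (I * (G y * qcnj I * e))" by (simp only: twG mult.assoc)
    also have "\<dots> = qre (G y * (qcnj I * e * I))" by (subst qre_mult_commute) (simp only: mult.assoc)
    finally show ?thesis unfolding \<tau>(3) f_def by (simp del: quat_mult_simps)
  qed
  \<comment> \<open>The unit shift leaves \<open>s\<close> unchanged and multiplies \<open>f\<close>
    by the sign with which \<open>I\<close> acts on the axis \<open>e\<close>; the angle changes by
    the same sign.\<close>
  have tw\<psi>: "tw (\<lambda>y. \<psi> y *\<^sub>R e)"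
  proof -
    have "\<psi> (y + 1) = \<tau> * \<psi> y" for y
      using \<tau>(1) by (auto simp: \<psi>_def g_def s1 f1 arctan_minus)
    moreover have "I * (\<psi> y *\<^sub>R e) * qcnj I = (\<tau> * \<psi> y) *\<^sub>R e" for y
      using \<tau>(2) by (simp add: mult.commute)
    ultimately show ?thesis by (simp add: tw_def)
  qed
  have e': "cls p' q' * cls p' q' = -1" using adm(2) by (simp add: adm_def)
  \<comment> \<open>Since the partner e' anticommutes with \<open>e\<close>, e' e e' = e. Averaging
    over (p', q') therefore applies to functions along the axis \<open>e\<close>.\<close>
  have fix1: "cls p' q' * (\<psi> y *\<^sub>R e) * cls p' q' = \<psi> y *\<^sub>R e" for y
  proof -
    have "cls p' q' * e = - (e * cls p' q')" using ac by (simp add: e_def)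
    then have "cls p' q' * e * cls p' q' = e" by (simp add: mult.assoc e')
    then show ?thesis by simp
  qed
  have C\<psi>e: "Cb UNIV r Q (c * v) (\<lambda>y. \<psi> y *\<^sub>R e)"
    using Cb_linear[of "\<lambda>x. x *\<^sub>R e" 1 UNIV r Q "c * v" \<psi>] C\<psi> bounded_linear_scaleR_left[of e]
    by (simp add: imag_unit(1)[OF e])
  obtain w x where w: "tw w" "tw x" and wx: "\<forall>y. T w y - w y = x y - \<psi> y *\<^sub>R e"
    and Cw: "Cb UNIV r Q (real q' * real r * (c * v) / 2) w" and Cx: "Cb UNIV r Q (c * v) x" "Cb UNIV r Q' (c * v * (Q / Q') ^ r) x"
    and wg: "\<forall>g s. adm g \<longrightarrow> (\<forall>y. g * (\<psi> y *\<^sub>R e) * g = s *\<^sub>R (\<psi> y *\<^sub>R e)) \<longrightarrow> (\<forall>y. g * w y * g = s *\<^sub>R w y \<and> g * x y * g = s *\<^sub>R x y)"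
    by (rule averaging[OF adm(2) tw\<psi> fix1 C\<psi>e Q0(3) Q(2) \<sigma>])
  define \<phi> where "\<phi> = (\<lambda>y. - qre (w y * e))"
  define \<chi>' where "\<chi>' = (\<lambda>y. - qre (x y * e))"
  \<comment> \<open>Averaging preserves both symmetries. Being fixed by the partner class excludes a
    real part; being reversed by \<open>e\<close> excludes a part orthogonal to 1 and
    \<open>e\<close>.\<close>
  have wx_e: "w y = \<phi> y *\<^sub>R e" "x y = \<chi>' y *\<^sub>R e" for y
  proof -
    have 1: "cls p' q' * w y * cls p' q' = w y" "cls p' q' * x y * cls p' q' = x y"
      using wg[rule_format, OF adm(2), of 1 y] fix1 by simp_all
    have 2: "e * w y * e = - w y" "e * x y * e = - x y"
      using wg[rule_format, OF adm(1), of "-1" y] by (simp_all add: e_def[symmetric] e)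
    have 3: "qre (w y) = 0" "qre (x y) = 0" using anti_class(1)[OF e' 1(1)] anti_class(1)[OF e' 1(2)] .
    show "w y = \<phi> y *\<^sub>R e" "x y = \<chi>' y *\<^sub>R e"
      using quat_decomp[OF e, of "w y"] quat_decomp[OF e, of "x y"] unfolding 2 3 by (simp_all add: \<phi>_def \<chi>'_def)
  qed
  have C\<phi>: "Cb UNIV r Q (real q' * real r * (c * v) / 2) \<phi>" unfolding \<phi>_def by (rule Cb_coord[OF e Cw])
  have C\<chi>: "Cb UNIV r Q' (c * v * (Q / Q') ^ r) \<chi>'" unfolding \<chi>'_def by (rule Cb_coord[OF e Cx(2)])
  have cv0: "0 \<le> c * v" using c4 v0 by simp
  have q\<phi>: "real q' * real r * (c * v) / 2 \<le> Q' * real r * (c * v)"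
  proof -
    have "real q' * (real r * (c * v) / 2) \<le> 2 * Q' * (real r * (c * v) / 2)"
      using q cv0 by (intro mult_right_mono) auto
    then show ?thesis by (simp add: mult_ac)
  qed
  \<comment> \<open>The primitive \<open>\<phi>\<close> may be far larger than 1, because q' can be
    of order Q'. Smallness of Q v keeps size times Q below Q', which is all that the rotation
    through \<open>\<phi>\<close> requires at frequency Q'.\<close>
  have big: "(Q' * real r * (c * v) + c * v) * Q \<le> Q'"
  proof -
    have "1 * 1 \<le> Q' * real r" using Q r by (intro mult_mono) auto
    from mult_right_mono[OF this, of "c * v"] have "c * v \<le> Q' * real r * (c * v)" using cv0 by simp
    then have "Q' * real r * (c * v) + c * v \<le> 2 * (Q' * real r * (c * v))" by linarith
    then have "(Q' * real r * (c * v) + c * v) * Q \<le> (2 * (Q' * real r * (c * v))) * Q"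
      by (rule mult_right_mono[OF _ Q0(1)])
    also have "\<dots> = Q' * (2 * real r * c * (Q * v))" by simp
    also have "\<dots> \<le> Q' * 1" using sm Q0 by (intro mult_left_mono) auto
    finally show ?thesis by simp
  qed
  define W where "W = (\<lambda>y. qexp e (\<phi> y))"
  have C\<phi>\<psi>: "Cb UNIV r Q (Q' * real r * (c * v) + c * v) (\<lambda>y. \<phi> y - \<psi> y)" "Cb UNIV r Q (Q' * real r * (c * v) + c * v) (\<lambda>y. - \<phi> y)"
    by (rule Cb_le[OF Cb_diff[OF _ C\<phi> C\<psi>]], use q\<phi> Q0 in auto)
       (rule Cb_le[OF Cb_minus[OF _ C\<phi>]], use q\<phi> Q0 cv0 in auto)
  have CE: "Cb UNIV r Q' (2 * K) (\<lambda>y. qexp e (u y))" if u: "Cb UNIV r Q (Q' * real r * (c * v) + c * v) u" for u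
  proof -
    have "\<bar>nth_deriv m u x\<bar> \<le> Q' ^ m" if "1 \<le> m" "m \<le> r" for m x
      using Cb_deriv_scale[OF u that big Q0(1) Q(2)] by simp
    from calc_sin_large[OF K Q0(2) Cb_smooth[OF u] this] calc_cos_large[OF K Q0(2) Cb_smooth[OF u] this]
    show ?thesis using Cb_qexp[OF e, of r Q' K u K 0] by simp
  qed
  define A' where "A' = (\<lambda>y. qexp e (\<phi> y - \<psi> y) * A y * qexp e (- \<phi> y))"
  have CA': "Cb UNIV r Q' (4 * P\<^sup>2 * K\<^sup>2 * \<delta>) A'"
  proof -
    have "Cb UNIV r Q' (2 ^ r * (2 ^ r * (2 * K) * \<delta>) * (2 * K)) A'"
      unfolding A'_def by (intro Cb_mult CE C\<phi>\<psi>) (use CA in \<open>auto simp: A_def e_def\<close>)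
    then show ?thesis by (simp add: P_def power2_eq_square mult_ac)
  qed
  have Ch: "Cb UNIV r Q' (K * \<delta>) (\<lambda>y. h y - 1)"
  proof -
    have "(norm (A y))\<^sup>2 = - qre (A y * A y)" for y by (rule norm_sq_imag[OF anti_class(1)[OF e Ac]])
    moreover have "Cb UNIV r Q' (P * \<delta> * \<delta>) (\<lambda>y. - (- qre (A y * A y)))"
      unfolding P_def by (intro Cb_minus Cb_qre Cb_mult) (use CA in \<open>auto simp: A_def e_def\<close>)
    moreover have "P * \<delta> * \<delta> \<le> \<delta>" using mult_right_mono[OF small(2) v0(2)] by simp
    ultimately have "Cb UNIV r Q' \<delta> (\<lambda>y. - (norm (A y))\<^sup>2)" using Cb_le Q0(2) by simp
    from calc_sqrt[OF K Q0(2) small(3) this] show ?thesis by (simp add: h_def)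
  qed
  define \<mu> where "\<mu> = (Q / Q') ^ r"
  have \<mu>: "0 \<le> \<mu>" "\<mu> \<le> 1" using Q Q0 by (auto simp: \<mu>_def intro!: power_le_one)
  have cv\<mu>: "c * v * \<mu> \<le> 1" using mult_mono[of "c * v" 1 \<mu> 1] \<mu> cv0 cv1 by simp
  have C\<chi>1: "Cb UNIV r Q' (2 * K * (c * v * \<mu>)) (\<lambda>y. qexp e (\<chi>' y) - 1)"
    using Cb_qexp[OF e calc_sin[OF K Q0(2) cv\<mu> C\<chi>[folded \<mu>_def]] calc_cos[OF K Q0(2) cv\<mu> C\<chi>[folded \<mu>_def]]] by (simp add: mult_ac)
  have C\<chi>2: "Cb UNIV r Q' (3 * K) (\<lambda>y. qexp e (\<chi>' y))"
  proof -
    have "Cb UNIV r Q' (2 * K * (c * v * \<mu>) + 1) (\<lambda>y. (qexp e (\<chi>' y) - 1) + 1)"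
      by (intro Cb_add C\<chi>1 Cb_const) (use Q0 in auto)
    moreover have "2 * K * (c * v * \<mu>) + 1 \<le> 3 * K"
    proof -
      have "2 * K * (c * v * \<mu>) \<le> 2 * K * 1" by (rule mult_left_mono[OF cv\<mu>]) (use K1 in simp)
      then show ?thesis using K1 by linarith
    qed
    ultimately show ?thesis using Cb_le Q0(2) by fastforce
  qed
  have "tw W"
  proof -
    have "\<phi> (y + 1) *\<^sub>R e = (\<tau> * \<phi> y) *\<^sub>R e" for y
    proof -
      have "\<phi> (y + 1) *\<^sub>R e = I * (\<phi> y *\<^sub>R e) * qcnj I" using w(1) unfolding tw_def wx_e(1) by blast
      then show ?thesis using \<tau>(2) by (simp add: mult.commute)
    qed
    then have \<phi>1: "\<phi> (y + 1) = \<tau> * \<phi> y" for y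
      using imag_unit(1)[OF e] by (metis norm_zero scaleR_cancel_right zero_neq_one)
    have "I * qexp e t * qcnj I = of_real (cos t) + (\<tau> * sin t) *\<^sub>R e" for t
    proof -
      have "I * qexp e t * qcnj I = of_real (cos t) * (I * qcnj I) + sin t *\<^sub>R (I * e * qcnj I)"
        by (simp add: qexp_def of_real_def algebra_simps)
      then show ?thesis using I_unit(1) by (simp add: \<tau>(2) mult.commute)
    qed
    then show ?thesis unfolding tw_def W_def \<phi>1 by (simp add: qexp_sign[OF \<tau>(1)])
  qed
  have TW: "T W y = qexp e (\<phi> y + \<chi>' y - \<psi> y)" for y
  proof -
    have "T W y = of_real (cos (\<phi> (y + \<alpha>))) * (qcnj J * J) + sin (\<phi> (y + \<alpha>)) *\<^sub>R (qcnj J * e * J)"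
      by (simp add: T_def W_def qexp_def of_real_def algebra_simps)
    then have 1: "T W y = qexp e (\<kappa> * \<phi> (y + \<alpha>))"
      using J_unit(1) by (simp add: \<kappa>(2) qexp_sign[OF \<kappa>(1), symmetric] mult.commute)
    have "T w y = \<phi> (y + \<alpha>) *\<^sub>R (qcnj J * e * J)" by (simp add: T_def wx_e)
    then have 2: "T w y = (\<kappa> * \<phi> (y + \<alpha>)) *\<^sub>R e" by (simp only: \<kappa>(2)) simp
    have "T w y = w y + (x y - \<psi> y *\<^sub>R e)" using wx[rule_format, of y] by (simp add: algebra_simps)
    then have "T w y = (\<phi> y + \<chi>' y - \<psi> y) *\<^sub>R e" by (simp add: wx_e algebra_simps)
    then have "(\<kappa> * \<phi> (y + \<alpha>)) *\<^sub>R e = (\<phi> y + \<chi>' y - \<psi> y) *\<^sub>R e" unfolding 2 .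
    then have "\<kappa> * \<phi> (y + \<alpha>) = \<phi> y + \<chi>' y - \<psi> y"
      using imag_unit(1)[OF e] by (metis norm_zero scaleR_cancel_right zero_neq_one)
    then show ?thesis using 1 by simp
  qed
  \<comment> \<open>The large angle \<open>\<phi>\<close> cancels from the commuting part, leaving
    only \<open>\<chi>'\<close>. It survives in \<open>A'\<close> alone, where it multiplies the
    small anticommuting part.\<close>
  have main: "gc W G y - 1 = (qexp e (\<chi>' y) - 1) + qexp e (\<chi>' y) * (of_real (h y - 1) + A' y)" for y
  proof -
    have 1: "G y = of_real (h y) * qexp e (\<psi> y) + A y" unfolding Gd[of y] cs[symmetric] by (simp add: of_real_def)
    have "gc W G y = qexp e (\<phi> y + \<chi>' y - \<psi> y) * (of_real (h y) * qexp e (\<psi> y) + A y) * qexp e (- \<phi> y)"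
      unfolding gc_def TW 1[symmetric] by (simp add: W_def qexp_cnj[OF e])
    also have "\<dots> = of_real (h y) * (qexp e (\<phi> y + \<chi>' y - \<psi> y) * qexp e (\<psi> y) * qexp e (- \<phi> y))
       + qexp e (\<phi> y + \<chi>' y - \<psi> y) * A y * qexp e (- \<phi> y)"
      by (simp add: of_real_def distrib_left distrib_right mult.assoc)
    also have "qexp e (\<phi> y + \<chi>' y - \<psi> y) * qexp e (\<psi> y) * qexp e (- \<phi> y) = qexp e (\<chi>' y)"
      unfolding qexp_add[OF e] by simp
    also have "qexp e (\<phi> y + \<chi>' y - \<psi> y) = qexp e (\<chi>' y) * qexp e (\<phi> y - \<psi> y)"
      unfolding qexp_add[OF e] by (simp add: algebra_simps)
    finally show ?thesis by (simp add: A'_def of_real_def algebra_simps)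
  qed
  have "Cb UNIV r Q' (2 * K * (c * v * \<mu>) + 2 ^ r * (3 * K) * (K * \<delta> + 4 * P\<^sup>2 * K\<^sup>2 * \<delta>)) (\<lambda>y. gc W G y - 1)"
  proof -
    have "Cb UNIV r Q' (K * \<delta>) (\<lambda>y. of_real (h y - 1) :: quat)"
      using Cb_linear[of "of_real :: real \<Rightarrow> quat" 1 UNIV r Q' "K * \<delta>" "\<lambda>y. h y - 1"] Ch bounded_linear_of_real by simp
    then show ?thesis unfolding main by (intro Cb_add Cb_mult C\<chi>1 C\<chi>2 CA') auto
  qed
  then have "Cb UNIV r Q' (8 * P\<^sup>2 * K ^ 3 * v * (Q / Q') ^ r + 15 * P ^ 3 * K ^ 3 * \<delta>) (\<lambda>y. gc W G y - 1)"
  proof (rule Cb_le)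
    have "K * \<delta> \<le> P\<^sup>2 * K\<^sup>2 * \<delta>"
      using mult_mono[OF PK(1) PK(4)] P1 K1 v0 by (intro mult_right_mono) auto
    then have "K * \<delta> + 4 * P\<^sup>2 * K\<^sup>2 * \<delta> \<le> 5 * (P\<^sup>2 * K\<^sup>2 * \<delta>)" by linarith
    then have "2 ^ r * (3 * K) * (K * \<delta> + 4 * P\<^sup>2 * K\<^sup>2 * \<delta>) \<le> 2 ^ r * (3 * K) * (5 * (P\<^sup>2 * K\<^sup>2 * \<delta>))"
      by (rule mult_left_mono) (use K1 in auto)
    also have "\<dots> = 15 * P ^ 3 * K ^ 3 * \<delta>" by (simp add: P_def power2_eq_square power3_eq_cube)
    finally show "2 * K * (c * v * \<mu>) + 2 ^ r * (3 * K) * (K * \<delta> + 4 * P\<^sup>2 * K\<^sup>2 * \<delta>)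
       \<le> 8 * P\<^sup>2 * K ^ 3 * v * (Q / Q') ^ r + 15 * P ^ 3 * K ^ 3 * \<delta>"
      by (simp add: c_def \<mu>_def power2_eq_square power3_eq_cube mult_ac)
  qed (rule Q0(2))
  moreover have "gauge W"
  proof -
    have "smooth_on UNIV W" unfolding W_def qexp_def
      by (intro smooth_on_add smooth_on_of_real smooth_on_scaleR smooth_on_const smooth_on_sin smooth_on_cos Cb_smooth[OF C\<phi>]) auto
    then show ?thesis using \<open>tw W\<close> by (simp add: gauge_def W_def norm_qexp[OF e])
  qed
  ultimately show thesis using that by blast
qed

text \<open>The nonlinear problem, for the anticommuting part, is solved along the vector of height
  of order Q, so that the Cayley correction is small. The remaining commuting part is an angle about
  one axis; its equation is exactly linear, so it tolerates the second vector, whose height may be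
  of order Q'. The new frequency is the inverse of the first return.\<close>

lemma renormalize_once:
  fixes r :: nat and K Q X :: real
  defines "P \<equiv> 2 ^ r"
  assumes irr: "\<alpha> \<notin> \<rat>" and K: "calc_const r K" and r: "1 \<le> r" and Q: "1 \<le> Q"
    and small: "19200 * P ^ 7 * K ^ 5 * real r * (Q * X) \<le> 1"
    and G: "gauge G" and CG: "Cb UNIV r Q X (\<lambda>y. G y - 1)"
  obtains W Q' where "gauge W" "100 * P ^ 3 * K ^ 3 * Q \<le> Q'"
    "Cb UNIV r Q' (100 * P ^ 3 * K ^ 3 * X * (Q / Q') ^ r) (\<lambda>y. gc W G y - 1)"
proof -
  have K1: "K \<ge> 1" by (rule calc_const_ge1[OF K])
  have P1: "P \<ge> 1" by (simp add: P_def)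
  have X0: "0 \<le> X" using Cb_nonneg[OF CG] .
  define C where "C = 100 * P ^ 3 * K ^ 3"
  have pw: "1 \<le> P ^ n" "1 \<le> K ^ n" for n using P1 K1 by (auto intro: one_le_power)
  have C1: "1 \<le> C" using mult_mono[OF pw(1)[of 3] pw(2)[of 3]] P1 K1 by (simp add: C_def)
  have CQ: "1 \<le> C * Q" using mult_mono[OF C1 Q] C1 by simp
  obtain p p' :: int and q q' :: nat where q: "1 \<le> q" "real q \<le> 2 * (C * Q)" and \<sigma>: "0 < \<bar>real q * \<alpha> - real_of_int p\<bar>"
    "\<bar>real q * \<alpha> - real_of_int p\<bar> < 1 / (C * Q)" and q': "1 \<le> q'" "\<bar>real q' * \<alpha> - real_of_int p'\<bar> \<le> \<bar>real q * \<alpha> - real_of_int p\<bar>"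
    "real q' \<le> 2 / \<bar>real q * \<alpha> - real_of_int p\<bar>" and od: "odd (p * int q' - p' * int q)"
    by (rule lattice_pair[OF irr CQ])
  define Q' where "Q' = 1 / \<bar>real q * \<alpha> - real_of_int p\<bar>"
  have QQ: "C * Q \<le> Q'" using \<sigma> CQ by (simp add: Q'_def field_simps)
  have QQ': "Q \<le> Q'"
  proof -
    have "1 * Q \<le> C * Q" using C1 Q by (intro mult_right_mono) auto
    then show ?thesis using QQ by linarith
  qed
  have \<sigma>1: "\<bar>real q * \<alpha> - real_of_int p\<bar> \<le> 1 / Q'" "\<bar>real q' * \<alpha> - real_of_int p'\<bar> \<le> 1 / Q'" and q2: "real q' \<le> 2 * Q'"
    using q' \<sigma> by (auto simp: Q'_def)
  note cl = cls_anticommute[OF od]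
  have Q0: "0 < Q" using Q by simp
  \<comment> \<open>Here the threshold originates: with L = 2 C, the number 19200 is 96 * 2 * 100,
    and the exponents are 4 + 3 and 2 + 3.\<close>
  have sm1: "96 * (2 ^ r) ^ 4 * K\<^sup>2 * (2 * C) * real r * (Q * X) \<le> 1"
  proof -
    have "96 * (2 ^ r) ^ 4 * K\<^sup>2 * (2 * C) * real r * (Q * X) = 19200 * P ^ 7 * K ^ 5 * real r * (Q * X)"
      unfolding C_def P_def[symmetric] by (simp add: power_numeral_reduce mult_ac)
    then show ?thesis using small by (simp only:)
  qed
  obtain W where W: "gauge W" and CW: "Cb UNIV r Q (6 * X) (\<lambda>y. gc W G y - 1)"
    and CA: "Cb UNIV r Q' (3 * (X * (Q / Q') ^ r)) (\<lambda>y. anti (cls p q) (gc W G y))"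
    by (rule reduce_anticommuting[OF K r cl(1) Q0 QQ' \<sigma>1(1) _ sm1 G CG]) (use q in auto)
  define \<mu> where "\<mu> = (Q / Q') ^ r"
  have \<mu>: "0 \<le> \<mu>" "\<mu> \<le> 1" using Q QQ' by (auto simp: \<mu>_def intro!: power_le_one)
  have XQ: "X \<le> Q * X" using mult_right_mono[OF Q X0] by simp
  have r1: "1 \<le> real r" using r by simp
  define Z where "Z = real r * (Q * X)"
  have Z0: "0 \<le> Z" using Q X0 by (simp add: Z_def)
  have "1 * (Q * X) \<le> real r * (Q * X)" using r1 Q X0 by (intro mult_right_mono) auto
  then have XZ: "X \<le> Z" using XQ unfolding Z_def by linarith
  have PKZ: "P\<^sup>2 * K\<^sup>2 * Z * 19200 \<le> 1"
  proof -
    have "P\<^sup>2 * K\<^sup>2 * Z * 19200 \<le> P ^ 7 * K ^ 5 * Z * 19200"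
      using P1 K1 Z0 by (intro mult_right_mono mult_mono power_increasing) auto
    also have "\<dots> = 19200 * P ^ 7 * K ^ 5 * real r * (Q * X)" by (simp add: Z_def)
    finally show ?thesis using small by linarith
  qed
  have PZ: "P * X * 19200 \<le> 1" "X * 19200 \<le> 1"
  proof -
    have "P * 1 \<le> P\<^sup>2 * K\<^sup>2"
      by (rule mult_mono) (use P1 pw[of 2] in \<open>auto intro: self_le_power\<close>)
    then have "P * 1 * X \<le> P\<^sup>2 * K\<^sup>2 * Z" by (rule mult_mono) (use XZ X0 in auto)
    then show 1: "P * X * 19200 \<le> 1" using PKZ by simp
    have "1 * X \<le> P * X" by (rule mult_right_mono[OF P1 X0])
    then show "X * 19200 \<le> 1" using 1 by linarith
  qed
  have X\<mu>: "X * \<mu> \<le> X" "0 \<le> X * \<mu>" using mult_left_mono[OF \<mu>(2) X0] \<mu> X0 by auto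
  obtain V where V: "gauge V" and CV: "Cb UNIV r Q' (8 * (2 ^ r)\<^sup>2 * K ^ 3 * (6 * X) * (Q / Q') ^ r + 15 * (2 ^ r) ^ 3 * K ^ 3 * (3 * (X * (Q / Q') ^ r)))
      (\<lambda>y. gc V (gc W G) y - 1)"
  proof (rule reduce_commuting[OF K r cl Q QQ' \<sigma>1(2) q2 _ _ _ gauge_gc[OF W G] CW CA])
    show "8 * (2 ^ r)\<^sup>2 * K\<^sup>2 * real r * (Q * (6 * X)) \<le> 1"
    proof -
      have "8 * (2 ^ r)\<^sup>2 * K\<^sup>2 * real r * (Q * (6 * X)) = 48 * (P\<^sup>2 * K\<^sup>2 * Z)" by (simp add: P_def Z_def)
      moreover have "0 \<le> P\<^sup>2 * K\<^sup>2 * Z" using Z0 by simp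
      ultimately show ?thesis using PKZ by linarith
    qed
    have "P * (X * \<mu>) \<le> P * X" using X\<mu> P1 by (intro mult_left_mono) auto
    moreover have "2 ^ r * (3 * (X * (Q / Q') ^ r)) = 3 * (P * (X * \<mu>))" by (simp add: P_def \<mu>_def)
    ultimately show "2 ^ r * (3 * (X * (Q / Q') ^ r)) \<le> 1" using PZ(1) by linarith
    show "3 * (X * (Q / Q') ^ r) \<le> 1 / 2" using PZ(2) X\<mu> unfolding \<mu>_def[symmetric] by linarith
  qed
  show thesis
  proof (rule that[OF gauge_mult[OF V W]])
    show "100 * P ^ 3 * K ^ 3 * Q \<le> Q'" using QQ by (simp add: C_def)
    \<comment> \<open>The contributions 48 = 8 * 6 and 45 = 15 * 3 add up to less than 100, the
      constant already used in the lower bound for Q'.\<close>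
    have "8 * (2 ^ r)\<^sup>2 * K ^ 3 * (6 * X) * (Q / Q') ^ r + 15 * (2 ^ r) ^ 3 * K ^ 3 * (3 * (X * (Q / Q') ^ r))
       = 48 * (P\<^sup>2 * (K ^ 3 * (X * \<mu>))) + 45 * (P ^ 3 * (K ^ 3 * (X * \<mu>)))" by (simp add: P_def \<mu>_def)
    also have "\<dots> \<le> 48 * (P ^ 3 * (K ^ 3 * (X * \<mu>))) + 52 * (P ^ 3 * (K ^ 3 * (X * \<mu>)))"
      using P1 K1 X\<mu> by (intro add_mono mult_left_mono mult_right_mono power_increasing) auto
    also have "\<dots> = 100 * P ^ 3 * K ^ 3 * X * (Q / Q') ^ r" by (simp add: \<mu>_def)
    finally have "Cb UNIV r Q' (100 * P ^ 3 * K ^ 3 * X * (Q / Q') ^ r) (\<lambda>y. gc V (gc W G) y - 1)"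
      by (rule Cb_le[OF CV]) (use Q0 QQ' in simp)
    then show "Cb UNIV r Q' (100 * P ^ 3 * K ^ 3 * X * (Q / Q') ^ r) (\<lambda>y. gc (\<lambda>y. V y * W y) G y - 1)"
      by (simp only: gc_gc)
  qed
qed

text \<open>The size \<epsilon> Q^(1-r) reproduces itself: one renormalization turns it into C
  \<epsilon> Q / Q'^r, and C Q \<le> Q' absorbs the constant. The smallness condition asks for Q X
  \<le> \<epsilon>, which holds along the iteration because \<open>2 \<le> r\<close>.\<close>

lemma renormalize_iterate:
  fixes r :: nat and K :: real
  defines "\<epsilon> \<equiv> 1 / (19200 * (2 ^ r) ^ 7 * K ^ 5 * real r)"
  assumes irr: "\<alpha> \<notin> \<rat>" and K: "calc_const r K" and r: "2 \<le> r"
    and G: "gauge G" and CG: "Cb UNIV r 1 \<epsilon> (\<lambda>y. G y - 1)"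
  shows "\<exists>W Q. gauge W \<and> 2 ^ n \<le> Q \<and> Cb UNIV r Q (\<epsilon> * (1 / Q) ^ (r - 1)) (\<lambda>y. gc W G y - 1)"
proof (induction n)
  case 0
  show ?case using CG gauge_one by (intro exI[of _ "\<lambda>y. 1"] exI[of _ 1]) (simp add: gc_one)
next
  case (Suc n)
  then obtain W Q where W: "gauge W" and Q: "2 ^ n \<le> Q" and CW: "Cb UNIV r Q (\<epsilon> * (1 / Q) ^ (r - 1)) (\<lambda>y. gc W G y - 1)" by blast
  have K1: "K \<ge> 1" by (rule calc_const_ge1[OF K])
  have Q1: "1 \<le> Q" using Q one_le_power[of "2::real" n] by linarith
  obtain s where s: "r = Suc (Suc s)" using le_Suc_ex[OF r] by auto
  have \<epsilon>0: "0 < \<epsilon>" using K1 r by (simp add: \<epsilon>_def)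
  have sm: "19200 * (2 ^ r) ^ 7 * K ^ 5 * real r * (Q * (\<epsilon> * (1 / Q) ^ (r - 1))) \<le> 1"
  proof -
    have "Q * (1 / Q) ^ (r - 1) = (1 / Q) ^ s" using Q1 by (simp add: s)
    also have "\<dots> \<le> 1" using Q1 by (intro power_le_one) auto
    finally have "\<epsilon> * (Q * (1 / Q) ^ (r - 1)) \<le> \<epsilon> * 1" using \<epsilon>0 by (intro mult_left_mono) auto
    then have "19200 * (2 ^ r) ^ 7 * K ^ 5 * real r * (\<epsilon> * (Q * (1 / Q) ^ (r - 1))) \<le> 19200 * (2 ^ r) ^ 7 * K ^ 5 * real r * (\<epsilon> * 1)"
      by (elim mult_left_mono) (use K1 in auto)
    also have "\<dots> = 1" using K1 r by (simp add: \<epsilon>_def)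
    finally show ?thesis by (simp add: mult_ac)
  qed
  define C where "C = 100 * (2 ^ r) ^ 3 * K ^ 3"
  obtain V Q' where V: "gauge V" and Q': "C * Q \<le> Q'" and CV: "Cb UNIV r Q' (C * (\<epsilon> * (1 / Q) ^ (r - 1)) * (Q / Q') ^ r) (\<lambda>y. gc V (gc W G) y - 1)"
    unfolding C_def by (rule renormalize_once[OF irr K _ Q1 sm gauge_gc[OF W G] CW]) (use r in auto)
  have C2: "2 \<le> C"
  proof -
    have "1 * 1 \<le> (2 ^ r) ^ 3 * K ^ 3" using K1 by (intro mult_mono one_le_power) auto
    moreover have "C = 100 * ((2 ^ r) ^ 3 * K ^ 3)" by (simp add: C_def)
    ultimately show ?thesis by linarith
  qed
  have Q'1: "2 * Q \<le> Q'" using Q' mult_right_mono[OF C2, of Q] Q1 by linarith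
  have "C * (\<epsilon> * (1 / Q) ^ (r - 1)) * (Q / Q') ^ r = \<epsilon> * ((C * Q) * (1 / Q') ^ r)"
    using Q1 by (simp add: s power_divide field_simps)
  also have "\<dots> \<le> \<epsilon> * (Q' * (1 / Q') ^ r)"
    using \<epsilon>0 Q' Q'1 Q1 by (intro mult_left_mono mult_right_mono) auto
  also have "Q' * (1 / Q') ^ r = (1 / Q') ^ (r - 1)" using Q'1 Q1 by (simp add: s)
  finally have "Cb UNIV r Q' (\<epsilon> * (1 / Q') ^ (r - 1)) (\<lambda>y. gc V (gc W G) y - 1)"
    using Cb_le[OF CV] Q'1 Q1 by simp
  then show ?case
    using gauge_mult[OF V W] Q'1 Q unfolding gc_gc by (intro exI conjI) auto
qed

end

text \<open>In the smallness threshold the derivative order \<open>r\<close> is the only parameter: it does not depend on \<open>\<alpha>\<close>.\<close>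

lemma near_constant_reducible:
  assumes "2 \<le> r"
  obtains \<epsilon> :: real where "\<epsilon> > 0" "\<And>I J \<alpha> G \<eta>. qframe I J \<Longrightarrow> \<alpha> \<notin> \<rat> \<Longrightarrow> qframe.gauge I G \<Longrightarrow> Cb UNIV r 1 \<epsilon> (\<lambda>y. G y - 1) \<Longrightarrow>
    0 < \<eta> \<Longrightarrow> \<exists>W. qframe.gauge I W \<and> Cb UNIV (r - 2) 1 \<eta> (\<lambda>y. qframe.gc J \<alpha> W G y - 1)"
proof -
  obtain K where K: "calc_const r K" using calc_const_exists by blast
  define \<epsilon> where "\<epsilon> = 1 / (19200 * (2 ^ r) ^ 7 * K ^ 5 * real r)"
  have \<epsilon>0: "0 < \<epsilon>" using calc_const_ge1[OF K] assms by (simp add: \<epsilon>_def)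
  show thesis
  proof (rule that[OF \<epsilon>0])
    fix I J :: quat and \<alpha> :: real and G and \<eta> :: real
    assume fr: "qframe I J" and irr: "\<alpha> \<notin> \<rat>" and G: "qframe.gauge I G" and CG: "Cb UNIV r 1 \<epsilon> (\<lambda>y. G y - 1)" and \<eta>: "0 < \<eta>"
    interpret qframe I J \<alpha> by (rule fr)
    obtain n where n: "\<epsilon> / \<eta> < 2 ^ n" using real_arch_pow[of 2 "\<epsilon> / \<eta>"] by auto
    obtain W Q where W: "gauge W" and Q: "2 ^ n \<le> Q" and CW: "Cb UNIV r Q (\<epsilon> * (1 / Q) ^ (r - 1)) (\<lambda>y. gc W G y - 1)"
      using renormalize_iterate[OF irr K assms G CG[unfolded \<epsilon>_def], of n] unfolding \<epsilon>_def by blast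
    have Q1: "1 \<le> Q" using Q one_le_power[of "2::real" n] by linarith
    have "Cb UNIV (r - 2) 1 \<eta> (\<lambda>y. gc W G y - 1)"
      unfolding Cb_def
    proof (intro conjI allI impI ballI)
      show "smooth_on UNIV (\<lambda>y. gc W G y - 1)" by (rule Cb_smooth[OF CW])
      fix m x assume m: "m \<le> r - 2"
      have "norm (nth_deriv m (\<lambda>y. gc W G y - 1) x) \<le> \<epsilon> * (1 / Q) ^ (r - 1) * Q ^ m"
        using CbD[OF CW, of m x] m by simp
      \<comment> \<open>Giving up two orders of differentiability leaves a factor 1/Q, which the
        choice of \<open>n\<close> makes small enough.\<close>
      also have "\<dots> \<le> \<epsilon> * (1 / Q) ^ (r - 1) * Q ^ (r - 2)"
        using m Q1 \<epsilon>0 by (intro mult_left_mono power_increasing) auto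
      also have "\<dots> = \<epsilon> / Q"
      proof -
        obtain s where s: "r = Suc (Suc s)" using le_Suc_ex[OF assms] by auto
        show ?thesis using Q1 by (simp add: s power_divide)
      qed
      also have "\<dots> \<le> \<eta>"
      proof -
        have "\<epsilon> / \<eta> \<le> Q" using n Q by linarith
        then show ?thesis using \<eta> Q1 by (simp add: field_simps)
      qed
      finally show "norm (nth_deriv m (\<lambda>y. gc W G y - 1) x) \<le> \<eta> * 1 ^ m" by simp
    qed
    then show "\<exists>W. gauge W \<and> Cb UNIV (r - 2) 1 \<eta> (\<lambda>y. gc W G y - 1)" using W by blast
  qed
qed

subsection \<open>Straightening a curve near a constant\<close>

lemma Cb_shift_on:
  assumes "open S" "Cb S r Q b f"
  shows "Cb {y. y + t \<in> S} r Q b (\<lambda>y. f (y + t))"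
proof -
  have o: "open {y. y + t \<in> S}"
    using open_vimage[OF assms(1), of "\<lambda>y. y + t"] by (simp add: vimage_def continuous_intros)
  show ?thesis
    using smooth_on_affine[OF assms(1) o, of 1 t f] nth_deriv_affine[OF assms(1) o, of 1 t f] assms(2)
    by (auto simp: Cb_def)
qed

lemma Cb_lmult:
  assumes "norm (X::quat) = 1" "open S" "Cb S r Q b f"
  shows "Cb S r Q b (\<lambda>y. X * f y)"
  using Cb_linear[OF bounded_linear_mult_right[of X], of 1 S r Q b f] assms by (simp add: norm_quat_mult)

lemma continuous_bounded_Cb:
  assumes "smooth_on UNIV f" "S \<subseteq> {a..b::real}"
  obtains C where "C \<ge> 1" "Cb S r 1 C f"
proof -
  have "\<exists>C. \<forall>x\<in>{a..b}. norm (nth_deriv m f x) \<le> C" for m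
  proof -
    have "continuous_on {a..b} (nth_deriv m f)"
      by (rule continuous_on_subset[OF smooth_on_continuous[OF assms(1)]]) simp
    then have "bounded (nth_deriv m f ` {a..b})" by (intro compact_imp_bounded compact_continuous_image) auto
    then show ?thesis by (auto simp: bounded_iff)
  qed
  then obtain c where c: "\<And>m x. x \<in> {a..b} \<Longrightarrow> norm (nth_deriv m f x) \<le> c m" by metis
  show thesis
  proof (rule that[of "1 + (\<Sum>m\<le>r. \<bar>c m\<bar>)"])
    show "1 \<le> 1 + (\<Sum>m\<le>r. \<bar>c m\<bar>)" by (simp add: sum_nonneg)
    show "Cb S r 1 (1 + (\<Sum>m\<le>r. \<bar>c m\<bar>)) f"
      unfolding Cb_def
    proof (intro conjI allI impI ballI)
      show "smooth_on S f" using assms(1) smooth_on_subset by blast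
      fix m x assume m: "m \<le> r" and x: "x \<in> S"
      have "norm (nth_deriv m f x) \<le> \<bar>c m\<bar>" using c[of x m] x assms(2) by force
      also have "\<dots> \<le> (\<Sum>m\<le>r. \<bar>c m\<bar>)" using m by (intro member_le_sum) auto
      finally show "norm (nth_deriv m f x) \<le> (1 + (\<Sum>m\<le>r. \<bar>c m\<bar>)) * 1 ^ m" by simp
    qed
  qed
qed

section \<open>Normalization of quaternion curves\<close>

lemma smooth_on_norm_sq:
  "smooth_on UNIV f \<Longrightarrow> smooth_on UNIV (\<lambda>y. (norm (f y :: quat))\<^sup>2)"
proof -
  assume f: "smooth_on UNIV f"
  have "(norm x)\<^sup>2 = qre (x * qcnj x)" for x :: quat by (simp only: quat_mult_cnj) (simp add: of_real_def)
  then show ?thesis using f by (simp only:) (intro smooth_on_qre smooth_on_mult smooth_on_qcnj open_UNIV)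
qed

text \<open>Radial projection to the unit sphere. The norm appears as the root of its square because
  the square is polynomial in the coordinates and the root is smooth on positive numbers.\<close>

definition qsgn :: "quat \<Rightarrow> quat" where
  "qsgn x = inverse (sqrt ((norm x)\<^sup>2)) *\<^sub>R x"

lemma qsgn_eq: "qsgn x = inverse (norm x) *\<^sub>R x"
  by (simp add: qsgn_def)

lemma norm_qsgn: "x \<noteq> 0 \<Longrightarrow> norm (qsgn x) = 1" and qsgn_unit: "norm x = 1 \<Longrightarrow> qsgn x = x"
  by (simp_all add: qsgn_eq)

lemma smooth_on_qsgn:
  assumes "smooth_on UNIV f" "\<And>y. f y \<noteq> 0"
  shows "smooth_on UNIV (\<lambda>y. qsgn (f y))"
  unfolding qsgn_def
  by (intro smooth_on_scaleR smooth_on_inverse smooth_on_sqrt smooth_on_norm_sq assms open_UNIV)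
     (use assms(2) in auto)

lemma Cb_qsgn:
  "\<exists>C\<ge>1. \<forall>S (f :: real \<Rightarrow> quat) b. open S \<longrightarrow> C * b \<le> 1 \<longrightarrow> Cb S r 1 b (\<lambda>y. f y - 1) \<longrightarrow> Cb S r 1 (C * b) (\<lambda>y. qsgn (f y) - 1)"
proof -
  obtain K1 where K1: "K1 \<ge> 1" "\<forall>S (f :: real \<Rightarrow> real) Q b. open S \<longrightarrow> 0 \<le> Q \<longrightarrow> b \<le> 1/2 \<longrightarrow> Cb S r Q b f \<longrightarrow>
    Cb S r Q (K1 * b) (\<lambda>x. inverse (1 + f x) - 1)" using Cb_inverse[of r] by blast
  obtain K2 where K2: "K2 \<ge> 1" "\<forall>S (f :: real \<Rightarrow> real) Q b. open S \<longrightarrow> 0 \<le> Q \<longrightarrow> b \<le> 1/2 \<longrightarrow> Cb S r Q b f \<longrightarrow>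
    Cb S r Q (K2 * b) (\<lambda>x. sqrt (1 + f x) - 1)" using Cb_sqrt[of r] by blast
  define P :: real where "P = 2 ^ r"
  have P1: "P \<ge> 1" by (simp add: P_def)
  define L where "L = 2 + P"
  define M where "M = K1 * (K2 * L)"
  define C where "C = 2 * M + 2 * P * M + 1"
  have L: "3 \<le> L" using P1 by (simp add: L_def)
  have K2L: "3 \<le> K2 * L" using mult_mono[OF K2(1) L] K2(1) by simp
  have "1 * L \<le> K2 * L" "1 * (K2 * L) \<le> K1 * (K2 * L)"
    using K1(1) K2(1) L K2L by (intro mult_right_mono; linarith)+
  then have M: "3 \<le> M" "L \<le> M" "K2 * L \<le> M" using L unfolding M_def by linarith+
  have "1 * M \<le> P * M" using P1 M by (intro mult_right_mono) auto
  then have C: "1 \<le> C" "2 * M \<le> C" "P * M + M \<le> C" using M by (auto simp: C_def)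
  show ?thesis
  proof (intro exI[of _ C] conjI allI impI)
    show "1 \<le> C" by (rule C)
    fix S and f :: "real \<Rightarrow> quat" and b
    assume S: "open S" and b: "C * b \<le> 1" and f: "Cb S r 1 b (\<lambda>y. f y - 1)"
    show "Cb S r 1 (C * b) (\<lambda>y. qsgn (f y) - 1)"
    proof (cases "S = {}")
      case True then show ?thesis by (auto simp: Cb_def smooth_on_def)
    next
      case False
      then have b0: "0 \<le> b" using CbD0[OF f] by (meson equals0I norm_ge_zero order_trans)
      have b1: "2 * M * b \<le> 1" using mult_right_mono[OF C(2) b0] b by linarith
      have b2: "b \<le> 1" using b1 mult_right_mono[OF M(1) b0] b0 by linarith
      define t where "t = (\<lambda>y. 2 * qre (f y - 1) + qre ((f y - 1) * qcnj (f y - 1)))"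
      have nt: "(norm (f y))\<^sup>2 = 1 + t y" for y
        by (simp add: t_def norm_quat_eq power2_eq_square algebra_simps)
      have "Cb S r 1 (\<bar>2\<bar> * b + P * b * b) (\<lambda>y. 2 *\<^sub>R qre (f y - 1) + qre ((f y - 1) * qcnj (f y - 1)))"
        unfolding P_def by (intro Cb_add Cb_cmult Cb_qre Cb_mult Cb_qcnj f S)
      moreover have "\<bar>2\<bar> * b + P * b * b \<le> L * b"
        using mult_left_mono[OF b2, of "P * b"] P1 b0 by (simp add: L_def algebra_simps)
      ultimately have Ct: "Cb S r 1 (L * b) t" unfolding t_def using Cb_le by fastforce
      have Lb: "L * b \<le> 1/2" "K2 * L * b \<le> 1/2"
        using mult_right_mono[OF M(2) b0] mult_right_mono[OF M(3) b0] b1 by auto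
      have C1: "Cb S r 1 (K2 * (L * b)) (\<lambda>y. sqrt (1 + t y) - 1)" using K2(2) S Lb(1) Ct by simp
      have C2: "Cb S r 1 (K1 * (K2 * (L * b))) (\<lambda>y. inverse (1 + (sqrt (1 + t y) - 1)) - 1)"
        using K1(2)[rule_format, OF S _ _ C1] Lb(2) by (simp add: mult.assoc)
      then have C3: "Cb S r 1 (M * b) (\<lambda>y. inverse (sqrt ((norm (f y))\<^sup>2)) - 1)"
        unfolding nt by (simp add: M_def mult.assoc)
      have "Cb S r 1 (P * (M * b) * (b + 1) + b) (\<lambda>y. (inverse (sqrt ((norm (f y))\<^sup>2)) - 1) *\<^sub>R ((f y - 1) + 1) + (f y - 1))"
        unfolding P_def by (intro Cb_add Cb_scaleR C3 f Cb_const S) auto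
      moreover have "(\<lambda>y. (inverse (sqrt ((norm (f y))\<^sup>2)) - 1) *\<^sub>R ((f y - 1) + 1) + (f y - 1)) = (\<lambda>y. qsgn (f y) - 1)"
        by (simp add: qsgn_def algebra_simps fun_eq_iff)
      ultimately have "Cb S r 1 (P * (M * b) * (b + 1) + b) (\<lambda>y. qsgn (f y) - 1)" by (simp only:)
      moreover have "P * (M * b) * (b + 1) + b \<le> C * b"
      proof -
        have "P * (M * b) * (b + 1) \<le> P * (M * b) * 2" using P1 M b0 b2 by (intro mult_left_mono) auto
        moreover have "b \<le> 2 * M * b" using mult_right_mono[of 1 "2 * M" b] M b0 by simp
        moreover have "C * b = 2 * M * b + P * (M * b) * 2 + b" by (simp add: C_def algebra_simps)
        ultimately show ?thesis using b0 by linarith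
      qed
      ultimately show ?thesis by (rule Cb_le) simp
    qed
  qed
qed

text \<open>On a fundamental interval, \<open>B0\<close> moves from 1 near 0 to the value X P (y -
  1)^-1 that the functional equation prescribes near 1. These values differ by at most 1/2 there, so
  the segment between them avoids 0 and can be normalized. The equation extends the piece, by
  \<open>U\<close> to the right and by \<open>D\<close> to the left; the explicit formulas are kept
  in the conclusion for the estimates that follow.\<close>

lemma frame_exists:
  fixes P :: "real \<Rightarrow> quat" and X :: quat and \<sigma> :: "real \<Rightarrow> real"
  assumes P: "smooth_on UNIV P" "\<And>y. norm (P y) = 1" and X: "norm X = 1"
    and near: "\<And>y. \<bar>y\<bar> \<le> 1 \<Longrightarrow> norm (P y - X) \<le> 1/2"
    and \<sigma>: "smooth_on UNIV \<sigma>" "\<And>y. 0 \<le> \<sigma> y" "\<And>y. \<sigma> y \<le> 1" "\<And>y. y \<le> 1/3 \<Longrightarrow> \<sigma> y = 0" "\<And>y. 2/3 \<le> y \<Longrightarrow> \<sigma> y = 1"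
  defines "U \<equiv> \<lambda>f y. X * f (y - 1) * qcnj (P (y - 1))" and "D \<equiv> \<lambda>f y. qcnj X * f (y + 1) * P y"
    and "B0 \<equiv> \<lambda>y. qsgn (1 + \<sigma> y *\<^sub>R (X * qcnj (P (y - 1)) - 1))"
  obtains B where "smooth_on UNIV B" "\<forall>y. norm (B y) = 1" "\<forall>y. B (y + 1) * P y = X * B y"
    "\<forall>n y. real n - 1/3 < y \<longrightarrow> y < real n + 1 \<longrightarrow> B y = (U ^^ n) B0 y"
    "\<forall>n y. - real n - 1/3 < y \<longrightarrow> y < - real n + 1 \<longrightarrow> B y = (D ^^ n) B0 y"
proof -
  define H where "H = (\<lambda>y. X * qcnj (P (y - 1)))"
  define N where "N = (\<lambda>y. 1 + \<sigma> y *\<^sub>R (H y - 1))"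
  have nH: "norm (H y) = 1" for y by (simp add: H_def norm_quat_mult X P)
  have sH: "smooth_on UNIV H"
    unfolding H_def using smooth_on_shift[OF P(1), of "-1"] by (intro smooth_on_mult smooth_on_const smooth_on_qcnj) auto
  have H1: "norm (H y - 1) \<le> 1/2" if "\<bar>y - 1\<bar> \<le> 1" for y
  proof -
    have "H y - 1 = X * qcnj (P (y - 1) - X)" using X by (simp add: H_def qcnj_diff algebra_simps)
    then show ?thesis using near[OF that] by (simp add: norm_quat_mult X)
  qed
  have N0: "N y \<noteq> 0" for y
  proof -
    consider "y \<le> 1/3" | "2/3 \<le> y" | "1/3 < y" "y < 2/3" by linarith
    then show ?thesis
    proof cases
      case 1 then show ?thesis by (simp add: N_def \<sigma>)
    next
      case 2 then have "N y = H y" by (simp add: N_def \<sigma>)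
      then show ?thesis using nH[of y] by auto
    next
      case 3
      have "norm (\<sigma> y *\<^sub>R (H y - 1)) \<le> 1 * (1/2)"
        unfolding norm_scaleR using H1[of y] 3 \<sigma>(2,3)[of y] by (intro mult_mono) auto
      then have "norm (- (\<sigma> y *\<^sub>R (H y - 1))) < norm (1::quat)" by simp
      then show ?thesis unfolding N_def by (metis add_eq_0_iff less_irrefl norm_minus_cancel)
    qed
  qed
  have B0N: "B0 = (\<lambda>y. qsgn (N y))" by (simp add: B0_def N_def H_def)
  have sB0: "smooth_on UNIV B0"
    unfolding B0N by (intro smooth_on_qsgn N0) (auto simp: N_def intro!: smooth_on_add smooth_on_const smooth_on_scaleR smooth_on_diff \<sigma> sH)
  have nB0: "norm (B0 y) = 1" for y unfolding B0N by (rule norm_qsgn[OF N0])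
  have B0l: "B0 y = 1" if "y \<le> 1/3" for y using that by (simp add: B0N N_def \<sigma> qsgn_unit)
  have B0r: "B0 y = H y" if "2/3 \<le> y" for y using that nH by (simp add: B0N N_def \<sigma> qsgn_unit)
  define F where "F = (\<lambda>n::int. if n \<ge> 0 then (U ^^ nat n) B0 else (D ^^ nat (- n)) B0)"
  have UD: "U (D f) = f" "D (U f) = f" for f
    using X P(2) by (auto simp: U_def D_def fun_eq_iff mult.assoc)
  have FU: "F (n + 1) = U (F n)" for n
  proof (cases "n \<ge> 0")
    case True then show ?thesis by (simp add: F_def nat_add_distrib)
  next
    case False
    then obtain k where k: "nat (- n) = Suc k" by (cases "nat (- n)") auto
    then have n: "n = - int k - 1" using False by linarith
    show ?thesis
    proof (cases "k = 0")
      case True then show ?thesis using n by (simp add: F_def UD)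
    next
      case False
      then have "F (n + 1) = (D ^^ k) B0" "F n = (D ^^ Suc k) B0" using n by (simp_all add: F_def nat_add_distrib)
      then show ?thesis by (simp add: UD)
    qed
  qed
  have FD: "F n = D (F (n + 1))" for n by (simp add: FU UD)
  have sU: "smooth_on UNIV (U f)" "smooth_on UNIV (D f)" if "smooth_on UNIV f" for f
    unfolding U_def D_def
    using smooth_on_shift[OF that, of "-1"] smooth_on_shift[OF that, of 1] smooth_on_shift[OF P(1), of "-1"] P(1)
    by (auto intro!: smooth_on_mult smooth_on_const smooth_on_qcnj)
  have nU: "\<forall>y. norm (U f y) = 1" "\<forall>y. norm (D f y) = 1" if "\<forall>y. norm (f y) = 1" for f
    using that by (simp_all add: U_def D_def norm_quat_mult X P)
  have sUp: "smooth_on UNIV ((U ^^ k) B0) \<and> (\<forall>y. norm ((U ^^ k) B0 y) = 1)" for k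
    by (induction k) (auto simp: sB0 nB0 sU nU)
  have sDp: "smooth_on UNIV ((D ^^ k) B0) \<and> (\<forall>y. norm ((D ^^ k) B0 y) = 1)" for k
    by (induction k) (auto simp: sB0 nB0 sU nU)
  have sF: "smooth_on UNIV (F n)" "norm (F n y) = 1" for n y using sUp sDp by (auto simp: F_def)
  \<comment> \<open>Neighbouring pieces agree on an interval around their common integer endpoint,
    because \<open>\<sigma>\<close> is constant near 0 and near 1; this makes the glued curve
    smooth.\<close>
  have match: "F (n + 1) y = F n y" if "\<bar>y - (of_int n + 1)\<bar> < 1/3" for n y
  proof -
    have up: "F (int k + 1) y = F (int k) y" if "\<bar>y - (real k + 1)\<bar> < 1/3" for k y
      using that
    proof (induction k arbitrary: y)
      case 0
      then have "\<bar>y - 1\<bar> < 1/3" by simp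
      then have "y - 1 \<le> 1/3" "2/3 \<le> y" by linarith+
      then have "F 1 y = B0 y" using FU[of 0] B0l[of "y - 1"] B0r[of y] by (simp add: F_def U_def H_def)
      then show ?case by (simp add: F_def)
    next
      case (Suc k)
      have "y - 1 - (real k + 1) = y - (real (Suc k) + 1)" by simp
      then have "F (int k + 1) (y - 1) = F (int k) (y - 1)" using Suc.prems by (intro Suc.IH) (simp only:)
      then have "U (F (int k + 1)) y = U (F (int k)) y" by (simp add: U_def)
      then show ?case by (simp add: FU[symmetric] add.commute)
    qed
    have down: "F (- int k + 1) y = F (- int k) y" if "\<bar>y - (- real k + 1)\<bar> < 1/3" for k y
      using that
    proof (induction k arbitrary: y)
      case 0 then show ?case using up[of y 0] by simp
    next
      case (Suc k)
      have "y + 1 - (- real k + 1) = y - (- real (Suc k) + 1)" by simp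
      then have "F (- int k + 1) (y + 1) = F (- int k) (y + 1)" using Suc.prems by (intro Suc.IH) (simp only:)
      then have "D (F (- int k + 1)) y = D (F (- int k)) y" by (simp add: D_def)
      moreover have "D (F (- int k + 1)) = F (- int k)" "D (F (- int k)) = F (- int (Suc k))"
        using FD[of "- int k"] FD[of "- int (Suc k)"] by (simp_all add: algebra_simps)
      ultimately show ?case by (simp add: algebra_simps)
    qed
    show ?thesis
    proof (cases "n \<ge> 0")
      case True then show ?thesis using up[of y "nat n"] that by simp
    next
      case False then show ?thesis using down[of y "nat (- n)"] that by simp
    qed
  qed
  define B where "B = (\<lambda>y. F \<lfloor>y\<rfloor> y)"
  have BF: "B y = F n y" if "of_int n - 1/3 < y" "y < of_int n + 1" for n y
  proof (cases "of_int n \<le> y")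
    case True
    then have "\<lfloor>y\<rfloor> = n" using that by (intro floor_unique) auto
    then show ?thesis by (simp add: B_def)
  next
    case False
    then have "\<lfloor>y\<rfloor> = n - 1" using that by (intro floor_unique) auto
    then show ?thesis using match[of y "n - 1"] that False by (simp add: B_def)
  qed
  show thesis
  proof (rule that[of B])
    have "\<forall>r x. nth_deriv r B differentiable at x"
    proof (intro allI)
      fix r and x :: real
      let ?S = "{of_int \<lfloor>x\<rfloor> - 1/3 <..< of_int \<lfloor>x\<rfloor> + (1::real)}"
      have x: "x \<in> ?S" by simp linarith
      have "smooth_on ?S B"
        by (rule smooth_on_cong[where f="F \<lfloor>x\<rfloor>"]) (use BF smooth_on_subset[OF sF(1)] in auto)
      then show "nth_deriv r B differentiable at x" using x by (auto simp: smooth_on_def)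
    qed
    then show "smooth_on UNIV B" by (simp add: smooth_on_def)
    show "\<forall>y. norm (B y) = 1" by (simp add: B_def sF)
    show "\<forall>y. B (y + 1) * P y = X * B y"
    proof
      fix y
      have "B (y + 1) = U (F \<lfloor>y\<rfloor>) (y + 1)" by (simp add: B_def FU)
      then show "B (y + 1) * P y = X * B y" using P(2) by (simp add: U_def B_def mult.assoc)
    qed
    show "\<forall>n y. real n - 1/3 < y \<longrightarrow> y < real n + 1 \<longrightarrow> B y = (U ^^ n) B0 y"
    proof (intro allI impI)
      fix n y assume "real n - 1/3 < y" "y < real n + 1"
      then show "B y = (U ^^ n) B0 y" using BF[of "int n" y] by (simp add: F_def)
    qed
    show "\<forall>n y. - real n - 1/3 < y \<longrightarrow> y < - real n + 1 \<longrightarrow> B y = (D ^^ n) B0 y"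
    proof (intro allI impI)
      fix n y assume "- real n - 1/3 < y" "y < - real n + 1"
      then show "B y = (D ^^ n) B0 y" using BF[of "- int n" y] by (cases "n = 0") (simp_all add: F_def)
    qed
  qed
qed

text \<open>Every use of the functional equation enlarges the distance from 1, so a bound is stated
  only within two unit steps of the fundamental interval. That range is enough for arguments in (-1,
  2) shifted by at most 1; the rest of the line is reached later by periodicity.\<close>

lemma frame:
  "\<exists>C\<ge>1. \<forall>P X \<delta>. smooth_on UNIV P \<longrightarrow> (\<forall>y. norm (P y) = 1) \<longrightarrow> norm X = 1 \<longrightarrow> C * \<delta> \<le> 1 \<longrightarrow>
     Cb {-4<..<4} r 1 \<delta> (\<lambda>y. P y - X) \<longrightarrow>
     (\<exists>B. smooth_on UNIV B \<and> (\<forall>y. norm (B y) = 1) \<and> (\<forall>y. B (y + 1) * P y = X * B y) \<and> Cb {-2<..<3} r 1 (C * \<delta>) (\<lambda>y. B y - (1::quat)))"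
proof -
  obtain \<sigma> :: "real \<Rightarrow> real" where \<sigma>: "smooth_on UNIV \<sigma>" "\<And>y. 0 \<le> \<sigma> y" "\<And>y. \<sigma> y \<le> 1" "\<And>y. y \<le> 1/3 \<Longrightarrow> \<sigma> y = 0" "\<And>y. 2/3 \<le> y \<Longrightarrow> \<sigma> y = 1"
    using smooth_step by metis
  obtain c\<sigma> where c\<sigma>: "c\<sigma> \<ge> 1" "Cb {-1/3<..<1} r 1 c\<sigma> \<sigma>"
    by (rule continuous_bounded_Cb[OF \<sigma>(1), of "{-1/3<..<1}" "-1/3" 1 r]) auto
  obtain cq where cq: "cq \<ge> 1" "\<forall>S (f :: real \<Rightarrow> quat) b. open S \<longrightarrow> cq * b \<le> 1 \<longrightarrow> Cb S r 1 b (\<lambda>y. f y - 1) \<longrightarrow> Cb S r 1 (cq * b) (\<lambda>y. qsgn (f y) - 1)"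
    using Cb_qsgn[of r] by blast
  define q where "q = (2::real) ^ r"
  have q1: "1 \<le> q" by (simp add: q_def)
  \<comment> \<open>\<open>k0\<close> accounts for interpolation and normalization in
    \<open>B0\<close>; one application of \<open>U\<close> or \<open>D\<close> turns a constant k
    into 2 q k + 1.\<close>
  define k0 where "k0 = cq * (q * c\<sigma>)"
  define k1 where "k1 = 2 * q * k0 + 1"
  define k2 where "k2 = 2 * q * k1 + 1"
  have "1 * 1 \<le> q * c\<sigma>" using q1 c\<sigma> by (intro mult_mono) auto
  then have "1 * 1 \<le> k0" unfolding k0_def using cq by (intro mult_mono) auto
  then have k0: "1 \<le> k0" by simp
  have "1 * k0 \<le> 2 * q * k0" using q1 k0 by (intro mult_right_mono) auto
  then have k1: "k0 \<le> k1" "1 \<le> k1" using k0 unfolding k1_def by linarith+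
  have "1 * k1 \<le> 2 * q * k1" using q1 k1 by (intro mult_right_mono) auto
  then have k2: "k1 \<le> k2" "1 \<le> k2" "k0 \<le> k2" using k1 unfolding k2_def by linarith+
  show ?thesis
  proof (intro exI[of _ "2 * k2"] conjI allI impI)
    show "1 \<le> 2 * k2" using k2 by simp
    fix P :: "real \<Rightarrow> quat" and X :: quat and \<delta> :: real
    assume sP: "smooth_on UNIV P" and nP: "\<forall>y. norm (P y) = 1" and X: "norm X = 1" and \<delta>: "2 * k2 * \<delta> \<le> 1"
      and CP: "Cb {-4<..<4} r 1 \<delta> (\<lambda>y. P y - X)"
    have \<delta>0: "0 \<le> \<delta>" using CbD0[OF CP, of 0] norm_ge_zero order_trans by (metis greaterThanLessThan_iff neg_less_0_iff_less zero_less_numeral)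
    have k\<delta>: "k0 * \<delta> \<le> k2 * \<delta>" "k1 * \<delta> \<le> k2 * \<delta>" "\<delta> \<le> k2 * \<delta>"
      using k2 \<delta>0 mult_right_mono[of 1 k2 \<delta>] by (auto intro: mult_right_mono)
    have \<delta>1: "\<delta> \<le> 1/2" "k0 * \<delta> \<le> 1" using k\<delta> \<delta> by auto
    define U where "U = (\<lambda>f y. X * f (y - 1) * qcnj (P (y - 1)))"
    define D where "D = (\<lambda>f y. qcnj X * f (y + 1) * P y)"
    define B0 where "B0 = (\<lambda>y. qsgn (1 + \<sigma> y *\<^sub>R (X * qcnj (P (y - 1)) - 1)))"
    have near: "norm (P y - X) \<le> 1/2" if "\<bar>y\<bar> \<le> 1" for y
      using CbD0[OF CP, of y] that \<delta>1 by (auto simp: abs_le_iff)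
    obtain B where B: "smooth_on UNIV B" "\<forall>y. norm (B y) = 1" "\<forall>y. B (y + 1) * P y = X * B y"
      and BU': "\<forall>n y. real n - 1/3 < y \<longrightarrow> y < real n + 1 \<longrightarrow> B y = (U ^^ n) B0 y"
      and BD': "\<forall>n y. - real n - 1/3 < y \<longrightarrow> y < - real n + 1 \<longrightarrow> B y = (D ^^ n) B0 y"
      unfolding U_def D_def B0_def by (rule frame_exists[OF sP nP[rule_format] X near \<sigma>])
    note BU = BU'[rule_format] and BD = BD'[rule_format]
    have cX: "norm (qcnj X) = 1" using X by simp
    have CP1: "Cb T r 1 2 P" if "open T" "T \<subseteq> {-4<..<4}" for T
    proof -
      have "Cb T r 1 (\<delta> + 1) (\<lambda>y. (P y - X) + X)"
        by (intro Cb_add Cb_const that(1) Cb_mono[OF CP that(2)]) (use X \<delta>0 in auto)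
      then have "Cb T r 1 (\<delta> + 1) P" by simp
      then show ?thesis by (rule Cb_le) (use \<delta>1 in auto)
    qed
    have XP: "Cb T r 1 \<delta> (\<lambda>y. X * qcnj (P y) - 1)" "Cb T r 1 \<delta> (\<lambda>y. qcnj X * P y - 1)" if "open T" "T \<subseteq> {-4<..<4}" for T
    proof -
      have "Cb T r 1 \<delta> (\<lambda>y. X * qcnj (P y - X))" "Cb T r 1 \<delta> (\<lambda>y. qcnj X * (P y - X))"
        by (intro Cb_lmult Cb_qcnj Cb_mono[OF CP that(2)] X cX that(1); use \<delta>0 in simp)+
      then show "Cb T r 1 \<delta> (\<lambda>y. X * qcnj (P y) - 1)" "Cb T r 1 \<delta> (\<lambda>y. qcnj X * P y - 1)"
        using X by (simp_all add: qcnj_diff right_diff_distrib)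
    qed
    have up: "Cb {y. y + -1 \<in> T} r 1 ((2 * q * k + 1) * \<delta>) (\<lambda>y. U f y - 1)"
      if T: "open T" "T \<subseteq> {-4<..<4}" and f: "Cb T r 1 (k * \<delta>) (\<lambda>y. f y - 1)" for T f k
    proof -
      have "Cb T r 1 (2 ^ r * (k * \<delta>) * 2 + \<delta>) (\<lambda>y. X * (f y - 1) * qcnj (P y) + (X * qcnj (P y) - 1))"
        by (intro Cb_add Cb_mult Cb_lmult Cb_qcnj CP1 XP T X f)
      then have "Cb T r 1 ((2 * q * k + 1) * \<delta>) (\<lambda>y. X * f y * qcnj (P y) - 1)"
        by (simp add: q_def algebra_simps)
      from Cb_shift_on[OF T(1) this, of "-1"] show ?thesis by (simp add: U_def)
    qed
    have down: "Cb T r 1 ((2 * q * k + 1) * \<delta>) (\<lambda>y. D f y - 1)"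
      if T: "open T" "T \<subseteq> {-4<..<4}" and S: "open S" "\<And>y. y \<in> T \<Longrightarrow> y + 1 \<in> S" and f: "Cb S r 1 (k * \<delta>) (\<lambda>y. f y - 1)" for S T f k
    proof -
      have "Cb T r 1 (k * \<delta>) (\<lambda>y. f (y + 1) - 1)"
        using Cb_shift_on[OF S(1) f, of 1] S(2) by (auto simp: Cb_def intro: smooth_on_subset)
      then have "Cb T r 1 (2 ^ r * (k * \<delta>) * 2 + \<delta>) (\<lambda>y. qcnj X * (f (y + 1) - 1) * P y + (qcnj X * P y - 1))"
        by (intro Cb_add Cb_mult Cb_lmult CP1 XP T cX)
      then show ?thesis by (simp add: q_def D_def algebra_simps)
    qed
    let ?T = "\<lambda>n::real. {n - 1/3 <..< n + 1}"
    have F0: "Cb (?T 0) r 1 (k0 * \<delta>) (\<lambda>y. B0 y - 1)"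
    proof -
      have "Cb {y. y + -1 \<in> {-4<..<4::real}} r 1 \<delta> (\<lambda>y. X * qcnj (P (y + -1)) - 1)"
        by (rule Cb_shift_on[OF _ XP(1)]) auto
      then have "Cb {y. y + -1 \<in> {-4<..<4::real}} r 1 \<delta> (\<lambda>y. X * qcnj (P (y - 1)) - 1)"
        by (simp only: diff_conv_add_uminus)
      then have "Cb (?T 0) r 1 \<delta> (\<lambda>y. X * qcnj (P (y - 1)) - 1)"
        by (rule Cb_mono) (use \<delta>0 in auto)
      then have "Cb (?T 0) r 1 (2 ^ r * c\<sigma> * \<delta>) (\<lambda>y. \<sigma> y *\<^sub>R (X * qcnj (P (y - 1)) - 1))"
        by (intro Cb_scaleR) (use c\<sigma> in auto)
      then have "Cb (?T 0) r 1 (cq * (2 ^ r * c\<sigma> * \<delta>)) (\<lambda>y. B0 y - 1)"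
        unfolding B0_def using \<delta>1 cq(2) by (simp add: k0_def q_def mult.assoc)
      then show ?thesis by (simp add: k0_def q_def mult.assoc)
    qed
    have sh: "{y. y + -1 \<in> ?T n} = ?T (n + 1)" for n by auto
    have F1: "Cb (?T 1) r 1 (k1 * \<delta>) (\<lambda>y. U B0 y - 1)"
    proof -
      have "Cb {y. y + -1 \<in> ?T 0} r 1 ((2 * q * k0 + 1) * \<delta>) (\<lambda>y. U B0 y - 1)" by (rule up[OF _ _ F0]) auto
      then show ?thesis unfolding sh k1_def by simp
    qed
    have F2: "Cb (?T 2) r 1 (k2 * \<delta>) (\<lambda>y. U (U B0) y - 1)"
    proof -
      have "Cb {y. y + -1 \<in> ?T 1} r 1 ((2 * q * k1 + 1) * \<delta>) (\<lambda>y. U (U B0) y - 1)" by (rule up[OF _ _ F1]) auto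
      then show ?thesis unfolding sh k2_def by simp
    qed
    have G1: "Cb (?T (-1)) r 1 (k1 * \<delta>) (\<lambda>y. D B0 y - 1)"
      unfolding k1_def by (rule down[OF _ _ _ _ F0]) auto
    have G2: "Cb (?T (-2)) r 1 (k2 * \<delta>) (\<lambda>y. D (D B0) y - 1)"
      unfolding k2_def by (rule down[OF _ _ _ _ G1]) auto
    have cover: "Cb (?T n) r 1 (2 * k2 * \<delta>) (\<lambda>y. B y - 1)" if "n = 0 \<or> n = 1 \<or> n = 2 \<or> n = -1 \<or> n = -2" for n
    proof -
      have le: "k0 * \<delta> \<le> 2 * k2 * \<delta>" "k1 * \<delta> \<le> 2 * k2 * \<delta>" "k2 * \<delta> \<le> 2 * k2 * \<delta>"
      proof -
        have "2 * k2 * \<delta> = k2 * \<delta> + k2 * \<delta>" by simp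
        then show "k0 * \<delta> \<le> 2 * k2 * \<delta>" "k1 * \<delta> \<le> 2 * k2 * \<delta>" "k2 * \<delta> \<le> 2 * k2 * \<delta>"
          using k\<delta> \<delta>0 by linarith+
      qed
      have "Cb (?T 0) r 1 (2 * k2 * \<delta>) (\<lambda>y. B y - 1)"
        by (rule Cb_cong[OF _ Cb_le[OF F0 le(1)]]) (use BU[of 0] in auto)
      moreover have "Cb (?T 1) r 1 (2 * k2 * \<delta>) (\<lambda>y. B y - 1)"
        by (rule Cb_cong[OF _ Cb_le[OF F1 le(2)]]) (use BU[of 1] in auto)
      moreover have "Cb (?T 2) r 1 (2 * k2 * \<delta>) (\<lambda>y. B y - 1)"
        by (rule Cb_cong[OF _ Cb_le[OF F2 le(3)]]) (use BU[of 2] in \<open>auto simp: numeral_2_eq_2\<close>)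
      moreover have "Cb (?T (-1)) r 1 (2 * k2 * \<delta>) (\<lambda>y. B y - 1)"
        by (rule Cb_cong[OF _ Cb_le[OF G1 le(2)]]) (use BD[of 1] in auto)
      moreover have "Cb (?T (-2)) r 1 (2 * k2 * \<delta>) (\<lambda>y. B y - 1)"
        by (rule Cb_cong[OF _ Cb_le[OF G2 le(3)]]) (use BD[of 2] in \<open>auto simp: numeral_2_eq_2\<close>)
      ultimately show ?thesis using that by auto
    qed
    have "Cb {-2<..<3} r 1 (2 * k2 * \<delta>) (\<lambda>y. B y - 1)"
      unfolding Cb_def
    proof (intro conjI allI impI ballI)
      show "smooth_on {-2<..<3} (\<lambda>y. B y - 1)"
        using smooth_on_subset[OF B(1)] by (intro smooth_on_diff smooth_on_const) auto
      fix m and y :: real assume m: "m \<le> r" and y: "y \<in> {-2<..<3}"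
      have "\<exists>n. (n = 0 \<or> n = 1 \<or> n = 2 \<or> n = -1 \<or> n = -2) \<and> y \<in> ?T n"
        using y by (cases "y < -1"; cases "y < 0"; cases "y < 1"; cases "y < 2") (force simp: ex_disj_distrib conj_disj_distribR)+
      then show "norm (nth_deriv m (\<lambda>y. B y - 1) y) \<le> 2 * k2 * \<delta> * 1 ^ m"
        using CbD[OF cover _] m by blast
    qed
    then show "\<exists>B. smooth_on UNIV B \<and> (\<forall>y. norm (B y) = 1) \<and> (\<forall>y. B (y + 1) * P y = X * B y) \<and> Cb {-2<..<3} r 1 (2 * k2 * \<delta>) (\<lambda>y. B y - 1)"
      using B by blast
  qed
qed

subsection \<open>The double covering of \<open>SO(3)\<close>\<close>

text \<open>The polarization of the quadratic map \<open>rot\<close>, in a form that is not symmetric in \<open>p\<close> and \<open>q\<close>.\<close>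

definition brot :: "quat \<Rightarrow> quat \<Rightarrow> real^3^3" where
  "brot p q = vector [
     vector [qre p * qre q + qi p * qi q - qj p * qj q - qk p * qk q,
             2 * (qi p * qj q - qre p * qk q), 2 * (qi p * qk q + qre p * qj q)],
     vector [2 * (qi p * qj q + qre p * qk q),
             qre p * qre q - qi p * qi q + qj p * qj q - qk p * qk q, 2 * (qj p * qk q - qre p * qi q)],
     vector [2 * (qi p * qk q - qre p * qj q), 2 * (qj p * qk q + qre p * qi q),
             qre p * qre q - qi p * qi q - qj p * qj q + qk p * qk q]]"

definition rot :: "quat \<Rightarrow> real^3^3" where "rot q = brot q q"

lemma brot_entries:
  "brot p q $ 1 $ 1 = qre p * qre q + qi p * qi q - qj p * qj q - qk p * qk q"
  "brot p q $ 1 $ 2 = 2 * (qi p * qj q - qre p * qk q)"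
  "brot p q $ 1 $ 3 = 2 * (qi p * qk q + qre p * qj q)"
  "brot p q $ 2 $ 1 = 2 * (qi p * qj q + qre p * qk q)"
  "brot p q $ 2 $ 2 = qre p * qre q - qi p * qi q + qj p * qj q - qk p * qk q"
  "brot p q $ 2 $ 3 = 2 * (qj p * qk q - qre p * qi q)"
  "brot p q $ 3 $ 1 = 2 * (qi p * qk q - qre p * qj q)"
  "brot p q $ 3 $ 2 = 2 * (qj p * qk q + qre p * qi q)"
  "brot p q $ 3 $ 3 = qre p * qre q - qi p * qi q - qj p * qj q + qk p * qk q"
  by (simp_all add: brot_def)

lemmas rot_entries = brot_entries[where p=q and q=q for q, folded rot_def]

lemma mat3_eq_iff: "(A :: real^3^3) = B \<longleftrightarrow>
   A$1$1 = B$1$1 \<and> A$1$2 = B$1$2 \<and> A$1$3 = B$1$3 \<and> A$2$1 = B$2$1 \<and> A$2$2 = B$2$2 \<and> A$2$3 = B$2$3 \<and>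
   A$3$1 = B$3$1 \<and> A$3$2 = B$3$2 \<and> A$3$3 = B$3$3"
  by (auto simp: vec_eq_iff forall_3)

lemma mat3_mult: "((A :: real^3^3) ** B) $ i $ j = A$i$1 * B$1$j + A$i$2 * B$2$j + A$i$3 * B$3$j"
  by (simp add: matrix_matrix_mult_def sum_3)

lemma mat3_one: "(mat 1 :: real^3^3) $ i $ j = (if i = j then 1 else 0)"
  by (simp add: mat_def)

lemma rot_mult: "rot (p * q) = rot p ** rot q"
  unfolding mat3_eq_iff mat3_mult rot_entries quat_mult_simps
  by (intro conjI; algebra)

lemma rot_one: "rot 1 = mat 1"
  unfolding mat3_eq_iff rot_entries mat3_one by simp

lemma rot_minus: "rot (- q) = rot q"
  unfolding mat3_eq_iff rot_entries by simp

lemma rot_qcnj: "rot (qcnj q) = transpose (rot q)"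
  unfolding mat3_eq_iff rot_entries transpose_def by (simp add: rot_entries)

lemma rot_orthogonal: "norm q = 1 \<Longrightarrow> orthogonal_matrix (rot q)"
  unfolding orthogonal_matrix rot_qcnj[symmetric] rot_mult[symmetric] by (simp add: rot_one)

lemma norm_sq_quat: "(norm q)\<^sup>2 = (qre q)\<^sup>2 + (qi q)\<^sup>2 + (qj q)\<^sup>2 + (qk q)\<^sup>2"
  by (simp add: norm_quat_eq)

lemma rot_det: "norm q = 1 \<Longrightarrow> det (rot q) = 1"
proof -
  assume "norm q = 1"
  then have 1: "(qre q)\<^sup>2 + (qi q)\<^sup>2 + (qj q)\<^sup>2 + (qk q)\<^sup>2 = 1" using norm_sq_quat[of q] by simp
  show ?thesis unfolding det_3 rot_entries using 1 by algebra
qed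

lemma rot_SO3: "norm q = 1 \<Longrightarrow> rot q \<in> SO3"
  by (simp add: SO3_def rot_orthogonal rot_det)

lemma trace_rot: "norm q = 1 \<Longrightarrow> trace (rot q) = 4 * (qre q)\<^sup>2 - 1"
proof -
  assume "norm q = 1"
  then have 1: "(qre q)\<^sup>2 + (qi q)\<^sup>2 + (qj q)\<^sup>2 + (qk q)\<^sup>2 = 1" using norm_sq_quat[of q] by simp
  show ?thesis unfolding trace_def sum_3 rot_entries using 1 by algebra
qed

text \<open>The kernel of \<open>rot\<close> is read off from the trace 4 w^2 - 1, with w the real
  part: it equals 3 only for w = \<plusminus>1.\<close>

lemma rot_inj:
  assumes "norm p = 1" "norm q = 1" "rot p = rot q"
  shows "p = q \<or> p = - q"
proof -
  let ?g = "p * qcnj q"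
  have g: "norm ?g = 1" by (simp add: norm_quat_mult assms)
  have "rot ?g = rot q ** transpose (rot q)" by (simp add: rot_mult rot_qcnj assms(3))
  also have "\<dots> = mat 1" using rot_orthogonal[OF assms(2)] by (simp add: orthogonal_matrix_def)
  finally have "trace (rot ?g) = 3" by (simp add: trace_def sum_3 mat3_one)
  then have w: "(qre ?g)\<^sup>2 = 1" using trace_rot[OF g] by simp
  then have "(qi ?g)\<^sup>2 + (qj ?g)\<^sup>2 + (qk ?g)\<^sup>2 = 0" using norm_sq_quat[of ?g] g by simp
  then have "qi ?g = 0" "qj ?g = 0" "qk ?g = 0" by (auto simp: add_nonneg_eq_0_iff)
  moreover have "qre ?g = 1 \<or> qre ?g = -1" using w by (simp add: power2_eq_1_iff)
  ultimately have "?g = 1 \<or> ?g = -1" by (auto simp only: quat_eq_iff quat_one_simps quat_minus_simps)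
  then have "?g * q = q \<or> ?g * q = - q" by auto
  then show ?thesis using assms(2) by (simp add: mult.assoc)
qed

text \<open>The section of \<open>rot\<close> over the rotations with angle different from \<open>\<pi>\<close> (\<open>w = 0\<close> otherwise).\<close>

definition qsec :: "real^3^3 \<Rightarrow> quat" where
  "qsec R = (let w = sqrt (1 + trace R) / 2 in
     Quat w ((R$3$2 - R$2$3) / (4 * w)) ((R$1$3 - R$3$1) / (4 * w)) ((R$2$1 - R$1$2) / (4 * w)))"

text \<open>Determinant 1 identifies the inverse with the adjugate, and orthogonality identifies it
  with the transpose.\<close>

lemma SO3_cofactors:
  assumes "R \<in> SO3"
  shows "transpose R ** R = mat 1" "R ** transpose R = mat 1"
    "R$2$2 * R$3$3 - R$2$3 * R$3$2 = R$1$1" "R$1$1 * R$3$3 - R$1$3 * R$3$1 = R$2$2" "R$1$1 * R$2$2 - R$1$2 * R$2$1 = R$3$3"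
    "R$2$3 * R$3$1 - R$2$1 * R$3$3 = R$1$2" "R$1$3 * R$3$2 - R$1$2 * R$3$3 = R$2$1"
    "R$2$1 * R$3$2 - R$2$2 * R$3$1 = R$1$3" "R$1$2 * R$2$3 - R$1$3 * R$2$2 = R$3$1"
    "R$1$2 * R$3$1 - R$1$1 * R$3$2 = R$2$3" "R$2$1 * R$1$3 - R$1$1 * R$2$3 = R$3$2"
proof -
  show 1: "transpose R ** R = mat 1" "R ** transpose R = mat 1" using assms by (simp_all add: SO3_def orthogonal_matrix_def)
  define C :: "real^3^3" where "C = vector [
    vector [R$2$2 * R$3$3 - R$2$3 * R$3$2, R$1$3 * R$3$2 - R$1$2 * R$3$3, R$1$2 * R$2$3 - R$1$3 * R$2$2],
    vector [R$2$3 * R$3$1 - R$2$1 * R$3$3, R$1$1 * R$3$3 - R$1$3 * R$3$1, R$2$1 * R$1$3 - R$1$1 * R$2$3],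
    vector [R$2$1 * R$3$2 - R$2$2 * R$3$1, R$1$2 * R$3$1 - R$1$1 * R$3$2, R$1$1 * R$2$2 - R$1$2 * R$2$1]]"
  have d: "det R = 1" using assms by (simp add: SO3_def)
  have "C ** R = mat 1"
    unfolding mat3_eq_iff mat3_mult mat3_one
    apply (simp add: C_def)
    using d[unfolded det_3] by (simp add: algebra_simps)
  then have "C = C ** (R ** transpose R)" "C ** R ** transpose R = transpose R" using 1 by simp_all
  then have "C = transpose R" by (simp add: matrix_mul_assoc)
  then show "R$2$2 * R$3$3 - R$2$3 * R$3$2 = R$1$1" "R$1$1 * R$3$3 - R$1$3 * R$3$1 = R$2$2" "R$1$1 * R$2$2 - R$1$2 * R$2$1 = R$3$3"
    "R$2$3 * R$3$1 - R$2$1 * R$3$3 = R$1$2" "R$1$3 * R$3$2 - R$1$2 * R$3$3 = R$2$1"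
    "R$2$1 * R$3$2 - R$2$2 * R$3$1 = R$1$3" "R$1$2 * R$2$3 - R$1$3 * R$2$2 = R$3$1"
    "R$1$2 * R$3$1 - R$1$1 * R$3$2 = R$2$3" "R$2$1 * R$1$3 - R$1$1 * R$2$3 = R$3$2"
    unfolding mat3_eq_iff by (simp_all add: C_def transpose_def)
qed

text \<open>A rotation matrix is quadratic in its quaternion, so it suffices to recover the products
  of coordinates. Those among x, y, z are first obtained multiplied by t = 4 w^2, from the row,
  column and cofactor identities.\<close>

lemma qsec_rot:
  assumes R: "R \<in> SO3" and tr: "trace R > -1"
  shows "rot (qsec R) = R" "norm (qsec R) = 1" "qre (qsec R) > 0"
proof -
  define t where "t = 1 + R$1$1 + R$2$2 + R$3$3"
  define w where "w = sqrt t / 2"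
  have tr': "1 + trace R = t" by (simp add: trace_def sum_3 t_def)
  have t0: "t > 0" using tr tr' by linarith
  have w0: "w > 0" using t0 by (simp add: w_def)
  have w2: "4 * w\<^sup>2 = t" using t0 by (simp add: w_def power_divide)
  define x where "x = (R$3$2 - R$2$3) / (4 * w)"
  define y where "y = (R$1$3 - R$3$1) / (4 * w)"
  define z where "z = (R$2$1 - R$1$2) / (4 * w)"
  have q: "qsec R = Quat w x y z" by (simp add: qsec_def tr' w_def[symmetric] x_def y_def z_def)
  have wx: "4 * w * x = R$3$2 - R$2$3" "4 * w * y = R$1$3 - R$3$1" "4 * w * z = R$2$1 - R$1$2"
    using w0 by (simp_all add: x_def y_def z_def)
  note c = SO3_cofactors[OF R]
  have col: "R$1$1 * R$1$1 + R$2$1 * R$2$1 + R$3$1 * R$3$1 = 1" "R$1$2 * R$1$2 + R$2$2 * R$2$2 + R$3$2 * R$3$2 = 1"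
     "R$1$3 * R$1$3 + R$2$3 * R$2$3 + R$3$3 * R$3$3 = 1"
     "R$1$1 * R$1$2 + R$2$1 * R$2$2 + R$3$1 * R$3$2 = 0" "R$1$1 * R$1$3 + R$2$1 * R$2$3 + R$3$1 * R$3$3 = 0"
     "R$1$2 * R$1$3 + R$2$2 * R$2$3 + R$3$2 * R$3$3 = 0"
    using c(1) unfolding mat3_eq_iff mat3_mult mat3_one by (simp_all add: transpose_def)
  have row: "R$1$1 * R$1$1 + R$1$2 * R$1$2 + R$1$3 * R$1$3 = 1" "R$2$1 * R$2$1 + R$2$2 * R$2$2 + R$2$3 * R$2$3 = 1"
     "R$3$1 * R$3$1 + R$3$2 * R$3$2 + R$3$3 * R$3$3 = 1"
     "R$1$1 * R$2$1 + R$1$2 * R$2$2 + R$1$3 * R$2$3 = 0" "R$1$1 * R$3$1 + R$1$2 * R$3$2 + R$1$3 * R$3$3 = 0"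
     "R$2$1 * R$3$1 + R$2$2 * R$3$2 + R$2$3 * R$3$3 = 0"
    using c(2) unfolding mat3_eq_iff mat3_mult mat3_one by (simp_all add: transpose_def)
  have sq1: "(4 * w * x)\<^sup>2 = (1 + R$1$1 - R$2$2 - R$3$3) * t"
    unfolding wx t_def using row(2) row(3) col(1) c(3) by algebra
  have sq2: "(4 * w * y)\<^sup>2 = (1 - R$1$1 + R$2$2 - R$3$3) * t"
    unfolding wx t_def using row(1) row(3) col(2) c(4) by algebra
  have sq3: "(4 * w * z)\<^sup>2 = (1 - R$1$1 - R$2$2 + R$3$3) * t"
    unfolding wx t_def using row(1) row(2) col(3) c(5) by algebra
  note sq = sq1 sq2 sq3
  have cr1: "(4 * w * x) * (4 * w * y) = t * (R$2$1 + R$1$2)"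
    unfolding wx t_def using c(6) c(7) col(4) row(4) by (simp add: algebra_simps)
  have cr2: "(4 * w * x) * (4 * w * z) = t * (R$3$1 + R$1$3)"
    unfolding wx t_def using c(8) c(9) col(5) row(5) by (simp add: algebra_simps)
  have cr3: "(4 * w * y) * (4 * w * z) = t * (R$3$2 + R$2$3)"
    unfolding wx t_def using c(10) c(11) col(6) row(6) by (simp add: algebra_simps)
  note cr = cr1 cr2 cr3
  have s4: "4 * x\<^sup>2 = 1 + R$1$1 - R$2$2 - R$3$3" "4 * y\<^sup>2 = 1 - R$1$1 + R$2$2 - R$3$3" "4 * z\<^sup>2 = 1 - R$1$1 - R$2$2 + R$3$3"
  proof -
    have "t * (4 * x\<^sup>2) = (4 * w * x)\<^sup>2" "t * (4 * y\<^sup>2) = (4 * w * y)\<^sup>2" "t * (4 * z\<^sup>2) = (4 * w * z)\<^sup>2"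
      by (simp_all add: w2[symmetric] power2_eq_square)
    then show "4 * x\<^sup>2 = 1 + R$1$1 - R$2$2 - R$3$3" "4 * y\<^sup>2 = 1 - R$1$1 + R$2$2 - R$3$3" "4 * z\<^sup>2 = 1 - R$1$1 - R$2$2 + R$3$3"
      unfolding sq using t0 by simp_all
  qed
  have c4: "4 * (x * y) = R$2$1 + R$1$2" "4 * (x * z) = R$3$1 + R$1$3" "4 * (y * z) = R$3$2 + R$2$3"
  proof -
    have "t * (4 * (x * y)) = (4 * w * x) * (4 * w * y)" "t * (4 * (x * z)) = (4 * w * x) * (4 * w * z)"
       "t * (4 * (y * z)) = (4 * w * y) * (4 * w * z)"
      by (simp_all add: w2[symmetric] power2_eq_square)
    then show "4 * (x * y) = R$2$1 + R$1$2" "4 * (x * z) = R$3$1 + R$1$3" "4 * (y * z) = R$3$2 + R$2$3"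
      unfolding cr using t0 by simp_all
  qed
  show "rot (qsec R) = R"
    unfolding mat3_eq_iff rot_entries q quat.sel
    using s4 c4 wx w2 t_def by (simp add: power2_eq_square)
  have "(norm (qsec R))\<^sup>2 = 1"
    unfolding norm_sq_quat q quat.sel using s4 w2 t_def by simp
  then show "norm (qsec R) = 1" using norm_ge_zero[of "qsec R"] by (simp add: power2_eq_1_iff)
  show "qre (qsec R) > 0" using w0 by (simp add: q)
qed

lemma qsec_of_rot:
  assumes "norm g = 1" "qre g > 0"
  shows "qsec (rot g) = g" "trace (rot g) > -1"
proof -
  show 1: "trace (rot g) > -1" using trace_rot[OF assms(1)] assms(2) by simp
  have "qsec (rot g) = g \<or> qsec (rot g) = - g"
    by (rule rot_inj) (use qsec_rot[OF rot_SO3[OF assms(1)] 1] assms in auto)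
  then show "qsec (rot g) = g" using qsec_rot(3)[OF rot_SO3[OF assms(1)] 1] assms(2) by auto
qed

lemma SO3_mult: "A \<in> SO3 \<Longrightarrow> B \<in> SO3 \<Longrightarrow> A ** B \<in> SO3"
  by (simp add: SO3_def orthogonal_matrix_mul det_mul)

lemma SO3_transpose: "A \<in> SO3 \<Longrightarrow> transpose A \<in> SO3"
  by (simp add: SO3_def det_transpose)

text \<open>The rotations belonging to 1, i, j, k are diagonal and sum to zero. One of the four
  products with \<open>R\<close> therefore has nonnegative trace and lies in the domain of
  \<open>qsec\<close>.\<close>

lemma rot_surj:
  assumes "R \<in> SO3"
  obtains q where "norm q = 1" "rot q = R"
proof -
  let ?E = "[1, Quat 0 1 0 0, Quat 0 0 1 0, Quat 0 0 0 1]"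
  have n: "\<forall>e\<in>set ?E. norm e = 1" by (simp add: norm_quat_eq)
  have "trace (R ** rot (?E ! 0)) + trace (R ** rot (?E ! 1)) + trace (R ** rot (?E ! 2)) + trace (R ** rot (?E ! 3)) = 0"
    unfolding trace_def sum_3 mat3_mult rot_entries by simp
  then have "\<exists>e\<in>set ?E. trace (R ** rot e) \<ge> 0" by auto
  then obtain e where "e \<in> set ?E" "trace (R ** rot e) \<ge> 0" by (elim bexE)
  then have e: "norm e = 1" "trace (R ** rot e) > -1" using n by (blast, linarith)
  have S: "R ** rot e \<in> SO3" by (rule SO3_mult[OF assms rot_SO3[OF e(1)]])
  show thesis
  proof (rule that[of "qsec (R ** rot e) * qcnj e"])
    show "norm (qsec (R ** rot e) * qcnj e) = 1" using qsec_rot(2)[OF S e(2)] e by (simp add: norm_quat_mult)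
    have "rot (qsec (R ** rot e) * qcnj e) = R ** (rot e ** transpose (rot e))"
      by (simp add: rot_mult qsec_rot(1)[OF S e(2)] rot_qcnj matrix_mul_assoc)
    then show "rot (qsec (R ** rot e) * qcnj e) = R" using rot_orthogonal[OF e(1)] by (simp add: orthogonal_matrix_def)
  qed
qed

declare quat_mult_simps [simp del]

section \<open>Smoothness of the covering map and lifts of curves\<close>

lemma bounded_bilinear_brot: "bounded_bilinear brot"
  unfolding bilinear_conv_bounded_bilinear[symmetric] bilinear_def
  by (intro conjI allI linearI) (simp_all add: mat3_eq_iff brot_entries algebra_simps)

lemma bounded_bilinear_matrix_matrix_mult: "bounded_bilinear ((**) :: real^'n^'m \<Rightarrow> real^'k^'n \<Rightarrow> real^'k^'m)"
  unfolding bilinear_conv_bounded_bilinear[symmetric] bilinear_def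
  by (intro conjI allI linearI)
    (simp_all add: matrix_matrix_mult_def vec_eq_iff sum.distrib distrib_left distrib_right sum_distrib_left mult_ac)

lemma smooth_on_rot: "open S \<Longrightarrow> smooth_on S f \<Longrightarrow> smooth_on S (\<lambda>x. rot (f x))"
  unfolding rot_def by (intro bounded_bilinear.smooth_on_prod[OF bounded_bilinear_brot])

lemma continuous_on_rot: "continuous_on S rot"
  unfolding rot_def[abs_def] by (intro bounded_bilinear.continuous_on[OF bounded_bilinear_brot] continuous_on_id)

lemma quat_basis: "Quat a b c d = a *\<^sub>R 1 + b *\<^sub>R Quat 0 1 0 0 + c *\<^sub>R Quat 0 0 1 0 + d *\<^sub>R Quat 0 0 0 1"
  by (simp add: quat_eq_iff)

lemma bounded_linear_entry: "bounded_linear (\<lambda>R :: real^3^3. R $ i $ j)"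
  by (rule bounded_linear_compose[OF bounded_linear_vec_nth bounded_linear_vec_nth])

lemma bounded_linear_trace: "bounded_linear (trace :: real^3^3 \<Rightarrow> real)"
  unfolding trace_def[abs_def] by (intro bounded_linear_sum bounded_linear_entry)

lemma smooth_on_qsec:
  assumes S: "open S" and R: "smooth_on S R" and tr: "\<And>x. x \<in> S \<Longrightarrow> trace (R x) > -1"
  shows "smooth_on S (\<lambda>x. qsec (R x))"
proof -
  have e: "smooth_on S (\<lambda>x. R x $ i $ j)" for i j by (rule smooth_on_linear[OF bounded_linear_entry S R])
  have t: "smooth_on S (\<lambda>x. 1 + trace (R x))"
    by (intro smooth_on_add smooth_on_const S smooth_on_linear[OF bounded_linear_trace S R])
  have w: "smooth_on S (\<lambda>x. sqrt (1 + trace (R x)))"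
    by (rule smooth_on_sqrt[OF S t]) (use tr in force)
  have iw: "smooth_on S (\<lambda>x. inverse (sqrt (1 + trace (R x))))"
    by (rule smooth_on_inverse[OF S w]) (use tr in force)
  have "qsec (R x) = (1/2 * sqrt (1 + trace (R x))) *\<^sub>R 1
     + (1/2 * ((R x $ 3 $ 2 - R x $ 2 $ 3) * inverse (sqrt (1 + trace (R x))))) *\<^sub>R Quat 0 1 0 0
     + (1/2 * ((R x $ 1 $ 3 - R x $ 3 $ 1) * inverse (sqrt (1 + trace (R x))))) *\<^sub>R Quat 0 0 1 0
     + (1/2 * ((R x $ 2 $ 1 - R x $ 1 $ 2) * inverse (sqrt (1 + trace (R x))))) *\<^sub>R Quat 0 0 0 1" for x
    unfolding qsec_def Let_def quat_basis[symmetric] by (simp add: field_simps)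
  then show ?thesis
    by (simp only:) (intro smooth_on_add smooth_on_scaleR smooth_on_mult smooth_on_const S e w iw smooth_on_diff)
qed

lemma continuous_on_qsec: "continuous_on {R. trace R > -1} qsec"
proof -
  have "qsec R = (1/2 * sqrt (1 + trace R)) *\<^sub>R 1
     + ((R $ 3 $ 2 - R $ 2 $ 3) / (2 * sqrt (1 + trace R))) *\<^sub>R Quat 0 1 0 0
     + ((R $ 1 $ 3 - R $ 3 $ 1) / (2 * sqrt (1 + trace R))) *\<^sub>R Quat 0 0 1 0
     + ((R $ 2 $ 1 - R $ 1 $ 2) / (2 * sqrt (1 + trace R))) *\<^sub>R Quat 0 0 0 1" for R
    unfolding qsec_def Let_def quat_basis[symmetric] by (simp add: field_simps)
  note q = this
  have t: "continuous_on S (trace :: real^3^3 \<Rightarrow> real)" for S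
    by (rule linear_continuous_on[OF bounded_linear_trace])
  show ?thesis unfolding q by (intro continuous_intros t) auto
qed

text \<open>Around \<open>R0\<close> the evenly covered set consists of the rotations whose angle
  relative to \<open>R0\<close> differs from pi. The two sheets over it are separated by the sign of
  the real part relative to \<open>q0\<close>, and a translate of \<plusminus>\<open>qsec\<close>
  inverts \<open>rot\<close> on each.\<close>

lemma covering_space_rot: "covering_space (sphere (0::quat) 1) rot SO3"
proof (rule covering_spaceI)
  show "continuous_on (sphere 0 1) rot" by (rule continuous_on_rot)
  show "rot ` sphere 0 1 = SO3"
  proof
    show "rot ` sphere 0 1 \<subseteq> SO3" by (auto intro: rot_SO3)
    show "SO3 \<subseteq> rot ` sphere 0 1"
    proof
      fix R assume "R \<in> SO3"
      then obtain q where "norm q = 1" "rot q = R" by (rule rot_surj)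
      then show "R \<in> rot ` sphere 0 1" by auto
    qed
  qed
  fix R0 assume R0: "R0 \<in> SO3"
  obtain q0 where q0: "norm q0 = 1" "rot q0 = R0" using R0 by (rule rot_surj)
  have R0o: "R0 ** transpose R0 = mat 1" "transpose R0 ** R0 = mat 1" using SO3_cofactors[OF R0] by auto
  define T where "T = {R \<in> SO3. trace (R ** transpose R0) > -1}"
  have trc: "continuous_on S (\<lambda>R. trace (R ** transpose R0))" for S
    by (intro linear_continuous_on bounded_linear_compose[OF bounded_linear_trace]
        bounded_bilinear.bounded_linear_left[OF bounded_bilinear_matrix_matrix_mult])
  define V where "V s = {q \<in> sphere 0 1. s * qre (q * qcnj q0) > 0}" for s :: real
  have trq: "trace (rot q ** transpose R0) = 4 * (qre (q * qcnj q0))\<^sup>2 - 1" if "norm q = 1" for q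
    unfolding q0(2)[symmetric] rot_qcnj[symmetric] rot_mult[symmetric]
    by (rule trace_rot) (simp add: norm_quat_mult q0 that)
  have Vn: "norm q = 1" if "q \<in> V s" for q s using that by (simp add: V_def)
  have hom: "homeomorphism (V s) T rot (\<lambda>R. s *\<^sub>R (qsec (R ** transpose R0) * q0))" if s: "s = 1 \<or> s = -1" for s
  proof -
    have ss: "s * s = 1" "\<bar>s\<bar> = 1" using s by auto
    have 1: "s *\<^sub>R (qsec (rot q ** transpose R0) * q0) = q" if q: "q \<in> V s" for q
    proof -
      let ?g = "s *\<^sub>R (q * qcnj q0)"
      have g: "norm ?g = 1" using Vn[OF q] q0 ss by (simp add: norm_quat_mult)
      have r: "rot ?g = rot q ** transpose R0"
        using s by (auto simp: rot_minus rot_mult rot_qcnj q0)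
      have "qsec (rot ?g) = ?g"
        by (rule qsec_of_rot(1)[OF g]) (use q in \<open>simp add: V_def\<close>)
      then show ?thesis unfolding r using ss q0 by (simp add: mult.assoc)
    qed
    have 2: "rot q \<in> T" if q: "q \<in> V s" for q
    proof -
      have "qre (q * qcnj q0) \<noteq> 0" using q by (auto simp: V_def)
      then show ?thesis unfolding T_def using trq[OF Vn[OF q]] rot_SO3[OF Vn[OF q]] by simp
    qed
    have 3: "s *\<^sub>R (qsec (R ** transpose R0) * q0) \<in> V s" "rot (s *\<^sub>R (qsec (R ** transpose R0) * q0)) = R"
      if R: "R \<in> T" for R
    proof -
      have S: "R ** transpose R0 \<in> SO3" "trace (R ** transpose R0) > -1"
        using R R0 by (auto simp: T_def intro!: SO3_mult SO3_transpose)
      note q = qsec_rot[OF S]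
      have "s * (s * qre (qsec (R ** transpose R0))) > 0" using q(3) ss by (simp add: mult.assoc[symmetric])
      then show "s *\<^sub>R (qsec (R ** transpose R0) * q0) \<in> V s"
        using q(2) q0 ss by (simp add: V_def norm_quat_mult mult.assoc)
      have "rot (s *\<^sub>R (qsec (R ** transpose R0) * q0)) = R ** transpose R0 ** R0"
        using s by (auto simp: rot_minus rot_mult q(1) q0)
      then show "rot (s *\<^sub>R (qsec (R ** transpose R0) * q0)) = R"
        by (simp add: matrix_mul_assoc[symmetric] R0o)
    qed
    show ?thesis
    proof (rule homeomorphismI)
      show "continuous_on (V s) rot" by (rule continuous_on_rot)
      show "continuous_on T (\<lambda>R. s *\<^sub>R (qsec (R ** transpose R0) * q0))"
        by (intro continuous_intros continuous_on_compose2[OF continuous_on_qsec]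
          linear_continuous_on bounded_bilinear.bounded_linear_left[OF bounded_bilinear_matrix_matrix_mult])
          (auto simp: T_def)
    qed (use 1 2 3 in auto)
  qed
  have oV: "openin (top_of_set (sphere 0 1)) (V s)" for s
  proof -
    have "continuous_on UNIV (\<lambda>q. s * qre (q * qcnj q0))"
      by (intro continuous_intros linear_continuous_on bounded_linear_compose[OF bounded_linear_qre] bounded_linear_mult_left)
    then have "open {q. s * qre (q * qcnj q0) > 0}" by (intro open_Collect_less continuous_on_const)
    then have "openin (top_of_set (sphere 0 1)) (sphere 0 1 \<inter> {q. s * qre (q * qcnj q0) > 0})" by (rule openin_open_Int)
    moreover have "sphere 0 1 \<inter> {q. s * qre (q * qcnj q0) > 0} = V s" by (auto simp: V_def)
    ultimately show ?thesis by simp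
  qed
  have oT: "openin (top_of_set SO3) T"
  proof -
    have "open {R. trace (R ** transpose R0) > -1}" by (intro open_Collect_less continuous_on_const trc)
    then have "openin (top_of_set SO3) (SO3 \<inter> {R. trace (R ** transpose R0) > -1})" by (rule openin_open_Int)
    moreover have "SO3 \<inter> {R. trace (R ** transpose R0) > -1} = T" by (auto simp: T_def)
    ultimately show ?thesis by simp
  qed
  have U: "\<Union>{V 1, V (-1)} = sphere 0 1 \<inter> rot -` T"
  proof
    show "\<Union>{V 1, V (-1)} \<subseteq> sphere 0 1 \<inter> rot -` T"
    proof
      fix q assume "q \<in> \<Union>{V 1, V (-1)}"
      then obtain s where s: "s = 1 \<or> s = -1" and q: "q \<in> V s" by auto
      show "q \<in> sphere 0 1 \<inter> rot -` T"
        using homeomorphism_image1[OF hom[OF s]] q Vn[OF q] by auto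
    qed
    show "sphere 0 1 \<inter> rot -` T \<subseteq> \<Union>{V 1, V (-1)}"
      using trq by (auto simp: T_def V_def linorder_neq_iff)
  qed
  have R0T: "R0 \<in> T" using R0 by (simp add: T_def R0o trace_def sum_3 mat3_one)
  have D: "pairwise disjnt {V 1, V (-1)}"
    by (auto simp: pairwise_insert disjnt_iff V_def)
  show "\<exists>T. R0 \<in> T \<and> openin (top_of_set SO3) T \<and>
     (\<exists>v. \<Union>v = sphere 0 1 \<inter> rot -` T \<and> (\<forall>u\<in>v. openin (top_of_set (sphere 0 1)) u) \<and> pairwise disjnt v \<and>
        (\<forall>u\<in>v. \<exists>q. homeomorphism u T rot q))"
    by (intro exI[of _ T] conjI exI[of _ "{V 1, V (-1)}"] R0T oT U D) (use oV hom in auto)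
qed

text \<open>The covering yields a continuous lift on the line. Near each point it coincides with the
  smooth section \<open>qsec\<close> of the rotation relative to that point, so it is
  smooth.\<close>

lemma lift_exists:
  assumes A: "smooth_on UNIV A" "\<And>x. A x \<in> SO3"
  obtains g where "smooth_on UNIV g" "\<And>x. norm (g x) = 1" "\<And>x. rot (g x) = A x"
proof -
  have cA: "continuous_on UNIV A" using smooth_on_continuous[OF A(1), of 0] by simp
  obtain g where g: "continuous_on UNIV g" "g \<in> UNIV \<rightarrow> sphere 0 1" "\<And>y. y \<in> UNIV \<Longrightarrow> rot (g y) = A y"
    by (rule covering_space_lift[OF covering_space_rot _ _ cA])
      (use A(2) in \<open>auto intro: convex_imp_simply_connected convex_imp_locally_path_connected\<close>)
  have n: "norm (g x) = 1" for x using g(2) by auto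
  have r: "rot (g x) = A x" for x using g(3) by simp
  have loc: "\<exists>S. open S \<and> x \<in> S \<and> smooth_on S g" for x
  proof -
    let ?S = "{y. qre (g y * qcnj (g x)) > 0}"
    have "continuous_on UNIV (\<lambda>y. qre (g y * qcnj (g x)))"
      by (intro continuous_intros g linear_continuous_on[THEN continuous_on_compose2[where f="\<lambda>y. g y * qcnj (g x)" and s=UNIV]] bounded_linear_qre) auto
    then have o: "open ?S" by (intro open_Collect_less continuous_on_const)
    have eq: "qsec (A y ** transpose (A x)) * g x = g y" if "y \<in> ?S" for y
    proof -
      have "qsec (rot (g y * qcnj (g x))) = g y * qcnj (g x)"
        by (rule qsec_of_rot(1)) (use that n in \<open>auto simp: norm_quat_mult\<close>)
      then show ?thesis using n[of x] by (simp add: rot_mult rot_qcnj r mult.assoc)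
    qed
    have tr: "trace (A y ** transpose (A x)) > -1" if "y \<in> ?S" for y
      using qsec_of_rot(2)[of "g y * qcnj (g x)"] that n by (simp add: norm_quat_mult rot_mult rot_qcnj r)
    have sm: "smooth_on ?S (\<lambda>y. qsec (A y ** transpose (A x)) * g x)"
      by (intro smooth_on_mult smooth_on_const smooth_on_qsec o tr
          bounded_bilinear.smooth_on_prod[OF bounded_bilinear_matrix_matrix_mult] smooth_on_subset[OF A(1)]) auto
    have "smooth_on ?S g" by (rule smooth_on_cong[OF o eq sm])
    moreover have "x \<in> ?S" using n[of x] by simp
    ultimately show ?thesis using o by blast
  qed
  have "smooth_on UNIV g" unfolding smooth_on_def
  proof (intro allI ballI)
    fix n x
    obtain S where "x \<in> S" "smooth_on S g" using loc[of x] by blast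
    then show "nth_deriv n g differentiable at x" by (simp add: smooth_on_def)
  qed
  then show thesis using n r that by blast
qed

text \<open>The sign in g (x + 1) = \<plusminus>g (x) is constant by connectedness. With the plus
  sign, \<open>g\<close> would be a loop in the simply connected 3-sphere, and projecting its
  contraction would contract \<open>A\<close>.\<close>

lemma lift_antiperiodic:
  assumes A: "smooth_on UNIV A" "\<And>x. A x \<in> SO3" "\<And>x. A (x + 1) = A x"
    and nh: "\<not> homotopic_loops SO3 A (\<lambda>x. mat 1)"
  obtains g where "smooth_on UNIV g" "\<And>x. norm (g x) = 1" "\<And>x. rot (g x) = A x" "\<And>x. g (x + 1) = - g x"
proof -
  obtain g where g: "smooth_on UNIV g" "\<And>x. norm (g x) = 1" "\<And>x. rot (g x) = A x"
    using lift_exists[OF A(1,2)] by blast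
  have cg: "continuous_on S g" for S
    using smooth_on_continuous[OF g(1), of 0] continuous_on_subset by auto
  have cg': "continuous_on UNIV (\<lambda>x. qre (g (x + 1) * qcnj (g x)))"
    using smooth_on_continuous[OF smooth_on_qre[OF open_UNIV smooth_on_mult[OF open_UNIV smooth_on_shift[OF g(1)] smooth_on_qcnj[OF open_UNIV g(1)]]], of 0]
    by simp
  have pm: "g (x + 1) = g x \<or> g (x + 1) = - g x" for x
    by (rule rot_inj) (simp_all add: g A(3))
  have v: "qre (g (x + 1) * qcnj (g x)) = 1 \<or> qre (g (x + 1) * qcnj (g x)) = -1" for x
    using pm[of x] g(2)[of x] by (auto simp del: quat_mult_simps)
  have const: "qre (g (x + 1) * qcnj (g x)) = qre (g (0 + 1) * qcnj (g 0))" for x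
  proof -
    have "is_interval ((\<lambda>x. qre (g (x + 1) * qcnj (g x))) ` UNIV)"
      unfolding is_interval_connected_1 by (rule connected_continuous_image[OF cg']) simp
    then have iv: "\<And>a b c. a \<in> range (\<lambda>x. qre (g (x + 1) * qcnj (g x))) \<Longrightarrow> b \<in> range (\<lambda>x. qre (g (x + 1) * qcnj (g x))) \<Longrightarrow> a \<le> c \<Longrightarrow> c \<le> b \<Longrightarrow> c \<in> range (\<lambda>x. qre (g (x + 1) * qcnj (g x)))"
      unfolding is_interval_1 by blast
    have "0 \<notin> range (\<lambda>x. qre (g (x + 1) * qcnj (g x)))" using v by (auto simp: image_iff) (metis zero_neq_one neg_equal_0_iff_equal)
    then show ?thesis
      using iv[of "qre (g (x + 1) * qcnj (g x))" "qre (g (0 + 1) * qcnj (g 0))" 0]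
        iv[of "qre (g (0 + 1) * qcnj (g 0))" "qre (g (x + 1) * qcnj (g x))" 0] v[of x] v[of 0]
      by fastforce
  qed
  have not1: "g (0 + 1) \<noteq> g 0"
  proof
    assume e: "g (0 + 1) = g 0"
    have sc: "simply_connected (sphere (0::quat) 1)" by (rule simply_connected_sphere) (simp add: DIM_quat)
    have "homotopic_loops (sphere 0 1) g (linepath 1 1)"
      by (rule sc[unfolded simply_connected_eq_contractible_loop_any, rule_format])
        (use e cg g(2) in \<open>auto simp: path_def path_image_def pathfinish_def pathstart_def\<close>)
    then have "homotopic_loops SO3 (rot \<circ> g) (rot \<circ> linepath 1 1)"
      by (rule homotopic_loops_continuous_image) (auto intro: continuous_on_rot rot_SO3)
    moreover have "rot \<circ> g = A" "rot \<circ> linepath 1 1 = (\<lambda>x. mat 1)" using g(3) by (auto simp: rot_one linepath_def algebra_simps)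
    ultimately show False using nh by simp
  qed
  then have "g (0 + 1) = - g 0" using pm[of 0] by blast
  then have "qre (g (0 + 1) * qcnj (g 0)) = -1" using g(2)[of 0] by simp
  then have c: "qre (g (x + 1) * qcnj (g x)) = -1" for x using const[of x] by simp
  have "g (x + 1) = - g x" for x
    using pm[of x] c[of x] g(2)[of x] by auto
  then show thesis using g that by blast
qed

subsection \<open>Sublinear growth of the derivatives of the iterates\<close>

lemma irrational_coprime_approx:
  assumes "\<theta> \<notin> \<rat>"
  obtains p :: int and q :: nat where "real q \<ge> M" "0 < q" "coprime p (int q)" "\<bar>\<theta> - of_int p / real q\<bar> < 1 / (real q)\<^sup>2"
proof -
  have "infinite (approx_set \<theta>)" using assms rational_iff_finite_approx_set by blast
  then obtain h k where hk: "(h,k) \<in> approx_set \<theta>" "k > max 0 \<lceil>M\<rceil>" using infinite_approx_set by blast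
  show thesis
    by (rule that[of "nat k" h]) (use hk in \<open>auto simp: approx_set_def, linarith\<close>)
qed

lemma periodic_of_int:
  fixes f :: "real \<Rightarrow> 'a"
  assumes "\<And>x. f (x + 1) = f x"
  shows "f (x + real_of_int n) = f x"
proof -
  have n: "f (x + real n) = f x" for x n
  proof (induction n)
    case (Suc n)
    then show ?case using assms[of "x + real n"] by (simp add: add_ac)
  qed simp
  show ?thesis
  proof (cases "n \<ge> 0")
    case True then show ?thesis using n[of x "nat n"] by simp
  next
    case False then show ?thesis using n[of "x + of_int n" "nat (- n)"] by simp
  qed
qed

text \<open>A Denjoy-Koksma estimate for Lipschitz functions. The orbit points lie within 1/q of the
  points of a translated grid of step 1/q, each grid point being met once. Moving to the grid, and
  from the grid to the integral, costs L in total each time, independently of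
  \<open>x\<close>.\<close>

lemma riemann_sum_le_integral:
  fixes f :: "real \<Rightarrow> real"
  assumes f: "continuous_on UNIV f" and per: "\<And>x. f (x + 1) = f x" and lip: "\<And>x y. \<bar>f x - f y\<bar> \<le> L * \<bar>x - y\<bar>"
    and q: "0 < q" "coprime p (int q)" "\<bar>\<theta> - of_int p / real q\<bar> < 1 / (real q)\<^sup>2"
  shows "(\<Sum>i<q. f (x + real i * \<theta>)) \<le> real q * integral {0..1} f + 2 * L"
proof -
  have L0: "0 \<le> L" using lip[of 0 1] by simp
  define m where "m = \<lfloor>x * real q\<rfloor>"
  define x' where "x' = x - of_int m / real q"
  have x': "0 \<le> x'" "x' < 1 / real q"
  proof -
    have "real q * x' = x * real q - of_int m" using q by (simp add: x'_def algebra_simps)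
    then have "0 \<le> real q * x'" "real q * x' < 1" unfolding m_def by linarith+
    then show "0 \<le> x'" "x' < 1 / real q" using q by (auto simp: zero_le_mult_iff field_simps)
  qed
  \<comment> \<open>The grid index of the i-th point of the rational orbit; coprimality makes it a
    permutation.\<close>
  define \<pi> where "\<pi> i = nat ((int i * p + m) mod int q)" for i :: nat
  have \<pi>q: "\<pi> i < q" for i using q by (simp add: \<pi>_def nat_less_iff)
  have inj: "inj_on \<pi> {..<q}"
  proof (rule inj_onI)
    fix i j assume ij: "i \<in> {..<q}" "j \<in> {..<q}" "\<pi> i = \<pi> j"
    have "(int i * p + m) mod int q = (int j * p + m) mod int q"
      using ij(3) q unfolding \<pi>_def by (simp add: eq_nat_nat_iff)
    then have "int q dvd (int i * p + m) - (int j * p + m)" by (simp add: mod_eq_dvd_iff)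
    then have "int q dvd (int i - int j) * p" by (simp add: algebra_simps)
    then have "int q dvd int i - int j" using q(2) by (simp add: coprime_commute coprime_dvd_mult_left_iff)
    then have "int i mod int q = int j mod int q" by (simp add: mod_eq_dvd_iff)
    then show "i = j" using ij by simp
  qed
  have bij: "bij_betw \<pi> {..<q} {..<q}"
    unfolding bij_betw_def using inj endo_inj_surj[of "{..<q}" \<pi>] \<pi>q by auto
  have 1: "f (x + real i * \<theta>) \<le> f (x' + real (\<pi> i) / real q) + L / real q" if i: "i < q" for i
  proof -
    define e where "e = (int i * p + m) div int q"
    have "int i * p + m = e * int q + int (\<pi> i)" using q unfolding e_def \<pi>_def by simp
    then have "of_int (int i * p + m) = real_of_int e * real q + real (\<pi> i)" by (metis of_int_add of_int_mult of_int_of_nat_eq)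
    then have "x + real i * (of_int p / real q) = x' + real (\<pi> i) / real q + of_int e"
      using q unfolding x'_def by (simp add: field_simps)
    then have "f (x + real i * (of_int p / real q)) = f (x' + real (\<pi> i) / real q)"
      using periodic_of_int[of f "x' + real (\<pi> i) / real q" e, OF per] by simp
    moreover have "\<bar>(x + real i * \<theta>) - (x + real i * (of_int p / real q))\<bar> \<le> 1 / real q"
    proof -
      have "\<bar>(x + real i * \<theta>) - (x + real i * (of_int p / real q))\<bar> = real i * \<bar>\<theta> - of_int p / real q\<bar>"
        by (simp add: abs_mult right_diff_distrib[symmetric] del: times_divide_eq_right)
      also have "\<dots> \<le> real q * (1 / (real q)\<^sup>2)" using q i by (intro mult_mono) auto
      also have "\<dots> = 1 / real q" using q(1) by (simp add: power2_eq_square)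
      finally show ?thesis .
    qed
    ultimately show ?thesis
      using lip[of "x + real i * \<theta>" "x + real i * (of_int p / real q)"] mult_left_mono[OF _ L0, of _ "1 / real q"]
      by fastforce
  qed
  have int: "f integrable_on {a..b}" for a b
    by (intro integrable_continuous_real continuous_on_subset[OF f]) auto
  have 2: "f (x' + real j / real q) \<le> real q * integral {real j / real q..real (Suc j) / real q} f + L / real q" for j
  proof -
    let ?I = "{real j / real q..real (Suc j) / real q}"
    have len: "real (Suc j) / real q - real j / real q = 1 / real q" by (simp add: diff_divide_distrib[symmetric])
    have "integral ?I (\<lambda>t. f (x' + real j / real q) - L / real q) \<le> integral ?I f"
    proof (rule integral_le)
      fix t assume t: "t \<in> ?I"
      then have "\<bar>(x' + real j / real q) - t\<bar> \<le> 1 / real q" using x' len by auto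
      then show "f (x' + real j / real q) - L / real q \<le> f t"
        using lip[of "x' + real j / real q" t] mult_left_mono[OF _ L0, of _ "1 / real q"] by fastforce
    qed (use int in auto)
    moreover have "integral ?I (\<lambda>t. f (x' + real j / real q) - L / real q) = (f (x' + real j / real q) - L / real q) * (1 / real q)"
      using len by (simp add: divide_right_mono)
    ultimately show ?thesis using q(1) by (simp add: field_simps)
  qed
  have 3: "(\<Sum>j<n. integral {real j / real q..real (Suc j) / real q} f) = integral {0..real n / real q} f" for n
  proof (induction n)
    case (Suc n)
    have "integral {0..real n / real q} f + integral {real n / real q..real (Suc n) / real q} f = integral {0..real (Suc n) / real q} f"
      by (rule Henstock_Kurzweil_Integration.integral_combine[OF _ _ int]) (auto simp: divide_right_mono)
    then show ?case using Suc by simp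
  qed simp
  have "(\<Sum>i<q. f (x + real i * \<theta>)) \<le> (\<Sum>i<q. f (x' + real (\<pi> i) / real q) + L / real q)"
    by (intro sum_mono 1) auto
  also have "\<dots> = (\<Sum>i<q. f (x' + real (\<pi> i) / real q)) + L" using q(1) by (simp add: sum.distrib)
  also have "(\<Sum>i<q. f (x' + real (\<pi> i) / real q)) = (\<Sum>j<q. f (x' + real j / real q))"
    by (rule sum.reindex_bij_betw[OF bij])
  also have "\<dots> \<le> (\<Sum>j<q. real q * integral {real j / real q..real (Suc j) / real q} f + L / real q)"
    by (intro sum_mono 2)
  also have "\<dots> = real q * integral {0..1} f + L"
    using q(1) 3[of q] by (simp add: sum.distrib sum_distrib_left[symmetric])
  finally show ?thesis by simp
qed

primrec qiter :: "real \<Rightarrow> (real \<Rightarrow> quat) \<Rightarrow> nat \<Rightarrow> real \<Rightarrow> quat" where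
  "qiter \<alpha> a 0 x = 1"
| "qiter \<alpha> a (Suc n) x = a (x + real n * \<alpha>) * qiter \<alpha> a n x"

lemma qiter_add: "qiter \<alpha> a (m + n) x = qiter \<alpha> a m (x + real n * \<alpha>) * qiter \<alpha> a n x"
  by (induction m) (simp_all add: mult.assoc algebra_simps)

lemma vector_differentiable_bound:
  assumes "convex S" "\<And>t. t \<in> S \<Longrightarrow> (f has_vector_derivative f' t) (at t within S)" "\<And>t. t \<in> S \<Longrightarrow> norm (f' t) \<le> B"
    "x \<in> S" "y \<in> S"
  shows "norm (f x - f y) \<le> B * norm (x - y)"
proof (rule differentiable_bound[OF assms(1) _ _ assms(4,5)])
  show "(f has_derivative (\<lambda>h. h *\<^sub>R f' t)) (at t within S)" if "t \<in> S" for t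
    using assms(2)[OF that] by (simp add: has_vector_derivative_def)
  show "onorm (\<lambda>h. h *\<^sub>R f' t) \<le> B" if "t \<in> S" for t
    by (rule onorm_le) (use assms(3)[OF that] in \<open>simp add: mult.commute[of B] mult_left_mono\<close>)
qed

text \<open>A Landau-Kolmogorov inequality, from a first-order Taylor expansion with step
  \<open>h\<close>. The step is left free so that the two terms can be balanced in the
  application.\<close>

lemma interpolation:
  fixes g :: "real \<Rightarrow> 'a::real_normed_vector"
  assumes g: "smooth_on UNIV g" and A: "\<And>x. norm (g x) \<le> A" and B: "\<And>x. norm (nth_deriv 2 g x) \<le> B" and h: "0 < h"
  shows "norm (nth_deriv 1 g x) \<le> 2 * A / h + h * B"
proof -
  have B0: "0 \<le> B" using B[of 0] norm_ge_zero order_trans by blast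
  have d1: "(g has_vector_derivative nth_deriv 1 g t) (at t)" for t by (rule smooth_on_deriv1[OF g]) simp
  have d2: "(nth_deriv 1 g has_vector_derivative nth_deriv 2 g t) (at t)" for t
    using smooth_on_deriv[OF g, of t 1] by (simp add: numeral_2_eq_2)
  have L: "norm (nth_deriv 1 g y - nth_deriv 1 g x) \<le> B * norm (y - x)" for x y
    by (rule vector_differentiable_bound[OF convex_UNIV _ B UNIV_I UNIV_I]) (rule d2)
  have "norm ((g (x + h) - (x + h) *\<^sub>R nth_deriv 1 g x) - (g x - x *\<^sub>R nth_deriv 1 g x)) \<le> (B * h) * norm (x + h - x)"
  proof (rule vector_differentiable_bound[where S="{x..x+h}" and f'="\<lambda>t. nth_deriv 1 g t - nth_deriv 1 g x"])
    fix t assume t: "t \<in> {x..x + h}"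
    show "((\<lambda>t. g t - t *\<^sub>R nth_deriv 1 g x) has_vector_derivative nth_deriv 1 g t - nth_deriv 1 g x) (at t within {x..x+h})"
      by (intro has_vector_derivative_diff has_vector_derivative_at_within[OF d1]
          bounded_linear_imp_has_derivative[OF bounded_linear_scaleR_left, folded has_vector_derivative_def])
    have "B * norm (t - x) \<le> B * h" using t B0 by (intro mult_left_mono) auto
    then show "norm (nth_deriv 1 g t - nth_deriv 1 g x) \<le> B * h" using L[of t x] by linarith
  qed (use h in simp_all)
  moreover have "(g (x + h) - (x + h) *\<^sub>R nth_deriv 1 g x) - (g x - x *\<^sub>R nth_deriv 1 g x) = g (x + h) - g x - h *\<^sub>R nth_deriv 1 g x"
    by (simp add: algebra_simps)
  ultimately have "norm (g (x + h) - g x - h *\<^sub>R nth_deriv 1 g x) \<le> (B * h) * norm (x + h - x)" by (simp only:)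
  moreover have "norm (x + h - x) = h" using h by simp
  ultimately have "norm (g (x + h) - g x - h *\<^sub>R nth_deriv 1 g x) \<le> B * h * h" by (simp only:)
  moreover have "norm (h *\<^sub>R nth_deriv 1 g x) = norm ((g (x + h) - g x) - (g (x + h) - g x - h *\<^sub>R nth_deriv 1 g x))" by simp
  ultimately have "norm (h *\<^sub>R nth_deriv 1 g x) \<le> norm (g (x + h)) + norm (g x) + B * h * h"
    using norm_triangle_ineq4[of "g (x+h) - g x" "g (x + h) - g x - h *\<^sub>R nth_deriv 1 g x"] norm_triangle_ineq4[of "g (x+h)" "g x"]
    by linarith
  then have "h * norm (nth_deriv 1 g x) \<le> 2 * A + B * h * h" using h A[of x] A[of "x + h"] by simp
  then show ?thesis using h by (simp add: field_simps)
qed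

section \<open>The derivative of the covering map\<close>

lemma norm_mat3_sq: "(norm (M :: real^3^3))\<^sup>2 = (\<Sum>i\<in>UNIV. \<Sum>j\<in>UNIV. (M $ i $ j)\<^sup>2)"
  by (simp add: norm_vec_def L2_set_def sum_nonneg)

text \<open>\<open>brot w 1 + brot 1 w\<close> is the derivative of \<open>rot\<close> at 1 in the
  direction \<open>w\<close>.\<close>

lemma norm_brot_one: "(norm (brot w 1 + brot 1 w))\<^sup>2 = 8 * (norm w)\<^sup>2 + 4 * (qre w)\<^sup>2"
  unfolding norm_mat3_sq sum_3 vector_add_component brot_entries norm_sq_quat quat_one_simps
  by algebra

text \<open>Multiplicativity of \<open>rot\<close> is polarized: the mixed terms in the expansion of
  the image of (p + q) u are compared.\<close>

lemma brot_mult_rot: "(brot p q + brot q p) ** rot u = brot (p * u) (q * u) + brot (q * u) (p * u)"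
proof -
  interpret b: bounded_bilinear brot by (rule bounded_bilinear_brot)
  interpret m: bounded_bilinear "(**) :: real^3^3 \<Rightarrow> real^3^3 \<Rightarrow> real^3^3" by (rule bounded_bilinear_matrix_matrix_mult)
  have "rot ((p + q) * u) = rot (p + q) ** rot u" by (rule rot_mult)
  moreover have "rot ((p + q) * u) = rot (p * u) + rot (q * u) + (brot (p * u) (q * u) + brot (q * u) (p * u))"
    unfolding rot_def distrib_right b.add_left b.add_right by simp
  moreover have "rot (p + q) ** rot u = rot p ** rot u + rot q ** rot u + (brot p q + brot q p) ** rot u"
    unfolding rot_def[of "p + q"] rot_def[of p] rot_def[of q] b.add_left b.add_right m.add_left by simp
  ultimately show ?thesis by (simp add: rot_mult)
qed

lemma matrix_inv_orthogonal:
  assumes "orthogonal_matrix (Q :: real^'n^'n)"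
  shows "matrix_inv Q = transpose Q"
proof -
  have Q: "Q ** transpose Q = mat 1" "transpose Q ** Q = mat 1" using assms by (simp_all add: orthogonal_matrix_def)
  have "Q ** matrix_inv Q = mat 1 \<and> matrix_inv Q ** Q = mat 1"
    unfolding matrix_inv_def by (rule someI[of _ "transpose Q"]) (use Q in simp)
  then have "transpose Q ** (Q ** matrix_inv Q) = transpose Q" by simp
  then show ?thesis by (simp add: matrix_mul_assoc Q)
qed

text \<open>Right translation turns the logarithmic derivative into the derivative of
  \<open>rot\<close> at 1 in the direction g' g^-1. The value dominates a multiple of
  \<bar>g'\<bar>^2, which transfers the degree condition to the quaternion lift.\<close>

lemma norm_log_derivative_rot:
  assumes g: "smooth_on UNIV g" "\<And>x. norm (g x) = 1"
  shows "(norm (vector_derivative (\<lambda>x. rot (g x)) (at x) ** matrix_inv (rot (g x))))\<^sup>2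
    = 8 * (norm (nth_deriv 1 g x))\<^sup>2 + 4 * (qre (nth_deriv 1 g x * qcnj (g x)))\<^sup>2"
proof -
  have "((\<lambda>x. rot (g x)) has_vector_derivative brot (g x) (nth_deriv 1 g x) + brot (nth_deriv 1 g x) (g x)) (at x)"
    unfolding rot_def
    by (intro bounded_bilinear.has_vector_derivative[OF bounded_bilinear_brot] smooth_on_deriv1[OF g(1)] UNIV_I)
  then have "vector_derivative (\<lambda>x. rot (g x)) (at x) = brot (g x) (nth_deriv 1 g x) + brot (nth_deriv 1 g x) (g x)"
    by (rule vector_derivative_at)
  moreover have "matrix_inv (rot (g x)) = rot (qcnj (g x))"
    by (simp add: matrix_inv_orthogonal rot_orthogonal g(2) rot_qcnj)
  moreover have "norm (nth_deriv 1 g x * qcnj (g x)) = norm (nth_deriv 1 g x)" by (simp add: norm_quat_mult g(2))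
  ultimately show ?thesis
    using norm_brot_one[of "nth_deriv 1 g x * qcnj (g x)"] g(2)[of x] by (simp add: brot_mult_rot add.commute)
qed

section \<open>Iterates of an antiperiodic quaternion cocycle\<close>

locale anticocycle =
  fixes \<alpha> :: real and a :: "real \<Rightarrow> quat"
  assumes irr: "\<alpha> \<notin> \<rat>" and smooth_a: "smooth_on UNIV a" and unit_a: "\<And>x. norm (a x) = 1" and anti_a: "\<And>x. a (x + 1) = - a x"
begin

abbreviation "an \<equiv> qiter \<alpha> a"

lemma smooth_an: "smooth_on UNIV (an n)"
proof (induction n)
  case (Suc n)
  have "smooth_on UNIV (\<lambda>x. a (x + real n * \<alpha>) * an n x)"
    by (intro smooth_on_mult smooth_on_shift smooth_a open_UNIV Suc)
  then show ?case by simp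
qed (simp add: smooth_on_const)

lemma unit_an: "norm (an n x) = 1"
  by (induction n) (simp_all add: norm_quat_mult unit_a)

lemma rot_an: "rot (an n x) = cocycle_iter \<alpha> (\<lambda>x. rot (a x)) n x"
  by (induction n) (simp_all add: rot_one rot_mult)

lemma anti_an: "an n (x + 1) = (-1) ^ n * an n x"
proof (induction n)
  case (Suc n)
  have "a (x + 1 + real n * \<alpha>) = - a (x + real n * \<alpha>)" using anti_a[of "x + real n * \<alpha>"] by (simp add: algebra_simps)
  then show ?case using Suc by (cases "even n") simp_all
qed simp

lemma nth_deriv_an_shift: "norm (nth_deriv m (an n) (x + 1)) = norm (nth_deriv m (an n) x)"
proof -
  have "nth_deriv m (an n) (x + 1) = nth_deriv m (\<lambda>x. an n (x + 1)) x" by (simp add: nth_deriv_shift smooth_an)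
  also have "\<dots> = nth_deriv m (\<lambda>x. if even n then an n x else - an n x) x" by (cases "even n") (simp_all add: anti_an)
  finally show ?thesis using nth_deriv_minus[OF open_UNIV smooth_an, of x m n] by (cases "even n") simp_all
qed

lemma bounded_deriv: "\<exists>c\<ge>1. \<forall>m\<le>r. \<forall>x. norm (nth_deriv m (an n) x) \<le> c"
proof -
  obtain C where C: "C \<ge> 1" "Cb {-1<..<2} r 1 C (an n)"
    by (rule continuous_bounded_Cb[OF smooth_an, of "{-1<..<2}" "-1" 2]) auto
  have "norm (nth_deriv m (an n) x) \<le> C" if "m \<le> r" for m x
  proof -
    have "norm (nth_deriv m (an n) x) = norm (nth_deriv m (an n) (frac x))"
      using periodic_of_int[of "\<lambda>x. norm (nth_deriv m (an n) x)" x "- \<lfloor>x\<rfloor>", OF nth_deriv_an_shift] by (simp add: frac_def)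
    moreover have "frac x \<in> {-1<..<2}" using frac_ge_0[of x] frac_lt_1[of x] unfolding greaterThanLessThan_iff by linarith
    ultimately show ?thesis using CbD[OF C(2) that] by simp
  qed
  then show ?thesis using C(1) by blast
qed

text \<open>The shape (c n)^m is stable under the Leibniz rule: one further factor turns it into (c
  + c n)^m by the binomial theorem.\<close>

lemma trivial_growth: "\<exists>c\<ge>1. \<forall>n m x. m \<le> r \<longrightarrow> norm (nth_deriv m (an n) x) \<le> (c * real n) ^ m"
proof -
  obtain c where c: "c \<ge> 1" "\<And>m x. m \<le> r \<Longrightarrow> norm (nth_deriv m (an 1) x) \<le> c" using bounded_deriv[of r 1] by blast
  have an1: "an 1 = a" by (rule ext) simp
  have ca: "norm (nth_deriv m a x) \<le> c ^ m" if "m \<le> r" for m x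
  proof (cases m)
    case 0 then show ?thesis by (simp add: unit_a)
  next
    case (Suc k)
    have "c \<le> c ^ m" using c(1) Suc self_le_power[of c m] by simp
    then show ?thesis using c(2)[OF that, of x] unfolding an1 by linarith
  qed
  have "norm (nth_deriv m (an n) x) \<le> (c * real n) ^ m" if "m \<le> r" for m n x
    using that
  proof (induction n arbitrary: m x)
    case 0
    have "an 0 = (\<lambda>x. 1)" by (rule ext) simp
    then show ?case by (simp add: nth_deriv_const[OF open_UNIV])
  next
    case (Suc n)
    have "an (Suc n) = (\<lambda>x. a (x + real n * \<alpha>) * an n x)" by (rule ext) simp
    then have "norm (nth_deriv m (an (Suc n)) x)
      = norm (\<Sum>k\<le>m. real (m choose k) *\<^sub>R (nth_deriv k a (x + real n * \<alpha>) * nth_deriv (m - k) (an n) x))"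
      by (simp add: nth_deriv_mult[OF open_UNIV smooth_on_shift[OF smooth_a] smooth_an] nth_deriv_shift[OF smooth_a])
    also have "\<dots> \<le> (\<Sum>k\<le>m. real (m choose k) * (c ^ k * (c * real n) ^ (m - k)))"
      by (rule sum_norm_le)
        (use Suc c ca in \<open>auto simp: norm_quat_mult intro!: mult_left_mono mult_mono\<close>)
    also have "\<dots> = (c + c * real n) ^ m" by (simp add: binomial_ring mult.assoc)
    finally show ?case by (simp add: algebra_simps del: qiter.simps)
  qed
  then show ?thesis using c(1) by blast
qed

text \<open>Unit factors do not affect norms, so the norms of first derivatives are subadditive
  along the orbit.\<close>

lemma deriv_an_add:
  "norm (nth_deriv 1 (an (m + n)) x) \<le> norm (nth_deriv 1 (an m) (x + real n * \<alpha>)) + norm (nth_deriv 1 (an n) x)"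
proof -
  have "an (m + n) = (\<lambda>x. an m (x + real n * \<alpha>) * an n x)" by (rule ext) (rule qiter_add)
  then have "nth_deriv 1 (an (m + n)) x = an m (x + real n * \<alpha>) * nth_deriv 1 (an n) x + nth_deriv 1 (an m) (x + real n * \<alpha>) * an n x"
    by (simp add: nth_deriv_mult[OF open_UNIV smooth_on_shift[OF smooth_an] smooth_an] nth_deriv_shift[OF smooth_an])
  then show ?thesis
    using norm_triangle_ineq[of "an m (x + real n * \<alpha>) * nth_deriv 1 (an n) x" "nth_deriv 1 (an m) (x + real n * \<alpha>) * an n x"]
    by (simp add: norm_quat_mult unit_an)
qed

lemma deriv_an_mult: "norm (nth_deriv 1 (an (q * K)) x) \<le> (\<Sum>i<q. norm (nth_deriv 1 (an K) (x + real i * (real K * \<alpha>))))"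
proof (induction q)
  case 0
  have "an 0 = (\<lambda>x. 1)" by (rule ext) simp
  then show ?case using nth_deriv_const[OF open_UNIV, of x 1 "1::quat"] by simp
next
  case (Suc q)
  then show ?case using deriv_an_add[of K "q * K" x] by (simp add: algebra_simps)
qed

lemma degree_zero_integral:
  assumes deg: "degree_zero \<alpha> (\<lambda>x. rot (a x))" and \<delta>: "0 < \<delta>"
  obtains K where "1 \<le> K" "integral {0..1} (\<lambda>x. (norm (nth_deriv 1 (an K) x))\<^sup>2) \<le> \<delta>\<^sup>2 * (real K)\<^sup>2"
proof -
  define F where "F n x = (norm ((1 / real n) *\<^sub>R
    (vector_derivative (cocycle_iter \<alpha> (\<lambda>x. rot (a x)) n) (at x) ** matrix_inv (cocycle_iter \<alpha> (\<lambda>x. rot (a x)) n x))))\<^sup>2" for n x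
  have cyc: "cocycle_iter \<alpha> (\<lambda>x. rot (a x)) n = (\<lambda>x. rot (an n x))" for n by (rule ext) (simp add: rot_an)
  have F: "F n x = (1 / real n)\<^sup>2 * (8 * (norm (nth_deriv 1 (an n) x))\<^sup>2 + 4 * (qre (nth_deriv 1 (an n) x * qcnj (an n x)))\<^sup>2)" for n x
    unfolding F_def cyc norm_scaleR power_mult_distrib
    by (subst norm_log_derivative_rot[OF smooth_an unit_an]) simp
  have "\<forall>\<^sub>F n in sequentially. L2_norm_circle (\<lambda>x. (1 / real n) *\<^sub>R
    (vector_derivative (cocycle_iter \<alpha> (\<lambda>x. rot (a x)) n) (at x) ** matrix_inv (cocycle_iter \<alpha> (\<lambda>x. rot (a x)) n x))) < \<delta>"
    using deg \<delta> unfolding degree_zero_def by (rule order_tendstoD(2))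
  then have "\<forall>\<^sub>F n in sequentially. sqrt (LBINT x:{0..1}. F n x) < \<delta>" by (simp add: L2_norm_circle_def F_def)
  then obtain N where N: "\<And>n. n \<ge> N \<Longrightarrow> sqrt (LBINT x:{0..1}. F n x) < \<delta>" by (auto simp: eventually_sequentially)
  define K where "K = max N 1"
  have K: "1 \<le> K" "sqrt (LBINT x:{0..1}. F K x) < \<delta>" using N[of K] by (simp_all add: K_def)
  have cd: "continuous_on S (nth_deriv m (an K))" for m S
    using smooth_on_continuous[OF smooth_an] continuous_on_subset by blast
  have cF: "continuous_on {0..1} (F K)"
    unfolding F using cd[of _ 0]
    by (intro continuous_intros cd bounded_linear.continuous_on[OF bounded_linear_qre] bounded_linear.continuous_on[OF bounded_linear_qcnj]) simp
  have "(LBINT x:{0..1}. F K x) = integral {0..1} (F K)"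
    by (intro set_borel_integral_eq_integral(2) borel_integrable_atLeastAtMost' cF)
  then have "integral {0..1} (F K) \<le> \<delta>\<^sup>2"
    using K(2) \<delta> by (metis less_eq_real_def real_sqrt_le_iff real_sqrt_unique)
  moreover have "integral {0..1} (\<lambda>x. (norm (nth_deriv 1 (an K) x))\<^sup>2) \<le> integral {0..1} (\<lambda>x. (real K)\<^sup>2 * F K x)"
  proof (rule integral_le)
    show "(\<lambda>x. (norm (nth_deriv 1 (an K) x))\<^sup>2) integrable_on {0..1}" by (intro integrable_continuous_real continuous_intros cd)
    show "(\<lambda>x. (real K)\<^sup>2 * F K x) integrable_on {0..1}" by (intro integrable_continuous_real continuous_intros cF)
    show "(norm (nth_deriv 1 (an K) x))\<^sup>2 \<le> (real K)\<^sup>2 * F K x" for x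
    proof -
      have "(real K)\<^sup>2 * F K x = 8 * (norm (nth_deriv 1 (an K) x))\<^sup>2 + 4 * (qre (nth_deriv 1 (an K) x * qcnj (an K x)))\<^sup>2"
        using K(1) unfolding F by (simp add: power_divide)
      then show ?thesis using zero_le_power2[of "norm (nth_deriv 1 (an K) x)"] zero_le_power2[of "qre (nth_deriv 1 (an K) x * qcnj (an K x))"]
        by linarith
    qed
  qed
  moreover have "integral {0..1} (\<lambda>x. (real K)\<^sup>2 * F K x) = (real K)\<^sup>2 * integral {0..1} (F K)" by simp
  ultimately have "integral {0..1} (\<lambda>x. (norm (nth_deriv 1 (an K) x))\<^sup>2) \<le> \<delta>\<^sup>2 * (real K)\<^sup>2"
    using mult_left_mono[of "integral {0..1} (F K)" "\<delta>\<^sup>2" "(real K)\<^sup>2"] by (simp add: mult.commute)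
  then show thesis using K(1) that by blast
qed

text \<open>A mean-square bound becomes a uniform one by lengthening the iterate: the derivative of
  the (q K)-th iterate is dominated by a Birkhoff sum over the rotation by K \<alpha>, which for
  suitable q is comparable with the integral.\<close>

lemma small_average:
  assumes deg: "degree_zero \<alpha> (\<lambda>x. rot (a x))" and \<delta>: "0 < \<delta>"
  obtains N where "1 \<le> N" "\<And>x. norm (nth_deriv 1 (an N) x) \<le> 2 * \<delta> * real N"
proof -
  obtain K where K: "1 \<le> K" "integral {0..1} (\<lambda>x. (norm (nth_deriv 1 (an K) x))\<^sup>2) \<le> \<delta>\<^sup>2 * (real K)\<^sup>2"
    using degree_zero_integral[OF deg \<delta>] .
  obtain c where c: "c \<ge> 1" "\<And>m x. m \<le> 2 \<Longrightarrow> norm (nth_deriv m (an K) x) \<le> c" using bounded_deriv[of 2 K] by blast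
  define f where "f x = (norm (nth_deriv 1 (an K) x))\<^sup>2" for x
  have cf: "continuous_on UNIV f" unfolding f_def by (intro continuous_intros smooth_on_continuous[OF smooth_an])
  have per: "f (x + 1) = f x" for x by (simp only: f_def nth_deriv_an_shift)
  have lip: "\<bar>f x - f y\<bar> \<le> 2 * c * c * \<bar>x - y\<bar>" for x y
  proof -
    let ?u = "nth_deriv 1 (an K)"
    have "norm (?u x - ?u y) \<le> c * norm (x - y)"
      by (rule vector_differentiable_bound[OF convex_UNIV _ _ UNIV_I UNIV_I, where f'="nth_deriv 2 (an K)"])
        (use c(2)[of 2] smooth_on_deriv[OF smooth_an, of _ 1 K] in \<open>simp_all add: numeral_2_eq_2\<close>)
    then have 1: "\<bar>norm (?u x) - norm (?u y)\<bar> \<le> c * \<bar>x - y\<bar>" using norm_triangle_ineq3[of "?u x" "?u y"] by simp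
    have 2: "norm (?u x) + norm (?u y) \<le> 2 * c" using c(2)[of 1 x] c(2)[of 1 y] by simp
    have "\<bar>f x - f y\<bar> = (norm (?u x) + norm (?u y)) * \<bar>norm (?u x) - norm (?u y)\<bar>"
      unfolding f_def by (simp add: power2_eq_square square_diff_square_factored abs_mult)
    also have "\<dots> \<le> (2 * c) * (c * \<bar>x - y\<bar>)" using 1 2 c(1) by (intro mult_mono) auto
    finally show ?thesis by (simp add: mult.assoc)
  qed
  have "real K * \<alpha> \<notin> \<rat>"
  proof
    assume "real K * \<alpha> \<in> \<rat>"
    then have "real K * \<alpha> / real K \<in> \<rat>" by (rule Rats_divide) simp
    then show False using K(1) irr by simp
  qed
  \<comment> \<open>\<open>q\<close> is so large that the error 2 L of the Riemann sum, with
    Lipschitz constant L = 2 c^2, is at most q (\<delta> K)^2.\<close>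
  then obtain p q where pq: "real q \<ge> 4 * c * c / (\<delta>\<^sup>2 * (real K)\<^sup>2)" "0 < q" "coprime p (int q)" "\<bar>real K * \<alpha> - of_int p / real q\<bar> < 1 / (real q)\<^sup>2"
    by (rule irrational_coprime_approx)
  have e: "0 < \<delta> * real K" using \<delta> K(1) by simp
  have q4: "2 * (2 * c * c) \<le> real q * (\<delta> * real K)\<^sup>2"
  proof -
    have "0 < \<delta>\<^sup>2 * (real K)\<^sup>2" using \<delta> K(1) by simp
    then have "4 * c * c \<le> real q * (\<delta>\<^sup>2 * (real K)\<^sup>2)" using pq(1) by (simp only: pos_divide_le_eq)
    then show ?thesis by (simp add: power_mult_distrib)
  qed
  have "norm (nth_deriv 1 (an (q * K)) x) \<le> 2 * \<delta> * real (q * K)" for x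
  proof -
    \<comment> \<open>The inequality of arithmetic and geometric means, used with u = \<delta> K,
      replaces the norm by its square, whose integral is controlled.\<close>
    have amgm0: "t \<le> u / 2 + t\<^sup>2 / (2 * u)" if "0 < u" for t u :: real
    proof -
      have "u / 2 + t\<^sup>2 / (2 * u) - t = (t - u)\<^sup>2 / (2 * u)" using that by (simp add: field_simps power2_eq_square)
      moreover have "0 \<le> (t - u)\<^sup>2 / (2 * u)" using that by simp
      ultimately show ?thesis by linarith
    qed
    note amgm = amgm0[OF e]
    have "norm (nth_deriv 1 (an (q * K)) x) \<le> (\<Sum>i<q. norm (nth_deriv 1 (an K) (x + real i * (real K * \<alpha>))))" by (rule deriv_an_mult)
    also have "\<dots> \<le> (\<Sum>i<q. (\<delta> * real K) / 2 + f (x + real i * (real K * \<alpha>)) / (2 * (\<delta> * real K)))"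
      unfolding f_def by (intro sum_mono amgm)
    also have "\<dots> = real q * ((\<delta> * real K) / 2) + (\<Sum>i<q. f (x + real i * (real K * \<alpha>))) / (2 * (\<delta> * real K))"
      by (simp add: sum.distrib sum_divide_distrib)
    also have "(\<Sum>i<q. f (x + real i * (real K * \<alpha>))) / (2 * (\<delta> * real K))
      \<le> (real q * (\<delta> * real K)\<^sup>2 + real q * (\<delta> * real K)\<^sup>2) / (2 * (\<delta> * real K))"
    proof (rule divide_right_mono)
      have "(\<Sum>i<q. f (x + real i * (real K * \<alpha>))) \<le> real q * integral {0..1} f + 2 * (2 * c * c)"
        by (rule riemann_sum_le_integral[OF cf per lip pq(2-4)])
      moreover have "real q * integral {0..1} f \<le> real q * (\<delta> * real K)\<^sup>2"
        using K(2) unfolding f_def by (intro mult_left_mono) (simp_all add: power_mult_distrib)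
      ultimately show "(\<Sum>i<q. f (x + real i * (real K * \<alpha>))) \<le> real q * (\<delta> * real K)\<^sup>2 + real q * (\<delta> * real K)\<^sup>2"
        using q4 by linarith
    qed (use e in simp)
    also have "(real q * (\<delta> * real K)\<^sup>2 + real q * (\<delta> * real K)\<^sup>2) / (2 * (\<delta> * real K)) = real q * (\<delta> * real K)"
      using e by (simp add: power2_eq_square)
    finally have "norm (nth_deriv 1 (an (q * K)) x) \<le> real q * ((\<delta> * real K) / 2) + real q * (\<delta> * real K)" by simp
    moreover have "real q * ((\<delta> * real K) / 2) \<le> real q * (\<delta> * real K)" using e by (intro mult_left_mono) auto
    moreover have "2 * \<delta> * real (q * K) = real q * (\<delta> * real K) + real q * (\<delta> * real K)" by simp
    ultimately show ?thesis by linarith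
  qed
  moreover have "1 \<le> q * K" using pq(2) K(1) by (simp add: Suc_le_eq)
  ultimately show thesis using that by blast
qed

text \<open>The length is divided by an \<open>N\<close> with small average derivative; the
  remainder is shorter than \<open>N\<close> and only contributes to the constant.\<close>

lemma first_growth:
  assumes deg: "degree_zero \<alpha> (\<lambda>x. rot (a x))" and \<delta>: "0 < \<delta>"
  shows "\<exists>C\<ge>0. \<forall>n x. norm (nth_deriv 1 (an n) x) \<le> \<delta> * real n + C"
proof -
  have "0 < \<delta> / 2" using \<delta> by simp
  then obtain N where N: "1 \<le> N" "\<And>x. norm (nth_deriv 1 (an N) x) \<le> 2 * (\<delta> / 2) * real N"
    using small_average[OF deg] by blast
  obtain c where c: "c \<ge> 1" "\<And>n m x. m \<le> 1 \<Longrightarrow> norm (nth_deriv m (an n) x) \<le> (c * real n) ^ m"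
    using trivial_growth[of 1] by blast
  have "norm (nth_deriv 1 (an n) x) \<le> \<delta> * real n + c * real N" for n x
  proof -
    let ?q = "n div N" and ?t = "n mod N"
    have n: "n = ?t + ?q * N" by simp
    have "norm (nth_deriv 1 (an n) x) \<le> norm (nth_deriv 1 (an ?t) (x + real (?q * N) * \<alpha>)) + norm (nth_deriv 1 (an (?q * N)) x)"
      using deriv_an_add[of ?t "?q * N" x] n by simp
    moreover have "norm (nth_deriv 1 (an ?t) (x + real (?q * N) * \<alpha>)) \<le> c * real ?t" using c(2)[of 1 ?t] by simp
    moreover have "c * real ?t \<le> c * real N" using c(1) N(1) by (intro mult_left_mono) (auto simp: less_imp_le)
    moreover have "norm (nth_deriv 1 (an (?q * N)) x) \<le> (\<Sum>i<?q. norm (nth_deriv 1 (an N) (x + real i * (real N * \<alpha>))))" by (rule deriv_an_mult)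
    moreover have "\<dots> \<le> (\<Sum>i<?q. \<delta> * real N)" by (intro sum_mono) (use N(2) in simp)
    moreover have "(\<Sum>i<?q. \<delta> * real N) = \<delta> * real (?q * N)" by simp
    moreover have "\<delta> * real (?q * N) \<le> \<delta> * real n" using \<delta> by (intro mult_left_mono) (auto simp: div_times_less_eq_dividend simp del: of_nat_mult)
    ultimately show ?thesis by linarith
  qed
  moreover have "0 \<le> c * real N" using c(1) by simp
  ultimately show ?thesis by blast
qed

text \<open>Each order is interpolated between the previous one, already small, and the trivial
  bound one order above it, with a step proportional to 1/k.\<close>

lemma growth_order:
  assumes deg: "degree_zero \<alpha> (\<lambda>x. rot (a x))" and "0 < \<eta>"
  shows "\<exists>k0\<ge>1. \<forall>k\<ge>k0. \<forall>n\<le>k. \<forall>x. norm (nth_deriv (Suc m) (an n) x) \<le> \<eta> * real k ^ Suc m"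
  using assms(2)
proof (induction m arbitrary: \<eta>)
  case 0
  then have "0 < \<eta> / 2" by simp
  then obtain C where C: "C \<ge> 0" "\<And>n x. norm (nth_deriv 1 (an n) x) \<le> \<eta> / 2 * real n + C"
    using first_growth[OF deg] by blast
  show ?case
  proof (intro exI[of _ "nat \<lceil>2 * C / \<eta>\<rceil> + 1"] conjI allI impI)
    fix k n x assume k: "nat \<lceil>2 * C / \<eta>\<rceil> + 1 \<le> k" and n: "n \<le> k"
    have "2 * C / \<eta> \<le> real k" using k by linarith
    then have "C \<le> \<eta> / 2 * real k" using 0 by (simp add: field_simps)
    moreover have "\<eta> / 2 * real n \<le> \<eta> / 2 * real k" using n 0 by (intro mult_left_mono) auto
    ultimately have "norm (nth_deriv 1 (an n) x) \<le> \<eta> / 2 * real k + \<eta> / 2 * real k" using C(2)[of n x] by linarith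
    then show "norm (nth_deriv (Suc 0) (an n) x) \<le> \<eta> * real k ^ Suc 0" by simp
  qed simp
next
  case (Suc m)
  obtain c where c: "c \<ge> 1" "\<And>n l x. l \<le> Suc (Suc (Suc m)) \<Longrightarrow> norm (nth_deriv l (an n) x) \<le> (c * real n) ^ l"
    using trivial_growth[of "Suc (Suc (Suc m))"] by blast
  \<comment> \<open>With step s/k and the induction hypothesis at \<eta> s / 4, both terms of the
    interpolation bound contribute \<eta>/2.\<close>
  define s where "s = \<eta> / (2 * c ^ Suc (Suc (Suc m)))"
  have cp: "0 < c ^ Suc (Suc (Suc m))" using c(1) by simp
  have s: "0 < s" using Suc.prems cp unfolding s_def by (intro divide_pos_pos) auto
  have sc: "s * c ^ Suc (Suc (Suc m)) = \<eta> / 2" using c(1) unfolding s_def by (simp add: field_simps)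
  have "0 < \<eta> * s / 4" using s Suc.prems by simp
  then obtain k0 where k0: "k0 \<ge> 1" "\<And>k n x. k \<ge> k0 \<Longrightarrow> n \<le> k \<Longrightarrow> norm (nth_deriv (Suc m) (an n) x) \<le> \<eta> * s / 4 * real k ^ Suc m"
    using Suc.IH[of "\<eta> * s / 4"] by blast
  show ?case
  proof (intro exI[of _ k0] conjI allI impI k0(1))
    fix k n x assume k: "k0 \<le> k" and n: "n \<le> k"
    have kp: "0 < real k" using k k0(1) by simp
    have h: "0 < s / real k" using s kp by simp
    let ?g = "nth_deriv (Suc m) (an n)"
    have B: "norm (nth_deriv 2 ?g y) \<le> (c * real k) ^ Suc (Suc (Suc m))" for y
    proof -
      have "norm (nth_deriv 2 ?g y) \<le> (c * real n) ^ Suc (Suc (Suc m))"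
        using c(2)[of "Suc (Suc (Suc m))" n y] by (simp only: nth_deriv_add numeral_2_eq_2 add_Suc add_0 order_refl)
      also have "\<dots> \<le> (c * real k) ^ Suc (Suc (Suc m))" using c(1) n by (intro power_mono mult_left_mono) auto
      finally show ?thesis .
    qed
    have "norm (nth_deriv 1 ?g x) \<le> 2 * (\<eta> * s / 4 * real k ^ Suc m) / (s / real k) + s / real k * (c * real k) ^ Suc (Suc (Suc m))"
      by (rule interpolation[OF smooth_on_nth_deriv[OF smooth_an] k0(2)[OF k n] B h])
    also have "2 * (\<eta> * s / 4 * real k ^ Suc m) / (s / real k) = \<eta> / 2 * real k ^ Suc (Suc m)"
      using s kp by (simp add: field_simps)
    also have "s / real k * (c * real k) ^ Suc (Suc (Suc m)) = s * c ^ Suc (Suc (Suc m)) * real k ^ Suc (Suc m)"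
      using kp by (simp add: power_mult_distrib)
    also have "\<dots> = \<eta> / 2 * real k ^ Suc (Suc m)" by (simp only: sc)
    finally have "norm (nth_deriv 1 ?g x) \<le> \<eta> * real k ^ Suc (Suc m)" by (simp add: field_simps)
    then show "norm (nth_deriv (Suc (Suc m)) (an n) x) \<le> \<eta> * real k ^ Suc (Suc m)"
      by (simp add: nth_deriv_add)
  qed
qed

lemma growth:
  assumes deg: "degree_zero \<alpha> (\<lambda>x. rot (a x))" and "0 < \<eta>"
  shows "\<exists>k0. \<forall>k\<ge>k0. \<forall>n\<le>k. \<forall>m x. 1 \<le> m \<longrightarrow> m \<le> r \<longrightarrow> norm (nth_deriv m (an n) x) \<le> \<eta> * real k ^ m"
proof (induction r)
  case (Suc r)
  obtain k1 where k1: "\<And>k n m x. k \<ge> k1 \<Longrightarrow> n \<le> k \<Longrightarrow> 1 \<le> m \<Longrightarrow> m \<le> r \<Longrightarrow> norm (nth_deriv m (an n) x) \<le> \<eta> * real k ^ m"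
    using Suc.IH by blast
  obtain k2 where k2: "\<And>k n x. k \<ge> k2 \<Longrightarrow> n \<le> k \<Longrightarrow> norm (nth_deriv (Suc r) (an n) x) \<le> \<eta> * real k ^ Suc r"
    using growth_order[OF assms, of r] by blast
  show ?case
  proof (intro exI[of _ "max k1 k2"] allI impI)
    fix k n m x assume "max k1 k2 \<le> k" "n \<le> k" "1 \<le> m" "m \<le> Suc r"
    then show "norm (nth_deriv m (an n) x) \<le> \<eta> * real k ^ m"
      using k1[of k n m x] k2[of k n x] by (cases "m = Suc r") auto
  qed
qed simp

end

subsection \<open>The renormalized pair\<close>

lemma imag_unit_square: "norm X = 1 \<Longrightarrow> qre X = 0 \<Longrightarrow> X * X = -1"
proof -
  assume X: "norm X = 1" "qre X = 0"
  then have "qcnj X = - X" using qimag_iff[of X] by (simp add: qimag_def)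
  then have "- (X * X) = 1" using unit_mult_cnj(1)[OF X(1)] by simp
  then show "X * X = -1" by (metis minus_minus)
qed

text \<open>The norm of the anticommutator is explicit in the real parts \<open>w\<close>,
  \<open>v\<close> and the inner product \<open>s\<close> of the imaginary parts, so all three are
  small. Gram-Schmidt on the imaginary parts then produces an orthonormal imaginary pair, and such
  pairs anticommute.\<close>

lemma near_anticommuting:
  assumes P: "norm P = 1" and R: "norm R = 1" and d: "norm (P * R + R * P) \<le> 2 * \<delta>" and \<delta>: "\<delta> \<le> 1/8"
  obtains X Y where "qframe X Y" "norm (P - X) \<le> 4 * \<delta>" "norm (R - Y) \<le> 8 * \<delta>"
proof -
  define w v s where "w = qre P" and "v = qre R" and "s = qi P * qi R + qj P * qj R + qk P * qk R"
  define p r where "p = P - of_real w" and "r = R - of_real v"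
  have \<delta>0: "0 \<le> \<delta>" using d norm_ge_zero[of "P * R + R * P"] by linarith
  have P2: "w\<^sup>2 + (qi P)\<^sup>2 + (qj P)\<^sup>2 + (qk P)\<^sup>2 = 1" using norm_sq_quat[of P] P by (simp add: w_def)
  have R2: "v\<^sup>2 + (qi R)\<^sup>2 + (qj R)\<^sup>2 + (qk R)\<^sup>2 = 1" using norm_sq_quat[of R] R by (simp add: v_def)
  have "(norm (P * R + R * P))\<^sup>2 = 4 * (w\<^sup>2 * (v\<^sup>2 + (qi R)\<^sup>2 + (qj R)\<^sup>2 + (qk R)\<^sup>2) + v\<^sup>2 * (w\<^sup>2 + (qi P)\<^sup>2 + (qj P)\<^sup>2 + (qk P)\<^sup>2) - w\<^sup>2 * v\<^sup>2 + s\<^sup>2)"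
    unfolding norm_sq_quat quat_add_simps quat_mult_simps w_def v_def s_def by algebra
  then have eq: "(norm (P * R + R * P))\<^sup>2 = 4 * (w\<^sup>2 + v\<^sup>2 - w\<^sup>2 * v\<^sup>2 + s\<^sup>2)" unfolding P2 R2 by simp
  have "(norm (P * R + R * P))\<^sup>2 \<le> (2 * \<delta>)\<^sup>2" using d by (intro power_mono) auto
  then have le: "w\<^sup>2 + v\<^sup>2 - w\<^sup>2 * v\<^sup>2 + s\<^sup>2 \<le> \<delta>\<^sup>2" unfolding eq by (simp add: power_mult_distrib)
  have w1: "w\<^sup>2 \<le> 1" and v1: "v\<^sup>2 \<le> 1"
    using P2 R2 zero_le_power2[of "qi P"] zero_le_power2[of "qj P"] zero_le_power2[of "qk P"]
      zero_le_power2[of "qi R"] zero_le_power2[of "qj R"] zero_le_power2[of "qk R"] by linarith+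
  have "w\<^sup>2 * v\<^sup>2 \<le> w\<^sup>2" "w\<^sup>2 * v\<^sup>2 \<le> v\<^sup>2" using w1 v1 by (auto intro: mult_left_le mult_left_le_one_le)
  then have "w\<^sup>2 \<le> 4 * \<delta>\<^sup>2" "v\<^sup>2 \<le> 4 * \<delta>\<^sup>2" "s\<^sup>2 \<le> \<delta>\<^sup>2"
    using le zero_le_power2[of w] zero_le_power2[of v] zero_le_power2[of s] zero_le_power2[of \<delta>] by linarith+
  then have "w\<^sup>2 \<le> (2 * \<delta>)\<^sup>2" "v\<^sup>2 \<le> (2 * \<delta>)\<^sup>2" "s\<^sup>2 \<le> \<delta>\<^sup>2" by (simp_all add: power_mult_distrib)
  then have w: "\<bar>w\<bar> \<le> 2 * \<delta>" and v: "\<bar>v\<bar> \<le> 2 * \<delta>" and s: "\<bar>s\<bar> \<le> \<delta>"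
    using \<delta>0 abs_le_square_iff[of w "2 * \<delta>"] abs_le_square_iff[of v "2 * \<delta>"] abs_le_square_iff[of s \<delta>] by linarith+
  define n where "n = norm p"
  have n2: "n\<^sup>2 = 1 - w\<^sup>2" using P2 unfolding n_def norm_sq_quat p_def by (simp add: w_def of_real_def)
  have Pp: "norm (P - p) = \<bar>w\<bar>" by (simp add: p_def)
  have n1: "\<bar>n - 1\<bar> \<le> \<bar>w\<bar>" using norm_triangle_ineq3[of p P] Pp P by (simp add: n_def norm_minus_commute)
  have n0: "n \<ge> 1/2" using n1 w \<delta> by linarith
  have p0: "p \<noteq> 0" using n0 by (auto simp: n_def)
  define X where "X = qsgn p"
  have X: "X = inverse n *\<^sub>R p" by (simp add: X_def qsgn_eq n_def)
  have X1: "norm X = 1" unfolding X_def by (rule norm_qsgn[OF p0])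
  have Xre: "qre X = 0" by (simp add: X p_def w_def of_real_def)
  have "(n - 1) * inverse n = 1 - inverse n" using n0 by (simp add: left_diff_distrib)
  then have "p - X = (n - 1) *\<^sub>R X" by (simp add: X scaleR_diff_left)
  then have pX: "norm (p - X) \<le> \<bar>w\<bar>" using n1 X1 by simp
  have PX: "norm (P - X) \<le> 4 * \<delta>" using norm_triangle_ineq[of "P - p" "p - X"] Pp pX w by simp
  define t where "t = s / n"
  have t: "\<bar>t\<bar> \<le> 2 * \<delta>"
  proof -
    have "\<bar>s\<bar> \<le> 2 * \<delta> * n" using s mult_left_mono[OF n0, of "2 * \<delta>"] \<delta>0 by simp
    then show ?thesis using n0 by (simp add: t_def abs_divide field_simps)
  qed
  define y0 where "y0 = r - t *\<^sub>R X"
  have "R - y0 = of_real v + t *\<^sub>R X" by (simp add: y0_def r_def)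
  then have Ry: "norm (R - y0) \<le> 4 * \<delta>" using norm_triangle_ineq[of "of_real v" "t *\<^sub>R X"] X1 v t by simp
  have ny: "\<bar>norm y0 - 1\<bar> \<le> 4 * \<delta>" using norm_triangle_ineq3[of y0 R] Ry R by (simp add: norm_minus_commute)
  have y00: "y0 \<noteq> 0" using ny \<delta> by auto
  define Y where "Y = qsgn y0"
  have Y: "Y = inverse (norm y0) *\<^sub>R y0" by (simp add: Y_def qsgn_eq)
  have Y1: "norm Y = 1" unfolding Y_def by (rule norm_qsgn[OF y00])
  have Yre: "qre Y = 0" using Xre by (simp add: Y y0_def r_def v_def of_real_def)
  have "(norm y0 - 1) * inverse (norm y0) = 1 - inverse (norm y0)" using y00 by (simp add: left_diff_distrib)
  then have "y0 - Y = (norm y0 - 1) *\<^sub>R Y" by (simp add: Y scaleR_diff_left)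
  then have yY: "norm (y0 - Y) \<le> 4 * \<delta>" using ny Y1 by simp
  have RY: "norm (R - Y) \<le> 8 * \<delta>" using norm_triangle_ineq[of "R - y0" "y0 - Y"] Ry yY by simp
  have "inner X r = t"
    by (simp add: X inner_quat_def p_def r_def w_def v_def of_real_def t_def s_def divide_inverse algebra_simps)
  then have "inner X y0 = 0" using X1 by (simp add: y0_def inner_diff_right dot_square_norm)
  then have "inner X Y = 0" by (simp add: Y)
  then have XY: "qi X * qi Y + qj X * qj Y + qk X * qk Y = 0" using Xre by (simp add: inner_quat_def)
  have "qframe X Y"
  proof
    show "X * X = -1" "Y * Y = -1" using imag_unit_square X1 Xre Y1 Yre by auto
    show "Y * X = - (X * Y)" using XY Xre Yre by (simp add: quat_eq_iff quat_mult_simps algebra_simps)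
  qed
  then show thesis using PX RY that by blast
qed

section \<open>Products, periodic extension and rescaling of almost constant curves\<close>

lemma Cb_rmult:
  assumes "norm (X::quat) = 1" "open S" "Cb S r Q b f"
  shows "Cb S r Q b (\<lambda>y. f y * X)"
  using Cb_linear[OF bounded_linear_mult_left[of X], of 1 S r Q b f] assms by (simp add: norm_quat_mult)

lemma Cb_near_mult:
  assumes S: "open S" and X: "norm (X::quat) = 1" and Y: "norm (Y::quat) = 1"
    and f: "Cb S r Q b (\<lambda>x. f x - X)" and g: "Cb S r Q c (\<lambda>x. g x - Y)"
  shows "Cb S r Q (2 ^ r * b * c + b + c) (\<lambda>x. f x * g x - X * Y)"
proof -
  have "Cb S r Q (2 ^ r * b * c + b + c) (\<lambda>x. (f x - X) * (g x - Y) + (f x - X) * Y + X * (g x - Y))"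
    by (intro Cb_add S Cb_mult f g Cb_rmult[OF Y] Cb_lmult[OF X])
  then show ?thesis by (simp add: algebra_simps)
qed

lemma Cb_near_qcnj: "open S \<Longrightarrow> Cb S r Q b (\<lambda>x. f x - X) \<Longrightarrow> Cb S r Q b (\<lambda>x. qcnj (f x) - qcnj X)"
  using Cb_qcnj[of S r Q b "\<lambda>x. f x - X"] by (simp add: qcnj_diff)

text \<open>For t \<le> 1 products of errors are absorbed into single errors, so the total stays
  linear in t.\<close>

lemma Cb_near_conj:
  assumes S: "open S" and Y: "norm (Y::quat) = 1" and t: "0 \<le> t" "t \<le> 1"
    and f: "Cb S r 1 t (\<lambda>x. f x - 1)" and g: "Cb S r 1 t (\<lambda>x. g x - Y)" and h: "Cb S r 1 t (\<lambda>x. h x - 1)"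
  shows "Cb S r 1 ((2 ^ r + 2)\<^sup>2 * t) (\<lambda>x. f x * g x * qcnj (h x) - Y)"
proof -
  define Q where "Q = (2::real) ^ r"
  have Q: "Q \<ge> 1" by (simp add: Q_def)
  have 1: "Cb S r 1 (2 ^ r * t * t + t + t) (\<lambda>x. f x * g x - 1 * Y)"
    by (rule Cb_near_mult[OF S _ Y f g]) simp
  have le1: "2 ^ r * t * t + t + t \<le> (Q + 2) * t"
  proof -
    have "Q * t * t \<le> Q * t * 1" using Q t by (intro mult_left_mono) auto
    then show ?thesis by (simp add: Q_def algebra_simps)
  qed
  have 2: "Cb S r 1 ((Q + 2) * t) (\<lambda>x. f x * g x - Y)" using Cb_le[OF 1 le1] by simp
  have 3: "Cb S r 1 (2 ^ r * ((Q + 2) * t) * t + (Q + 2) * t + t) (\<lambda>x. f x * g x * qcnj (h x) - Y * qcnj 1)"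
    by (rule Cb_near_mult[OF S Y _ 2 Cb_near_qcnj[OF S h]]) simp
  have le2: "2 ^ r * ((Q + 2) * t) * t + (Q + 2) * t + t \<le> (Q + 2)\<^sup>2 * t"
  proof -
    have "Q * ((Q + 2) * t) * t \<le> Q * ((Q + 2) * t) * 1" using Q t by (intro mult_left_mono) auto
    then have "2 ^ r * ((Q + 2) * t) * t + (Q + 2) * t + t \<le> Q * ((Q + 2) * t) + (Q + 2) * t + t" by (simp add: Q_def)
    also have "\<dots> \<le> Q * ((Q + 2) * t) + (Q + 2) * t + (Q + 2) * t" using Q t by (simp add: algebra_simps)
    also have "\<dots> = (Q + 2)\<^sup>2 * t" by (simp add: power2_eq_square algebra_simps)
    finally show ?thesis .
  qed
  show ?thesis using Cb_le[OF 3 le2] by (simp add: Q_def)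
qed

text \<open>Translation by \<open>p\<close> acts on every derivative through the isometry z
  \<mapsto> u z v, so a bound over one period is a bound everywhere.\<close>

lemma Cb_periodic:
  fixes f :: "real \<Rightarrow> quat"
  assumes f: "smooth_on UNIV f" and p: "p > 0" "{0..<p} \<subseteq> S"
    and per: "\<And>y. f (y + p) = u * f y * v" "norm u = 1" "norm v = 1" and C: "Cb S r Q b f"
  shows "Cb UNIV r Q b f"
  unfolding Cb_def
proof (intro conjI allI impI ballI f)
  fix m x assume m: "m \<le> r"
  have L: "bounded_linear (\<lambda>z. u * z * v)"
    by (rule bounded_linear_compose[OF bounded_linear_mult_left bounded_linear_mult_right])
  have *: "norm (nth_deriv m f (y + p)) = norm (nth_deriv m f y)" for y
  proof -
    have "nth_deriv m f (y + p) = nth_deriv m (\<lambda>y. f (y + p)) y" by (rule nth_deriv_shift[OF f, symmetric])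
    also have "\<dots> = u * nth_deriv m f y * v" unfolding per(1) by (rule nth_deriv_linear[OF L open_UNIV f UNIV_I])
    finally show ?thesis by (simp add: norm_quat_mult per)
  qed
  have "norm (nth_deriv m f (p * (x / p + of_int (- \<lfloor>x / p\<rfloor>)))) = norm (nth_deriv m f (p * (x / p)))"
    by (rule periodic_of_int[of "\<lambda>z. norm (nth_deriv m f (p * z))"]) (simp add: distrib_left *)
  then have "norm (nth_deriv m f x) = norm (nth_deriv m f (p * frac (x / p)))" using p by (simp add: frac_def)
  moreover have "p * frac (x / p) \<in> S" using p frac_ge_0[of "x / p"] frac_lt_1[of "x / p"] by (auto intro!: subsetD[OF p(2)])
  ultimately show "norm (nth_deriv m f x) \<le> b * Q ^ m" using CbD[OF C m] by simp
qed

text \<open>The m-th derivative acquires the factor t^m, bounded uniformly by K^r. It is used to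
  return from the rescaled variable, with a factor that is fixed before the accuracy is
  chosen.\<close>

lemma Cb_rescale:
  assumes "Cb UNIV r 1 b f" "1 \<le> K" "\<bar>t\<bar> \<le> K" "0 \<le> b"
  shows "Cb UNIV r 1 (b * K ^ r) (\<lambda>x. f (t * x))"
  unfolding Cb_def
proof (intro conjI allI impI ballI)
  note f = Cb_smooth[OF assms(1)]
  show "smooth_on UNIV (\<lambda>x. f (t * x))" using smooth_on_affine[OF open_UNIV open_UNIV _ f, of t 0] by simp
  fix m x assume m: "m \<le> r"
  have "nth_deriv m (\<lambda>x. f (t * x)) x = t ^ m *\<^sub>R nth_deriv m f (t * x)"
    using nth_deriv_affine[OF open_UNIV open_UNIV _ f, of t 0 x m] by simp
  then have "norm (nth_deriv m (\<lambda>x. f (t * x)) x) = \<bar>t\<bar> ^ m * norm (nth_deriv m f (t * x))" by (simp add: power_abs)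
  also have "\<dots> \<le> K ^ r * b"
  proof (rule mult_mono)
    have "\<bar>t\<bar> ^ m \<le> K ^ m" using assms by (intro power_mono) auto
    also have "\<dots> \<le> K ^ r" using assms m by (intro power_increasing) auto
    finally show "\<bar>t\<bar> ^ m \<le> K ^ r" .
    show "norm (nth_deriv m f (t * x)) \<le> b" using CbD[OF assms(1) m, of "t * x"] by simp
  qed (use assms in auto)
  finally show "norm (nth_deriv m (\<lambda>x. f (t * x)) x) \<le> b * K ^ r * 1 ^ m" by (simp add: mult.commute)
qed

text \<open>\<open>nearc Ad s \<theta> c Z\<close>: sufficiently good conjugations \<open>b\<close> (those with \<open>Ad \<eta> b\<close> for small \<open>\<eta>\<close>) take the
  skew product \<open>(x, S) \<mapsto> (x + \<theta>, c x S)\<close> close to the constant \<open>Z\<close>. Such skew products form a group,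
  so it is enough to control the conjugation on two generators of the lattice.\<close>

definition nearc :: "(real \<Rightarrow> (real \<Rightarrow> quat) \<Rightarrow> bool) \<Rightarrow> nat \<Rightarrow> real \<Rightarrow> (real \<Rightarrow> quat) \<Rightarrow> quat \<Rightarrow> bool" where
  "nearc Ad s \<theta> c Z \<longleftrightarrow> norm Z = 1 \<and> (\<forall>\<delta>>0. \<exists>\<eta>0>0. \<forall>\<eta> b. 0 < \<eta> \<longrightarrow> \<eta> \<le> \<eta>0 \<longrightarrow> Ad \<eta> b \<longrightarrow>
     Cb UNIV s 1 \<delta> (\<lambda>x. b (x + \<theta>) * c x * qcnj (b x) - Z))"

lemma nearc_mult:
  assumes Ad: "\<And>\<eta> b x. Ad \<eta> b \<Longrightarrow> norm (b x) = 1" and 1: "nearc Ad s \<theta>1 c1 Z1" and 2: "nearc Ad s \<theta>2 c2 Z2"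
  shows "nearc Ad s (\<theta>1 + \<theta>2) (\<lambda>x. c1 (x + \<theta>2) * c2 x) (Z1 * Z2)"
  unfolding nearc_def
proof (intro conjI allI impI)
  have Z: "norm Z1 = 1" "norm Z2 = 1" using 1 2 by (auto simp: nearc_def)
  then show "norm (Z1 * Z2) = 1" by (simp add: norm_quat_mult)
  fix \<delta> :: real assume \<delta>: "0 < \<delta>"
  define d where "d = min 1 (\<delta> / (2 ^ s + 2))"
  have d: "0 < d" "d \<le> 1" "d * (2 ^ s + 2) \<le> \<delta>"
  proof -
    have p: "(0::real) < 2 ^ s + 2" by (simp add: add_pos_pos)
    show "0 < d" "d \<le> 1" using \<delta> p by (auto simp: d_def)
    have "d \<le> \<delta> / (2 ^ s + 2)" by (simp add: d_def)
    then show "d * (2 ^ s + 2) \<le> \<delta>" using p by (simp only: pos_le_divide_eq)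
  qed
  obtain \<eta>1 where \<eta>1: "\<eta>1 > 0" "\<And>\<eta> b. 0 < \<eta> \<Longrightarrow> \<eta> \<le> \<eta>1 \<Longrightarrow> Ad \<eta> b \<Longrightarrow> Cb UNIV s 1 d (\<lambda>x. b (x + \<theta>1) * c1 x * qcnj (b x) - Z1)"
    using 1 d(1) unfolding nearc_def by blast
  obtain \<eta>2 where \<eta>2: "\<eta>2 > 0" "\<And>\<eta> b. 0 < \<eta> \<Longrightarrow> \<eta> \<le> \<eta>2 \<Longrightarrow> Ad \<eta> b \<Longrightarrow> Cb UNIV s 1 d (\<lambda>x. b (x + \<theta>2) * c2 x * qcnj (b x) - Z2)"
    using 2 d(1) unfolding nearc_def by blast
  show "\<exists>\<eta>0>0. \<forall>\<eta> b. 0 < \<eta> \<longrightarrow> \<eta> \<le> \<eta>0 \<longrightarrow> Ad \<eta> b \<longrightarrow>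
     Cb UNIV s 1 \<delta> (\<lambda>x. b (x + (\<theta>1 + \<theta>2)) * (c1 (x + \<theta>2) * c2 x) * qcnj (b x) - Z1 * Z2)"
  proof (intro exI[of _ "min \<eta>1 \<eta>2"] conjI allI impI)
    show "0 < min \<eta>1 \<eta>2" using \<eta>1(1) \<eta>2(1) by simp
    fix \<eta> b assume \<eta>: "0 < \<eta>" "\<eta> \<le> min \<eta>1 \<eta>2" and b: "Ad \<eta> b"
    have "Cb UNIV s 1 d (\<lambda>x. b (x + \<theta>2 + \<theta>1) * c1 (x + \<theta>2) * qcnj (b (x + \<theta>2)) - Z1)"
      using Cb_shift[OF \<eta>1(2)[OF \<eta>(1) _ b], of \<theta>2] \<eta>(2) by simp
    from Cb_near_mult[OF open_UNIV Z this \<eta>2(2)[OF \<eta>(1) _ b]] \<eta>(2)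
    have "Cb UNIV s 1 (2 ^ s * d * d + d + d) (\<lambda>x. b (x + \<theta>2 + \<theta>1) * c1 (x + \<theta>2) * qcnj (b (x + \<theta>2)) * (b (x + \<theta>2) * c2 x * qcnj (b x)) - Z1 * Z2)"
      by simp
    moreover have "b (x + \<theta>2 + \<theta>1) * c1 (x + \<theta>2) * qcnj (b (x + \<theta>2)) * (b (x + \<theta>2) * c2 x * qcnj (b x))
      = b (x + (\<theta>1 + \<theta>2)) * (c1 (x + \<theta>2) * c2 x) * qcnj (b x)" for x
      using Ad[OF b] by (simp add: mult.assoc add_ac)
    ultimately have "Cb UNIV s 1 (2 ^ s * d * d + d + d) (\<lambda>x. b (x + (\<theta>1 + \<theta>2)) * (c1 (x + \<theta>2) * c2 x) * qcnj (b x) - Z1 * Z2)" by simp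
    moreover have "2 ^ s * d * d + d + d \<le> \<delta>"
    proof -
      have "2 ^ s * d * d \<le> 2 ^ s * d * 1" using d by (intro mult_left_mono) auto
      then have "2 ^ s * d * d + d + d \<le> d * (2 ^ s + 2)" by (simp add: algebra_simps)
      then show ?thesis using d(3) by linarith
    qed
    ultimately show "Cb UNIV s 1 \<delta> (\<lambda>x. b (x + (\<theta>1 + \<theta>2)) * (c1 (x + \<theta>2) * c2 x) * qcnj (b x) - Z1 * Z2)"
      by (rule Cb_le) simp
  qed
qed

lemma nearc_inverse:
  assumes 1: "nearc Ad s \<theta> c Z"
  shows "nearc Ad s (- \<theta>) (\<lambda>x. qcnj (c (x - \<theta>))) (qcnj Z)"
  unfolding nearc_def
proof (intro conjI allI impI)
  show "norm (qcnj Z) = 1" using 1 by (simp add: nearc_def)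
  fix \<delta> :: real assume \<delta>: "0 < \<delta>"
  obtain \<eta>1 where \<eta>1: "\<eta>1 > 0" "\<And>\<eta> b. 0 < \<eta> \<Longrightarrow> \<eta> \<le> \<eta>1 \<Longrightarrow> Ad \<eta> b \<Longrightarrow> Cb UNIV s 1 \<delta> (\<lambda>x. b (x + \<theta>) * c x * qcnj (b x) - Z)"
    using 1 \<delta> unfolding nearc_def by blast
  show "\<exists>\<eta>0>0. \<forall>\<eta> b. 0 < \<eta> \<longrightarrow> \<eta> \<le> \<eta>0 \<longrightarrow> Ad \<eta> b \<longrightarrow>
     Cb UNIV s 1 \<delta> (\<lambda>x. b (x + - \<theta>) * qcnj (c (x - \<theta>)) * qcnj (b x) - qcnj Z)"
  proof (intro exI[of _ \<eta>1] conjI allI impI \<eta>1(1))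
    fix \<eta> b assume \<eta>: "0 < \<eta>" "\<eta> \<le> \<eta>1" and b: "Ad \<eta> b"
    show "Cb UNIV s 1 \<delta> (\<lambda>x. b (x + - \<theta>) * qcnj (c (x - \<theta>)) * qcnj (b x) - qcnj Z)"
      using Cb_near_qcnj[OF open_UNIV Cb_shift[OF \<eta>1(2)[OF \<eta> b], of "- \<theta>"]] by (simp add: qcnj_mult mult.assoc)
  qed
qed

lemma nearc_minus:
  assumes 1: "nearc Ad s \<theta> c Z"
  shows "nearc Ad s \<theta> (\<lambda>x. - c x) (- Z)"
  unfolding nearc_def
proof (intro conjI allI impI)
  show "norm (- Z) = 1" using 1 by (simp add: nearc_def)
  fix \<delta> :: real assume \<delta>: "0 < \<delta>"
  obtain \<eta>1 where \<eta>1: "\<eta>1 > 0" "\<And>\<eta> b. 0 < \<eta> \<Longrightarrow> \<eta> \<le> \<eta>1 \<Longrightarrow> Ad \<eta> b \<Longrightarrow> Cb UNIV s 1 \<delta> (\<lambda>x. b (x + \<theta>) * c x * qcnj (b x) - Z)"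
    using 1 \<delta> unfolding nearc_def by blast
  show "\<exists>\<eta>0>0. \<forall>\<eta> b. 0 < \<eta> \<longrightarrow> \<eta> \<le> \<eta>0 \<longrightarrow> Ad \<eta> b \<longrightarrow> Cb UNIV s 1 \<delta> (\<lambda>x. b (x + \<theta>) * - c x * qcnj (b x) - - Z)"
  proof (intro exI[of _ \<eta>1] conjI allI impI \<eta>1(1))
    fix \<eta> b assume \<eta>: "0 < \<eta>" "\<eta> \<le> \<eta>1" and b: "Ad \<eta> b"
    show "Cb UNIV s 1 \<delta> (\<lambda>x. b (x + \<theta>) * - c x * qcnj (b x) - - Z)"
      using Cb_minus[OF open_UNIV \<eta>1(2)[OF \<eta> b]] by simp
  qed
qed

lemma nearc_one:
  assumes "\<And>\<eta> b x. Ad \<eta> b \<Longrightarrow> norm (b x) = 1"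
  shows "nearc Ad s 0 (\<lambda>x. 1) 1"
  unfolding nearc_def using assms by (auto intro!: exI[of _ 1] simp: Cb_const)

section \<open>The rescaled iterates as an almost anticommuting pair\<close>

context anticocycle
begin

lemma an_int_shift: "an n (x + of_int j) = (if even (int n * j) then an n x else - an n x)"
proof (cases "even n")
  case True
  then have "an n (x + 1) = an n x" for x by (simp add: anti_an)
  then show ?thesis using periodic_of_int[of "an n" x j] True by simp
next
  case False
  then have s: "an n (x + 1) = - an n x" for x by (simp add: anti_an)
  have "an n (x + of_int j) = (if even j then an n x else - an n x)"
  proof (induction j rule: int_induct[of _ 0])
    case (step1 i)
    then show ?case using s[of "x + of_int i"] by (auto simp: add_ac)
  next
    case (step2 i)
    then show ?case using s[of "x + of_int (i - 1)"] by (auto simp: algebra_simps)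
  qed simp
  then show ?thesis using False by simp
qed

text \<open>Iterates of one cocycle commute exactly as skew products. Dropping the integer
  translations \<open>h\<close> and \<open>p'\<close> costs the signs (-1)^(q' h) and (-1)^(k p'),
  which differ because the determinant is odd.\<close>

lemma an_commute:
  assumes "odd (int k * p' - h * int q')"
  shows "an q' (x + (real k * \<alpha> - of_int h)) * an k x = - (an k (x + (real q' * \<alpha> - of_int p')) * an q' x)"
proof -
  have "an q' (x + real k * \<alpha>) * an k x = an k (x + real q' * \<alpha>) * an q' x"
    using qiter_add[of \<alpha> a q' k x] qiter_add[of \<alpha> a k q' x] by (simp add: add.commute)
  moreover have "an q' (x + (real k * \<alpha> - of_int h)) = (if even (int q' * h) then an q' (x + real k * \<alpha>) else - an q' (x + real k * \<alpha>))"
    using an_int_shift[of q' "x + real k * \<alpha>" "- h"] by (simp add: add_diff_eq)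
  moreover have "an k (x + (real q' * \<alpha> - of_int p')) = (if even (int k * p') then an k (x + real q' * \<alpha>) else - an k (x + real q' * \<alpha>))"
    using an_int_shift[of k "x + real q' * \<alpha>" "- p'"] by (simp add: add_diff_eq)
  moreover have "even (int k * p') \<longleftrightarrow> odd (int q' * h)" using assms by (auto simp: mult.commute)
  ultimately show ?thesis by auto
qed

text \<open>With \<open>\<tau> = q' \<alpha> - p'\<close> and \<open>\<tau>\<^sub>1 = k \<alpha> - h\<close> one has \<open>k \<tau> - q' \<tau>\<^sub>1 = \<plusminus>1\<close>; choosing the sign of \<open>\<tau>\<^sub>1\<close>
  prevents cancellation and makes \<open>\<bar>\<tau>\<bar>\<close> comparable to \<open>1 / k\<close>.\<close>

lemma cocycle_pair:
  obtains h p' :: int and k q' :: nat where "M \<le> real k" "0 < k" "q' \<le> k"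
    "1 / real k \<le> \<bar>real q' * \<alpha> - of_int p'\<bar>" "\<bar>real q' * \<alpha> - of_int p'\<bar> \<le> 2 / real k" "\<bar>real k * \<alpha> - of_int h\<bar> < 1 / real k"
    "(real k * \<alpha> - of_int h) / (real q' * \<alpha> - of_int p') \<notin> \<rat>" "\<bar>int k * p' - h * int q'\<bar> = 1"
proof -
  obtain h :: int and k :: nat where hk: "real k \<ge> M" "0 < k" "coprime h (int k)" "\<bar>\<alpha> - of_int h / real k\<bar> < 1 / (real k)\<^sup>2"
    using irrational_coprime_approx[OF irr] .
  have kp: "0 < real k" using hk by simp
  define t1 where "t1 = real k * \<alpha> - of_int h"
  have t1: "\<bar>t1\<bar> < 1 / real k"
  proof -
    have "\<bar>t1\<bar> = real k * \<bar>\<alpha> - of_int h / real k\<bar>" using kp by (simp add: t1_def abs_mult_pos' right_diff_distrib)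
    also have "\<dots> < real k * (1 / (real k)\<^sup>2)" using hk(4) kp by (rule mult_strict_left_mono)
    finally show ?thesis using kp by (simp add: power2_eq_square)
  qed
  define \<epsilon> :: int where "\<epsilon> = (if t1 \<ge> 0 then 1 else -1)"
  obtain u v where uv: "u * h + v * int k = 1" using bezout_int[of h "int k"] hk(3) by auto
  \<comment> \<open>A residue modulo \<open>k\<close>, so that q' \<le> k and the growth bound for
    lengths up to k covers both iterates.\<close>
  define q' where "q' = nat ((\<epsilon> * u) mod int k)"
  define p' where "p' = - (\<epsilon> * v) - h * ((\<epsilon> * u) div int k)"
  have q': "int q' = \<epsilon> * u - int k * ((\<epsilon> * u) div int k)" using hk(2) by (simp add: q'_def minus_mult_div_eq_mod)
  have q'k: "q' \<le> k" using hk(2) by (simp add: q'_def nat_le_iff less_imp_le)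
  have e: "int k * p' - h * int q' = - \<epsilon>"
  proof -
    have "int k * p' - h * int q' = - \<epsilon> * (u * h + v * int k)" unfolding q' p'_def by (simp add: algebra_simps)
    then show ?thesis using uv by simp
  qed
  define t' where "t' = real q' * \<alpha> - of_int p'"
  have "real k * t' - real q' * t1 = - of_int (int k * p' - h * int q')" by (simp add: t1_def t'_def algebra_simps)
  then have kt': "real k * t' = of_int \<epsilon> + real q' * t1" using e by simp
  have q't1: "real q' * \<bar>t1\<bar> \<le> 1"
  proof -
    have "real q' * \<bar>t1\<bar> \<le> real k * (1 / real k)" using q'k t1 by (intro mult_mono) auto
    then show ?thesis using kp by simp
  qed
  have "\<bar>of_int \<epsilon> + real q' * t1\<bar> = 1 + real q' * \<bar>t1\<bar>"
  proof (cases "t1 \<ge> 0")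
    case False
    then have "real q' * t1 \<le> 0" by (simp add: mult_nonneg_nonpos)
    then show ?thesis using False by (simp add: \<epsilon>_def)
  qed (simp add: \<epsilon>_def)
  then have "real k * \<bar>t'\<bar> = 1 + real q' * \<bar>t1\<bar>" using kt' kp by (metis abs_mult abs_of_nat)
  then have "1 \<le> real k * \<bar>t'\<bar>" "real k * \<bar>t'\<bar> \<le> 2" using q't1 by auto
  then have t': "1 / real k \<le> \<bar>t'\<bar>" "\<bar>t'\<bar> \<le> 2 / real k" using kp by (simp_all add: field_simps)
  \<comment> \<open>A rational ratio is an integer relation for \<alpha>; irrationality makes both
    of its coefficients vanish, contrary to the nonzero determinant.\<close>
  have "t1 / t' \<notin> \<rat>"
  proof
    assume "t1 / t' \<in> \<rat>"
    then obtain m n :: int where mn: "n > 0" "t1 / t' = of_int m / of_int n" by (rule Rats_cases')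
    have t'0: "t' \<noteq> 0" using t'(1) kp by auto
    have "of_int n * t1 = of_int m * t'" using mn t'0 by (simp add: field_simps)
    then have r: "(of_int (n * int k - m * int q')) * \<alpha> = of_int (n * h - m * p')" by (simp add: t1_def t'_def algebra_simps)
    have z1: "n * int k - m * int q' = 0"
    proof (rule ccontr)
      assume "n * int k - m * int q' \<noteq> 0"
      then have "\<alpha> = of_int (n * h - m * p') / of_int (n * int k - m * int q')" using r
        by (metis nonzero_mult_div_cancel_left of_int_eq_0_iff)
      then have "\<alpha> \<in> \<rat>" by (metis Rats_divide Rats_of_int)
      then show False using irr by simp
    qed
    have z2: "n * h - m * p' = 0" using r unfolding z1 by (metis mult_zero_left of_int_0 of_int_eq_0_iff)
    have "n * (int k * p' - h * int q') = (n * int k - m * int q') * p' - (n * h - m * p') * int q'" by (simp add: algebra_simps)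
    then have "n * (int k * p' - h * int q') = 0" unfolding z1 z2 by simp
    then show False using mn(1) e by (auto simp: \<epsilon>_def split: if_splits)
  qed
  then show thesis
    using that[OF hk(1,2) q'k, of p' h] t' t1 e by (simp add: t1_def t'_def \<epsilon>_def split: if_splits)
qed

text \<open>The generators are treated asymmetrically: the first becomes the constant
  \<open>X\<close> exactly, and only the second carries an error.\<close>

definition adapted where
  "adapted s h k p' q' X Y \<eta> b \<longleftrightarrow> smooth_on UNIV b \<and> (\<forall>x. norm (b x) = 1) \<and>
     (\<forall>x. b (x + (real q' * \<alpha> - of_int p')) * an q' x = X * b x) \<and>
     Cb UNIV s 1 \<eta> (\<lambda>x. b (x + (real k * \<alpha> - of_int h)) * an k x * qcnj (b x) - Y)"

text \<open>The m-th derivative in the rescaled variable is at most (\<bar>t\<bar> k)^m \<eta> \<le>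
  2^m \<eta>. The term 8 \<eta> is a displacement at speed 2 \<eta> over a distance below 4.\<close>

lemma rescaled_near:
  assumes g: "\<And>m x. 1 \<le> m \<Longrightarrow> m \<le> r \<Longrightarrow> norm (nth_deriv m (an n) x) \<le> \<eta> * real k ^ m" and r: "1 \<le> r" and \<eta>: "0 \<le> \<eta>"
    and k: "0 < k" and t: "\<bar>t\<bar> \<le> 2 / real k"
  shows "norm (an n (t * y) - an n (t * z)) \<le> 2 * \<eta> * \<bar>y - z\<bar>"
    and "norm (an n 0 - X) \<le> d \<Longrightarrow> Cb {-4<..<4} r 1 (d + 8 * \<eta> + 2 ^ r * \<eta>) (\<lambda>y. an n (t * y) - X)"
proof -
  have tk: "\<bar>t\<bar> * real k \<le> 2" using t k by (simp add: field_simps)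
  have d: "nth_deriv m (\<lambda>y. an n (t * y)) y = t ^ m *\<^sub>R nth_deriv m (an n) (t * y)" for m y
    using nth_deriv_affine[OF open_UNIV open_UNIV _ smooth_an, of t 0 y m n] by simp
  have sm: "smooth_on UNIV (\<lambda>y. an n (t * y))"
    using smooth_on_affine[OF open_UNIV open_UNIV _ smooth_an, of t 0 n] by simp
  have bd: "norm (nth_deriv m (\<lambda>y. an n (t * y)) y) \<le> 2 ^ m * \<eta>" if "1 \<le> m" "m \<le> r" for m y
  proof -
    have "norm (nth_deriv m (\<lambda>y. an n (t * y)) y) = \<bar>t\<bar> ^ m * norm (nth_deriv m (an n) (t * y))" unfolding d by (simp add: power_abs)
    also have "\<dots> \<le> \<bar>t\<bar> ^ m * (\<eta> * real k ^ m)" by (intro mult_left_mono g that) simp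
    also have "\<dots> = (\<bar>t\<bar> * real k) ^ m * \<eta>" by (simp add: power_mult_distrib)
    also have "\<dots> \<le> 2 ^ m * \<eta>" using tk \<eta> by (intro mult_right_mono power_mono) auto
    finally show ?thesis .
  qed
  show L: "norm (an n (t * y) - an n (t * z)) \<le> 2 * \<eta> * \<bar>y - z\<bar>" for y z
    using vector_differentiable_bound[OF convex_UNIV _ _ UNIV_I UNIV_I, of "\<lambda>y. an n (t * y)" "nth_deriv 1 (\<lambda>y. an n (t * y))" "2 * \<eta>" y z]
      smooth_on_deriv1[OF sm UNIV_I] bd[of 1] r by simp
  assume X: "norm (an n 0 - X) \<le> d"
  show "Cb {-4<..<4} r 1 (d + 8 * \<eta> + 2 ^ r * \<eta>) (\<lambda>y. an n (t * y) - X)"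
    unfolding Cb_def
  proof (intro conjI allI impI ballI)
    show "smooth_on {-4<..<4} (\<lambda>y. an n (t * y) - X)"
      by (intro smooth_on_diff smooth_on_const smooth_on_subset[OF sm]) auto
    have d0: "0 \<le> d" using X norm_ge_zero order_trans by blast
    fix m y assume m: "m \<le> r" and y: "y \<in> {-4<..<4::real}"
    show "norm (nth_deriv m (\<lambda>y. an n (t * y) - X) y) \<le> (d + 8 * \<eta> + 2 ^ r * \<eta>) * 1 ^ m"
    proof (cases m)
      case 0
      have "norm (an n (t * y) - an n (t * 0)) \<le> 2 * \<eta> * 4" using L[of y 0] y \<eta> mult_left_mono[of "\<bar>y\<bar>" 4 "2 * \<eta>"] by fastforce
      then have "norm (an n (t * y) - X) \<le> 8 * \<eta> + d" using X norm_triangle_ineq[of "an n (t * y) - an n (t * 0)" "an n 0 - X"] by simp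
      moreover have "0 \<le> 2 ^ r * \<eta>" using \<eta> by simp
      ultimately show ?thesis using 0 by simp
    next
      case (Suc l)
      have "norm (nth_deriv m (\<lambda>y. an n (t * y) - X) y) \<le> 2 ^ m * \<eta>"
        using bd[of m y] m Suc by (simp add: nth_deriv_diff[OF open_UNIV sm smooth_on_const[OF open_UNIV]] nth_deriv_const[OF open_UNIV])
      also have "\<dots> \<le> 2 ^ r * \<eta>" using m \<eta> by (intro mult_right_mono power_increasing) auto
      finally show ?thesis using d0 \<eta> by simp
    qed
  qed
qed

text \<open>In the variable x / t' the two small translations become 1 and \<beta>. The frame
  straightens the generator over 1, and \<open>near_constant_reducible\<close> treats the other over
  \<beta>, losing two orders of differentiability; hence r = s + 2.\<close>

lemma normal_form:
  assumes deg: "degree_zero \<alpha> (\<lambda>x. rot (a x))"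
  obtains h p' :: int and k q' :: nat and X Y :: quat where "0 < k" "\<bar>int k * p' - h * int q'\<bar> = 1" "qframe X Y"
    "\<forall>\<eta>>0. \<exists>b. adapted s h k p' q' X Y \<eta> b"
proof -
  define r where "r = s + 2"
  have r: "2 \<le> r" "r - 2 = s" "1 \<le> r" by (simp_all add: r_def)
  obtain \<epsilon> where \<epsilon>: "\<epsilon> > 0" "\<And>I J \<alpha> G \<eta>. qframe I J \<Longrightarrow> \<alpha> \<notin> \<rat> \<Longrightarrow> qframe.gauge I G \<Longrightarrow> Cb UNIV r 1 \<epsilon> (\<lambda>y. G y - 1) \<Longrightarrow>
    0 < \<eta> \<Longrightarrow> \<exists>W. qframe.gauge I W \<and> Cb UNIV s 1 \<eta> (\<lambda>y. qframe.gc J \<alpha> W G y - 1)"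
    using near_constant_reducible[OF r(1)] unfolding r(2) by metis
  obtain C where C: "C \<ge> 1" "\<forall>P X \<delta>. smooth_on UNIV P \<longrightarrow> (\<forall>y. norm (P y) = 1) \<longrightarrow> norm X = 1 \<longrightarrow> C * \<delta> \<le> 1 \<longrightarrow>
     Cb {-4<..<4} r 1 \<delta> (\<lambda>y. P y - X) \<longrightarrow>
     (\<exists>B. smooth_on UNIV B \<and> (\<forall>y. norm (B y) = 1) \<and> (\<forall>y. B (y + 1) * P y = X * B y) \<and> Cb {-2<..<3} r 1 (C * \<delta>) (\<lambda>y. B y - (1::quat)))"
    using frame[of r] by blast
  define Q where "Q = (2::real) ^ r"
  have Q: "Q \<ge> 1" by (simp add: Q_def)
  \<comment> \<open>The factor 24 + Q collects 16 + 8 + 2^r from the anticommuting pair and the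
    rescaling, C comes from the frame, and (Q + 2)^2 from the final triple product.\<close>
  define \<kappa> where "\<kappa> = (Q + 2)\<^sup>2 * C * (24 + Q)"
  have "1 * 1 * 24 \<le> (Q + 2)\<^sup>2 * C * (24 + Q)" using Q C(1) by (intro mult_mono) (auto simp: one_le_power)
  then have \<kappa>: "\<kappa> \<ge> 24" by (simp add: \<kappa>_def)
  define \<eta>1 where "\<eta>1 = min 1 \<epsilon> / \<kappa>"
  have \<eta>1: "0 < \<eta>1" using \<epsilon>(1) \<kappa> by (simp add: \<eta>1_def)
  have \<eta>\<kappa>: "\<kappa> * \<eta>1 = min 1 \<epsilon>" using \<kappa> by (simp add: \<eta>1_def)
  have \<eta>24: "24 * \<eta>1 \<le> 1" using \<eta>\<kappa> mult_right_mono[OF \<kappa>, of \<eta>1] \<eta>1 by linarith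
  define d where "d = (24 + Q) * \<eta>1"
  define t where "t = C * d"
  have d0: "0 \<le> d" using Q \<eta>1 by (simp add: d_def)
  have dt: "d \<le> t" using C(1) d0 by (simp add: t_def mult_le_cancel_right1)
  have Qt: "(Q + 2)\<^sup>2 * t = min 1 \<epsilon>" unfolding \<eta>\<kappa>[symmetric] by (simp add: t_def d_def \<kappa>_def)
  have t1': "t \<le> 1"
  proof -
    have "1 * t \<le> (Q + 2)\<^sup>2 * t" using Q d0 dt by (intro mult_right_mono) (auto simp: one_le_power)
    then show ?thesis using Qt by simp
  qed
  obtain k0 where k0: "\<And>k n m x. k \<ge> k0 \<Longrightarrow> n \<le> k \<Longrightarrow> 1 \<le> m \<Longrightarrow> m \<le> r \<Longrightarrow> norm (nth_deriv m (an n) x) \<le> \<eta>1 * real k ^ m"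
    using growth[OF deg \<eta>1, of r] by blast
  obtain h p' :: int and k q' :: nat where hk: "real k0 \<le> real k" "0 < k" "q' \<le> k"
    "1 / real k \<le> \<bar>real q' * \<alpha> - of_int p'\<bar>" "\<bar>real q' * \<alpha> - of_int p'\<bar> \<le> 2 / real k" "\<bar>real k * \<alpha> - of_int h\<bar> < 1 / real k"
    "(real k * \<alpha> - of_int h) / (real q' * \<alpha> - of_int p') \<notin> \<rat>" "\<bar>int k * p' - h * int q'\<bar> = 1"
    by (rule cocycle_pair)
  define t' t1 where "t' = real q' * \<alpha> - of_int p'" and "t1 = real k * \<alpha> - of_int h"
  define \<beta> where "\<beta> = t1 / t'"
  have kp: "0 < real k" using hk by simp
  have t'0: "t' \<noteq> 0" using hk(4) kp by (auto simp: t'_def)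
  have t1: "t1 = \<beta> * t'" using t'0 by (simp add: \<beta>_def)
  have \<beta>irr: "\<beta> \<notin> \<rat>" using hk(7) by (simp add: \<beta>_def t1_def t'_def)
  have \<beta>1: "\<bar>\<beta>\<bar> \<le> 1"
  proof -
    have "\<bar>t1\<bar> \<le> \<bar>t'\<bar>" using hk(4,6) by (simp add: t1_def t'_def)
    then show ?thesis using t'0 by (simp add: \<beta>_def abs_divide)
  qed
  define P R where "P y = an q' (t' * y)" and "R y = an k (t' * y)" for y
  have smP: "smooth_on UNIV P" and smR: "smooth_on UNIV R" and uP: "norm (P y) = 1" and uR: "norm (R y) = 1" for y
    using smooth_on_affine[OF open_UNIV open_UNIV _ smooth_an, of t' 0] by (simp_all add: P_def[abs_def] R_def[abs_def] unit_an)
  have "int k * p' - h * int q' = 1 \<or> int k * p' - h * int q' = - 1" using hk(8) by linarith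
  then have od: "odd (int k * p' - h * int q')" by (elim disjE) simp_all
  have PR: "P (y + \<beta>) * R y = - (R (y + 1) * P y)" for y
    using an_commute[OF od, of "t' * y"] unfolding P_def R_def t'_def[symmetric] t1_def[symmetric] t1
    by (simp add: algebra_simps)
  note gq = k0[OF _ hk(3)] and gk = k0[OF _ order_refl, of k]
  have kk: "k0 \<le> k" using hk(1) by simp
  have tk: "\<bar>t'\<bar> \<le> 2 / real k" using hk(5) by (simp add: t'_def)
  have Pl: "norm (P y - P z) \<le> 2 * \<eta>1 * \<bar>y - z\<bar>" for y z
    unfolding P_def by (rule rescaled_near(1)[OF gq[OF kk] r(3) _ hk(2) tk]) (use \<eta>1 in simp_all)
  have Rl: "norm (R y - R z) \<le> 2 * \<eta>1 * \<bar>y - z\<bar>" for y z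
    unfolding R_def by (rule rescaled_near(1)[OF gk[OF kk] r(3) _ hk(2) tk]) (use \<eta>1 in simp_all)
  have "norm (P 0 * R 0 + R 0 * P 0) \<le> 2 * (2 * \<eta>1)"
  proof -
    \<comment> \<open>The arguments \<beta> and 1 in \<open>PR\<close> are moved to 0; each move is
      at most 1 long and costs at most 2 \<eta>1.\<close>
    have "P 0 * R 0 + R 0 * P 0 = (P 0 - P \<beta>) * R 0 + (R 0 - R 1) * P 0" using PR[of 0] by (simp add: algebra_simps)
    then have "norm (P 0 * R 0 + R 0 * P 0) \<le> norm (P 0 - P \<beta>) + norm (R 0 - R 1)"
      using norm_triangle_ineq[of "(P 0 - P \<beta>) * R 0" "(R 0 - R 1) * P 0"] by (simp add: norm_quat_mult uP uR)
    moreover have "2 * \<eta>1 * \<bar>0 - \<beta>\<bar> \<le> 2 * \<eta>1 * 1" using \<beta>1 \<eta>1 by (intro mult_left_mono) auto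
    ultimately show ?thesis using Pl[of 0 \<beta>] Rl[of 0 1] by simp
  qed
  then obtain X Y where XY: "qframe X Y" "norm (P 0 - X) \<le> 4 * (2 * \<eta>1)" "norm (R 0 - Y) \<le> 8 * (2 * \<eta>1)"
    by (rule near_anticommuting[OF uP uR]) (use \<eta>24 in auto)
  interpret qframe X Y \<beta> by (rule XY(1))
  have X1: "norm X = 1" and Y1: "norm Y = 1" using I_unit J_unit by auto
  have CP: "Cb {-4<..<4} r 1 d (\<lambda>y. P y - X)"
  proof -
    have "Cb {-4<..<4} r 1 (16 * \<eta>1 + 8 * \<eta>1 + 2 ^ r * \<eta>1) (\<lambda>y. P y - X)"
      unfolding P_def by (rule rescaled_near(2)[OF gq[OF kk] r(3) _ hk(2) tk]) (use \<eta>1 XY(2) in \<open>simp_all add: P_def\<close>)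
    then show ?thesis by (simp add: d_def Q_def algebra_simps)
  qed
  have CR: "Cb {-4<..<4} r 1 d (\<lambda>y. R y - Y)"
  proof -
    have "Cb {-4<..<4} r 1 (16 * \<eta>1 + 8 * \<eta>1 + 2 ^ r * \<eta>1) (\<lambda>y. R y - Y)"
      unfolding R_def by (rule rescaled_near(2)[OF gk[OF kk] r(3) _ hk(2) tk]) (use \<eta>1 XY(3) in \<open>simp_all add: R_def\<close>)
    then show ?thesis by (simp add: d_def Q_def algebra_simps)
  qed
  obtain B where B: "smooth_on UNIV B" "\<And>y. norm (B y) = 1" "\<And>y. B (y + 1) * P y = X * B y" "Cb {-2<..<3} r 1 t (\<lambda>y. B y - 1)"
    using C(2)[rule_format, OF smP uP X1 _ CP] t1' unfolding t_def by blast
  have B': "B (y + 1) = X * B y * qcnj (P y)" for y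
  proof -
    have "B (y + 1) = B (y + 1) * P y * qcnj (P y)" using uP by (simp add: mult.assoc)
    then show ?thesis unfolding B(3) .
  qed
  define G where "G y = qcnj Y * (B (y + \<beta>) * R y * qcnj (B y))" for y
  have G1: "norm (G y) = 1" for y by (simp add: G_def norm_quat_mult B uR Y1)
  have smG: "smooth_on UNIV G"
    unfolding G_def[abs_def] by (intro smooth_on_mult smooth_on_const open_UNIV smooth_on_shift B smR smooth_on_qcnj)
  \<comment> \<open>The sign from \<open>PR\<close> is cancelled by the sign in
    \<open>Y X = - X Y\<close>.\<close>
  have twG: "G (y + 1) = X * G y * qcnj X" for y
  proof -
    have "B (y + 1 + \<beta>) * R (y + 1) * qcnj (B (y + 1)) = X * B (y + \<beta>) * qcnj (P (y + \<beta>)) * (R (y + 1) * P y) * qcnj (B y) * qcnj X"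
      using B'[of "y + \<beta>"] B'[of y] by (simp add: qcnj_mult mult.assoc add_ac)
    also have "R (y + 1) * P y = - (P (y + \<beta>) * R y)" using PR[of y] by simp
    finally have "B (y + 1 + \<beta>) * R (y + 1) * qcnj (B (y + 1)) = - (X * (B (y + \<beta>) * R y * qcnj (B y)) * qcnj X)"
      using uP by (simp add: mult.assoc)
    then show ?thesis unfolding G_def by (simp add: IJ_simps)
  qed
  have gG: "gauge G" unfolding gauge_def tw_def using smG G1 twG by blast
  have CG: "Cb UNIV r 1 \<epsilon> (\<lambda>y. G y - 1)"
  proof -
    let ?S = "{-1<..<2::real}"
    have o: "open ?S" by simp
    have b1: "Cb ?S r 1 t (\<lambda>y. B (y + \<beta>) - 1)"
      by (rule Cb_mono[OF Cb_shift_on[OF _ B(4), of \<beta>]]) (use \<beta>1 dt d0 in auto)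
    have b2: "Cb ?S r 1 t (\<lambda>y. B y - 1)"
      by (rule Cb_mono[OF B(4)]) (use dt d0 in auto)
    have b3: "Cb ?S r 1 t (\<lambda>y. R y - Y)"
      by (rule Cb_mono[OF CR]) (use dt d0 in auto)
    have t0: "0 \<le> t" using d0 dt by simp
    have 3: "Cb ?S r 1 \<epsilon> (\<lambda>y. B (y + \<beta>) * R y * qcnj (B y) - Y)"
      by (rule Cb_le[OF Cb_near_conj[OF o Y1 t0 t1' b1 b3 b2]]) (use Qt in \<open>simp_all add: Q_def\<close>)
    have 4: "Cb ?S r 1 \<epsilon> (\<lambda>y. qcnj Y * (B (y + \<beta>) * R y * qcnj (B y) - Y))"
      by (rule Cb_lmult[OF _ o]) (use 3 Y1 in simp_all)
    have 5: "qcnj Y * (B (y + \<beta>) * R y * qcnj (B y) - Y) = G y - 1" for y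
      using Y1 by (simp add: G_def right_diff_distrib)
    have 6: "Cb ?S r 1 \<epsilon> (\<lambda>y. G y - 1)" using 4 unfolding 5 .
    show ?thesis
    proof (rule Cb_periodic[where p=1 and S="?S" and u=X and v="qcnj X", OF _ _ _ _ _ _ 6])
      show "smooth_on UNIV (\<lambda>y. G y - 1)" by (intro smooth_on_diff smG smooth_on_const open_UNIV)
      show "G (y + 1) - 1 = X * (G y - 1) * qcnj X" for y using X1 by (simp add: twG right_diff_distrib left_diff_distrib)
    qed (use X1 in auto)
  qed
  show thesis
  proof (rule that[OF hk(2,8) XY(1)], intro allI impI)
    fix \<eta> :: real assume \<eta>: "0 < \<eta>"
    \<comment> \<open>\<open>t'\<close> is already fixed, so the derivatives of x \<mapsto> x / t'
      are compensated by demanding the accuracy \<eta> / K^s.\<close>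
    define K where "K = max 1 \<bar>1 / t'\<bar>"
    have K: "1 \<le> K" "\<bar>1 / t'\<bar> \<le> K" by (auto simp: K_def)
    have Ks: "0 < K ^ s" using K by simp
    have eK: "\<eta> / K ^ s * K ^ s = \<eta>" using K by simp
    have "0 < \<eta> / K ^ s" using \<eta> Ks by simp
    then obtain W where W: "gauge W" "Cb UNIV s 1 (\<eta> / K ^ s) (\<lambda>y. gc W G y - 1)"
      using \<epsilon>(2)[OF XY(1) \<beta>irr gG CG] by blast
    have Wt: "W (y + 1) = X * W y * qcnj X" and sW: "smooth_on UNIV W" and uW: "norm (W y) = 1" for y
      using W(1) by (auto simp: gauge_def tw_def)
    \<comment> \<open>Since \<open>W\<close> is twisted by \<open>X\<close>, multiplying the frame
      by it leaves the first generator exactly equal to \<open>X\<close>.\<close>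
    define b where "b x = W (1 / t' * x) * B (1 / t' * x)" for x
    have sb: "smooth_on UNIV b"
      using smooth_on_affine[OF open_UNIV open_UNIV _ smooth_on_mult[OF open_UNIV sW B(1)], of "1 / t'" 0] by (simp add: b_def[abs_def])
    have an_eq: "an q' x = P (1 / t' * x)" "an k x = R (1 / t' * x)" for x using t'0 by (simp_all add: P_def R_def)
    have sh: "1 / t' * (x + t') = 1 / t' * x + 1" "1 / t' * (x + t1) = 1 / t' * x + \<beta>" for x
      using t'0 by (simp_all add: \<beta>_def field_simps)
    have 1: "b (x + t') * an q' x = X * b x" for x
    proof -
      have "b (x + t') * an q' x = X * W (1 / t' * x) * qcnj X * (B (1 / t' * x + 1) * P (1 / t' * x))"
        unfolding b_def sh an_eq Wt by (simp add: mult.assoc)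
      then show ?thesis unfolding B(3) b_def using X1 by (simp add: mult.assoc)
    qed
    have 2: "b (x + t1) * an k x * qcnj (b x) - Y = Y * (gc W G (1 / t' * x) - 1)" for x
      unfolding b_def sh an_eq gc_def T_def G_def using Y1 by (simp add: qcnj_mult mult.assoc right_diff_distrib)
    have "Cb UNIV s 1 (\<eta> / K ^ s * K ^ s) (\<lambda>x. gc W G (1 / t' * x) - 1)"
      by (rule Cb_rescale[OF W(2) K]) (use \<eta> Ks in simp)
    then have "Cb UNIV s 1 \<eta> (\<lambda>x. b (x + t1) * an k x * qcnj (b x) - Y)"
      unfolding 2 eK by (intro Cb_lmult Y1 open_UNIV)
    then have "adapted s h k p' q' X Y \<eta> b"
      unfolding adapted_def t'_def[symmetric] t1_def[symmetric] using sb 1 by (simp add: b_def norm_quat_mult uW B(2))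
    then show "\<exists>b. adapted s h k p' q' X Y \<eta> b" by blast
  qed
qed

lemma adapted_unit: "adapted s h k p' q' X Y \<eta> b \<Longrightarrow> norm (b x) = 1"
  by (simp add: adapted_def)

end

section \<open>From two lattice generators back to the unit shift and the cocycle itself\<close>

lemma qpow_cases: "(X::quat) * X = -1 \<Longrightarrow> X ^ n = 1 \<or> X ^ n = -1 \<or> X ^ n = X \<or> X ^ n = - X"
  by (induction n) auto

lemma (in qframe) square_pow_qcnj_pow:
  "Z = I ^ m * qcnj (J ^ n) \<or> Z = J ^ n * qcnj (I ^ m) \<Longrightarrow> Z * Z = 1 \<or> Z * Z = -1"
  using qpow_cases[OF II, of m] qpow_cases[OF JJ, of n]
  by (elim disjE) (simp_all add: IJ_simps qcnj_minus)

locale adapted_family = anticocycle +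
  fixes Ad :: "real \<Rightarrow> (real \<Rightarrow> quat) \<Rightarrow> bool" and s :: nat
  assumes Ad: "Ad \<eta> b \<Longrightarrow> norm (b x) = 1"
begin

text \<open>The sign of a lift does not matter, so the lattice element \<open>(N, m)\<close> stands for both \<open>\<plusminus> an N\<close>.\<close>

definition latc :: "nat \<Rightarrow> int \<Rightarrow> quat \<Rightarrow> bool" where
  "latc N m Z \<longleftrightarrow> nearc Ad s (real N * \<alpha> - of_int m) (an N) Z \<or> nearc Ad s (real N * \<alpha> - of_int m) (an N) (- Z)"

lemma nearc_mult_Ad: "nearc Ad s \<theta>1 c1 Z1 \<Longrightarrow> nearc Ad s \<theta>2 c2 Z2 \<Longrightarrow> nearc Ad s (\<theta>1 + \<theta>2) (\<lambda>x. c1 (x + \<theta>2) * c2 x) (Z1 * Z2)"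
  by (rule nearc_mult, erule Ad, assumption, assumption)

lemma nearc_sign: "nearc Ad s \<theta> (\<lambda>x. - c x) Z \<Longrightarrow> nearc Ad s \<theta> c (- Z)"
  using nearc_minus[of Ad s \<theta> "\<lambda>x. - c x" Z] by simp

lemma nearc_latc_mult:
  assumes "nearc Ad s (real N * \<alpha> - of_int m) (an N) Z" "nearc Ad s (real N' * \<alpha> - of_int m') (an N') Z'"
  shows "latc (N + N') (m + m') (Z * Z')"
proof -
  have t: "real N * \<alpha> - of_int m + (real N' * \<alpha> - of_int m') = real (N + N') * \<alpha> - of_int (m + m')" by (simp add: algebra_simps)
  have e: "an N (x + (real N' * \<alpha> - of_int m')) * an N' x = (if even (int N * m') then an (N + N') x else - an (N + N') x)" for x
    using an_int_shift[of N "x + real N' * \<alpha>" "- m'"] by (simp add: qiter_add add_diff_eq)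
  have n: "nearc Ad s (real (N + N') * \<alpha> - of_int (m + m')) (\<lambda>x. if even (int N * m') then an (N + N') x else - an (N + N') x) (Z * Z')"
    using nearc_mult_Ad[OF assms] unfolding t e .
  show ?thesis
  proof (cases "even (int N * m')")
    case True then show ?thesis using n by (simp add: latc_def)
  next
    case False then show ?thesis using n nearc_sign by (simp add: latc_def)
  qed
qed

lemma latc_minus: "latc N m (- Z) \<longleftrightarrow> latc N m Z"
  by (auto simp: latc_def)

lemma latc_mult: "latc N m Z \<Longrightarrow> latc N' m' Z' \<Longrightarrow> latc (N + N') (m + m') (Z * Z')"
  using nearc_latc_mult[of N m Z N' m' Z'] nearc_latc_mult[of N m "- Z" N' m' Z']
    nearc_latc_mult[of N m Z N' m' "- Z'"] nearc_latc_mult[of N m "- Z" N' m' "- Z'"]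
  unfolding latc_def[of N m Z] latc_def[of N' m' Z'] by (auto simp: latc_minus)

lemma latc_one: "latc 0 0 1"
proof -
  have "an 0 = (\<lambda>x. 1)" by (rule ext) simp
  then show ?thesis using nearc_one[of Ad s] Ad by (simp add: latc_def)
qed

lemma latc_pow: "latc N m Z \<Longrightarrow> latc (n * N) (int n * m) (Z ^ n)"
proof (induction n)
  case (Suc n)
  then show ?case using latc_mult[of N m Z "n * N" "int n * m" "Z ^ n"] by (simp add: algebra_simps)
qed (simp add: latc_one)

lemma nearc_latc_diff:
  assumes N: "N' \<le> N" and 1: "nearc Ad s (real N * \<alpha> - of_int m) (an N) Z" and 2: "nearc Ad s (real N' * \<alpha> - of_int m') (an N') Z'"
  shows "latc (N - N') (m - m') (Z * qcnj Z')"
proof -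
  let ?\<theta> = "real N' * \<alpha> - of_int m'"
  have t: "real N * \<alpha> - of_int m + - ?\<theta> = real (N - N') * \<alpha> - of_int (m - m')" using N by (simp add: of_nat_diff algebra_simps)
  have e: "an N (x + - ?\<theta>) * qcnj (an N' (x - ?\<theta>)) = (if even (int (N - N') * m') then an (N - N') x else - an (N - N') x)" for x
  proof -
    have "an N (x - ?\<theta>) = an (N - N') (x + of_int m') * an N' (x - ?\<theta>)"
      using qiter_add[of \<alpha> a "N - N'" N' "x - ?\<theta>"] N by (simp add: algebra_simps)
    then have "an N (x + - ?\<theta>) * qcnj (an N' (x - ?\<theta>)) = an (N - N') (x + of_int m') * (an N' (x - ?\<theta>) * qcnj (an N' (x - ?\<theta>)))"
      by (simp only: mult.assoc add_uminus_conv_diff)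
    then have "an N (x + - ?\<theta>) * qcnj (an N' (x - ?\<theta>)) = an (N - N') (x + of_int m')" by (simp only: unit_mult_cnj(1)[OF unit_an] mult_1_right)
    then show ?thesis unfolding an_int_shift .
  qed
  have n: "nearc Ad s (real (N - N') * \<alpha> - of_int (m - m')) (\<lambda>x. if even (int (N - N') * m') then an (N - N') x else - an (N - N') x) (Z * qcnj Z')"
    using nearc_mult_Ad[OF 1 nearc_inverse[OF 2]] unfolding t e .
  show ?thesis
  proof (cases "even (int (N - N') * m')")
    case True then show ?thesis using n by (simp add: latc_def)
  next
    case False then show ?thesis using n nearc_sign by (simp add: latc_def)
  qed
qed

lemma latc_diff: "N' \<le> N \<Longrightarrow> latc N m Z \<Longrightarrow> latc N' m' Z' \<Longrightarrow> latc (N - N') (m - m') (Z * qcnj Z')"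
  using nearc_latc_diff[of N' N m Z m' Z'] nearc_latc_diff[of N' N m "- Z" m' Z']
    nearc_latc_diff[of N' N m Z m' "- Z'"] nearc_latc_diff[of N' N m "- Z" m' "- Z'"]
  unfolding latc_def[of N m Z] latc_def[of N' m' Z'] by (auto simp: latc_minus qcnj_minus)

text \<open>Determinant \<plusminus>1 makes (q', p') and (k, h) a basis of the integer lattice. They
  generate (0, -1), the translation by 1 with trivial cocycle, and (1, 0), the original cocycle. The
  constant of the translation is a product of powers of \<open>X\<close> and \<open>Y\<close> up to
  inverses, an element of the quaternion group, so its square is \<plusminus>1.\<close>

lemma latc_generators:
  assumes X: "latc q' p' X" and Y: "latc k h Y" and k: "0 < k" and det: "\<bar>int k * p' - h * int q'\<bar> = 1" and fr: "qframe X Y"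
  obtains Z0 Y0 where "nearc Ad s 1 (\<lambda>x. 1) Z0" "Z0 * Z0 = 1 \<or> Z0 * Z0 = -1" "nearc Ad s \<alpha> a Y0"
proof -
  interpret qframe X Y \<alpha> by (rule fr)
  have kp: "latc (k * q') (int k * p') (X ^ k)" and qh: "latc (k * q') (h * int q') (Y ^ q')"
    using latc_pow[OF X, of k] latc_pow[OF Y, of q'] by (simp_all add: mult.commute)
  have "\<exists>Z. latc 0 (-1) Z \<and> (Z * Z = 1 \<or> Z * Z = -1)"
  proof (cases "int k * p' - h * int q' = -1")
    case True
    have "latc 0 (-1) (X ^ k * qcnj (Y ^ q'))" using latc_diff[OF _ kp qh] True by simp
    then show ?thesis using square_pow_qcnj_pow by blast
  next
    case False
    then have "h * int q' - int k * p' = -1" using det by linarith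
    then have "latc 0 (-1) (Y ^ q' * qcnj (X ^ k))" using latc_diff[OF _ qh kp] by simp
    then show ?thesis using square_pow_qcnj_pow by blast
  qed
  then obtain Z where Z: "latc 0 (-1) Z" "Z * Z = 1 \<or> Z * Z = -1" by blast
  have an0: "an 0 = (\<lambda>x. 1)" and an1: "an 1 = a" by (rule ext, simp)+
  obtain Z0 where Z0: "nearc Ad s 1 (\<lambda>x. 1) Z0" "Z0 * Z0 = 1 \<or> Z0 * Z0 = -1"
    using Z unfolding latc_def an0 by (auto simp: minus_mult_minus)
  \<comment> \<open>A Bezout relation reaches height 1 with some translation m; multiples of (0, -1)
    then remove m.\<close>
  obtain x y where xy: "x * k = q' * y + 1"
  proof -
    have "coprime k q'"
    proof (rule coprimeI)
      fix c assume "c dvd k" "c dvd q'"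
      then have "int c dvd int k * p' - h * int q'" by (intro dvd_diff dvd_mult dvd_mult2) simp_all
      then show "is_unit c" using det by (metis dvd_abs_iff int_dvd_int_iff of_nat_1)
    qed
    then show thesis using bezout_nat[of k q'] k that by (auto simp: mult.commute)
  qed
  have "latc (x * k - y * q') (int x * h - int y * p') (Y ^ x * qcnj (X ^ y))"
    by (rule latc_diff[OF _ latc_pow[OF Y] latc_pow[OF X]]) (use xy in \<open>simp add: mult.commute[of y]\<close>)
  then obtain m Z1 where Z1: "latc 1 m Z1" using xy by (auto simp: mult.commute)
  have "\<exists>Z2. latc 0 (- m) Z2"
  proof (cases "m \<ge> 0")
    case True
    then show ?thesis using latc_pow[OF Z(1), of "nat m"] by auto
  next
    case False
    then show ?thesis using latc_pow[OF latc_diff[OF _ latc_one Z(1)], of "nat (- m)"] by auto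
  qed
  then obtain Z2 where "latc 0 (- m) Z2" by blast
  from latc_mult[OF Z1 this] have "latc 1 0 (Z1 * Z2)" by simp
  then obtain Y0 where "nearc Ad s \<alpha> a Y0" unfolding latc_def an1 by auto
  then show thesis using Z0 that by blast
qed

end

text \<open>The conjugation \<open>b\<close> need not be periodic: b (x + 1) b (x)^-1 is only close
  to a constant Z0. A second use of the frame makes it exactly Z0, and Z0^2 = \<plusminus>1 becomes
  period 2 after projection to SO(3).\<close>

lemma (in anticocycle) near_constant_conjugate:
  assumes deg: "degree_zero \<alpha> (\<lambda>x. rot (a x))" and \<alpha>: "\<bar>\<alpha>\<bar> \<le> 1" and \<eta>: "0 < \<eta>"
  obtains e Y0 where "smooth_on UNIV e" "\<And>x. norm (e x) = 1" "\<And>x. rot (e (x + 2)) = rot (e x)" "norm Y0 = 1"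
    "\<And>x. e (x + 2 + \<alpha>) * a (x + 2) * qcnj (e (x + 2)) = e (x + \<alpha>) * a x * qcnj (e x)"
    "Cb UNIV s 1 \<eta> (\<lambda>x. e (x + \<alpha>) * a x * qcnj (e x) - Y0)"
proof -
  obtain h p' :: int and k q' :: nat and X Y :: quat where nf: "0 < k" "\<bar>int k * p' - h * int q'\<bar> = 1" "qframe X Y"
    "\<forall>\<eta>>0. \<exists>b. adapted s h k p' q' X Y \<eta> b"
    using normal_form[OF deg] .
  define Ad where "Ad = adapted s h k p' q' X Y"
  interpret adapted_family \<alpha> a Ad s by unfold_locales (simp add: Ad_def adapted_unit)
  interpret F: qframe X Y \<alpha> by (rule nf(3))
  have "nearc Ad s (real q' * \<alpha> - of_int p') (an q') X"
    unfolding nearc_def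
  proof (intro conjI allI impI exI[of _ 1])
    fix \<delta> \<eta> :: real and b assume "0 < \<delta>" "Ad \<eta> b"
    then have "b (x + (real q' * \<alpha> - of_int p')) * an q' x * qcnj (b x) - X = 0" for x
      by (simp add: Ad_def adapted_def mult.assoc)
    then show "Cb UNIV s 1 \<delta> (\<lambda>x. b (x + (real q' * \<alpha> - of_int p')) * an q' x * qcnj (b x) - X)"
      using \<open>0 < \<delta>\<close> by (simp only:) (intro Cb_const open_UNIV, simp_all)
  qed (use F.I_unit in auto)
  then have X: "latc q' p' X" by (simp add: latc_def)
  have "nearc Ad s (real k * \<alpha> - of_int h) (an k) Y"
    unfolding nearc_def
  proof (intro conjI allI impI)
    fix \<delta> :: real assume \<delta>: "0 < \<delta>"
    have "Cb UNIV s 1 \<delta> (\<lambda>x. b (x + (real k * \<alpha> - of_int h)) * an k x * qcnj (b x) - Y)"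
      if "\<eta> \<le> \<delta>" "Ad \<eta> b" for \<eta> b
      using that unfolding Ad_def adapted_def by (elim conjE) (rule Cb_le, assumption, simp_all)
    then show "\<exists>\<eta>0>0. \<forall>\<eta> b. 0 < \<eta> \<longrightarrow> \<eta> \<le> \<eta>0 \<longrightarrow> Ad \<eta> b \<longrightarrow>
       Cb UNIV s 1 \<delta> (\<lambda>x. b (x + (real k * \<alpha> - of_int h)) * an k x * qcnj (b x) - Y)"
      using \<delta> by blast
  qed (use F.J_unit in auto)
  then have Y: "latc k h Y" by (simp add: latc_def)
  obtain Z0 Y0 where Z0: "nearc Ad s 1 (\<lambda>x. 1) Z0" "Z0 * Z0 = 1 \<or> Z0 * Z0 = -1" and Y0: "nearc Ad s \<alpha> a Y0"
    using latc_generators[OF X Y nf(1-3)] .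
  have nZ: "norm Z0 = 1" and nY: "norm Y0 = 1" using Z0(1) Y0 by (auto simp: nearc_def)
  obtain C where C: "C \<ge> 1" "\<forall>P X \<delta>. smooth_on UNIV P \<longrightarrow> (\<forall>y. norm (P y) = 1) \<longrightarrow> norm X = 1 \<longrightarrow> C * \<delta> \<le> 1 \<longrightarrow>
     Cb {-4<..<4} s 1 \<delta> (\<lambda>y. P y - X) \<longrightarrow>
     (\<exists>B. smooth_on UNIV B \<and> (\<forall>y. norm (B y) = 1) \<and> (\<forall>y. B (y + 1) * P y = X * B y) \<and> Cb {-2<..<3} s 1 (C * \<delta>) (\<lambda>y. B y - (1::quat)))"
    using frame[of s] by blast
  define Q where "Q = (2::real) ^ s"
  have Q: "Q \<ge> 1" by (simp add: Q_def)
  define t where "t = min 1 (\<eta> / (Q + 2)\<^sup>2)"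
  have Q2: "0 < (Q + 2)\<^sup>2" using Q by simp
  have t: "0 < t" "t \<le> 1" using \<eta> Q2 by (simp_all add: t_def)
  have Qt: "(Q + 2)\<^sup>2 * t \<le> \<eta>"
  proof -
    have "t \<le> \<eta> / (Q + 2)\<^sup>2" by (simp add: t_def)
    then show ?thesis using Q2 by (simp add: pos_le_divide_eq mult.commute)
  qed
  define \<delta> where "\<delta> = t / C"
  have \<delta>: "0 < \<delta>" "C * \<delta> = t" "\<delta> \<le> t"
    using t C(1) by (auto simp: \<delta>_def divide_le_eq_1 mult_le_cancel_left1 field_simps)
  obtain \<eta>1 where \<eta>1: "\<eta>1 > 0" "\<And>\<eta> b. 0 < \<eta> \<Longrightarrow> \<eta> \<le> \<eta>1 \<Longrightarrow> Ad \<eta> b \<Longrightarrow> Cb UNIV s 1 \<delta> (\<lambda>x. b (x + 1) * 1 * qcnj (b x) - Z0)"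
    using Z0(1) \<delta>(1) unfolding nearc_def by blast
  obtain \<eta>2 where \<eta>2: "\<eta>2 > 0" "\<And>\<eta> b. 0 < \<eta> \<Longrightarrow> \<eta> \<le> \<eta>2 \<Longrightarrow> Ad \<eta> b \<Longrightarrow> Cb UNIV s 1 \<delta> (\<lambda>x. b (x + \<alpha>) * a x * qcnj (b x) - Y0)"
    using Y0 \<delta>(1) unfolding nearc_def by blast
  have m: "0 < min \<eta>1 \<eta>2" using \<eta>1(1) \<eta>2(1) by simp
  then obtain b where b: "Ad (min \<eta>1 \<eta>2) b" using nf(4) unfolding Ad_def by blast
  have sb: "smooth_on UNIV b" and ub: "norm (b x) = 1" for x using b by (simp_all add: Ad_def adapted_def)
  define P where "P x = b (x + 1) * qcnj (b x)" for x
  define M where "M x = b (x + \<alpha>) * a x * qcnj (b x)" for x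
  have CP: "Cb UNIV s 1 \<delta> (\<lambda>x. P x - Z0)" using \<eta>1(2)[OF m _ b] by (simp add: P_def)
  have CM: "Cb UNIV s 1 \<delta> (\<lambda>x. M x - Y0)" using \<eta>2(2)[OF m _ b] by (simp add: M_def)
  have sP: "smooth_on UNIV P" unfolding P_def[abs_def] by (intro smooth_on_mult smooth_on_shift sb smooth_on_qcnj open_UNIV)
  have uP: "norm (P x) = 1" for x by (simp add: P_def norm_quat_mult ub)
  have CP': "Cb {-4<..<4} s 1 \<delta> (\<lambda>x. P x - Z0)" by (rule Cb_mono[OF CP]) (use \<delta> in auto)
  obtain B where B: "smooth_on UNIV B" "\<And>y. norm (B y) = 1" "\<And>y. B (y + 1) * P y = Z0 * B y" "Cb {-2<..<3} s 1 t (\<lambda>y. B y - 1)"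
    using C(2)[rule_format, OF sP uP nZ _ CP'] t unfolding \<delta>(2) by blast
  define e where "e x = B x * b x" for x
  have se: "smooth_on UNIV e" unfolding e_def[abs_def] by (intro smooth_on_mult open_UNIV B sb)
  have ue: "norm (e x) = 1" for x by (simp add: e_def norm_quat_mult B ub)
  have e1: "e (x + 1) = Z0 * e x" for x
  proof -
    have "e (x + 1) = B (x + 1) * P x * b x" by (simp add: e_def P_def mult.assoc ub)
    then show ?thesis unfolding B(3) e_def by (simp add: mult.assoc)
  qed
  have e2: "e (x + 2) = Z0 * Z0 * e x" for x
  proof -
    have "e (x + 1 + 1) = Z0 * (Z0 * e x)" by (simp only: e1)
    moreover have "x + 1 + 1 = x + 2" by simp
    ultimately show ?thesis by (simp only: mult.assoc)
  qed
  define N where "N x = e (x + \<alpha>) * a x * qcnj (e x)" for x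
  have N: "N x = B (x + \<alpha>) * M x * qcnj (B x)" for x
    by (simp add: N_def e_def M_def qcnj_mult mult.assoc)
  have sN: "smooth_on UNIV N"
    unfolding N_def[abs_def] by (intro smooth_on_mult smooth_on_shift se smooth_a smooth_on_qcnj open_UNIV)
  \<comment> \<open>The sign Z0^2 enters on both sides of \<open>a\<close> and cancels, while
    \<open>a\<close> itself has period 2.\<close>
  have N2: "N (x + 2) = N x" for x
  proof -
    have "a (x + 1 + 1) = a x" by (simp only: anti_a minus_minus)
    moreover have "x + 1 + 1 = x + 2" by simp
    ultimately have "a (x + 2) = a x" by (simp only:)
    moreover have "e (x + 2 + \<alpha>) = Z0 * Z0 * e (x + \<alpha>)" using e2[of "x + \<alpha>"] by (simp add: algebra_simps)
    ultimately show ?thesis using Z0(2) unfolding N_def e2 by (auto simp: qcnj_minus)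
  qed
  have CN: "Cb UNIV s 1 \<eta> (\<lambda>x. N x - Y0)"
  proof -
    let ?S = "{-1<..<2::real}"
    have o: "open ?S" by simp
    have b1: "Cb ?S s 1 t (\<lambda>y. B (y + \<alpha>) - 1)"
      by (rule Cb_mono[OF Cb_shift_on[OF _ B(4), of \<alpha>]]) (use \<alpha> t in auto)
    have b2: "Cb ?S s 1 t (\<lambda>y. B y - 1)"
      by (rule Cb_mono[OF B(4)]) (use t in auto)
    have b3: "Cb ?S s 1 t (\<lambda>y. M y - Y0)"
      by (rule Cb_mono[OF CM]) (use t \<delta> in auto)
    have 4: "Cb ?S s 1 \<eta> (\<lambda>x. N x - Y0)"
      unfolding N by (rule Cb_le[OF Cb_near_conj[OF o nY _ t(2) b1 b3 b2]]) (use Qt t in \<open>simp_all add: Q_def\<close>)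
    show ?thesis
    proof (rule Cb_periodic[where p=2 and S="?S" and u=1 and v=1, OF _ _ _ _ _ _ 4])
      show "smooth_on UNIV (\<lambda>x. N x - Y0)" by (intro smooth_on_diff sN smooth_on_const open_UNIV)
      show "N (y + 2) - Y0 = 1 * (N y - Y0) * 1" for y by (simp add: N2)
    qed auto
  qed
  have r2: "rot (e (x + 2)) = rot (e x)" for x
    using Z0(2) unfolding e2 by (auto simp: rot_minus)
  show thesis
    by (rule that[OF se ue r2 nY _ CN[unfolded N_def]]) (use N2 in \<open>simp add: N_def\<close>)
qed

subsection \<open>Logarithms and the conclusion\<close>

text \<open>The cross-product identification of imaginary quaternions with so(3); the real part is
  ignored.\<close>

definition qhat :: "quat \<Rightarrow> real^3^3" where
  "qhat q = vector [vector [0, - qk q, qj q], vector [qk q, 0, - qi q], vector [- qj q, qi q, 0]]"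

lemma qhat_entries:
  "qhat q $ 1 $ 1 = 0" "qhat q $ 1 $ 2 = - qk q" "qhat q $ 1 $ 3 = qj q"
  "qhat q $ 2 $ 1 = qk q" "qhat q $ 2 $ 2 = 0" "qhat q $ 2 $ 3 = - qi q"
  "qhat q $ 3 $ 1 = - qj q" "qhat q $ 3 $ 2 = qi q" "qhat q $ 3 $ 3 = 0"
  by (simp_all add: qhat_def)

lemma qhat_so3: "qhat q \<in> so3"
  unfolding so3_def mem_Collect_eq mat3_eq_iff by (simp add: transpose_def qhat_entries)

lemma norm_qhat: "norm (qhat q) \<le> 2 * norm q"
proof (rule power2_le_imp_le)
  show "(norm (qhat q))\<^sup>2 \<le> (2 * norm q)\<^sup>2"
    unfolding norm_mat3_sq sum_3 qhat_entries power_mult_distrib norm_sq_quat by simp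
qed simp

lemma bounded_linear_qhat: "bounded_linear qhat"
proof (rule bounded_linear_intro[where K=2])
  show "norm (qhat q) \<le> norm q * 2" for q using norm_qhat[of q] by simp
qed (simp_all add: mat3_eq_iff qhat_entries)

lemma qhat_cube: "qhat n ** (qhat n ** qhat n) = (- ((qi n)\<^sup>2 + (qj n)\<^sup>2 + (qk n)\<^sup>2)) *\<^sub>R qhat n"
  unfolding mat3_eq_iff mat3_mult qhat_entries vector_scaleR_component by (simp add: power2_eq_square algebra_simps)

lemma rot_qhat:
  "rot (Quat c (s * x) (s * y) (s * z)) = (c\<^sup>2 + s\<^sup>2 * (x\<^sup>2 + y\<^sup>2 + z\<^sup>2)) *\<^sub>R mat 1 + (2 * c * s) *\<^sub>R qhat (Quat w x y z)
     + (2 * s\<^sup>2) *\<^sub>R (qhat (Quat w x y z) ** qhat (Quat w x y z))"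
  unfolding mat3_eq_iff rot_entries vector_add_component vector_scaleR_component mat3_mult mat3_one qhat_entries quat.sel
  by (simp add: power2_eq_square algebra_simps)

text \<open>By N^3 = - N the positive powers reduce to \<plusminus>N and \<plusminus>N^2, and the
  exponential series separates into those of sine and cosine.\<close>

lemma mat_exp_rodrigues:
  fixes N :: "real^'n^'n"
  assumes N: "N ** (N ** N) = - N"
  shows "mat_exp (\<phi> *\<^sub>R N) = mat 1 + sin \<phi> *\<^sub>R N + (1 - cos \<phi>) *\<^sub>R (N ** N)"
proof -
  interpret m: bounded_bilinear "(**) :: real^'n^'n \<Rightarrow> real^'n^'n \<Rightarrow> real^'n^'n" by (rule bounded_bilinear_matrix_matrix_mult)
  let ?X = "\<phi> *\<^sub>R N"
  \<comment> \<open>The extra term at k = 0 restores the identity matrix: the cosine series on its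
    own would begin with - N^2.\<close>
  let ?t = "\<lambda>k. (if k = 0 then mat 1 + N ** N else 0) + (sin_coeff k * \<phi> ^ k) *\<^sub>R N - (cos_coeff k * \<phi> ^ k) *\<^sub>R (N ** N)"
  have t: "((\<lambda>Y. ?X ** Y) ^^ k) (mat 1) = fact k *\<^sub>R ?t k" for k
  proof (induction k)
    case 0
    show ?case by simp
  next
    case (Suc k)
    have f: "sin_coeff (Suc k) * fact (Suc k) = cos_coeff k * fact k" "cos_coeff (Suc k) * fact (Suc k) = - sin_coeff k * fact k"
      by (simp_all add: sin_coeff_Suc cos_coeff_Suc field_simps del: of_nat_Suc)
    have "((\<lambda>Y. ?X ** Y) ^^ Suc k) (mat 1) = ?X ** (fact k *\<^sub>R ?t k)" using Suc by simp
    also have "\<dots> = (fact k * \<phi>) *\<^sub>R ((sin_coeff k * \<phi> ^ k) *\<^sub>R (N ** N) + (cos_coeff k * \<phi> ^ k) *\<^sub>R N)"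
      by (simp add: m.add_right m.diff_right m.scaleR_left m.scaleR_right m.zero_right N scaleR_add_right mult_ac)
    also have "\<dots> = (cos_coeff k * fact k * \<phi> ^ Suc k) *\<^sub>R N - (- sin_coeff k * fact k * \<phi> ^ Suc k) *\<^sub>R (N ** N)"
      by (simp add: scaleR_add_right mult_ac)
    also have "\<dots> = fact (Suc k) *\<^sub>R ?t (Suc k)"
      unfolding f[symmetric] by (simp add: scaleR_diff_right mult_ac del: fact_Suc)
    finally show ?case .
  qed
  have "(\<lambda>k. sin_coeff k * \<phi> ^ k) sums sin \<phi>" "(\<lambda>k. cos_coeff k * \<phi> ^ k) sums cos \<phi>"
    using sin_converges[of \<phi>] cos_converges[of \<phi>] by simp_all
  then have "?t sums ((mat 1 + N ** N) + sin \<phi> *\<^sub>R N - cos \<phi> *\<^sub>R (N ** N))"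
    by (intro sums_add sums_diff bounded_linear.sums[OF bounded_linear_scaleR_left] sums_single[of 0 "\<lambda>_. mat 1 + N ** N", simplified])
  moreover have "(\<lambda>k. (1 / fact k) *\<^sub>R ((\<lambda>Y. ?X ** Y) ^^ k) (mat 1)) = ?t" unfolding t by auto
  ultimately have "mat_exp ?X = (mat 1 + N ** N) + sin \<phi> *\<^sub>R N - cos \<phi> *\<^sub>R (N ** N)"
    unfolding mat_exp_def by (simp only: sums_unique[symmetric])
  then show ?thesis by (simp add: algebra_simps)
qed

text \<open>Rodrigues' formula combined with angle doubling: a quaternion of angle \<theta> rotates
  space by 2 \<theta>.\<close>

lemma rot_polar:
  assumes n: "norm n = 1" "qre n = 0"
  shows "rot (of_real (cos \<theta>) + sin \<theta> *\<^sub>R n) = mat_exp (qhat ((2 * \<theta>) *\<^sub>R n))"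
proof -
  have 1: "(qi n)\<^sup>2 + (qj n)\<^sup>2 + (qk n)\<^sup>2 = 1" using norm_sq_quat[of n] n by simp
  have "qhat ((2 * \<theta>) *\<^sub>R n) = (2 * \<theta>) *\<^sub>R qhat n"
    by (rule linear_simps(5)[OF bounded_linear_qhat])
  moreover have "qhat n ** (qhat n ** qhat n) = - qhat n" unfolding qhat_cube 1 by simp
  ultimately have e: "mat_exp (qhat ((2 * \<theta>) *\<^sub>R n)) = mat 1 + sin (2 * \<theta>) *\<^sub>R qhat n + (1 - cos (2 * \<theta>)) *\<^sub>R (qhat n ** qhat n)"
    by (simp add: mat_exp_rodrigues)
  have "of_real (cos \<theta>) + sin \<theta> *\<^sub>R n = Quat (cos \<theta>) (sin \<theta> * qi n) (sin \<theta> * qj n) (sin \<theta> * qk n)"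
    by (simp add: quat_eq_iff of_real_def n)
  moreover have "Quat 0 (qi n) (qj n) (qk n) = n" by (simp add: quat_eq_iff n)
  ultimately have "rot (of_real (cos \<theta>) + sin \<theta> *\<^sub>R n) = mat 1 + (2 * cos \<theta> * sin \<theta>) *\<^sub>R qhat n + (2 * (sin \<theta>)\<^sup>2) *\<^sub>R (qhat n ** qhat n)"
    using rot_qhat[of "cos \<theta>" "sin \<theta>" "qi n" "qj n" "qk n" 0] 1 by simp
  moreover have "sin (2 * \<theta>) = 2 * cos \<theta> * sin \<theta>" "1 - cos (2 * \<theta>) = 2 * (sin \<theta>)\<^sup>2"
    by (simp_all add: sin_double cos_double_sin)
  ultimately show ?thesis unfolding e by simp
qed

text \<open>Coefficients of the \<open>n\<close>-th derivative of \<open>arctan (sqrt t) / sqrt t\<close>, which is smooth at \<open>t = 0\<close>.\<close>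

definition atc :: "nat \<Rightarrow> nat \<Rightarrow> real" where
  "atc n = (diffs ^^ n) (\<lambda>k. (-1) ^ k / (2 * real k + 1))"

definition ats :: "nat \<Rightarrow> real \<Rightarrow> real" where
  "ats n t = (\<Sum>k. atc n k * t ^ k)"

lemma summable_atc: "\<bar>t\<bar> < 1 \<Longrightarrow> summable (\<lambda>k. atc n k * t ^ k)"
proof (induction n arbitrary: t)
  case 0
  show ?case
  proof (rule summable_comparison_test')
    show "summable (\<lambda>k. \<bar>t\<bar> ^ k)" using 0 by (simp add: summable_geometric)
    show "norm (atc 0 k * t ^ k) \<le> \<bar>t\<bar> ^ k" if "k \<ge> 0" for k
      using mult_left_mono[of 1 "2 * real k + 1" "\<bar>t\<bar> ^ k"]
      by (simp add: atc_def abs_mult power_abs abs_divide divide_le_eq)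
  qed
next
  case (Suc n)
  have "summable (\<lambda>k. diffs (atc n) k * t ^ k)"
    by (rule termdiff_converges[of t 1]) (use Suc in auto)
  then show ?case by (simp add: atc_def)
qed

lemma deriv_ats: "\<bar>t\<bar> < 1 \<Longrightarrow> (ats n has_real_derivative ats (Suc n) t) (at t)"
proof -
  assume t: "\<bar>t\<bar> < 1"
  then obtain K where K: "\<bar>t\<bar> < K" "K < 1" using dense by blast
  have "((\<lambda>t. \<Sum>k. atc n k * t ^ k) has_real_derivative (\<Sum>k. diffs (atc n) k * t ^ k)) (at t)"
    by (rule termdiffs_strong[of _ K]) (use K in \<open>auto intro: summable_atc\<close>)
  then show ?thesis by (simp add: ats_def[abs_def] atc_def)
qed

lemma ats_0: "ats 0 0 = 1"
  using powser_zero[of "atc 0"] by (simp add: ats_def atc_def)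

lemma ats_arctan:
  assumes "\<bar>x\<bar> < 1"
  shows "ats 0 (x\<^sup>2) * x = arctan x"
proof -
  have "\<bar>x\<^sup>2\<bar> < 1" using assms by (simp add: abs_square_less_1)
  then have "(\<lambda>k. atc 0 k * (x\<^sup>2) ^ k) sums ats 0 (x\<^sup>2)" unfolding ats_def by (intro summable_sums summable_atc)
  then have "(\<lambda>k. atc 0 k * (x\<^sup>2) ^ k * x) sums (ats 0 (x\<^sup>2) * x)" by (rule sums_mult2)
  moreover have "(\<lambda>k. atc 0 k * (x\<^sup>2) ^ k * x) = (\<lambda>k. (-1) ^ k * (1 / real (k * 2 + 1) * x ^ (k * 2 + 1)))"
    by (rule ext) (simp add: atc_def power_mult[symmetric] mult_ac add_ac)
  ultimately show ?thesis using arctan_series[of x] assms by (simp add: sums_iff)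
qed

text \<open>For g = cos \<theta> + sin \<theta> n with small \<theta>, \<open>c\<close> is tan
  \<theta> n and the value is \<theta> n. The power series in \<bar>c\<bar>^2 keeps the logarithm
  smooth at g = 1, where the axis n is undefined.\<close>

definition qlog :: "quat \<Rightarrow> quat" where
  "qlog g = (let c = inverse (qre g) *\<^sub>R (g - of_real (qre g)) in ats 0 ((norm c)\<^sup>2) *\<^sub>R c)"

lemma rot_exp_qlog:
  assumes g: "norm g = 1" "qre g > 0" and c: "norm (inverse (qre g) *\<^sub>R (g - of_real (qre g))) < 1"
  shows "rot g = mat_exp (qhat (2 *\<^sub>R qlog g))"
proof (cases "g - of_real (qre g) = 0")
  case True
  then have "g = of_real (qre g)" by simp
  then have "\<bar>qre g\<bar> = 1" using g(1) by (metis norm_of_real)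
  then have "g = 1" using \<open>g = of_real (qre g)\<close> g(2) by simp
  moreover have "rot (of_real (cos 0) + sin 0 *\<^sub>R Quat 0 1 0 0) = mat_exp (qhat ((2 * 0) *\<^sub>R Quat 0 1 0 0))"
    by (rule rot_polar) (simp_all add: norm_quat_eq)
  ultimately show ?thesis by (simp add: qlog_def)
next
  case False
  define s v where "s = qre g" and "v = g - of_real s"
  have v0: "0 < norm v" using False by (simp add: v_def s_def)
  have s0: "0 < s" using g by (simp add: s_def)
  define n where "n = inverse (norm v) *\<^sub>R v"
  have n: "norm n = 1" "qre n = 0" using v0 by (simp_all add: n_def v_def s_def of_real_def)
  have sv: "s\<^sup>2 + (norm v)\<^sup>2 = 1" using norm_sq_quat[of g] norm_sq_quat[of v] g(1) by (simp add: s_def v_def of_real_def)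
  define x where "x = norm v / s"
  have x1: "\<bar>x\<bar> < 1" using c s0 by (simp add: x_def v_def s_def divide_inverse mult.commute)
  define \<theta> where "\<theta> = arctan x"
  have "1 + x\<^sup>2 = (inverse s)\<^sup>2" using sv s0 by (simp add: x_def power_divide field_simps)
  then have sq: "sqrt (1 + x\<^sup>2) = inverse s" using s0 by simp
  have "cos \<theta> = s" "sin \<theta> = norm v"
    using s0 unfolding \<theta>_def cos_arctan sin_arctan sq by (simp_all add: x_def divide_inverse)
  then have "of_real (cos \<theta>) + sin \<theta> *\<^sub>R n = g" using v0 by (simp add: n_def v_def)
  moreover have "qlog g = \<theta> *\<^sub>R n"
  proof -
    have c: "inverse (qre g) *\<^sub>R (g - of_real (qre g)) = x *\<^sub>R n" using v0 by (simp add: x_def n_def v_def s_def divide_inverse)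
    have "qlog g = ats 0 (x\<^sup>2) *\<^sub>R (x *\<^sub>R n)" unfolding qlog_def Let_def c by (simp add: n)
    then show ?thesis using ats_arctan[OF x1] by (simp add: \<theta>_def)
  qed
  ultimately show ?thesis using rot_polar[OF n, of \<theta>] by simp
qed

lemma Cb_qlog:
  "\<exists>K\<ge>1. \<forall>G b. Cb UNIV r 1 b (\<lambda>x. G x - 1) \<longrightarrow> K * b \<le> 1 \<longrightarrow> 0 < b \<longrightarrow>
     Cb UNIV r 1 (K * b) (\<lambda>x. qlog (G x)) \<and>
     (\<forall>x. qre (G x) > 0 \<and> norm (inverse (qre (G x)) *\<^sub>R (G x - of_real (qre (G x)))) < 1)"
proof -
  obtain K1 where K1: "K1 \<ge> 1" "\<forall>S (f :: real \<Rightarrow> real) Q b. open S \<longrightarrow> 0 \<le> Q \<longrightarrow> b \<le> 1/2 \<longrightarrow> Cb S r Q b f \<longrightarrow>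
    Cb S r Q (K1 * b) (\<lambda>x. inverse (1 + f x) - 1)" using Cb_inverse[of r] by blast
  have hs: "(ats n has_real_derivative ats (Suc n) t) (at t)" if "\<bar>t\<bar> \<le> 1/2" for n t
    by (rule deriv_ats) (use that in simp)
  obtain K3 where K3: "K3 \<ge> 1" "\<forall>S f Q b. open S \<longrightarrow> 0 \<le> Q \<longrightarrow> b \<le> 1/2 \<longrightarrow> Cb S r Q b f \<longrightarrow>
    Cb S r Q (K3 * b) (\<lambda>x. ats 0 (f x) - ats 0 0)"
    using Cb_comp[of "1/2" ats r, OF hs] by auto
  define q where "q = (2::real) ^ r"
  have q1: "q \<ge> 1" by (simp add: q_def)
  define K2 where "K2 = 2 + q * K1 * 2"
  have K2: "K2 \<ge> 2" using q1 K1 by (simp add: K2_def)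
  \<comment> \<open>The first summand keeps \<bar>c\<bar>^2 below 1/2, inside the disc where the
    series is controlled; the other two bound the logarithm itself.\<close>
  define K where "K = 2 * (q * K2 * K2) + K2 + q * (K3 * (q * K2 * K2)) * K2"
  have p: "0 \<le> q * (K3 * (q * K2 * K2)) * K2" "K2 * 1 \<le> q * K2 * K2" "0 \<le> q * K2 * K2"
    using q1 K2 K3(1) mult_mono[of 1 q 1 K2] by (auto simp: mult_ac)
  have K: "K \<ge> 2 * (q * K2 * K2)" "K \<ge> K2" "K \<ge> 2" "K \<ge> K2 + q * (K3 * (q * K2 * K2)) * K2"
    using p(1,3) K2 unfolding K_def by linarith+
  show ?thesis
  proof (intro exI[of _ K] conjI allI impI)
    show "1 \<le> K" using K by simp
    fix G :: "real \<Rightarrow> quat" and b assume G: "Cb UNIV r 1 b (\<lambda>x. G x - 1)" and b: "K * b \<le> 1" "0 < b"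
    note o = open_UNIV
    have b2: "b \<le> 1/2" using mult_right_mono[OF K(3), of b] b by linarith
    have s: "Cb UNIV r 1 b (\<lambda>x. qre (G x - 1))" by (rule Cb_qre[OF o G])
    have i: "Cb UNIV r 1 (K1 * b) (\<lambda>x. inverse (qre (G x)) - 1)"
      using K1(2)[rule_format, OF o _ b2 s] by simp
    have os: "Cb UNIV r 1 (1 * b) (\<lambda>x. of_real (qre (G x - 1)) :: quat)"
      by (rule Cb_linear[OF bounded_linear_of_real _ _ o s]) auto
    have "Cb UNIV r 1 (b + 1 * b) (\<lambda>x. (G x - 1) - of_real (qre (G x - 1)))"
      by (rule Cb_diff[OF o G os])
    then have v: "Cb UNIV r 1 (2 * b) (\<lambda>x. G x - of_real (qre (G x)))" by simp
    define c where "c x = inverse (qre (G x)) *\<^sub>R (G x - of_real (qre (G x)))" for x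
    have "Cb UNIV r 1 (2 * b + 2 ^ r * (K1 * b) * (2 * b)) (\<lambda>x. (G x - of_real (qre (G x))) + (inverse (qre (G x)) - 1) *\<^sub>R (G x - of_real (qre (G x))))"
      by (intro Cb_add o v Cb_scaleR i)
    then have c0: "Cb UNIV r 1 (2 * b + 2 ^ r * (K1 * b) * (2 * b)) c"
      by (simp add: c_def[abs_def] scaleR_diff_left)
    have c: "Cb UNIV r 1 (K2 * b) c"
    proof (rule Cb_le[OF c0])
      have "q * K1 * 2 * b * b \<le> q * K1 * 2 * b * 1" using q1 K1 b b2 by (intro mult_left_mono) auto
      then show "2 * b + 2 ^ r * (K1 * b) * (2 * b) \<le> K2 * b" by (simp add: K2_def q_def algebra_simps)
    qed simp
    have "Cb UNIV r 1 (2 ^ r * (K2 * b) * (K2 * b)) (\<lambda>x. c x * qcnj (c x))"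
      by (intro Cb_mult o c Cb_qcnj)
    then have "Cb UNIV r 1 (2 ^ r * (K2 * b) * (K2 * b)) (\<lambda>x. qre (c x * qcnj (c x)))" by (rule Cb_qre[OF o])
    then have n0: "Cb UNIV r 1 (2 ^ r * (K2 * b) * (K2 * b)) (\<lambda>x. (norm (c x))\<^sup>2)"
      by (simp add: inner_eq_qre[symmetric] dot_square_norm)
    have bb: "q * K2 * K2 * b \<le> 1/2" using mult_right_mono[OF K(1), of b] b by linarith
    have n: "Cb UNIV r 1 (q * K2 * K2 * b) (\<lambda>x. (norm (c x))\<^sup>2)"
    proof (rule Cb_le[OF n0])
      have "q * K2 * K2 * b * b \<le> q * K2 * K2 * b * 1" using p b b2 by (intro mult_left_mono) auto
      then show "2 ^ r * (K2 * b) * (K2 * b) \<le> q * K2 * K2 * b" by (simp add: q_def mult_ac)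
    qed simp
    have h: "Cb UNIV r 1 (K3 * (q * K2 * K2 * b)) (\<lambda>x. ats 0 ((norm (c x))\<^sup>2) - 1)"
      using K3(2)[rule_format, OF o _ bb n] by (simp add: ats_0)
    have "Cb UNIV r 1 (K2 * b + 2 ^ r * (K3 * (q * K2 * K2 * b)) * (K2 * b)) (\<lambda>x. c x + (ats 0 ((norm (c x))\<^sup>2) - 1) *\<^sub>R c x)"
      by (intro Cb_add o c Cb_scaleR h)
    moreover have "c x + (ats 0 ((norm (c x))\<^sup>2) - 1) *\<^sub>R c x = qlog (G x)" for x
      unfolding qlog_def Let_def c_def[symmetric] by (simp add: scaleR_diff_left)
    ultimately have l: "Cb UNIV r 1 (K2 * b + 2 ^ r * (K3 * (q * K2 * K2 * b)) * (K2 * b)) (\<lambda>x. qlog (G x))"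
      by simp
    show "Cb UNIV r 1 (K * b) (\<lambda>x. qlog (G x))"
    proof (rule Cb_le[OF l])
      have "q * (K3 * (q * K2 * K2)) * K2 * b * b \<le> q * (K3 * (q * K2 * K2)) * K2 * b * 1"
        using p b b2 by (intro mult_left_mono) auto
      moreover have "(K2 + q * (K3 * (q * K2 * K2)) * K2) * b \<le> K * b" using K(4) b by (intro mult_right_mono) auto
      ultimately show "K2 * b + 2 ^ r * (K3 * (q * K2 * K2 * b)) * (K2 * b) \<le> K * b"
        by (simp add: q_def algebra_simps)
    qed simp
    fix x
    have "\<bar>qre (G x) - 1\<bar> \<le> 1/2" using CbD0[OF s, of x] b2 by simp
    then show "qre (G x) > 0" by linarith
    have "(norm (c x))\<^sup>2 \<le> 1/2" using CbD0[OF n, of x] bb by simp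
    then have "norm (c x) < 1" using abs_square_less_1[of "norm (c x)"] by simp
    then show "norm (inverse (qre (G x)) *\<^sub>R (G x - of_real (qre (G x)))) < 1" by (simp add: c_def)
  qed
qed

lemma (in anticocycle) approximate_reduction:
  assumes deg: "degree_zero \<alpha> (\<lambda>x. rot (a x))" and \<alpha>: "\<bar>\<alpha>\<bar> \<le> 1" and \<epsilon>: "0 < \<epsilon>"
  shows "\<exists>B A' U. B \<in> C_infty 2 SO3 \<and> A' \<in> SO3 \<and> U \<in> C_infty 2 so3 \<and>
    (\<forall>x. B (x + \<alpha>) ** rot (a x) ** matrix_inv (B x) = A' ** mat_exp (U x)) \<and>
    (\<forall>r x. r \<le> s \<longrightarrow> norm (nth_deriv r U x) \<le> \<epsilon>)"
proof -
  obtain K where K: "K \<ge> 1" "\<forall>G b. Cb UNIV s 1 b (\<lambda>x. G x - 1) \<longrightarrow> K * b \<le> 1 \<longrightarrow> 0 < b \<longrightarrow>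
     Cb UNIV s 1 (K * b) (\<lambda>x. qlog (G x)) \<and>
     (\<forall>x. qre (G x) > 0 \<and> norm (inverse (qre (G x)) *\<^sub>R (G x - of_real (qre (G x)))) < 1)"
    using Cb_qlog[of s] by blast
  \<comment> \<open>The divisor 4 anticipates a factor 2 from angle doubling and a factor 2 from
    \<open>norm_qhat\<close>.\<close>
  define \<eta> where "\<eta> = min 1 (\<epsilon> / 4) / K"
  have \<eta>: "0 < \<eta>" "K * \<eta> \<le> 1" "4 * (K * \<eta>) \<le> \<epsilon>" using \<epsilon> K(1) by (auto simp: \<eta>_def)
  obtain e Y0 where e: "smooth_on UNIV e" "\<And>x. norm (e x) = 1" "\<And>x. rot (e (x + 2)) = rot (e x)" "norm Y0 = 1"
    "\<And>x. e (x + 2 + \<alpha>) * a (x + 2) * qcnj (e (x + 2)) = e (x + \<alpha>) * a x * qcnj (e x)"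
    "Cb UNIV s 1 \<eta> (\<lambda>x. e (x + \<alpha>) * a x * qcnj (e x) - Y0)"
    by (rule near_constant_conjugate[OF deg \<alpha> \<eta>(1), of s]) (rule that)
  define N where "N x = e (x + \<alpha>) * a x * qcnj (e x)" for x
  define G where "G x = qcnj Y0 * N x" for x
  have uG: "norm (G x) = 1" for x by (simp add: G_def N_def norm_quat_mult e unit_a)
  have CG: "Cb UNIV s 1 \<eta> (\<lambda>x. G x - 1)"
  proof -
    have "Cb UNIV s 1 \<eta> (\<lambda>x. qcnj Y0 * (N x - Y0))"
      by (rule Cb_lmult) (use e in \<open>simp_all add: N_def\<close>)
    then show ?thesis using e(4) by (simp add: G_def right_diff_distrib)
  qed
  have L: "Cb UNIV s 1 (K * \<eta>) (\<lambda>x. qlog (G x))" "\<And>x. qre (G x) > 0"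
    "\<And>x. norm (inverse (qre (G x)) *\<^sub>R (G x - of_real (qre (G x)))) < 1"
    using K(2)[rule_format, OF CG \<eta>(2) \<eta>(1)] by blast+
  define U where "U x = qhat (2 *\<^sub>R qlog (G x))" for x
  have CU: "Cb UNIV s 1 (4 * (K * \<eta>)) U"
    unfolding U_def[abs_def]
  proof (rule Cb_linear[OF _ _ _ open_UNIV L(1)])
    show "bounded_linear (\<lambda>y. qhat (2 *\<^sub>R y))"
      by (rule bounded_linear_compose[OF bounded_linear_qhat bounded_linear_scaleR_right])
    show "norm (qhat (2 *\<^sub>R y)) \<le> 4 * norm y" for y using norm_qhat[of "2 *\<^sub>R y"] by simp
  qed simp
  show ?thesis
  proof (intro exI conjI allI impI)
    show "(\<lambda>x. rot (e x)) \<in> C_infty 2 SO3"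
      by (auto simp: C_infty_def smooth_iff e intro!: smooth_on_rot rot_SO3)
    show "rot Y0 \<in> SO3" by (rule rot_SO3[OF e(4)])
    have "G (x + 2) = G x" for x unfolding G_def N_def by (simp only: e(5))
    then show "U \<in> C_infty 2 so3"
      using Cb_smooth[OF CU] by (auto simp: C_infty_def smooth_iff U_def[abs_def] qhat_so3)
    fix x
    have "rot (e (x + \<alpha>)) ** rot (a x) ** matrix_inv (rot (e x)) = rot (N x)"
      by (simp add: N_def rot_mult rot_qcnj matrix_inv_orthogonal rot_orthogonal e(2))
    also have "N x = Y0 * G x" using e(4) by (simp add: G_def)
    also have "rot (Y0 * G x) = rot Y0 ** mat_exp (U x)"
      unfolding rot_mult U_def by (simp add: rot_exp_qlog[OF uG L(2,3)])
    finally show "rot (e (x + \<alpha>)) ** rot (a x) ** matrix_inv (rot (e x)) = rot Y0 ** mat_exp (U x)" .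
    fix r assume "r \<le> s"
    then show "norm (nth_deriv r U x) \<le> \<epsilon>" using CbD[OF CU, of r x] \<eta>(3) by simp
  qed
qed

theorem theorem1p1:
  fixes \<alpha> :: real and A :: "real \<Rightarrow> real^3^3"
  assumes "\<alpha> \<in> {0<..<1} - \<rat>"
    and "A \<in> C_infty 1 SO3"
    and "degree_zero \<alpha> A"
    and "\<not> homotopic_loops SO3 A (\<lambda>x. mat 1)"
    and "\<alpha> \<in> RDC_tilde"
  shows "almost_reducible_2periodic \<alpha> A"
proof -
  have A: "smooth_on UNIV A" "\<And>x. A x \<in> SO3" "\<And>x. A (x + 1) = A x"
    using assms(2) by (auto simp: C_infty_def smooth_iff)
  obtain a where a: "smooth_on UNIV a" "\<And>x. norm (a x) = 1" "\<And>x. rot (a x) = A x" "\<And>x. a (x + 1) = - a x"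
    using lift_antiperiodic[OF A assms(4)] by blast
  interpret anticocycle \<alpha> a by unfold_locales (use assms(1) a in auto)
  have rA: "(\<lambda>x. rot (a x)) = A" using a(3) by auto
  have deg: "degree_zero \<alpha> (\<lambda>x. rot (a x))" using assms(3) by (simp add: rA)
  \<comment> \<open>The order of differentiability and the accuracy both follow the index, so that a
    single sequence converges in every derivative.\<close>
  have "\<forall>m::nat. \<exists>B A' U. B \<in> C_infty 2 SO3 \<and> A' \<in> SO3 \<and> U \<in> C_infty 2 so3 \<and>
    (\<forall>x. B (x + \<alpha>) ** A x ** matrix_inv (B x) = A' ** mat_exp (U x)) \<and>
    (\<forall>r x. r \<le> m \<longrightarrow> norm (nth_deriv r U x) \<le> 1 / real (Suc m))"
    using approximate_reduction[OF deg, unfolded a(3)] assms(1) by auto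
  then obtain B A' U where BAU: "\<And>m. B m \<in> C_infty 2 SO3 \<and> A' m \<in> SO3 \<and> U m \<in> C_infty 2 so3 \<and>
    (\<forall>x. B m (x + \<alpha>) ** A x ** matrix_inv (B m x) = A' m ** mat_exp (U m x)) \<and>
    (\<forall>r x. r \<le> m \<longrightarrow> norm (nth_deriv r (U m) x) \<le> 1 / real (Suc m))"
    by metis
  have "tendsto_zero_C_infty U"
    unfolding tendsto_zero_C_infty_def
  proof
    fix r
    show "uniform_limit UNIV (\<lambda>m. nth_deriv r (U m)) (\<lambda>x. 0) sequentially"
    proof (rule uniform_limitI)
      fix \<epsilon> :: real assume "0 < \<epsilon>"
      then obtain M where M: "inverse (real (Suc M)) < \<epsilon>" using reals_Archimedean by blast
      show "\<forall>\<^sub>F m in sequentially. \<forall>x\<in>UNIV. dist (nth_deriv r (U m) x) 0 < \<epsilon>"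
      proof (rule eventually_sequentiallyI[of "max r M"], intro ballI)
        fix m x assume m: "max r M \<le> m"
        then have "norm (nth_deriv r (U m) x) \<le> 1 / real (Suc m)" using BAU[of m] by simp
        also have "\<dots> \<le> 1 / real (Suc M)" using m by (intro divide_left_mono) auto
        also have "\<dots> < \<epsilon>" using M by (simp add: inverse_eq_divide)
        finally show "dist (nth_deriv r (U m) x) 0 < \<epsilon>" by simp
      qed
    qed
  qed
  moreover have "\<forall>m. B m \<in> C_infty 2 SO3 \<and> A' m \<in> SO3 \<and> U m \<in> C_infty 2 so3"
    "\<forall>m x. B m (x + \<alpha>) ** A x ** matrix_inv (B m x) = A' m ** mat_exp (U m x)"
    using BAU by simp_all
  ultimately show ?thesis unfolding almost_reducible_2periodic_def by (intro exI conjI)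
qed

end
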